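(* Let $(v_\lambda)$ be a multiplicative family in $F^\times$, let $$f(x)=\exp\Big(-\sum_{n\ge1}\frac{v_n^{-1}}{n}x^n\Big),\qquad \sigma(z,w)=z\cdot i_{\mathbf t}f\Big(\frac wz\Big),$$ and let $V=\mathrm{Sym}(D^{(n)}\alpha:\ n\ge1)\otimes k[\mathbf Z\alpha]$. Let $r$ be the bicharacter on $V$ with target $\mathbf K=k[z^{\pm1},w^{\pm1},(z-w)^{\pm1}][[\mathbf t]]$ determined by $r(e^\alpha\otimes e^\alpha)(z,w)=\sigma(z,w)$, and for $a,b\in V$ put $$Y(a,z)b=\sum (e^{zD}(a'))\,b'\,r(a''\otimes b'')(z,0).$$ Then: (1) The field $Y(e^\alpha,z)$ equals the field $$\Psi(z)=\exp\Big(\sum_{n\ge1}\frac{h_{-n}}{n}z^n\Big)\exp\Big(-\sum_{n\ge1}\frac{h_n}{n}z^{-n}\Big)e^\alpha z^{\partial_\alpha}.$$ (2) Moreover, the field $\Psi(z)$ belongs to an $H_D$-quantum vertex algebra structure on $V$, with braiding map given by $$R(z,w)(a\otimes b)=\sum a'\otimes b'\,(r^\tau*r^{-1})(a''\otimes b'')\qquad\text{for any } a,b\in V.$$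
   Context: **Ground ring.** $k$ is a field of characteristic zero, $F$ is a field extension of $k$ (for instance $k(t)$ or $k(q,t)$ with parameters $q,t$), and $\mathbf t$ is a (multi)parameter. $H_D=k[D]$ is the Hopf algebra generated by a primitive element $D$, and $D^{(n)}=D^n/n!$. **Multiplicative family and expansion.** $(v_\lambda)$ is indexed by partitions and $v_\lambda=\prod_i v_{\lambda_i}$. For a function $f(x)$ depending on $\mathbf t$, $i_{\mathbf t}f$ denotes its power series expansion in the parameter(s) $\mathbf t$ (considered very small). The choice of $\mathbf t$ depends on the family. For example, for Hall–Littlewood polynomials $\mathbf t=t$, $v_n^{-1}=1-t^n$, $f(x)=\frac{1-x}{1-tx}$, $i_{\mathbf t}f(x)=(1-x)\sum_{n\ge0}x^nt^n$; for Macdonald polynomials $\mathbf t=(t,q)$, $v_n^{-1}=\frac{1-t^n}{1-q^n}$, $f(x)=\frac{(x;q)_\infty}{(tx;q)_\infty}$, where $(x;q)_\infty=\prod_{n\ge0}(1-xq^n)$. **The space $V$.** $k[\mathbf Z\alpha]$ is the group algebra with basis $e^{m\alpha}$, $m\in\mathbf Z$, and $e^{m\alpha}e^{n\alpha}=e^{(m+n)\alpha}$. $V$ is the universal commutative $H_D$-module algebra containing $k[\mathbf Z\alpha]$, viewed as a topologically free module over $k[[\mathbf t]]$ by extension of scalars. Put $h=D\alpha:=(De^\alpha)e^{-\alpha}$ and $h^{(n)}=D^{(n)}h$; $D^{(n)}\alpha$ for $n\ge1$ means $\frac1n D^{(n-1)}h$. As an algebra $V$ is the tensor product of the polynomial algebra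 in these variables with $k[\mathbf Z\alpha]$. $V$ is a commutative cocommutative Hopf algebra, with coproduct $\Delta$, counit $\eta$ and antipode $S$ compatible with $D$, and with $e^\alpha$ grouplike, so $h$ is primitive, $S(e^\alpha)=e^{-\alpha}$, $S(h)=-h$. Sweedler notation: $\Delta(a)=\sum a'\otimes a''$. **Bicharacters.** A bicharacter on $V$ with target $\mathbf K$ is a linear map $r:V\otimes V\to\mathbf K$ with $r(1\otimes a)=\eta(a)=r(a\otimes1)$, $r(ab\otimes c)=\sum r(a\otimes c')r(b\otimes c'')$, $r(a\otimes bc)=\sum r(a'\otimes b)r(a''\otimes c)$. Its values are functions $r(a\otimes b)(z,w)$. The bicharacter of the claim is determined on $k[\mathbf Z\alpha]$ by $r(e^\alpha\otimes e^\alpha)=\sigma$ and extended to $V$ by $r(Da\otimes b)(z,w)=\partial_zr(a\otimes b)(z,w)$, $r(a\otimes Db)(z,w)=\partial_wr(a\otimes b)(z,w)$. Operations: $(r*s)(a\otimes b)=\sum r(a'\otimes b')s(a''\otimes b'')$; $r^{-1}(a\otimes b)=r(S(a)\otimes b)$; $r^\tau(a\otimes b)(z,w)=r(b\otimes a)(w,z)$. **The operator $\Psi(z)$.** $\Lambda_F$ is the ring of symmetric functions over $F$, with power sums $p_n$ and scalar product $\langle p_\lambda,p_\mu\rangle_v=\delta_{\lambda\mu}z_\lambda v_\lambda$, where $z_\lambda=\prod_i i^{m_i}m_i!$ and $m_i$ is the number of parts of $\lambda$ equal to $i$. $p_n$ acts by multiplication and $p_n^\perp$ is its adjoint: $\langle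 p_n^\perp f,g\rangle_v=\langle f,p_ng\rangle_v$. For $n\ge1$, $h_{-n}=v_n^{-1}p_n$ and $h_n=v_n^{-1}p_n^\perp$; they satisfy the deformed Heisenberg relations $[h_m,h_n]=m v_{|m|}^{-1}\delta_{m+n,0}$. $\Psi(z)$ is defined on $\Lambda_F\otimes k[\mathbf Z\alpha]$, where $e^\alpha$ acts by multiplication and $z^{\partial_\alpha}e^{m\alpha}=z^me^{m\alpha}$. On $V$ the $h_n$ are the modes of $Y(D\alpha,z)=\sum_n h_nz^{-n-1}$, which satisfy the same relations; the two spaces are identified by $v_n^{-1}p_n\leftrightarrow D^{(n-1)}h$ ($n\ge1$), $e^{m\alpha}\leftrightarrow e^{m\alpha}$. **$H_D$-quantum vertex algebra over $k[[\mathbf t]]$.** A field on $V$ is a series $a(z)=\sum_{n\in\mathbf Z}a_{(n)}z^{-n-1}$ with $a_{(n)}\in\mathrm{End}(V)$ and, for each $v\in V$, $a_{(n)}v=0$ for $n\gg0$. The data are: a topologically free $k[[\mathbf t]]$-module $V$; a vacuum vector $|0\rangle\in V$; a linear state-field correspondence $a\mapsto Y(a,z)$ from $V$ to fields, also written $Y(z):V\otimes V\to V((z))$, $Y(z)(a\otimes b)=Y(a,z)b$; an operator $D:V\to V$; and a linear braiding map $R(z,w):V\otimes V\to V\otimes V\otimes\mathbf K$. They satisfy: - Yang–Baxter: $R_{12}(z_1,z_2)R_{13}(z_1,z_3)R_{23}(z_2,z_3)=R_{23}(z_2,z_3)R_{13}(z_1,z_3)R_{12}(z_1,z_2)$; -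 shift: $[D\otimes1,R(z,w)]=-\partial_zR(z,w)$, $[1\otimes D,R(z,w)]=-\partial_wR(z,w)$; - unitarity: $\tau R(w,z)\tau=R(z,w)^{-1}$, where $\tau(a\otimes b)=b\otimes a$; - translation covariance: $Y(Da,z)=\partial_zY(a,z)$; - vacuum: $Y(|0\rangle,z)=\mathrm{Id}_V$; - creation: $Y(a,z)|0\rangle|_{z=0}=a$; - braided locality: for all $a,b\in V$ there exists $N$ such that $(z-w)^NY(a,z)Y(b,w)=(w-z)^N\tilde R(Y(b,w),Y(a,z))$, where $\tilde R(Y(b,w),Y(a,z))c=Y(w)(1\otimes Y(z))\big(R(w,z)(b\otimes a)\otimes c\big)$ for all $c\in V$. In the structure of the claim the vacuum vector is $1\in V$, the distinguished operator is $D$, and the state-field correspondence is the $Y$ of the claim.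
   Formalization: The field condition (a_(n)v=0 for n≫0) and braided locality (existence of N) are required modulo each power of the ideal (t), with bounds depending on the power; read literally they fail on the topologically free V, e.g. for Y(e^α,z) applied to the sum of t^j h^(j). *)

theory Defs
  imports
    "HOL-Library.Multiset"
    "HOL-Library.Poly_Mapping"
    "HOL-Library.Product_Plus"
    "HOL-Library.Groups_Big_Fun"
    "HOL-Computational_Algebra.Formal_Laurent_Series"
    "HOL-Computational_Algebra.Fraction_Field"
begin

section \<open>Power series in the parameters\<close>

text \<open>
  \<open>('p, 'a) tps\<close> is \<open>'a[[\<^bold>t]]\<close>, where \<open>\<^bold>t\<close> is the family of commuting parameters indexed by the
  (finite) type \<open>'p\<close>; a multiset over \<open>'p\<close> is a monomial in the parameters. For a \<open>k\<close>-vector space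
  \<open>M\<close>, \<open>('p, M) tps\<close> is the topologically free \<open>k[[\<^bold>t]]\<close>-module \<open>M[[\<^bold>t]]\<close>.
\<close>

typedef ('p, 'a) tps = "UNIV :: ('p multiset \<Rightarrow> 'a) set"
  morphisms tcoeff Abs_tps ..

lemma tcoeff_Abs [simp]: "tcoeff (Abs_tps f) = f"
  by (simp add: Abs_tps_inverse)

lemma tps_eqI: "(\<And>n. tcoeff x n = tcoeff y n) \<Longrightarrow> x = y"
  by (metis ext tcoeff_inject)

lemma finite_decomp: "finite {(i, j). i + j = (n :: 'p multiset)}"
proof -
  have "finite {i. i \<subseteq># n}"
  proof (induction n)
    case (add x n)
    have "{i. i \<subseteq># add_mset x n} \<subseteq> {i. i \<subseteq># n} \<union> add_mset x ` {i. i \<subseteq># n}"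
    proof
      fix i assume i: "i \<in> {i. i \<subseteq># add_mset x n}"
      show "i \<in> {i. i \<subseteq># n} \<union> add_mset x ` {i. i \<subseteq># n}"
      proof (cases "x \<in># i")
        case True
        then obtain i' where "i = add_mset x i'"
          by (metis multi_member_split)
        with i show ?thesis
          by auto
      next
        case False
        with i show ?thesis
          by (metis CollectD CollectI UnI1 diff_single_trivial subset_eq_diff_conv union_single_eq_diff
              add_mset_add_single)
      qed
    qed
    with add show ?case
      by (meson finite_UnI finite_imageI finite_subset)
  qed auto
  then have "finite ({i. i \<subseteq># n} \<times> {i. i \<subseteq># n})"
    by simp
  then show ?thesis
    by (rule finite_subset[rotated]) auto
qed

lemma finite_decomp' [simp]: "finite {p. fst p + snd p = (n :: 'p multiset)}"
  using finite_decomp[of n] by (simp add: case_prod_unfold)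

definition tconst :: "'a::zero \<Rightarrow> ('p, 'a) tps" where
  "tconst a = Abs_tps (\<lambda>n. if n = {#} then a else 0)"

definition tmap :: "('a \<Rightarrow> 'b) \<Rightarrow> ('p, 'a) tps \<Rightarrow> ('p, 'b) tps" where
  "tmap f x = Abs_tps (\<lambda>n. f (tcoeff x n))"

definition tconv :: "('a \<Rightarrow> 'b \<Rightarrow> 'c::comm_monoid_add) \<Rightarrow> ('p, 'a) tps \<Rightarrow> ('p, 'b) tps \<Rightarrow> ('p, 'c) tps" where
  "tconv f x y = Abs_tps (\<lambda>n. \<Sum>(i, j) | i + j = n. f (tcoeff x i) (tcoeff y j))"

instantiation tps :: (type, ab_group_add) ab_group_add
begin

definition "0 = Abs_tps (\<lambda>_. 0)"
definition "x + y = Abs_tps (\<lambda>n. tcoeff x n + tcoeff y n)"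
definition "x - y = Abs_tps (\<lambda>n. tcoeff x n - tcoeff y n)"
definition "- x = Abs_tps (\<lambda>n. - tcoeff x n)"

instance
  by standard
    (auto intro!: tps_eqI simp: zero_tps_def plus_tps_def minus_tps_def uminus_tps_def algebra_simps)

end

lemma tcoeff_add_group [simp]:
  "tcoeff 0 n = 0" "tcoeff (x + y) n = tcoeff x n + tcoeff y n"
  "tcoeff (x - y) n = tcoeff x n - tcoeff y n" "tcoeff (- x) n = - tcoeff x n"
  by (simp_all add: zero_tps_def plus_tps_def minus_tps_def uminus_tps_def)

instantiation tps :: (type, comm_ring_1) comm_ring_1
begin

definition "1 = tconst 1"
definition "x * y = tconv (*) x y"

instance
proof
  fix a b c :: "('a, 'b) tps"
  show "a * b * c = a * (b * c)"
  proof (rule tps_eqI)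
    fix n :: "'a multiset"
    have "tcoeff (a * b * c) n =
        (\<Sum>(i, j) | i + j = n. \<Sum>(k, l) | k + l = i. tcoeff a k * tcoeff b l * tcoeff c j)"
      by (simp add: times_tps_def tconv_def sum_distrib_right case_prod_unfold)
    also have "\<dots> = (\<Sum>((i, j), (k, l))\<in>(SIGMA p:{(i, j). i + j = n}. {(k, l). k + l = fst p}).
        tcoeff a k * tcoeff b l * tcoeff c j)"
      by (subst sum.Sigma[symmetric]) (simp_all add: case_prod_unfold)
    also have "\<dots> = (\<Sum>((i, j), (k, l))\<in>(SIGMA p:{(i, j). i + j = n}. {(k, l). k + l = snd p}).
        tcoeff a i * (tcoeff b k * tcoeff c l))"
      by (rule sum.reindex_bij_witness
            [of _ "\<lambda>((i, j), (k, l)). ((i + k, l), (i, k))" "\<lambda>((i, j), (k, l)). ((k, l + j), (l, j))"])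
        (auto simp: algebra_simps)
    also have "\<dots> = (\<Sum>(i, j) | i + j = n. \<Sum>(k, l) | k + l = j. tcoeff a i * (tcoeff b k * tcoeff c l))"
      by (subst sum.Sigma[symmetric]) (simp_all add: case_prod_unfold)
    also have "\<dots> = tcoeff (a * (b * c)) n"
      by (simp add: times_tps_def tconv_def sum_distrib_left case_prod_unfold)
    finally show "tcoeff (a * b * c) n = tcoeff (a * (b * c)) n" .
  qed
  show "a * b = b * a"
  proof (rule tps_eqI)
    fix n :: "'a multiset"
    show "tcoeff (a * b) n = tcoeff (b * a) n"
      unfolding times_tps_def tconv_def tcoeff_Abs
      by (rule sum.reindex_bij_witness[of _ prod.swap prod.swap]) (auto simp: algebra_simps)
  qed
  show "1 * a = a"
  proof (rule tps_eqI)
    fix n :: "'a multiset"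
    have "tcoeff (1 * a) n = (\<Sum>(i, j) | i + j = n. if i = {#} then tcoeff a j else 0)"
      by (auto simp: times_tps_def one_tps_def tconv_def tconst_def intro!: sum.cong)
    also have "\<dots> = (\<Sum>(i, j)\<in>{({#} :: 'a multiset, n)}. tcoeff a j)"
      by (rule sum.mono_neutral_cong_right) (auto simp: finite_decomp split: if_splits)
    finally show "tcoeff (1 * a) n = tcoeff a n"
      by simp
  qed
  show "(a + b) * c = a * c + b * c"
    by (rule tps_eqI)
      (simp add: times_tps_def tconv_def case_prod_unfold distrib_right sum.distrib)
  show "(0 :: ('a, 'b) tps) \<noteq> 1"
    by (auto simp: zero_tps_def one_tps_def tconst_def Abs_tps_inject fun_eq_iff)
qed

end


section \<open>Modules with a basis\<close>

text \<open>
  \<open>'b \<Rightarrow>\<^sub>0 'a\<close> is the free \<open>'a\<close>-module with basis \<open>'b\<close>, and \<open>('b \<times> 'c) \<Rightarrow>\<^sub>0 'a\<close> is the tensor product of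
  \<open>'b \<Rightarrow>\<^sub>0 'a\<close> and \<open>'c \<Rightarrow>\<^sub>0 'a\<close>. Accordingly \<open>('p, 'b \<Rightarrow>\<^sub>0 'a) tps\<close> is a topologically free module with
  topological basis \<open>'b\<close>, and \<open>('p, ('b \<times> 'c) \<Rightarrow>\<^sub>0 'a) tps\<close> is a (completed) tensor product.
\<close>

definition scl :: "'a::comm_ring_1 \<Rightarrow> ('b \<Rightarrow>\<^sub>0 'a) \<Rightarrow> 'b \<Rightarrow>\<^sub>0 'a" where
  "scl c x = Poly_Mapping.map ((*) c) x"

definition lin :: "('b \<Rightarrow> 'c \<Rightarrow>\<^sub>0 'a) \<Rightarrow> ('b \<Rightarrow>\<^sub>0 'a) \<Rightarrow> 'c \<Rightarrow>\<^sub>0 'a::comm_ring_1" where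
  "lin g x = (\<Sum>b\<in>Poly_Mapping.keys x. scl (Poly_Mapping.lookup x b) (g b))"

definition tens :: "('b \<Rightarrow>\<^sub>0 'a) \<Rightarrow> ('c \<Rightarrow>\<^sub>0 'a) \<Rightarrow> ('b \<times> 'c) \<Rightarrow>\<^sub>0 'a::comm_ring_1" where
  "tens x y = (\<Sum>b\<in>Poly_Mapping.keys x. \<Sum>c\<in>Poly_Mapping.keys y.
     Poly_Mapping.single (b, c) (Poly_Mapping.lookup x b * Poly_Mapping.lookup y c))"

definition bas :: "'b \<Rightarrow> 'b \<Rightarrow>\<^sub>0 'a::comm_ring_1" where
  "bas b = Poly_Mapping.single b 1"

definition tbas :: "'b \<Rightarrow> ('p, 'b \<Rightarrow>\<^sub>0 'a::comm_ring_1) tps" where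
  "tbas b = tconst (bas b)"

definition tscl :: "('p, 'a::comm_ring_1) tps \<Rightarrow> ('p, 'b \<Rightarrow>\<^sub>0 'a) tps \<Rightarrow> ('p, 'b \<Rightarrow>\<^sub>0 'a) tps" where
  "tscl = tconv scl"

definition ttens ::
    "('p, 'b \<Rightarrow>\<^sub>0 'a) tps \<Rightarrow> ('p, 'c \<Rightarrow>\<^sub>0 'a) tps \<Rightarrow> ('p, ('b \<times> 'c) \<Rightarrow>\<^sub>0 'a::comm_ring_1) tps" where
  "ttens = tconv tens"

definition tlinear :: "(('p, 'b \<Rightarrow>\<^sub>0 'a) tps \<Rightarrow> ('p, 'c \<Rightarrow>\<^sub>0 'a::comm_ring_1) tps) \<Rightarrow> bool" where
  "tlinear T \<longleftrightarrow> (\<forall>x y. T (x + y) = T x + T y) \<and> (\<forall>c x. T (tscl c x) = tscl c (T x))"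

text \<open>The \<open>'a[[\<^bold>t]]\<close>-linear (hence \<open>\<^bold>t\<close>-adically continuous) map with prescribed values on the basis.\<close>

definition tlin ::
    "('b \<Rightarrow> ('p, 'c \<Rightarrow>\<^sub>0 'a) tps) \<Rightarrow> ('p, 'b \<Rightarrow>\<^sub>0 'a) tps \<Rightarrow> ('p, 'c \<Rightarrow>\<^sub>0 'a::comm_ring_1) tps" where
  "tlin g x = Abs_tps (\<lambda>n. \<Sum>(i, j) | i + j = n. lin (\<lambda>b. tcoeff (g b) j) (tcoeff x i))"


section \<open>Rational functions and the target \<open>K\<close>\<close>

text \<open>
  Rational functions in variables \<open>x\<^sub>0, x\<^sub>1, \<dots>\<close>. Functions of \<open>(z, w)\<close> use \<open>z = x\<^sub>0\<close> and \<open>w = x\<^sub>1\<close>; the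
  Yang--Baxter equation uses \<open>z\<^sub>1 = x\<^sub>0\<close>, \<open>z\<^sub>2 = x\<^sub>1\<close>, \<open>z\<^sub>3 = x\<^sub>2\<close>.
\<close>

type_synonym 'k mpol = "(nat \<Rightarrow>\<^sub>0 nat) \<Rightarrow>\<^sub>0 'k"
type_synonym 'k ratfun = "'k mpol fract"

definition cst :: "'k::field \<Rightarrow> 'k ratfun" where
  "cst c = Fract (Poly_Mapping.single 0 c) 1"

definition xv :: "nat \<Rightarrow> 'k::field ratfun" where
  "xv i = Fract (Poly_Mapping.single (Poly_Mapping.single i 1) 1) 1"

definition mpol_eval :: "('k::field \<Rightarrow> 'c) \<Rightarrow> (nat \<Rightarrow> 'c) \<Rightarrow> 'k mpol \<Rightarrow> 'c::field" where
  "mpol_eval c x p = (\<Sum>m\<in>Poly_Mapping.keys p. c (Poly_Mapping.lookup p m) *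
     (\<Prod>i\<in>Poly_Mapping.keys m. x i ^ Poly_Mapping.lookup m i))"

text \<open>
  Evaluation \<open>x\<^sub>i \<mapsto> x i\<close> along the field homomorphism \<open>c\<close>; only used at functions which have a
  denominator that does not vanish at the point \<open>x\<close>, where the value is unique.
\<close>

definition rf_eval :: "('k::field \<Rightarrow> 'c) \<Rightarrow> (nat \<Rightarrow> 'c) \<Rightarrow> 'k ratfun \<Rightarrow> 'c::field" where
  "rf_eval c x g = (THE y. \<exists>p q. g = Fract p q \<and> mpol_eval c x q \<noteq> 0 \<and>
     y = mpol_eval c x p / mpol_eval c x q)"

definition subst2 :: "nat \<Rightarrow> nat \<Rightarrow> 'k::field ratfun \<Rightarrow> 'k ratfun" where
  \<comment> \<open>\<open>g(z, w) \<mapsto> g(x\<^sub>i, x\<^sub>j)\<close>\<close>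
  "subst2 i j = rf_eval cst (\<lambda>l. if l = 0 then xv i else if l = 1 then xv j else 0)"

text \<open>
  \<open>expn i j g \<in> k((x\<^sub>i))((x\<^sub>j))\<close> is the expansion of \<open>g\<close> in the region \<open>|x\<^sub>i| > |x\<^sub>j|\<close>: the outer Laurent
  series variable is \<open>x\<^sub>j\<close>, the inner one \<open>x\<^sub>i\<close>.
\<close>

definition expn :: "nat \<Rightarrow> nat \<Rightarrow> 'k::field ratfun \<Rightarrow> 'k fls fls" where
  "expn i j = rf_eval (\<lambda>c. fls_const (fls_const c))
     (\<lambda>l. if l = i then fls_const fls_X else if l = j then fls_X else 0)"

definition mpol_pd :: "nat \<Rightarrow> 'k::field mpol \<Rightarrow> 'k mpol" where
  "mpol_pd i p = (\<Sum>m\<in>Poly_Mapping.keys p. Poly_Mapping.single (m - Poly_Mapping.single i 1)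
     (of_nat (Poly_Mapping.lookup m i) * Poly_Mapping.lookup p m))"

definition rf_pd :: "nat \<Rightarrow> 'k::field ratfun \<Rightarrow> 'k ratfun" where
  "rf_pd i g = (THE y. \<exists>p q. q \<noteq> 0 \<and> g = Fract p q \<and>
     y = Fract (mpol_pd i p * q - p * mpol_pd i q) (q * q))"

text \<open>\<open>K0 = k[z\<^sup>\<plusminus>\<^sup>1, w\<^sup>\<plusminus>\<^sup>1, (z - w)\<^sup>\<plusminus>\<^sup>1]\<close> and \<open>KT = K = K0[[\<^bold>t]]\<close>.\<close>

definition K0 :: "'k::field ratfun set" where
  "K0 = {Fract p 1 / (xv 0 ^ a * xv 1 ^ b * (xv 0 - xv 1) ^ c) | p a b c.
     \<forall>m\<in>Poly_Mapping.keys p. Poly_Mapping.keys m \<subseteq> {0, 1}}"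

definition KT :: "('p, 'k::field ratfun) tps set" where
  "KT = {g. \<forall>n. tcoeff g n \<in> K0}"


section \<open>\<open>H\<^sub>D\<close>-quantum vertex algebras\<close>

text \<open>
  A formal series with coefficients in \<open>V\<close> is given by its coefficient function; \<open>Y a n b\<close> is the
  coefficient of \<open>z\<^sup>n\<close> in \<open>Y(a, z)b\<close>, i.e. \<open>a\<^sub>(\<^sub>m\<^sub>)b = Y a (-m-1) b\<close>. Likewise \<open>F m n\<close> is the coefficient of
  \<open>z\<^sup>m w\<^sup>n\<close> in \<open>F(z, w)\<close>.
\<close>

definition mul_zw :: "(int \<Rightarrow> int \<Rightarrow> 'v::ab_group_add) \<Rightarrow> int \<Rightarrow> int \<Rightarrow> 'v" where
  "mul_zw F = (\<lambda>m n. F (m - 1) n - F m (n - 1))"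

definition mul_wz :: "(int \<Rightarrow> int \<Rightarrow> 'v::ab_group_add) \<Rightarrow> int \<Rightarrow> int \<Rightarrow> 'v" where
  "mul_wz F = (\<lambda>m n. F m (n - 1) - F (m - 1) n)"

text \<open>\<open>x \<equiv> y\<close> modulo \<open>(\<^bold>t)\<^sup>M\<close>, \<open>(\<^bold>t)\<close> being the ideal generated by the parameters\<close>

definition tcong :: "nat \<Rightarrow> ('p, 'a) tps \<Rightarrow> ('p, 'a) tps \<Rightarrow> bool" where
  "tcong M x y \<longleftrightarrow> (\<forall>j. size j < M \<longrightarrow> tcoeff x j = tcoeff y j)"

definition scalar_ext :: "('p, 'b \<Rightarrow>\<^sub>0 'k::field) tps \<Rightarrow> ('p, 'b \<Rightarrow>\<^sub>0 'k ratfun) tps" where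
  "scalar_ext = tmap (Poly_Mapping.map cst)"

definition flip :: "('p, ('b \<times> 'b) \<Rightarrow>\<^sub>0 'a::comm_ring_1) tps \<Rightarrow> ('p, ('b \<times> 'b) \<Rightarrow>\<^sub>0 'a) tps" where
  "flip = tmap (lin (\<lambda>(b, c). bas (c, b)))"

text \<open>
  \<open>R\<close> is a map \<open>V \<otimes> V \<rightarrow> V \<otimes> V \<otimes> K\<close> of functions of \<open>(z, w)\<close>. \<open>Rvars R i j\<close> is \<open>R(x\<^sub>i, x\<^sub>j)\<close>, extended linearly
  to \<open>V \<otimes> V\<close> with rational functions as scalars, and \<open>R12\<close>, \<open>R13\<close>, \<open>R23\<close> are its three actions on
  \<open>V \<otimes> V \<otimes> V\<close>.
\<close>

type_synonym ('p, 'b, 'k) braiding =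
  "('p, ('b \<times> 'b) \<Rightarrow>\<^sub>0 'k) tps \<Rightarrow> ('p, ('b \<times> 'b) \<Rightarrow>\<^sub>0 'k ratfun) tps"

definition Rval :: "('p, 'b, 'k::field) braiding \<Rightarrow> nat \<Rightarrow> nat \<Rightarrow> 'b \<times> 'b \<Rightarrow>
    ('p, ('b \<times> 'b) \<Rightarrow>\<^sub>0 'k ratfun) tps" where
  "Rval R i j bc = tmap (Poly_Mapping.map (subst2 i j)) (R (tbas bc))"

definition Rvars :: "('p, 'b, 'k::field) braiding \<Rightarrow> nat \<Rightarrow> nat \<Rightarrow>
    ('p, ('b \<times> 'b) \<Rightarrow>\<^sub>0 'k ratfun) tps \<Rightarrow> ('p, ('b \<times> 'b) \<Rightarrow>\<^sub>0 'k ratfun) tps" where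
  "Rvars R i j = tlin (Rval R i j)"

definition R12 :: "('p, 'b, 'k::field) braiding \<Rightarrow> nat \<Rightarrow> nat \<Rightarrow>
    ('p, ('b \<times> 'b \<times> 'b) \<Rightarrow>\<^sub>0 'k ratfun) tps \<Rightarrow> ('p, ('b \<times> 'b \<times> 'b) \<Rightarrow>\<^sub>0 'k ratfun) tps" where
  "R12 R i j = tlin (\<lambda>(b, c, d). tmap (lin (\<lambda>(b', c'). bas (b', c', d))) (Rval R i j (b, c)))"

definition R13 :: "('p, 'b, 'k::field) braiding \<Rightarrow> nat \<Rightarrow> nat \<Rightarrow>
    ('p, ('b \<times> 'b \<times> 'b) \<Rightarrow>\<^sub>0 'k ratfun) tps \<Rightarrow> ('p, ('b \<times> 'b \<times> 'b) \<Rightarrow>\<^sub>0 'k ratfun) tps" where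
  "R13 R i j = tlin (\<lambda>(b, c, d). tmap (lin (\<lambda>(b', d'). bas (b', c, d'))) (Rval R i j (b, d)))"

definition R23 :: "('p, 'b, 'k::field) braiding \<Rightarrow> nat \<Rightarrow> nat \<Rightarrow>
    ('p, ('b \<times> 'b \<times> 'b) \<Rightarrow>\<^sub>0 'k ratfun) tps \<Rightarrow> ('p, ('b \<times> 'b \<times> 'b) \<Rightarrow>\<^sub>0 'k ratfun) tps" where
  "R23 R i j = tlin (\<lambda>(b, c, d). tmap (lin (\<lambda>(c', d'). bas (b, c', d'))) (Rval R i j (c, d)))"

definition op_left :: "(('p, 'b \<Rightarrow>\<^sub>0 'k) tps \<Rightarrow> ('p, 'b \<Rightarrow>\<^sub>0 'k::field) tps) \<Rightarrow>
    ('p, ('b \<times> 'b) \<Rightarrow>\<^sub>0 'k ratfun) tps \<Rightarrow> ('p, ('b \<times> 'b) \<Rightarrow>\<^sub>0 'k ratfun) tps" where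
  "op_left D = tlin (\<lambda>(b, c). scalar_ext (ttens (D (tbas b)) (tbas c)))"

definition op_right :: "(('p, 'b \<Rightarrow>\<^sub>0 'k) tps \<Rightarrow> ('p, 'b \<Rightarrow>\<^sub>0 'k::field) tps) \<Rightarrow>
    ('p, ('b \<times> 'b) \<Rightarrow>\<^sub>0 'k ratfun) tps \<Rightarrow> ('p, ('b \<times> 'b) \<Rightarrow>\<^sub>0 'k ratfun) tps" where
  "op_right D = tlin (\<lambda>(b, c). scalar_ext (ttens (tbas b) (D (tbas c))))"

text \<open>
  The coefficient of \<open>z\<^sup>m w\<^sup>n\<close> in \<open>Y(w)(1 \<otimes> Y(z))(X \<otimes> c)\<close> for \<open>X \<in> V \<otimes> V \<otimes> K\<close>. As \<open>Y(b, w)Y(a, z)c\<close> lies in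
  the \<open>\<^bold>t\<close>-adic completion of \<open>V((w))((z))\<close>, the elements of \<open>K\<close> act through their expansions in
  \<open>|w| > |z|\<close>. For given \<open>m\<close>, \<open>n\<close> and \<open>\<^bold>t\<close>-degree only finitely many \<open>p\<close>, \<open>q\<close> contribute.
\<close>

definition YYX ::
    "(('p, 'b \<Rightarrow>\<^sub>0 'k) tps \<Rightarrow> int \<Rightarrow> ('p, 'b \<Rightarrow>\<^sub>0 'k) tps \<Rightarrow> ('p, 'b \<Rightarrow>\<^sub>0 'k::field) tps) \<Rightarrow>
     ('p, ('b \<times> 'b) \<Rightarrow>\<^sub>0 'k ratfun) tps \<Rightarrow> ('p, 'b \<Rightarrow>\<^sub>0 'k) tps \<Rightarrow> int \<Rightarrow> int \<Rightarrow> ('p, 'b \<Rightarrow>\<^sub>0 'k) tps" where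
  "YYX Y X c m n = Abs_tps (\<lambda>N. \<Sum>(i, j) | i + j = N. \<Sum>(b, a)\<in>Poly_Mapping.keys (tcoeff X i).
     \<Sum>(p, q). scl (fls_nth (fls_nth (expn 1 0 (Poly_Mapping.lookup (tcoeff X i) (b, a))) p) q)
       (tcoeff (Y (tbas b) (n - q) (Y (tbas a) (m - p) c)) j))"

text \<open>
  The module is \<open>V = ('p, 'b \<Rightarrow>\<^sub>0 'k) tps\<close>, the general topologically free \<open>k[[\<^bold>t]]\<close>-module. Over \<open>k[[\<^bold>t]]\<close>,
  \<open>V((z))\<close> means its \<open>\<^bold>t\<close>-adic completion: lower truncation, and likewise locality, holds modulo every
  power of the ideal \<open>(\<^bold>t)\<close>, with bounds that depend on the power.
\<close>

locale HD_quantum_vertex_algebra =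
  fixes vac :: "('p::finite, 'b \<Rightarrow>\<^sub>0 'k::field_char_0) tps"
    and Y :: "('p, 'b \<Rightarrow>\<^sub>0 'k) tps \<Rightarrow> int \<Rightarrow> ('p, 'b \<Rightarrow>\<^sub>0 'k) tps \<Rightarrow> ('p, 'b \<Rightarrow>\<^sub>0 'k) tps"
    and D :: "('p, 'b \<Rightarrow>\<^sub>0 'k) tps \<Rightarrow> ('p, 'b \<Rightarrow>\<^sub>0 'k) tps"
    and R :: "('p, 'b, 'k) braiding"
  assumes D_linear: "tlinear D"
    and Y_linear: "tlinear (\<lambda>a. Y a n b)"
    and Y_End: "tlinear (Y a n)"
    and Y_field: "\<exists>n0. \<forall>n<n0. tcong M (Y a n b) 0"
    and R_add: "R (X + X') = R X + R X'"
    and R_scale: "R (tscl c X) = tscl (tmap cst c) (R X)"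
    and R_K: "Poly_Mapping.lookup (tcoeff (R X) j) bc \<in> K0"
    and yang_baxter: "R12 R 0 1 \<circ> R13 R 0 2 \<circ> R23 R 1 2 = R23 R 1 2 \<circ> R13 R 0 2 \<circ> R12 R 0 1"
    and shift_left: "op_left D (R X) - Rvars R 0 1 (op_left D (scalar_ext X)) =
          - tmap (Poly_Mapping.map (rf_pd 0)) (R X)"
    and shift_right: "op_right D (R X) - Rvars R 0 1 (op_right D (scalar_ext X)) =
          - tmap (Poly_Mapping.map (rf_pd 1)) (R X)"
    and unitarity: "(flip \<circ> Rvars R 1 0 \<circ> flip) \<circ> Rvars R 0 1 = id"
          "Rvars R 0 1 \<circ> (flip \<circ> Rvars R 1 0 \<circ> flip) = id"
    and translation_covariance: "Y (D a) n b = tscl (of_int (n + 1)) (Y a (n + 1) b)"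
    and vacuum: "Y vac n b = (if n = 0 then b else 0)"
    and creation: "n < 0 \<Longrightarrow> Y a n vac = 0" "Y a 0 vac = a"
    and braided_locality: "\<exists>N. \<forall>c m n.
          tcong M ((mul_zw ^^ N) (\<lambda>m n. Y a m (Y b n c)) m n)
            ((mul_wz ^^ N) (YYX Y (tmap (Poly_Mapping.map (subst2 1 0)) (R (ttens b a))) c) m n)"


section \<open>The Hopf algebra \<open>V\<close>\<close>

text \<open>
  The monomial \<open>\<Prod>\<^sub>n (h\<^sup>(\<^sup>n\<^sup>))\<^bsup>u n\<^esup> e\<^bsup>m\<alpha>\<^esup>\<close> is encoded by \<open>(u, m)\<close>, so that the ring \<open>'k V0\<close> is the tensor product
  of the polynomial algebra in \<open>h\<^sup>(\<^sup>n\<^sup>) = (n+1) D\<^sup>(\<^sup>n\<^sup>+\<^sup>1\<^sup>)\<alpha>\<close>, \<open>n \<ge> 0\<close>, with the group algebra \<open>k[Z\<alpha>]\<close>. Extending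
  scalars to \<open>k[[\<^bold>t]]\<close> gives \<open>V = ('p, 'k V0) tps\<close>.
\<close>

type_synonym mon = "(nat \<Rightarrow>\<^sub>0 nat) \<times> int"
type_synonym 'k V0 = "mon \<Rightarrow>\<^sub>0 'k"

definition hgen :: "nat \<Rightarrow> 'k::comm_ring_1 V0" where
  "hgen n = bas (Poly_Mapping.single n 1, 0)"

definition ealpha :: "int \<Rightarrow> 'k::comm_ring_1 V0" where
  "ealpha m = bas (0, m)"

text \<open>The derivation with \<open>D h\<^sup>(\<^sup>n\<^sup>) = (n+1) h\<^sup>(\<^sup>n\<^sup>+\<^sup>1\<^sup>)\<close> and \<open>D e\<^bsup>m\<alpha>\<^esup> = m h e\<^bsup>m\<alpha>\<^esup>\<close>\<close>

definition D0 :: "'k::field_char_0 V0 \<Rightarrow> 'k V0" where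
  "D0 = lin (\<lambda>(u, m).
     (\<Sum>n\<in>Poly_Mapping.keys u. Poly_Mapping.single
        (u - Poly_Mapping.single n 1 + Poly_Mapping.single (n + 1) 1, m)
        (of_nat (Poly_Mapping.lookup u n * (n + 1)))) +
     Poly_Mapping.single (u + Poly_Mapping.single 0 1, m) (of_int m))"

definition comult :: "'k::comm_ring_1 V0 \<Rightarrow> (mon \<times> mon) \<Rightarrow>\<^sub>0 'k" where
  "comult = lin (\<lambda>(u, m).
     (\<Prod>n\<in>Poly_Mapping.keys u. (tens (hgen n) 1 + tens 1 (hgen n)) ^ Poly_Mapping.lookup u n) *
     tens (ealpha m) (ealpha m))"

definition counit :: "'k::comm_ring_1 V0 \<Rightarrow> 'k" where
  "counit x = (\<Sum>(u, m)\<in>Poly_Mapping.keys x. if u = 0 then Poly_Mapping.lookup x (u, m) else 0)"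

definition antipode :: "'k::comm_ring_1 V0 \<Rightarrow> 'k V0" where
  "antipode = lin (\<lambda>(u, m). Poly_Mapping.single (u, - m)
     ((- 1) ^ (\<Sum>n\<in>Poly_Mapping.keys u. Poly_Mapping.lookup u n)))"

text \<open>\<open>sweedler s a B\<close> is \<open>\<Sum> B a' a''\<close> for a bilinear \<open>B\<close> with values in a module with scalar action \<open>s\<close>.\<close>

definition sweedler ::
    "('k::comm_ring_1 \<Rightarrow> 'c \<Rightarrow> 'c) \<Rightarrow> 'k V0 \<Rightarrow> ('k V0 \<Rightarrow> 'k V0 \<Rightarrow> 'c) \<Rightarrow> 'c::comm_monoid_add" where
  "sweedler s a B = (\<Sum>(b, c)\<in>Poly_Mapping.keys (comult a).
     s (Poly_Mapping.lookup (comult a) (b, c)) (B (bas b) (bas c)))"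


section \<open>Bicharacters\<close>

text \<open>
  A bicharacter is given on \<open>'k V0\<close>; it extends uniquely to a \<open>k[[\<^bold>t]]\<close>-bilinear map on \<open>V\<close>.
\<close>

type_synonym ('p, 'k) bichar = "'k V0 \<Rightarrow> 'k V0 \<Rightarrow> ('p, 'k ratfun) tps"

definition sK :: "'k::field \<Rightarrow> ('p, 'k ratfun) tps \<Rightarrow> ('p, 'k ratfun) tps" where
  "sK c x = tconst (cst c) * x"

definition bicharacter :: "('p, 'k::field_char_0) bichar \<Rightarrow> bool" where
  "bicharacter r \<longleftrightarrow>
     (\<forall>a b. r a b \<in> KT) \<and>
     (\<forall>a b c. r (a + b) c = r a c + r b c) \<and> (\<forall>a b c. r a (b + c) = r a b + r a c) \<and>
     (\<forall>s a b. r (scl s a) b = sK s (r a b)) \<and> (\<forall>s a b. r a (scl s b) = sK s (r a b)) \<and>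
     (\<forall>a. r 1 a = tconst (cst (counit a))) \<and> (\<forall>a. r a 1 = tconst (cst (counit a))) \<and>
     (\<forall>a b c. r (a * b) c = sweedler sK c (\<lambda>c' c''. r a c' * r b c'')) \<and>
     (\<forall>a b c. r a (b * c) = sweedler sK a (\<lambda>a' a''. r a' b * r a'' c))"

definition D_compatible :: "('p, 'k::field_char_0) bichar \<Rightarrow> bool" where
  "D_compatible r \<longleftrightarrow>
     (\<forall>a b. r (D0 a) b = tmap (rf_pd 0) (r a b)) \<and> (\<forall>a b. r a (D0 b) = tmap (rf_pd 1) (r a b))"

definition bc_conv ::
    "('p, 'k::field_char_0) bichar \<Rightarrow> ('p, 'k) bichar \<Rightarrow> ('p, 'k) bichar" where
  "bc_conv r s a b = sweedler sK a (\<lambda>a' a''. sweedler sK b (\<lambda>b' b''. r a' b' * s a'' b''))"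

definition bc_inv :: "('p, 'k::field_char_0) bichar \<Rightarrow> ('p, 'k) bichar" where
  "bc_inv r a b = r (antipode a) b"

definition bc_tau :: "('p, 'k::field_char_0) bichar \<Rightarrow> ('p, 'k) bichar" where
  "bc_tau r a b = tmap (subst2 1 0) (r b a)"


section \<open>The structure on \<open>V\<close> given by a bicharacter\<close>

definition exp_zD :: "'k::field_char_0 V0 \<Rightarrow> 'k V0 fls" where
  "exp_zD a = fps_to_fls (Abs_fps (\<lambda>n. scl (1 / fact n) ((D0 ^^ n) a)))"

text \<open>
  \<open>g(z, 0)\<close> as a Laurent series with (scalar) coefficients in \<open>'k V0\<close>: the coefficient of \<open>w\<^sup>0\<close> of the
  expansion in \<open>|z| > |w|\<close>, which is the value at \<open>w = 0\<close> for \<open>g\<close> without pole at \<open>w = 0\<close>.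
\<close>

definition at_w0 :: "'k::field_char_0 ratfun \<Rightarrow> 'k V0 fls" where
  "at_w0 g = Abs_fls (\<lambda>n. Poly_Mapping.single 0 (fls_nth (fls_nth (expn 0 1 g) 0) n))"

definition Y0 :: "('p, 'k::field_char_0) bichar \<Rightarrow> 'k V0 \<Rightarrow> 'k V0 \<Rightarrow> ('p, 'k V0 fls) tps" where
  "Y0 r a b =
     (let s = (\<lambda>c x. tconst (fls_const (Poly_Mapping.single 0 c)) * x) in
      sweedler s a (\<lambda>a' a''. sweedler s b (\<lambda>b' b''.
        tconst (exp_zD a') * tconst (fls_const b') * tmap at_w0 (r a'' b''))))"

definition Y_r :: "('p, 'k::field_char_0) bichar \<Rightarrow>
    ('p, 'k V0) tps \<Rightarrow> int \<Rightarrow> ('p, 'k V0) tps \<Rightarrow> ('p, 'k V0) tps" where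
  "Y_r r a n b = Abs_tps (\<lambda>N. \<Sum>(i, j, l) | i + j + l = N.
     fls_nth (tcoeff (Y0 r (tcoeff a i) (tcoeff b j)) l) n)"

definition R0 :: "('p, 'k::field_char_0) bichar \<Rightarrow>
    'k V0 \<Rightarrow> 'k V0 \<Rightarrow> ('p, (mon \<times> mon) \<Rightarrow>\<^sub>0 'k ratfun) tps" where
  "R0 r a b =
     (let s = (\<lambda>c. tmap (scl (cst c))) in
      sweedler s a (\<lambda>a' a''. sweedler s b (\<lambda>b' b''.
        tscl (bc_conv (bc_tau r) (bc_inv r) a'' b'') (scalar_ext (tconst (tens a' b'))))))"

definition R_r :: "('p, 'k::field_char_0) bichar \<Rightarrow> ('p, mon, 'k) braiding" where
  "R_r r X = tlin (\<lambda>(b, c). R0 r (bas b) (bas c)) (scalar_ext X)"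


section \<open>Symmetric functions and \<open>\<Psi>(z)\<close>\<close>

text \<open>
  In characteristic zero \<open>\<Lambda>\<^sub>F = F[p\<^sub>1, p\<^sub>2, \<dots>]\<close>. The exponent of \<open>p\<^sub>i\<^sub>+\<^sub>1\<close> in a monomial \<open>p\<^sub>\<lambda>\<close>, i.e. the
  multiplicity of the part \<open>i + 1\<close> in \<open>\<lambda>\<close>, is stored at index \<open>i\<close>. The same indices make
  \<open>\<Lambda>\<^sub>F \<otimes> k[Z\<alpha>] = mon \<Rightarrow>\<^sub>0 'f\<close>.
\<close>

type_synonym 'f symfun = "(nat \<Rightarrow>\<^sub>0 nat) \<Rightarrow>\<^sub>0 'f"

definition psum :: "nat \<Rightarrow> 'f::field symfun" where
  "psum n = bas (Poly_Mapping.single (n - 1) 1)"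

definition zee :: "(nat \<Rightarrow>\<^sub>0 nat) \<Rightarrow> nat" where
  "zee l = (\<Prod>i\<in>Poly_Mapping.keys l. (i + 1) ^ Poly_Mapping.lookup l i * fact (Poly_Mapping.lookup l i))"

definition vpart :: "(nat \<Rightarrow> 'f::field) \<Rightarrow> (nat \<Rightarrow>\<^sub>0 nat) \<Rightarrow> 'f" where
  "vpart v l = (\<Prod>i\<in>Poly_Mapping.keys l. v (i + 1) ^ Poly_Mapping.lookup l i)"

definition vform :: "(nat \<Rightarrow> 'f::field) \<Rightarrow> 'f symfun \<Rightarrow> 'f symfun \<Rightarrow> 'f" where
  "vform v f g = (\<Sum>l\<in>Poly_Mapping.keys f.
     Poly_Mapping.lookup f l * Poly_Mapping.lookup g l * of_nat (zee l) * vpart v l)"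

definition perp :: "(nat \<Rightarrow> 'f::field) \<Rightarrow> nat \<Rightarrow> 'f symfun \<Rightarrow> 'f symfun" where
  "perp v n f = (THE f'. \<forall>g. vform v f' g = vform v f (psum n * g))"

definition on_Lambda :: "('f::field symfun \<Rightarrow> 'f symfun) \<Rightarrow> (mon \<Rightarrow>\<^sub>0 'f) \<Rightarrow> mon \<Rightarrow>\<^sub>0 'f" where
  "on_Lambda T = lin (\<lambda>(l, m). tens (T (bas l)) (bas m))"

text \<open>\<open>h\<^sub>-\<^sub>n\<close> and \<open>h\<^sub>n\<close> for \<open>n \<ge> 1\<close>\<close>

definition heis_minus :: "(nat \<Rightarrow> 'f::field) \<Rightarrow> nat \<Rightarrow> (mon \<Rightarrow>\<^sub>0 'f) \<Rightarrow> mon \<Rightarrow>\<^sub>0 'f" where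
  "heis_minus v n x = scl (inverse (v n)) (on_Lambda ((*) (psum n)) x)"

definition heis_plus :: "(nat \<Rightarrow> 'f::field) \<Rightarrow> nat \<Rightarrow> (mon \<Rightarrow>\<^sub>0 'f) \<Rightarrow> mon \<Rightarrow>\<^sub>0 'f" where
  "heis_plus v n x = scl (inverse (v n)) (on_Lambda (perp v n) x)"

text \<open>
  The coefficient of \<open>y\<^sup>k\<close> in \<open>exp (\<Sum>\<^sub>n\<^sub>\<ge>\<^sub>1 A\<^sub>n y\<^sup>n) = \<Sum>\<^sub>j (\<Sum>\<^sub>n\<^sub>\<ge>\<^sub>1 A\<^sub>n y\<^sup>n)\<^sup>j / j!\<close>, as a sum over the compositions
  \<open>(n\<^sub>1, \<dots>, n\<^sub>j)\<close> of \<open>k\<close>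
\<close>

definition exp_coeff ::
    "(nat \<Rightarrow> ('b \<Rightarrow>\<^sub>0 'f) \<Rightarrow> 'b \<Rightarrow>\<^sub>0 'f::field_char_0) \<Rightarrow> nat \<Rightarrow> ('b \<Rightarrow>\<^sub>0 'f) \<Rightarrow> 'b \<Rightarrow>\<^sub>0 'f" where
  "exp_coeff A k x = (\<Sum>ns | 0 \<notin> set ns \<and> sum_list ns = k. scl (1 / fact (length ns)) (foldr A ns x))"

text \<open>The coefficient of \<open>z\<^sup>n\<close> in \<open>\<Psi>(z)\<close>; on each vector only finitely many \<open>j\<close>, \<open>l\<close> contribute.\<close>

definition Psi :: "(nat \<Rightarrow> 'f::field_char_0) \<Rightarrow> int \<Rightarrow> (mon \<Rightarrow>\<^sub>0 'f) \<Rightarrow> mon \<Rightarrow>\<^sub>0 'f" where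
  "Psi v n = lin (\<lambda>(u, m). \<Sum>(j, l).
     if int j - int l + m = n
     then exp_coeff (\<lambda>i x. scl (1 / of_nat i) (heis_minus v i x)) j
           (exp_coeff (\<lambda>i x. scl (- 1 / of_nat i) (heis_plus v i x)) l
             (ealpha 1 * bas (u, m)))
     else 0)"


section \<open>Expansion in the parameters and the identification of the two spaces\<close>

text \<open>
  \<open>F\<close> is a field extension of \<open>k\<close> via \<open>\<kappa>\<close>. The elements of \<open>F\<close> that have a power series expansion in
  the parameters form a \<open>k\<close>-subalgebra \<open>A\<close>, and \<open>\<iota> : A \<rightarrow> k[[\<^bold>t]]\<close> is the expansion. E.g. for \<open>F = k(t)\<close>, \<open>A\<close>
  consists of the rational functions without pole at \<open>t = 0\<close>.
\<close>

definition t_expansion ::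
    "('k::field \<Rightarrow> 'f::field) \<Rightarrow> 'f set \<Rightarrow> ('f \<Rightarrow> ('p, 'k) tps) \<Rightarrow> bool" where
  "t_expansion \<kappa> A \<iota> \<longleftrightarrow>
     \<kappa> 1 = 1 \<and> (\<forall>c d. \<kappa> (c + d) = \<kappa> c + \<kappa> d) \<and> (\<forall>c d. \<kappa> (c * d) = \<kappa> c * \<kappa> d) \<and>
     (\<forall>c. \<kappa> c \<in> A \<and> \<iota> (\<kappa> c) = tconst c) \<and>
     (\<forall>a\<in>A. \<forall>b\<in>A. a + b \<in> A \<and> a * b \<in> A \<and> \<iota> (a + b) = \<iota> a + \<iota> b \<and> \<iota> (a * b) = \<iota> a * \<iota> b) \<and>
     inj_on \<iota> A"

definition f_ser :: "(nat \<Rightarrow> 'f::field_char_0) \<Rightarrow> 'f fps" where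
  "f_ser v = fps_compose (fps_exp 1)
     (Abs_fps (\<lambda>n. if n = 0 then 0 else - (inverse (v n) / of_nat n)))"

text \<open>
  \<open>\<sigma>(z, w) = z i\<^sub>t f(w/z)\<close>: each \<open>\<^bold>t\<close>-coefficient of \<open>\<sigma>\<close> is the element of \<open>K0\<close> whose expansion in
  \<open>|z| > |w|\<close> is the corresponding coefficient of \<open>\<Sum>\<^sub>q \<iota>(f\<^sub>q) z\<^sup>1\<^sup>-\<^sup>q w\<^sup>q\<close>. This determines \<open>\<sigma>\<close>.
\<close>

definition is_sigma :: "('f::field_char_0 \<Rightarrow> ('p, 'k::field) tps) \<Rightarrow> (nat \<Rightarrow> 'f) \<Rightarrow>
    ('p, 'k ratfun) tps \<Rightarrow> bool" where
  "is_sigma \<iota> v s \<longleftrightarrow> s \<in> KT \<and>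
     (\<forall>N p q. fls_nth (fls_nth (expn 0 1 (tcoeff s N)) q) p =
        (if q \<ge> 0 \<and> p = 1 - q then tcoeff (\<iota> (fps_nth (f_ser v) (nat q))) N else 0))"

text \<open>
  The basis of \<open>\<Lambda>\<^sub>F \<otimes> k[Z\<alpha>]\<close> identified with the monomial basis of \<open>V\<close> by \<open>v\<^sub>n\<^sup>-\<^sup>1 p\<^sub>n \<leftrightarrow> h\<^sup>(\<^sup>n\<^sup>-\<^sup>1\<^sup>)\<close>; its \<open>A\<close>-span;
  and the resulting map from this span to \<open>V\<close>.
\<close>

definition fock_bas :: "(nat \<Rightarrow> 'f::field) \<Rightarrow> mon \<Rightarrow> mon \<Rightarrow>\<^sub>0 'f" where
  "fock_bas v u = Poly_Mapping.single u (inverse (vpart v (fst u)))"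

definition fock_lattice :: "(nat \<Rightarrow> 'f::field) \<Rightarrow> 'f set \<Rightarrow> (mon \<Rightarrow>\<^sub>0 'f) set" where
  "fock_lattice v A = {x. \<forall>u. vpart v (fst u) * Poly_Mapping.lookup x u \<in> A}"

definition identify :: "(nat \<Rightarrow> 'f::field) \<Rightarrow> ('f \<Rightarrow> ('p, 'k::field) tps) \<Rightarrow>
    (mon \<Rightarrow>\<^sub>0 'f) \<Rightarrow> ('p, 'k V0) tps" where
  "identify v \<iota> x = Abs_tps (\<lambda>N. \<Sum>u\<in>Poly_Mapping.keys x.
     Poly_Mapping.single u (tcoeff (\<iota> (vpart v (fst u) * Poly_Mapping.lookup x u)) N))"

text \<open>
  \<open>transports v A \<iota> T T'\<close>: \<open>T\<close> preserves the \<open>A\<close>-span of the basis, and \<open>T'\<close> is the \<open>k[[\<^bold>t]]\<close>-linear operator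
  on \<open>V\<close> that corresponds to \<open>T\<close> under the identification.
\<close>

definition transports :: "(nat \<Rightarrow> 'f::field) \<Rightarrow> 'f set \<Rightarrow> ('f \<Rightarrow> ('p, 'k::field) tps) \<Rightarrow>
    ((mon \<Rightarrow>\<^sub>0 'f) \<Rightarrow> mon \<Rightarrow>\<^sub>0 'f) \<Rightarrow> (('p, 'k V0) tps \<Rightarrow> ('p, 'k V0) tps) \<Rightarrow> bool" where
  "transports v A \<iota> T T' \<longleftrightarrow>
     (\<forall>x\<in>fock_lattice v A. T x \<in> fock_lattice v A) \<and>
     T' = tlin (\<lambda>u. identify v \<iota> (T (fock_bas v u)))"

end

theory Submission imports Defs begin

text \<open>
  Everything rests on the factorization \<open>Y(a, z)b = \<Sum> e\<^bsup>zD\<^esup>(a') M(a'', b)\<close> with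
  \<open>M(a, b) = \<Sum> b' r(a, b'')(z, 0)\<close>, where \<open>M\<close> turns products in \<open>b\<close> into coproducts of \<open>a\<close>. For a primitive \<open>a\<close>
  the map \<open>M(a, -)\<close> is therefore a derivation, and for a grouplike \<open>a\<close> an algebra homomorphism. The logarithmic
  derivative of \<open>\<sigma>\<close> gives \<open>r(e\<^sup>\<alpha>, h\<^sup>(\<^sup>j\<^sup>))(z, 0) = - v\<^sub>j\<^sub>+\<^sub>1\<^sup>-\<^sup>1 z\<^sup>-\<^sup>j\<^sup>-\<^sup>1\<close>, so that \<open>M(h, -)\<close> is the generating function of
  the annihilation operators and \<open>M(e\<^sup>\<alpha>, -)\<close> is the substitution \<open>h\<^sup>(\<^sup>j\<^sup>) \<mapsto> h\<^sup>(\<^sup>j\<^sup>) - v\<^sub>j\<^sub>+\<^sub>1\<^sup>-\<^sup>1 z\<^sup>-\<^sup>j\<^sup>-\<^sup>1\<close>, which is their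
  exponential. The coefficients of \<open>e\<^bsup>zD\<^esup> e\<^sup>\<alpha>\<close> satisfy the recursion \<open>k c\<^sub>k = \<Sum> n A\<^sub>n c\<^sub>k\<^sub>-\<^sub>n\<close> of the other exponential.

  A product of two fields is the convolution
  \<open>Y(a, z)Y(b, w)c = \<Sum> r(a', b')(z, w) P(a'', b'', c)(z, w)\<close>, with \<open>r\<close> expanded in \<open>|z| > |w|\<close> and \<open>P\<close> symmetric in
  the pairs \<open>(a, z)\<close> and \<open>(b, w)\<close>. Hence the braiding \<open>r\<^sup>\<tau> * r\<^sup>-\<^sup>1\<close> turns the product in the other order into the same expression with
  \<open>r\<close> expanded in \<open>|w| > |z|\<close>, and the two expansions of an element of \<open>K0\<close> agree after multiplication by a
  power of \<open>z - w\<close>. The axioms of the braiding itself are identities in the convolution algebra of bilinear maps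
  on a cocommutative Hopf algebra.
\<close>

\<comment> \<open>The expansions are homomorphisms only on \<open>K0\<close>, and evaluation at
  \<open>w = 0\<close> is multiplicative only on functions without pole there. The factorization of
  \<open>Y\<close> therefore depends on \<open>r\<close> having no such pole, which the bicharacter
  axioms do not state. It follows from \<sigma>: this is regular at \<open>w = 0\<close>, and so is
  its inverse because its constant term in the parameters does not vanish there; products and
  \<open>D\<close> then generate everything from \<open>e^\<alpha>\<close> and
  \<open>e^-\<alpha>\<close>. Regularity also gives Taylor's formula
  \<open>r(a, e^(wD) b)(z, 0) = r(a, b)(z, w)\<close>, by which the composite of two fields produces
  the two-point function. The comparison with \<Psi> has another obstacle: only elements of
  \<open>A\<close> can be expanded in the parameters, and \<open>A\<close> contains the inverses of
  the \<open>v n\<close> but need not be closed under division. Both exponentials are handled by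
  recursions that divide only by positive integers, on an \<open>A\<close>-lattice preserved by all
  operators. Finiteness of the set of parameters makes the bounds for fields and locality uniform
  below each degree.\<close>
alias lookup = Poly_Mapping.lookup
alias keys = Poly_Mapping.keys
alias single = Poly_Mapping.single

section \<open>Linear extension\<close>

lemma lookup_map0: "f 0 = 0 \<Longrightarrow> lookup (Poly_Mapping.map f x) b = f (lookup x b)"
  by (simp add: Poly_Mapping.map.rep_eq when_def)

lemma lookup_scl [simp]: "lookup (scl c x) b = c * lookup x b"
  by (simp add: scl_def lookup_map0)

lemma lookup_bas: "lookup (bas b) c = (if b = c then 1 else 0)"
  by (simp add: bas_def lookup_single when_def)

lemma module_scl: "module (scl :: 'a::comm_ring_1 \<Rightarrow> _)"
  by standard (auto intro!: poly_mapping_eqI simp: lookup_add algebra_simps)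

lemma scl_mult: "scl c x = single 0 c * (x :: 'b::comm_monoid_add \<Rightarrow>\<^sub>0 'a::comm_ring_1)"
  by (simp add: scl_def mult_map_scale_conv_mult)

lemma scl_single [simp]: "scl c (single b d) = single b (c * d)"
  by (auto intro!: poly_mapping_eqI simp: lookup_single when_def)

lemma single_eq_scl_bas: "single b c = scl c (bas b)"
  by (simp add: bas_def)

lemma pm_expand: "x = (\<Sum>b\<in>keys x. single b (lookup x b))"
  by (rule poly_mapping_eqI)
    (simp add: lookup_sum lookup_single when_def in_keys_iff)

lemma pm_induct [case_names zero single add]:
  assumes "P 0" "\<And>b c. P (single b c)" "\<And>x y. P x \<Longrightarrow> P y \<Longrightarrow> P (x + y)"
  shows "P (x :: 'b \<Rightarrow>\<^sub>0 'a::comm_monoid_add)"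
proof -
  have "P (\<Sum>b\<in>A. single b (lookup x b))" for A
    by (induction A rule: infinite_finite_induct) (auto intro: assms)
  then have "P (\<Sum>b\<in>keys x. single b (lookup x b))" .
  then show ?thesis
    by (simp only: pm_expand[symmetric])
qed

lemma pm_additive_eqI:
  assumes "additive F" "additive G" "\<And>b c. F (single b c) = G (single b c)"
  shows "F x = G (x :: 'b \<Rightarrow>\<^sub>0 'a::ab_group_add)"
  by (induction x rule: pm_induct)
    (auto simp: assms additive.zero[OF assms(1)] additive.zero[OF assms(2)]
      additive.add[OF assms(1)] additive.add[OF assms(2)])

text \<open>Linear extension, Sweedler sums, polynomial evaluation and the counit are all sums over
  a support that differ only in the scalar action. Taking the action \<open>s\<close> as a parameter
  lets one set of lemmas serve all of them.\<close>

definition ext :: "('a::comm_ring_1 \<Rightarrow> 'm \<Rightarrow> 'm) \<Rightarrow> ('b \<Rightarrow> 'm) \<Rightarrow> ('b \<Rightarrow>\<^sub>0 'a) \<Rightarrow> 'm::ab_group_add" where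
  "ext s g x = (\<Sum>b\<in>keys x. s (lookup x b) (g b))"

lemma lin_eq_ext: "lin = ext scl"
  by (simp add: fun_eq_iff lin_def ext_def)

lemma sweedler_eq_ext: "sweedler s a B = ext s (\<lambda>(b, c). B (bas b) (bas c)) (comult a)"
  by (auto simp: sweedler_def ext_def intro!: sum.cong)

context module
begin

text \<open>Sums over the supports of \<open>x\<close>, \<open>y\<close> and \<open>x + y\<close>
  become comparable once they run over a common finite set; the extra terms have coefficient
  0.\<close>

lemma ext_superset:
  assumes "finite S" "keys x \<subseteq> S"
  shows "ext scale g x = (\<Sum>b\<in>S. lookup x b *s g b)"
  unfolding ext_def using assms by (intro sum.mono_neutral_left) (auto simp: in_keys_iff)

lemma ext_zero [simp]: "ext scale g 0 = 0"
  by (simp add: ext_def)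

lemma ext_add: "ext scale g (x + y) = ext scale g x + ext scale g y"
proof -
  have "keys (x + y) \<subseteq> keys x \<union> keys y"
    by (rule keys_add)
  then show ?thesis
    by (simp add: ext_superset[of "keys x \<union> keys y"] lookup_add algebra_simps sum.distrib)
qed

lemma additive_ext: "additive (ext scale g)"
  by standard (rule ext_add)

lemma ext_single [simp]: "ext scale g (single b c) = c *s g b"
  by (simp add: ext_superset[of "{b}"])

lemma ext_bas [simp]: "ext scale g (bas b) = g b"
  by (simp add: bas_def)

lemma ext_sum: "ext scale g (sum f A) = (\<Sum>i\<in>A. ext scale g (f i))"
  by (rule additive.sum[OF additive_ext])

lemma ext_scl: "ext scale g (scl c x) = c *s ext scale g x"
proof -
  have "keys (scl c x) \<subseteq> keys x"
    by (auto simp: in_keys_iff)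
  then show ?thesis
    by (subst (1 2) ext_superset[of "keys x"]) (auto simp: scale_sum_right)
qed

lemma ext_add_fun: "ext scale (\<lambda>b. g b + h b) x = ext scale g x + ext scale h x"
  by (simp add: ext_def algebra_simps sum.distrib)

lemma ext_scale_fun: "ext scale (\<lambda>b. c *s g b) x = c *s ext scale g x"
  by (simp add: ext_def scale_sum_right mult.commute)

lemma ext_zero_fun [simp]: "ext scale (\<lambda>b. 0) x = 0"
  by (simp add: ext_def)

lemma ext_sum_fun: "ext scale (\<lambda>b. \<Sum>i\<in>A. g i b) x = (\<Sum>i\<in>A. ext scale (g i) x)"
  unfolding ext_def scale_sum_right by (rule sum.swap)

lemma ext_swap:
  "ext scale (\<lambda>b. ext scale (g b) y) x = ext scale (\<lambda>c. ext scale (\<lambda>b. g b c) x) y"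
  unfolding ext_def scale_sum_right by (subst sum.swap) (simp add: mult.commute)

lemma ext_ext: "ext scale g (ext scl h x) = ext scale (\<lambda>b. ext scale g (h b)) x"
  unfolding ext_def[of scl h] by (simp add: ext_sum ext_scl ext_def[of scale _ x])

end

text \<open>Expansions and substitutions of rational functions are additive only where the
  denominators stay invertible, so the homomorphism lemmas come in a form relative to a subset
  closed under addition.\<close>

definition add_on :: "'a::ab_group_add set \<Rightarrow> ('a \<Rightarrow> 'b::ab_group_add) \<Rightarrow> bool" where
  "add_on P f \<longleftrightarrow> 0 \<in> P \<and> (\<forall>x\<in>P. \<forall>y\<in>P. x + y \<in> P \<and> f (x + y) = f x + f y)"

lemma add_on_UNIV [simp]: "add_on UNIV f \<longleftrightarrow> additive f"
  by (auto simp: add_on_def additive_def)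

lemma add_on_0: "add_on P f \<Longrightarrow> f 0 = 0"
  unfolding add_on_def by (metis add_cancel_left_left)

lemma add_on_sum_mem: "add_on P f \<Longrightarrow> (\<And>i. i \<in> A \<Longrightarrow> g i \<in> P) \<Longrightarrow> sum g A \<in> P"
  by (induction A rule: infinite_finite_induct) (auto simp: add_on_def)

lemma add_on_sum:
  "add_on P f \<Longrightarrow> (\<And>i. i \<in> A \<Longrightarrow> g i \<in> P) \<Longrightarrow> f (sum g A) = (\<Sum>i\<in>A. f (g i))"
proof (induction A rule: infinite_finite_induct)
  case (insert x A)
  then have "sum g A \<in> P" "g x \<in> P"
    by (auto intro: add_on_sum_mem)
  with insert show ?case
    by (auto simp: add_on_def)
qed (auto simp: add_on_0)

lemma ext_hom_on:
  assumes "add_on P \<phi>" "\<And>b. b \<in> keys x \<Longrightarrow> s (lookup x b) (g b) \<in> P"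
    "\<And>b. b \<in> keys x \<Longrightarrow> \<phi> (s (lookup x b) (g b)) = s' (lookup x b) (\<phi> (g b))"
  shows "\<phi> (ext s g x) = ext s' (\<lambda>b. \<phi> (g b)) x"
  unfolding ext_def using assms by (simp add: add_on_sum)

lemma ext_hom:
  assumes "additive \<phi>" "\<And>c y. \<phi> (s c y) = s' c (\<phi> y)"
  shows "\<phi> (ext s g x) = ext s' (\<lambda>b. \<phi> (g b)) x"
  by (rule ext_hom_on[of UNIV]) (auto simp: assms)

lemma additive_comp: "additive f \<Longrightarrow> additive g \<Longrightarrow> additive (\<lambda>x. f (g x))"
  by (simp add: additive_def)

subsection \<open>Tensors\<close>

lemma lookup_tens [simp]: "lookup (tens x y) (b, c) = lookup x b * lookup y c"
proof -
  have "lookup (tens x y) (b, c) = (\<Sum>b'\<in>keys x. \<Sum>c'\<in>keys y.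
      if b' = b then if c' = c then lookup x b * lookup y c else 0 else 0)"
    by (auto simp: tens_def lookup_sum lookup_single when_def intro!: sum.cong)
  also have "\<dots> = lookup x b * lookup y c"
  proof -
    have "(\<Sum>c'\<in>keys y. if b' = b then if c' = c then lookup x b * lookup y c else 0 else 0) =
        (if b' = b then lookup x b * lookup y c else 0)" for b'
      by (auto simp: in_keys_iff)
    then show ?thesis
      by (simp add: in_keys_iff)
  qed
  finally show ?thesis .
qed

lemma tens_add_left: "tens (x + x') y = tens x y + tens x' y"
  and tens_add_right: "tens x (y + y') = tens x y + tens x y'"
  and tens_scl_left: "tens (scl c x) y = scl c (tens x y)"
  and tens_scl_right: "tens x (scl c y) = scl c (tens x y)"
  by (auto intro!: poly_mapping_eqI simp: lookup_add algebra_simps)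

lemma tens_zero [simp]: "tens 0 y = 0" "tens x 0 = 0"
  by (auto intro!: poly_mapping_eqI)

lemma tens_single [simp]: "tens (single b c) (single b' c') = single (b, b') (c * c')"
  by (auto intro!: poly_mapping_eqI simp: lookup_single when_def)

lemma tens_bas [simp]: "tens (bas b) (bas b') = bas (b, b')"
  by (simp add: bas_def)

lemma tens_mult: "tens (x * x') (y * y') = tens x y * (tens x' y' :: ('b::comm_monoid_add \<times> 'c::comm_monoid_add) \<Rightarrow>\<^sub>0 'a::comm_ring_1)"
proof (induction x rule: pm_induct)
  case (single b c)
  show ?case
  proof (induction x' rule: pm_induct)
    case (single b' c')
    show ?case
    proof (induction y rule: pm_induct)
      case (single b'' c'')
      show ?case
        by (induction y' rule: pm_induct)
          (auto simp: mult_single distrib_left distrib_right tens_add_right mult_ac)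
    qed (auto simp: distrib_right tens_add_right)
  qed (auto simp: distrib_left distrib_right tens_add_left)
qed (auto simp: distrib_right tens_add_left)

section \<open>The t-adic extension of an additive map\<close>

lemma tcoeff_tconst: "tcoeff (tconst a) n = (if n = {#} then a else 0)"
  by (simp add: tconst_def)

lemma tcoeff_tmap [simp]: "tcoeff (tmap f x) n = f (tcoeff x n)"
  by (simp add: tmap_def)

lemma tcoeff_tconv: "tcoeff (tconv f x y) n = (\<Sum>(i, j) | i + j = n. f (tcoeff x i) (tcoeff y j))"
  by (simp add: tconv_def)

lemma tcoeff_mult: "tcoeff (x * y) n = (\<Sum>(i, j) | i + j = n. tcoeff x i * tcoeff y j)"
  by (simp add: times_tps_def tcoeff_tconv)

lemma tcoeff_one: "tcoeff 1 n = (if n = {#} then 1 else 0)"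
  by (simp add: one_tps_def tcoeff_tconst)

lemma tcoeff_sum: "tcoeff (sum f A) n = (\<Sum>i\<in>A. tcoeff (f i) n)"
  by (induction A rule: infinite_finite_induct) auto

text \<open>The extension of a map \<open>M \<rightarrow> N[[t]]\<close> to \<open>M[[t]]\<close>.
  The product, \<open>tconv\<close>, \<open>tscl\<close> and \<open>tlin\<close> are all instances,
  so the rearrangements of triple sums are carried out for \<open>tapp\<close> only.\<close>

definition tapp :: "('a \<Rightarrow> ('p, 'm::comm_monoid_add) tps) \<Rightarrow> ('p, 'a) tps \<Rightarrow> ('p, 'm) tps" where
  "tapp f x = Abs_tps (\<lambda>n. \<Sum>(i, j) | i + j = n. tcoeff (f (tcoeff x i)) j)"

lemma tcoeff_tapp: "tcoeff (tapp f x) n = (\<Sum>(i, j) | i + j = n. tcoeff (f (tcoeff x i)) j)"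
  by (simp add: tapp_def)

lemma tapp_add: "additive f \<Longrightarrow> tapp f (x + y) = tapp f x + tapp f y"
  by (rule tps_eqI) (simp add: tcoeff_tapp additive.add case_prod_unfold sum.distrib)

lemma additive_tapp: "additive f \<Longrightarrow> additive (tapp f)"
  by (simp add: additive_def tapp_add)

lemma tapp_add_fun: "tapp (\<lambda>a. f a + g a) x = tapp f x + tapp g x"
  for f :: "'a \<Rightarrow> ('p, 'b::ab_group_add) tps"
  by (rule tps_eqI) (simp add: tcoeff_tapp case_prod_unfold sum.distrib)

lemma sum_decomp_delta_left:
  "(\<Sum>(i, j) | i + j = (n :: 'p multiset). if i = {#} then f j else 0) = f n"
proof -
  have "(\<Sum>(i, j) | i + j = n. if i = {#} then f j else 0) = (\<Sum>(i, j)\<in>{({#} :: 'p multiset, n)}. f j)"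
    by (rule sum.mono_neutral_cong_right) (auto simp: finite_decomp split: if_splits)
  then show ?thesis by simp
qed

lemma sum_decomp_delta_right:
  "(\<Sum>(i, j) | i + j = (n :: 'p multiset). if j = {#} then f i else 0) = f n"
proof -
  have "(\<Sum>(i, j) | i + j = n. if j = {#} then f i else 0) = (\<Sum>(i, j)\<in>{(n, {#} :: 'p multiset)}. f i)"
    by (rule sum.mono_neutral_cong_right) (auto simp: finite_decomp split: if_splits)
  then show ?thesis by simp
qed

text \<open>Two ways of decomposing \<open>n\<close> into three summands; the bijection is the one
  behind the associativity of the product.\<close>

lemma sum_decomp_assoc:
  "(\<Sum>(i, j) | i + j = (n :: 'p multiset). \<Sum>(k, l) | k + l = i. f k l j) =
   (\<Sum>(k, j') | k + j' = n. \<Sum>(l, j) | l + j = j'. f k l j)"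
proof -
  have "(\<Sum>(i, j) | i + j = n. \<Sum>(k, l) | k + l = i. f k l j) =
      (\<Sum>((i, j), (k, l))\<in>(SIGMA p:{(i, j). i + j = n}. {(k, l). k + l = fst p}). f k l j)"
    by (subst sum.Sigma[symmetric]) (simp_all add: case_prod_unfold)
  also have "\<dots> = (\<Sum>((k, j'), (l, j))\<in>(SIGMA p:{(i, j). i + j = n}. {(k, l). k + l = snd p}). f k l j)"
    by (rule sum.reindex_bij_witness
          [of _ "\<lambda>((i, j), (k, l)). ((i + k, l), (i, k))" "\<lambda>((i, j), (k, l)). ((k, l + j), (l, j))"])
      (auto simp: algebra_simps)
  also have "\<dots> = (\<Sum>(k, j') | k + j' = n. \<Sum>(l, j) | l + j = j'. f k l j)"
    by (subst sum.Sigma[symmetric]) (simp_all add: case_prod_unfold)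
  finally show ?thesis .
qed

lemma sum_decomp_swap:
  "(\<Sum>(i, j) | i + j = (n :: 'p multiset). f i j) = (\<Sum>(i, j) | i + j = n. f j i)"
  by (rule sum.reindex_bij_witness[of _ prod.swap prod.swap]) (auto simp: algebra_simps)

lemma tapp_tconst:
  assumes "f 0 = 0"
  shows "tapp f (tconst a) = f a"
proof (rule tps_eqI)
  fix n
  have "tcoeff (tapp f (tconst a)) n = (\<Sum>(i, j) | i + j = n. if i = {#} then tcoeff (f a) j else 0)"
    by (auto simp: tcoeff_tapp tcoeff_tconst assms intro!: sum.cong)
  then show "tcoeff (tapp f (tconst a)) n = tcoeff (f a) n"
    by (simp add: sum_decomp_delta_left)
qed

text \<open>Each coefficient of \<open>tapp g x\<close> is a finite sum of elements of
  \<open>P\<close>, through which \<open>f\<close> passes by additivity on \<open>P\<close>.\<close>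

lemma tapp_comp_on:
  assumes "add_on P f" "\<And>a n. tcoeff (g a) n \<in> P"
  shows "tapp f (tapp g x) = tapp (\<lambda>a. tapp f (g a)) x"
proof (rule tps_eqI)
  fix n
  have *: "tcoeff (f (\<Sum>(k, l) | k + l = i. tcoeff (g (tcoeff x k)) l)) j =
     (\<Sum>(k, l) | k + l = i. tcoeff (f (tcoeff (g (tcoeff x k)) l)) j)" for i j
    by (subst add_on_sum[OF assms(1)]) (auto simp: tcoeff_sum case_prod_unfold assms)
  show "tcoeff (tapp f (tapp g x)) n = tcoeff (tapp (\<lambda>a. tapp f (g a)) x) n"
    by (simp add: tcoeff_tapp * sum_decomp_assoc)
qed

lemma tapp_comp: "additive f \<Longrightarrow> tapp f (tapp g x) = tapp (\<lambda>a. tapp f (g a)) x"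
  by (rule tapp_comp_on[of UNIV]) auto

lemma tmap_tapp_on:
  assumes "add_on P \<phi>" "\<And>a n. tcoeff (f a) n \<in> P"
  shows "tmap \<phi> (tapp f x) = tapp (\<lambda>a. tmap \<phi> (f a)) x"
proof (rule tps_eqI)
  fix n
  show "tcoeff (tmap \<phi> (tapp f x)) n = tcoeff (tapp (\<lambda>a. tmap \<phi> (f a)) x) n"
    using assms by (simp add: tcoeff_tapp case_prod_unfold, subst add_on_sum[OF assms(1)]) auto
qed

lemma tmap_tapp: "additive \<phi> \<Longrightarrow> tmap \<phi> (tapp f x) = tapp (\<lambda>a. tmap \<phi> (f a)) x"
  by (rule tmap_tapp_on[of UNIV]) auto

lemma tapp_tmap: "tapp f (tmap g x) = tapp (\<lambda>a. f (g a)) x"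
  by (rule tps_eqI) (simp add: tcoeff_tapp)

text \<open>Fubini: both sides are the sum over decompositions of the degree into three parts, with
  the parts taken from \<open>x\<close> and \<open>y\<close> exchanged.\<close>

lemma tapp_swap: "tapp (\<lambda>a. tapp (f a) y) x = tapp (\<lambda>b. tapp (\<lambda>a. f a b) x) y"
  for f :: "'a \<Rightarrow> 'b \<Rightarrow> ('p, 'm::comm_monoid_add) tps"
proof (rule tps_eqI)
  fix n
  let ?f = "\<lambda>k l j. tcoeff (f (tcoeff x k) (tcoeff y l)) j"
  have "tcoeff (tapp (\<lambda>a. tapp (f a) y) x) n = (\<Sum>(k, j') | k + j' = n. \<Sum>(l, j) | l + j = j'. ?f k l j)"
    by (simp add: tcoeff_tapp)
  also have "\<dots> = (\<Sum>(i, j) | i + j = n. \<Sum>(k, l) | k + l = i. ?f k l j)"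
    by (simp add: sum_decomp_assoc)
  also have "\<dots> = (\<Sum>(i, j) | i + j = n. \<Sum>(k, l) | k + l = i. ?f l k j)"
    by (subst (2) sum_decomp_swap) simp
  also have "\<dots> = tcoeff (tapp (\<lambda>b. tapp (\<lambda>a. f a b) x) y) n"
    by (simp add: tcoeff_tapp sum_decomp_assoc)
  finally show "tcoeff (tapp (\<lambda>a. tapp (f a) y) x) n = tcoeff (tapp (\<lambda>b. tapp (\<lambda>a. f a b) x) y) n" .
qed

lemma tconv_eq_tapp: "tconv f x y = tapp (\<lambda>a. tmap (f a) y) x"
  by (rule tps_eqI) (simp add: tcoeff_tconv tcoeff_tapp)

lemma mult_eq_tapp: "x * y = tapp (\<lambda>a. tmap ((*) a) y) x"
  by (simp add: times_tps_def tconv_eq_tapp)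

lemma tmap_add: "additive f \<Longrightarrow> tmap f (x + y) = tmap f x + tmap f y"
  by (rule tps_eqI) (simp add: additive.add)

lemma additive_tmap: "additive f \<Longrightarrow> additive (tmap f)"
  by (simp add: additive_def tmap_add)

lemma tmap_tconst: "f 0 = 0 \<Longrightarrow> tmap f (tconst a) = tconst (f a)"
  by (rule tps_eqI) (simp add: tcoeff_tconst)

lemma tmap_tmap: "tmap f (tmap g x) = tmap (\<lambda>a. f (g a)) x"
  by (rule tps_eqI) simp

lemma tconst_add: "tconst (a + b) = tconst a + tconst (b :: 'a::ab_group_add)"
  by (rule tps_eqI) (simp add: tcoeff_tconst)

lemma additive_tconst: "additive (tconst :: 'a::ab_group_add \<Rightarrow> _)"
  by (simp add: additive_def tconst_add)

lemma tconst_mult_left: "tconst a * x = tmap ((*) a) x"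
  by (simp add: mult_eq_tapp tapp_tconst tps_eqI)

lemma tconst_mult: "tconst (a * b) = tconst a * tconst (b :: 'a::comm_ring_1)"
  by (simp add: tconst_mult_left tmap_tconst)

lemma tconst_0 [simp]: "tconst 0 = 0"
  by (rule tps_eqI) (simp add: tcoeff_tconst)

lemma tconst_1 [simp]: "tconst 1 = 1"
  by (simp add: one_tps_def)

lemma additive_mult_left: "additive ((*) (a :: 'a::comm_ring_1))"
  by (simp add: additive_def distrib_left)

lemma mult_tapp: "y * tapp f x = tapp (\<lambda>a. y * f a) x"
  by (subst (1 2) mult_eq_tapp)
    (simp add: tmap_tapp additive_mult_left tapp_swap[of _ _ x])

lemma tapp_mult: "tapp f x * y = tapp (\<lambda>a. f a * y) x"
  using mult_tapp[of y f x] by (simp add: mult.commute)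

lemma tapp_sum_fun: "tapp (\<lambda>a. \<Sum>i\<in>A. f i a) x = (\<Sum>i\<in>A. tapp (f i) x)"
  for f :: "'i \<Rightarrow> 'a \<Rightarrow> ('p, 'b::ab_group_add) tps"
  by (rule tps_eqI) (simp add: tcoeff_tapp tcoeff_sum case_prod_unfold sum.swap[of _ A])

section \<open>Evaluation of rational functions\<close>

definition rhom :: "('a::comm_ring_1 \<Rightarrow> 'b::comm_ring_1) \<Rightarrow> bool" where
  "rhom f \<longleftrightarrow> f 1 = 1 \<and> (\<forall>x y. f (x + y) = f x + f y) \<and> (\<forall>x y. f (x * y) = f x * f y)"

lemma rhomI:
  "f 1 = 1 \<Longrightarrow> (\<And>x y. f (x + y) = f x + f y) \<Longrightarrow> (\<And>x y. f (x * y) = f x * f y) \<Longrightarrow> rhom f"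
  by (simp add: rhom_def)

lemma rhomD:
  assumes "rhom f"
  shows "f 1 = 1" "f (x + y) = f x + f y" "f (x * y) = f x * f y" "additive f" "f 0 = 0"
    "f (- x) = - f x" "f (x - y) = f x - f y" "f (x ^ n) = f x ^ n" "f (sum g A) = (\<Sum>i\<in>A. f (g i))"
proof -
  show *: "additive f"
    using assms by (simp add: rhom_def additive_def)
  show "f 1 = 1" "f (x + y) = f x + f y" and m: "f (x * y) = f x * f y" for x y
    using assms by (simp_all add: rhom_def)
  then show "f (x ^ n) = f x ^ n"
    by (induction n) auto
  show "f 0 = 0" "f (- x) = - f x" "f (x - y) = f x - f y" "f (sum g A) = (\<Sum>i\<in>A. f (g i))"
    using additive.zero[OF *] additive.minus[OF *] additive.diff[OF *] additive.sum[OF *] by blast+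
qed

lemma rhom_comp: "rhom f \<Longrightarrow> rhom g \<Longrightarrow> rhom (\<lambda>x. f (g x))"
  by (simp add: rhom_def)

text \<open>A commutative ring that receives the scalars through \<phi> is a module over them.
  Ring-valued Sweedler sums use this action.\<close>

definition act :: "('a \<Rightarrow> 'b) \<Rightarrow> 'a \<Rightarrow> 'b \<Rightarrow> 'b::times" where
  "act \<phi> c x = \<phi> c * x"

lemma module_act: "rhom \<phi> \<Longrightarrow> module (act \<phi>)"
  by standard (auto simp: act_def rhom_def algebra_simps)

text \<open>A monoid homomorphism on exponents and a ring homomorphism on coefficients define a
  homomorphism of the monoid algebra. Polynomial evaluation, counit, antipode and coproduct are all
  obtained this way.\<close>

lemma rhom_ext:
  assumes "rhom \<phi>" "g 0 = 1" "\<And>b b'. g (b + b') = g b * g b'"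
  shows "rhom (ext (act \<phi>) (g :: 'b::comm_monoid_add \<Rightarrow> _))"
proof -
  interpret module "act \<phi>"
    by (rule module_act) fact
  show ?thesis
  proof (rule rhomI)
    show "ext (act \<phi>) g 1 = 1"
      using assms by (simp add: act_def rhomD flip: single_one)
    show "ext (act \<phi>) g (x * y) = ext (act \<phi>) g x * ext (act \<phi>) g y" for x y
    proof (induction x rule: pm_induct)
      case (single b c)
      show ?case
      proof (induction y rule: pm_induct)
        case (single b' c')
        show ?case
          by (simp add: mult_single assms) (simp add: act_def rhomD[OF assms(1)] mult_ac)
      qed (auto simp: distrib_left ext_add)
    qed (auto simp: distrib_right ext_add)
  qed (rule ext_add)
qed

definition meval :: "(nat \<Rightarrow> 'c) \<Rightarrow> (nat \<Rightarrow>\<^sub>0 nat) \<Rightarrow> 'c::comm_ring_1" where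
  "meval x m = (\<Prod>i\<in>keys m. x i ^ lookup m i)"

lemma meval_superset:
  assumes "finite S" "keys m \<subseteq> S"
  shows "meval x m = (\<Prod>i\<in>S. x i ^ lookup m i)"
  unfolding meval_def using assms by (intro prod.mono_neutral_left) (auto simp: in_keys_iff)

lemma meval_0 [simp]: "meval x 0 = 1"
  by (simp add: meval_def)

lemma meval_add: "meval x (m + m') = meval x m * meval x m'"
proof -
  have "keys (m + m') \<subseteq> keys m \<union> keys m'"
    by (rule keys_add)
  then show ?thesis
    by (simp add: meval_superset[of "keys m \<union> keys m'"] lookup_add power_add prod.distrib)
qed

lemma meval_single [simp]: "meval x (single i n) = x i ^ n"
  by (subst meval_superset[of "{i}"]) auto

lemma mpol_eval_eq_ext: "mpol_eval c x = ext (act c) (meval x)"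
  by (simp add: fun_eq_iff mpol_eval_def ext_def act_def meval_def)

lemma rhom_mpol_eval: "rhom c \<Longrightarrow> rhom (mpol_eval c x)"
  unfolding mpol_eval_eq_ext by (rule rhom_ext) (auto simp: meval_add)

definition rf_dom :: "('k::field \<Rightarrow> 'c) \<Rightarrow> (nat \<Rightarrow> 'c::field) \<Rightarrow> 'k ratfun set" where
  "rf_dom c x = {Fract p q | p q. mpol_eval c x q \<noteq> 0}"

context
  fixes c :: "'k::field \<Rightarrow> 'c::field" and x :: "nat \<Rightarrow> 'c"
  assumes c: "rhom c"
begin

text \<open>The value does not depend on the representation: evaluating the cross-multiplied
  equation gives equal quotients.\<close>

lemma rf_eval_Fract:
  assumes q: "mpol_eval c x q \<noteq> 0"
  shows "rf_eval c x (Fract p q) = mpol_eval c x p / mpol_eval c x q"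
  unfolding rf_eval_def
proof (rule the_equality)
  note E = rhomD[OF rhom_mpol_eval[OF c]]
  fix y assume "\<exists>p' q'. Fract p q = Fract p' q' \<and> mpol_eval c x q' \<noteq> 0 \<and> y = mpol_eval c x p' / mpol_eval c x q'"
  then obtain p' q' where *: "Fract p q = Fract p' q'" "mpol_eval c x q' \<noteq> 0"
    "y = mpol_eval c x p' / mpol_eval c x q'"
    by blast
  have "q \<noteq> 0" "q' \<noteq> 0"
    using q * by (auto simp: E)
  with * have "p * q' = p' * q"
    by (simp add: eq_fract)
  then have "mpol_eval c x p * mpol_eval c x q' = mpol_eval c x p' * mpol_eval c x q"
    by (metis E(3))
  with q * show "y = mpol_eval c x p / mpol_eval c x q"
    by (simp add: frac_eq_eq)
qed (use q in blast)

lemma rf_dom_add_mult: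
  assumes "g \<in> rf_dom c x" "h \<in> rf_dom c x"
  shows "g + h \<in> rf_dom c x" "rf_eval c x (g + h) = rf_eval c x g + rf_eval c x h"
    "g * h \<in> rf_dom c x" "rf_eval c x (g * h) = rf_eval c x g * rf_eval c x h"
proof -
  note E = rhomD[OF rhom_mpol_eval[OF c]]
  obtain p q p' q' where g: "g = Fract p q" "mpol_eval c x q \<noteq> 0"
    and h: "h = Fract p' q'" "mpol_eval c x q' \<noteq> 0"
    using assms by (auto simp: rf_dom_def)
  have nz: "q \<noteq> 0" "q' \<noteq> 0" and e: "mpol_eval c x (q * q') \<noteq> 0"
    using g h by (auto simp: E)
  have s: "g + h = Fract (p * q' + p' * q) (q * q')" and m: "g * h = Fract (p * p') (q * q')"
    using nz by (auto simp: g h)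
  show "g + h \<in> rf_dom c x" "g * h \<in> rf_dom c x"
    unfolding rf_dom_def s m using e by auto
  show "rf_eval c x (g + h) = rf_eval c x g + rf_eval c x h" "rf_eval c x (g * h) = rf_eval c x g * rf_eval c x h"
    unfolding s m rf_eval_Fract[OF e] unfolding g(1) h(1) rf_eval_Fract[OF g(2)] rf_eval_Fract[OF h(2)]
    using g(2) h(2) by (simp_all add: E add_frac_eq)
qed

lemma rf_dom_poly: "Fract p 1 \<in> rf_dom c x" "rf_eval c x (Fract p 1) = mpol_eval c x p"
proof -
  note E = rhomD[OF rhom_mpol_eval[OF c]]
  show "Fract p 1 \<in> rf_dom c x"
    unfolding rf_dom_def using E(1) by (metis (mono_tags, lifting) mem_Collect_eq zero_neq_one)
  show "rf_eval c x (Fract p 1) = mpol_eval c x p"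
    by (simp add: rf_eval_Fract E)
qed

lemma rf_dom_cst: "cst a \<in> rf_dom c x" "rf_eval c x (cst a) = c a"
proof -
  interpret module "act c" by (rule module_act) (rule c)
  show "cst a \<in> rf_dom c x" "rf_eval c x (cst a) = c a"
    by (simp_all add: cst_def rf_dom_poly mpol_eval_eq_ext) (simp add: act_def)
qed

lemma rf_dom_xv: "xv i \<in> rf_dom c x" "rf_eval c x (xv i) = x i"
proof -
  interpret module "act c" by (rule module_act) (rule c)
  show "xv i \<in> rf_dom c x" "rf_eval c x (xv i) = x i"
    by (simp_all add: xv_def rf_dom_poly mpol_eval_eq_ext scale_one)
qed

lemma rf_dom_inverse:
  assumes "g \<in> rf_dom c x" "rf_eval c x g \<noteq> 0"
  shows "inverse g \<in> rf_dom c x" "rf_eval c x (inverse g) = inverse (rf_eval c x g)"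
proof -
  obtain p q where g: "g = Fract p q" "mpol_eval c x q \<noteq> 0"
    using assms by (auto simp: rf_dom_def)
  with assms have p: "mpol_eval c x p \<noteq> 0"
    by (auto simp: rf_eval_Fract)
  then show "inverse g \<in> rf_dom c x"
    by (auto simp: g rf_dom_def)
  show "rf_eval c x (inverse g) = inverse (rf_eval c x g)"
    using p g by (simp add: rf_eval_Fract)
qed

end

lemma rhom_cst: "rhom (cst :: 'k::field \<Rightarrow> _)"
  by (rule rhomI) (auto simp: cst_def single_add mult_single fract_collapse)

lemma cst_0 [simp]: "cst 0 = 0" and cst_1 [simp]: "cst 1 = 1"
  using rhomD[OF rhom_cst] by auto

lemma Fract_single:
  "Fract (single m c) 1 = cst c * meval xv m"
proof (induction m arbitrary: c rule: pm_induct)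
  case (single i n)
  show ?case
  proof (induction n arbitrary: c)
    case (Suc n)
    have "Fract (single (single i (Suc n)) c) 1 = Fract (single (single i n) c) 1 * xv i"
      by (simp add: xv_def mult_single flip: single_add)
    with Suc show ?case by (simp add: mult_ac)
  qed (simp add: cst_def)
next
  case (add m m')
  have "Fract (single (m + m') c) 1 = Fract (single m c) 1 * Fract (single m' 1) 1"
    by (simp add: mult_single)
  then show ?case by (simp add: add meval_add)
qed (simp add: cst_def)

lemma Fract_sum: "Fract (sum f A) 1 = (\<Sum>i\<in>A. Fract (f i) 1)"
proof (induction A rule: infinite_finite_induct)
  case (insert i A)
  then show ?case
    by (simp add: insert.hyps flip: insert.IH)
qed (auto simp: fract_collapse)

text \<open>Two variables are separated by evaluation at the point with \<open>i\<close>-th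
  coordinate 1 and all other coordinates 0.\<close>

lemma xv_inject: "xv i = (xv j :: 'k::field ratfun) \<longleftrightarrow> i = j"
proof
  assume *: "xv i = (xv j :: 'k ratfun)"
  let ?x = "\<lambda>l. if l = i then 1 else 0 :: 'k"
  have id: "rhom (\<lambda>a :: 'k. a)"
    by (simp add: rhom_def)
  have "rf_eval (\<lambda>a. a) ?x (xv i) = 1"
    using rf_dom_xv(2)[OF id, of ?x i] by simp
  moreover have "rf_eval (\<lambda>a. a) ?x (xv j) = (if j = i then 1 else 0)"
    by (rule rf_dom_xv(2)[OF id])
  ultimately show "i = j"
    using * by (metis zero_neq_one)
qed simp

lemma xv_nonzero [simp]: "xv i \<noteq> (0 :: 'k::field ratfun)"
proof
  assume *: "xv i = (0 :: 'k ratfun)"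
  have id: "rhom (\<lambda>a :: 'k. a)"
    by (simp add: rhom_def)
  show False
    using rf_dom_xv(2)[OF id, of "\<lambda>_. 1" i] rf_dom_cst(2)[OF id, of "\<lambda>_. 1" 0] * by simp
qed

lemma xv01_nonzero [simp]: "xv 0 - xv (Suc 0) \<noteq> (0 :: 'k::field ratfun)" "xv 0 \<noteq> (xv (Suc 0) :: 'k::field ratfun)"
  by (simp_all add: xv_inject)

section \<open>The ring \<open>K0\<close>: closure properties and generators\<close>

definition K0_den :: "nat \<Rightarrow> nat \<Rightarrow> nat \<Rightarrow> 'k::field ratfun" where
  "K0_den a b c = xv 0 ^ a * xv 1 ^ b * (xv 0 - xv 1) ^ c"

definition K0_num :: "'k::field ratfun set" where
  "K0_num = {Fract p 1 | p. \<forall>m\<in>keys p. keys m \<subseteq> {0, 1}}"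

lemma K0_iff: "g \<in> K0 \<longleftrightarrow> (\<exists>n\<in>K0_num. \<exists>a b c. g = n / K0_den a b c)"
  unfolding K0_def K0_num_def K0_den_def by blast

lemma K0_den_add: "K0_den a b c * K0_den a' b' c' = K0_den (a + a') (b + b') (c + c')"
  by (simp add: K0_den_def power_add mult_ac)

lemma K0_den_nonzero [simp]: "K0_den a b c \<noteq> 0"
  by (simp add: K0_den_def)

lemma K0_num_add: "g \<in> K0_num \<Longrightarrow> h \<in> K0_num \<Longrightarrow> g + h \<in> K0_num"
  unfolding K0_num_def
  by clarsimp (metis (no_types, opaque_lifting) UnE keys_add subset_iff)

lemma K0_num_mult: "g \<in> K0_num \<Longrightarrow> h \<in> K0_num \<Longrightarrow> g * h \<in> K0_num"
proof -
  assume "g \<in> K0_num" "h \<in> K0_num"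
  then obtain p q where pq: "g = Fract p 1" "h = Fract q 1"
    "\<forall>m\<in>keys p. keys m \<subseteq> {0, 1}" "\<forall>m\<in>keys q. keys m \<subseteq> {0, 1}"
    unfolding K0_num_def by blast
  have "keys m \<subseteq> {0, 1}" if m: "m \<in> keys (p * q)" for m
  proof -
    obtain a b where "m = a + b" "a \<in> keys p" "b \<in> keys q"
      using keys_mult[of p q] m by blast
    then show ?thesis
      using pq keys_add[of a b] by blast
  qed
  then show ?thesis
    unfolding K0_num_def pq by auto
qed

lemma K0_num_cst: "cst a \<in> K0_num"
  unfolding K0_num_def cst_def by (auto split: if_splits)

lemma K0_num_xv: "xv 0 \<in> K0_num" "xv 1 \<in> K0_num" "xv (Suc 0) \<in> K0_num"
  unfolding K0_num_def xv_def by (force)+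

lemma K0_num_power: "g \<in> K0_num \<Longrightarrow> g ^ n \<in> K0_num"
  by (induction n) (auto simp: K0_num_mult K0_num_cst simp flip: cst_1)

lemma K0_num_diff: "g \<in> K0_num \<Longrightarrow> h \<in> K0_num \<Longrightarrow> g - h \<in> K0_num"
  using K0_num_add[of g "cst (-1) * h"] K0_num_mult[OF K0_num_cst, of h "-1"]
  by (simp add: rhomD[OF rhom_cst])

lemma K0_num_den: "K0_den a b c \<in> K0_num"
  unfolding K0_den_def by (intro K0_num_mult K0_num_power K0_num_diff K0_num_xv)

lemma K0_num_K0: "g \<in> K0_num \<Longrightarrow> g \<in> K0"
  unfolding K0_iff by (rule bexI[of _ g], rule exI[of _ 0], rule exI[of _ 0], rule exI[of _ 0])
    (auto simp: K0_den_def)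

lemma K0_add: "g \<in> K0 \<Longrightarrow> h \<in> K0 \<Longrightarrow> g + h \<in> K0"
proof -
  assume "g \<in> K0" "h \<in> K0"
  then obtain n a b c n' a' b' c' where *: "g = n / K0_den a b c" "h = n' / K0_den a' b' c'" "n \<in> K0_num" "n' \<in> K0_num"
    unfolding K0_iff by blast
  have "g + h = (n * K0_den a' b' c' + n' * K0_den a b c) / K0_den (a + a') (b + b') (c + c')"
    by (simp add: * add_frac_eq K0_den_add)
  moreover have "n * K0_den a' b' c' + n' * K0_den a b c \<in> K0_num"
    by (intro K0_num_add K0_num_mult K0_num_den *)
  ultimately show ?thesis
    unfolding K0_iff by blast
qed

lemma K0_mult: "g \<in> K0 \<Longrightarrow> h \<in> K0 \<Longrightarrow> g * h \<in> K0"
proof -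
  assume "g \<in> K0" "h \<in> K0"
  then obtain n a b c n' a' b' c' where *: "g = n / K0_den a b c" "h = n' / K0_den a' b' c'" "n \<in> K0_num" "n' \<in> K0_num"
    unfolding K0_iff by blast
  have "g * h = (n * n') / K0_den (a + a') (b + b') (c + c')"
    by (simp add: * flip: K0_den_add)
  then show ?thesis
    unfolding K0_iff using K0_num_mult * by blast
qed

lemma K0_cst: "cst a \<in> K0" and K0_0: "0 \<in> K0" and K0_1: "1 \<in> K0" and
  K0_xv: "xv 0 \<in> K0" "xv 1 \<in> K0"
  using K0_num_K0[OF K0_num_cst] K0_num_K0[OF K0_num_xv(1)] K0_num_K0[OF K0_num_xv(2)] 
    cst_0 cst_1 by metis+

lemma K0_inverse: "inverse (xv 0) \<in> K0" "inverse (xv 1) \<in> K0" "inverse (xv 0 - xv 1) \<in> K0"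
proof -
  have 1: "1 / K0_den a b c \<in> K0" for a b c
    unfolding K0_iff using K0_num_cst[of 1] by auto
  show "inverse (xv 0) \<in> K0" "inverse (xv 1) \<in> K0" "inverse (xv 0 - xv 1) \<in> K0"
    using 1[of 1 0 0] 1[of 0 1 0] 1[of 0 0 1] by (simp_all add: K0_den_def inverse_eq_divide)
qed

lemma K0_uminus: "g \<in> K0 \<Longrightarrow> - g \<in> K0"
  using K0_mult[OF K0_cst, of g "-1"] by (simp add: rhomD[OF rhom_cst])

lemma K0_diff: "g \<in> K0 \<Longrightarrow> h \<in> K0 \<Longrightarrow> g - h \<in> K0"
  using K0_add[of g "- h"] by (simp add: K0_uminus)

lemma K0_power: "g \<in> K0 \<Longrightarrow> g ^ n \<in> K0"
  by (induction n) (auto simp: K0_1 K0_mult)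

lemma K0_sum: "(\<And>i. i \<in> A \<Longrightarrow> f i \<in> K0) \<Longrightarrow> sum f A \<in> K0"
  by (induction A rule: infinite_finite_induct) (auto intro: K0_0 K0_add)

text \<open>Constants, the two variables and the three inverses generate \<open>K0\<close> under
  sums and products: the numerator is a sum of monomials, the denominator a product of powers.
  Statements about homomorphisms, derivatives and expansions on \<open>K0\<close> are reduced to
  these generators.\<close>

lemma K0_induct [consumes 1, case_names cst add mult xv0 xv1 inv0 inv1 inv01]:
  assumes "g \<in> K0"
    and cst: "\<And>c. P (cst c)"
    and add: "\<And>g h. g \<in> K0 \<Longrightarrow> h \<in> K0 \<Longrightarrow> P g \<Longrightarrow> P h \<Longrightarrow> P (g + h)"
    and mult: "\<And>g h. g \<in> K0 \<Longrightarrow> h \<in> K0 \<Longrightarrow> P g \<Longrightarrow> P h \<Longrightarrow> P (g * h)"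
    and xv: "P (xv 0)" "P (xv 1)" and inv: "P (inverse (xv 0))" "P (inverse (xv 1))" "P (inverse (xv 0 - xv 1))"
  shows "P (g :: 'k::field ratfun)"
proof -
  obtain p a b c where g: "g = Fract p 1 / K0_den a b c" and p: "\<forall>m\<in>keys p. keys m \<subseteq> {0, 1}"
    using assms(1) unfolding K0_iff K0_num_def by blast
  \<comment> \<open>Membership in \<open>K0\<close> is carried along because the cases for sums and
    products assume it.\<close>
  define Q where "Q g \<longleftrightarrow> g \<in> K0 \<and> P g" for g
  have Q_mult: "Q (g * h)" if "Q g" "Q h" for g h
    using that by (auto simp: Q_def K0_mult mult)
  have Q_add: "Q (g + h)" if "Q g" "Q h" for g h
    using that by (auto simp: Q_def K0_add add)
  have Q_cst: "Q (cst a)" for a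
    by (simp add: Q_def K0_cst cst)
  have Q_power: "Q (g ^ n)" if "Q g" for g n
    using Q_cst[of 1] by (induction n) (auto simp: Q_mult that)
  have "Q (Fract (single m d) 1)" if "keys m \<subseteq> {0, 1}" for m d
  proof -
    have "Fract (single m d) 1 = cst d * (xv 0 ^ lookup m 0 * xv 1 ^ lookup m 1)"
      using that by (simp add: Fract_single meval_superset[of "{0, 1}" m])
    also have "Q \<dots>"
      by (intro Q_mult Q_cst Q_power) (simp_all add: Q_def K0_xv xv K0_xv(2)[simplified] xv(2)[simplified])
    finally show ?thesis .
  qed
  then have "Q (\<Sum>m\<in>S. Fract (single m (lookup p m)) 1)" if "S \<subseteq> keys p" for S
    using that p
  proof (induction S rule: infinite_finite_induct)
    case (insert m S)
    then show ?case by (auto intro!: Q_add)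
  qed (use Q_cst[of 0] in auto)
  then have "Q (Fract p 1)"
    by (subst pm_expand) (simp add: Fract_sum)
  moreover have "g = Fract p 1 * (inverse (xv 0) ^ a * inverse (xv 1) ^ b * inverse (xv 0 - xv 1) ^ c)"
    by (simp add: g K0_den_def divide_inverse power_inverse)
  moreover have "Q (inverse (xv 0) ^ a * inverse (xv 1) ^ b * inverse (xv 0 - xv 1) ^ c)"
    using inv K0_inverse by (intro Q_mult Q_power) (auto simp: Q_def)
  ultimately show ?thesis
    using Q_mult Q_def by simp
qed

lemma K0_subset_rf_dom:
  assumes "rhom c" "x 0 \<noteq> 0" "x 1 \<noteq> 0" "x 0 \<noteq> x 1"
  shows "K0 \<subseteq> rf_dom c x"
proof
  fix g :: "'a ratfun"
  note D = rf_dom_add_mult[OF assms(1)] rf_dom_cst[OF assms(1)] rf_dom_xv[OF assms(1)]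
  \<comment> \<open>The difference is written as a sum, since the facts about the domain cover sums,
    products, constants and variables.\<close>
  have m: "xv 0 - xv 1 = xv 0 + cst (- 1) * xv 1"
    by (simp add: rhomD[OF rhom_cst])
  assume "g \<in> K0"
  then show "g \<in> rf_dom c x"
  proof (induction rule: K0_induct)
    case inv01
    show ?case
      unfolding m using assms
      by (intro rf_dom_inverse(1)[OF assms(1)] D) (simp add: D rhomD[OF assms(1)])
  qed (use assms in \<open>auto intro!: D rf_dom_inverse(1)[OF assms(1)] simp: D\<close>)
qed

subsection \<open>Partial derivatives\<close>

context
  fixes i :: nat
begin

lemma mpol_pd_eq_ext: "mpol_pd i p = ext scl (\<lambda>m. single (m - single i 1) (of_nat (lookup m i))) p"
  by (simp add: mpol_pd_def ext_def mult.commute)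

lemma mpol_pd_single: "mpol_pd i (single m a) = single (m - single i 1) (of_nat (lookup m i) * a)"
  by (simp add: mpol_pd_eq_ext module.ext_single[OF module_scl] mult.commute)

lemma mpol_pd_add: "mpol_pd i (p + q) = mpol_pd i p + mpol_pd i q"
  by (simp add: mpol_pd_eq_ext module.ext_add[OF module_scl])

lemma mpol_pd_0 [simp]: "mpol_pd i 0 = 0"
  by (simp add: mpol_pd_def)

text \<open>Subtraction of exponents is truncated, so it commutes with adding \<open>m'\<close> only
  if the variable occurs in \<open>m\<close>.\<close>

lemma single_minus_one:
  "lookup m i \<noteq> 0 \<Longrightarrow> m + m' - single i (1::nat) = (m - single i 1) + m'"
  by (rule poly_mapping_eqI) (auto simp: lookup_minus lookup_add lookup_single when_def)

lemma mpol_pd_mult: "mpol_pd i (p * q) = mpol_pd i p * q + p * mpol_pd i q"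
proof (induction p rule: pm_induct)
  case (single m a)
  show ?case
  proof (induction q rule: pm_induct)
    case (single m' a')
    \<comment> \<open>If the variable does not occur in \<open>m\<close>, the truncated exponent is
      wrong, but then the coefficient is 0.\<close>
    have 1: "single (m + m' - single i 1) (of_nat (lookup m i) * a * a') =
        single (m - single i 1) (of_nat (lookup m i) * a) * single m' a'"
      by (cases "lookup m i = 0") (simp_all add: mult_single single_minus_one mult.assoc del: One_nat_def)
    have 2: "single (m + m' - single i 1) (of_nat (lookup m' i) * a * a') =
        single m a * single (m' - single i 1) (of_nat (lookup m' i) * a')"
      using single_minus_one[of m' m]
      by (cases "lookup m' i = 0") (auto simp: mult_single ac_simps simp del: One_nat_def)
    have "mpol_pd i (single m a * single m' a') =
       single (m + m' - single i 1) (of_nat (lookup m i) * a * a') + single (m + m' - single i 1) (of_nat (lookup m' i) * a * a')"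
      by (simp add: mult_single mpol_pd_single lookup_add algebra_simps flip: single_add)
    then show ?case
      by (simp only: 1 2 mpol_pd_single)
  qed (auto simp: algebra_simps mpol_pd_add)
qed (auto simp: algebra_simps mpol_pd_add)

lemma mpol_pd_1 [simp]: "mpol_pd i 1 = 0"
  by (simp add: mpol_pd_single flip: single_one)

lemma rf_pd_Fract:
  assumes "q \<noteq> 0"
  shows "rf_pd i (Fract p q) = Fract (mpol_pd i p * q - p * mpol_pd i q) (q * q)"
  unfolding rf_pd_def
proof (rule the_equality)
  fix y assume "\<exists>p' q'. q' \<noteq> 0 \<and> Fract p q = Fract p' q' \<and> y = Fract (mpol_pd i p' * q' - p' * mpol_pd i q') (q' * q')"
  then obtain p' q' where *: "q' \<noteq> 0" "Fract p q = Fract p' q'"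
    "y = Fract (mpol_pd i p' * q' - p' * mpol_pd i q') (q' * q')"
    by blast
  then have e: "p * q' = p' * q"
    using assms by (simp add: eq_fract)
  \<comment> \<open>Differentiating the cross-multiplied relation gives the second equation from
    which the quotient rules for both representations are seen to agree.\<close>
  then have d: "mpol_pd i p * q' + p * mpol_pd i q' = mpol_pd i p' * q + p' * mpol_pd i q"
    by (metis mpol_pd_mult)
  have "(mpol_pd i p' * q' - p' * mpol_pd i q') * (q * q) = (mpol_pd i p * q - p * mpol_pd i q) * (q' * q')"
    using e d by algebra
  then show "y = Fract (mpol_pd i p * q - p * mpol_pd i q) (q * q)"
    using assms * by (simp add: eq_fract)
qed (use assms in blast)

lemma rf_pd_add: "rf_pd i (g + h) = rf_pd i g + rf_pd i h"
proof -
  obtain p q p' q' where *: "g = Fract p q" "q \<noteq> 0" "h = Fract p' q'" "q' \<noteq> 0"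
    by (metis Fract_cases)
  then show ?thesis
    by (simp add: rf_pd_Fract mpol_pd_mult mpol_pd_add eq_fract algebra_simps)
qed

lemma rf_pd_mult: "rf_pd i (g * h) = rf_pd i g * h + g * rf_pd i h"
proof -
  obtain p q p' q' where *: "g = Fract p q" "q \<noteq> 0" "h = Fract p' q'" "q' \<noteq> 0"
    by (metis Fract_cases)
  then show ?thesis
    by (simp add: rf_pd_Fract mpol_pd_mult mpol_pd_add eq_fract algebra_simps)
qed

lemma rf_pd_cst [simp]: "rf_pd i (cst a) = 0"
  by (simp add: cst_def rf_pd_Fract mpol_pd_single fract_collapse)

lemma rf_pd_xv: "rf_pd i (xv j) = (if i = j then 1 else 0)"
  by (auto simp: xv_def rf_pd_Fract mpol_pd_single lookup_single when_def fract_collapse)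

lemma additive_rf_pd: "additive (rf_pd i)"
  by (simp add: additive_def rf_pd_add)

lemma rf_pd_inverse: "rf_pd i (inverse g) = - (rf_pd i g * inverse g * inverse g)"
proof (cases "g = 0")
  case False
  have "rf_pd i (g * inverse g) = 0"
    using rf_pd_cst[of 1] False by simp
  then have "g * rf_pd i (inverse g) = - (rf_pd i g * inverse g)"
    by (simp add: rf_pd_mult eq_neg_iff_add_eq_0 add.commute)
  then show ?thesis
    using False by (simp add: field_simps)
qed (use rf_pd_cst[of 0] in auto)

end

text \<open>A derivation \<open>d\<close> of the target field that kills constants and acts on the
  coordinates like the \<open>i\<close>-th partial derivative commutes with evaluation, since both
  sides are determined by the generators of \<open>K0\<close>. It is applied with the derivative in
  the outer variable, with that in the inner variable, and with \<open>rf_pd\<close> itself after an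
  exchange of variables; stability of \<open>K0\<close> under derivatives is a by-product.\<close>

lemma rf_eval_pd:
  assumes c: "rhom c" and g: "g \<in> K0" and x: "x 0 \<noteq> 0" "x 1 \<noteq> 0" "x 0 \<noteq> x 1"
    and d: "\<And>a b. d (a + b) = d a + d b" "\<And>a b. d (a * b) = d a * b + a * d b" "\<And>a. d (c a) = 0"
      "d (x 0) = (if i = 0 then 1 else 0)" "d (x 1) = (if i = 1 then 1 else 0)"
  shows "rf_eval c x (rf_pd i g) = d (rf_eval c x g) \<and> rf_pd i g \<in> K0"
proof -
  note D = rf_dom_add_mult[OF c] rf_dom_cst[OF c] rf_dom_xv[OF c]
  have ad: "additive d"
    using d by (simp add: additive_def)
  have d1: "d 1 = 0"
    using d(3)[of 1] by (auto simp: rhomD[OF c])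
  have dinv: "d (inverse y) = - (d y * inverse y * inverse y)" for y
  proof (cases "y = 0")
    case False
    then have "y * d (inverse y) + d y * inverse y = 0"
      using d(2)[of y "inverse y"] by (simp add: d1 add.commute)
    then show ?thesis
      using False by (simp add: field_simps add_eq_0_iff)
  qed (simp add: additive.zero[OF ad])
  have K: "K0 \<subseteq> rf_dom c x"
    using c x by (rule K0_subset_rf_dom)
  have m: "xv 0 - xv 1 = xv 0 + cst (- 1) * xv 1"
    by (simp add: rhomD[OF rhom_cst])
  \<comment> \<open>One argument for all three inverse generators, by the rule for the derivative of
    an inverse in source and target.\<close>
  have inv: "rf_eval c x (rf_pd i (inverse y)) = d (rf_eval c x (inverse y)) \<and> rf_pd i (inverse y) \<in> K0"
    if y: "y \<in> K0" "inverse y \<in> K0" "rf_eval c x y \<noteq> 0"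
      "rf_eval c x (rf_pd i y) = d (rf_eval c x y) \<and> rf_pd i y \<in> K0" for y
  proof -
    have e: "rf_pd i (inverse y) = cst (-1) * (rf_pd i y * inverse y * inverse y)"
      by (simp add: rf_pd_inverse rhomD[OF rhom_cst])
    have "rf_pd i (inverse y) \<in> K0"
      unfolding e using y by (intro K0_mult K0_cst) auto
    moreover have *: "rf_eval c x (inverse y) = inverse (rf_eval c x y)"
      using y K by (intro rf_dom_inverse(2)[OF c]) auto
    have "rf_eval c x (rf_pd i (inverse y)) = d (rf_eval c x (inverse y))"
      unfolding * dinv e using y(1,2,4) K
      by (simp add: D K0_mult subset_iff * rhomD[OF c])
    ultimately show ?thesis by simp
  qed
  from g show ?thesis
  proof (induction rule: K0_induct)
    case (cst a)
    then show ?case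
      using rf_dom_cst(2)[OF c, of x 0] by (simp add: D d K0_0 rhomD[OF c])
  next
    case (add g h)
    then show ?case
      using K by (auto simp: rf_pd_add D d K0_add subset_iff)
  next
    case (mult g h)
    then show ?case
      using K by (auto simp: rf_pd_mult D d K0_add K0_mult subset_iff)
  next
    case xv0
    show ?case
      using rf_dom_cst(2)[OF c, of x 0] rf_dom_cst(2)[OF c, of x 1] by (simp add: rf_pd_xv D d K0_0 K0_1 rhomD[OF c])
  next
    case xv1
    show ?case
      using rf_dom_cst(2)[OF c, of x 0] rf_dom_cst(2)[OF c, of x 1] d(5)
      by (simp add: rf_pd_xv D K0_0 K0_1 rhomD[OF c])
  next
    case inv0
    show ?case
      using rf_dom_cst(2)[OF c, of x 0] rf_dom_cst(2)[OF c, of x 1] x K0_inverse K0_xv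
      by (intro inv) (auto simp: rf_pd_xv D d K0_0 K0_1 rhomD[OF c])
  next
    case inv1
    show ?case
      using rf_dom_cst(2)[OF c, of x 0] rf_dom_cst(2)[OF c, of x 1] x K0_inverse K0_xv d(5)
      by (intro inv) (auto simp: rf_pd_xv D K0_0 K0_1 rhomD[OF c])
  next
    case inv01
    have "rf_eval c x (xv 0 - xv 1) = x 0 - x 1"
      unfolding m by (simp add: D rhomD[OF c])
    moreover have "rf_eval c x (rf_pd i (xv 0 - xv 1)) = d (x 0 - x 1)"
    proof -
      have e1: "d (x 0 - x 1) = d (x 0) - d (x 1)"
        by (rule additive.diff[OF ad])
      have e2: "rf_pd i (xv 0 - xv 1) = cst ((if i = 0 then 1 else 0) - (if i = 1 then 1 else 0))"
        by (subst additive.diff[OF additive_rf_pd]) (simp add: rf_pd_xv rhomD[OF rhom_cst])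
      have e3: "c ((if i = 0 then 1 else 0) - (if i = 1 then 1 else 0)) =
          (if i = 0 then 1 else 0) - (if i = 1 then 1 else 0)"
        by (simp add: rhomD[OF c])
      show ?thesis
        by (simp only: e1 e2 e3 D d)
    qed
    moreover have "rf_pd i (xv 0 - xv 1) \<in> K0"
      by (subst additive.diff[OF additive_rf_pd]) (auto simp: rf_pd_xv intro!: K0_uminus K0_0 K0_1)
    ultimately show ?case
      using x K0_inverse(3) K0_xv by (intro inv) (auto intro: K0_diff)
  qed
qed

declare One_nat_def [simp del]

lemma xv01_neq [simp]: "xv 0 \<noteq> (xv 1 :: 'k::field ratfun)" "xv 1 \<noteq> (xv 0 :: 'k::field ratfun)"
  by (simp_all add: xv_inject)

section \<open>Iterated Laurent series\<close>

lemma fls_lower_bound: "\<exists>a. \<forall>n<a. fls_nth F n = 0"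
  by (meson fls_nth_vanishes_belowE)

text \<open>Arbitrary lower bounds replace the subdegrees: a coefficientwise map may change a
  subdegree but respects bounds.\<close>

lemma fls_mult_nth_bound:
  fixes F G :: "'a::comm_ring_1 fls"
  assumes "\<And>i. i < a \<Longrightarrow> fls_nth F i = 0" "\<And>i. i < b \<Longrightarrow> fls_nth G i = 0"
  shows "fls_nth (F * G) n = (\<Sum>i=a..n - b. fls_nth F i * fls_nth G (n - i))"
proof -
  let ?S = "{min a (fls_subdegree F)..max (n - b) (n - fls_subdegree G)}"
  have "fls_nth (F * G) n = (\<Sum>i=fls_subdegree F..n - fls_subdegree G. fls_nth F i * fls_nth G (n - i))"
    by (rule fls_times_nth(2))
  also have "\<dots> = (\<Sum>i\<in>?S. fls_nth F i * fls_nth G (n - i))"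
    by (rule sum.mono_neutral_left) auto
  also have "\<dots> = (\<Sum>i=a..n - b. fls_nth F i * fls_nth G (n - i))"
    by (rule sum.mono_neutral_right) (auto simp: assms)
  finally show ?thesis .
qed

definition flsmap :: "('a::zero \<Rightarrow> 'b::zero) \<Rightarrow> 'a fls \<Rightarrow> 'b fls" where
  "flsmap f F = Abs_fls (\<lambda>n. f (fls_nth F n))"

lemma fls_nth_flsmap [simp]: "f 0 = 0 \<Longrightarrow> fls_nth (flsmap f F) n = f (fls_nth F n)"
proof -
  assume f: "f 0 = 0"
  obtain a where "\<forall>n<a. fls_nth F n = 0"
    using fls_lower_bound by blast
  with f have "\<exists>N. \<forall>n<N. f (fls_nth F n) = 0"
    by (intro exI[of _ a]) auto
  then show ?thesis
    unfolding flsmap_def by (rule nth_Abs_fls_ex_lower_bound)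
qed

lemma additive_flsmap: "additive f \<Longrightarrow> additive (flsmap f)"
  by (auto simp: additive_def additive.zero fls_eq_iff)

lemma flsmap_mult:
  assumes f: "rhom f"
  shows "flsmap f (F * G) = flsmap f F * flsmap f G"
proof (rule fls_eqI)
  fix n
  obtain a where a: "\<And>i. i < a \<Longrightarrow> fls_nth F i = 0"
    using fls_lower_bound by blast
  obtain b where b: "\<And>i. i < b \<Longrightarrow> fls_nth G i = 0"
    using fls_lower_bound by blast
  show "fls_nth (flsmap f (F * G)) n = fls_nth (flsmap f F * flsmap f G) n"
    by (subst fls_mult_nth_bound[of a _ b])
      (auto simp: a b fls_mult_nth_bound[of a F b G] rhomD[OF f])
qed

lemma rhom_flsmap: "rhom f \<Longrightarrow> rhom (flsmap f)"
  by (intro rhomI flsmap_mult) (auto simp: fls_eq_iff rhomD)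

lemma flsmap_deriv:
  fixes d :: "'a::comm_ring_1 \<Rightarrow> 'a"
  assumes d: "\<And>a b. d (a + b) = d a + d b" "\<And>a b. d (a * b) = d a * b + a * d b"
  shows "flsmap d (F * G) = flsmap d F * G + F * flsmap d G"
proof (rule fls_eqI)
  fix n
  have ad: "additive d"
    using d by (simp add: additive_def)
  note d0 = additive.zero[OF ad]
  obtain a where a: "\<And>i. i < a \<Longrightarrow> fls_nth F i = 0"
    using fls_lower_bound by blast
  obtain b where b: "\<And>i. i < b \<Longrightarrow> fls_nth G i = 0"
    using fls_lower_bound by blast
  have 1: "fls_nth (flsmap d F * G) n = (\<Sum>i=a..n - b. d (fls_nth F i) * fls_nth G (n - i))"
    by (subst fls_mult_nth_bound[of a _ b]) (auto simp: a b d0)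
  have 2: "fls_nth (F * flsmap d G) n = (\<Sum>i=a..n - b. fls_nth F i * d (fls_nth G (n - i)))"
    by (subst fls_mult_nth_bound[of a _ b]) (auto simp: a b d0)
  show "fls_nth (flsmap d (F * G)) n = fls_nth (flsmap d F * G + F * flsmap d G) n"
    by (simp add: 1 2 d0 fls_mult_nth_bound[of a F b G, OF a b] additive.sum[OF ad] d sum.distrib)
qed

lemma flsmap_const: "f 0 = 0 \<Longrightarrow> flsmap f (fls_const c) = fls_const (f c)"
  by (auto simp: fls_eq_iff)

lemma rhom_fls_const: "rhom (fls_const :: 'a::comm_ring_1 \<Rightarrow> _)"
  by (rule rhomI) (auto simp: fls_plus_const)

lemma rhom_single0: "rhom (single (0 :: 'b::comm_monoid_add) :: 'a::comm_ring_1 \<Rightarrow> _)"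
  by (rule rhomI) (auto simp: single_add mult_single)

text \<open>\<open>F\<close> and \<open>F'\<close> are the same double series, with outer and inner variable exchanged.\<close>

definition trans_fls :: "'a::zero fls fls \<Rightarrow> 'a fls fls \<Rightarrow> bool" where
  "trans_fls F F' \<longleftrightarrow> (\<forall>m n. fls_nth (fls_nth F n) m = fls_nth (fls_nth F' m) n)"

lemma trans_fls_add: "trans_fls F F' \<Longrightarrow> trans_fls G G' \<Longrightarrow> trans_fls (F + G) (F' + G' :: 'a::comm_ring_1 fls fls)"
  by (simp add: trans_fls_def)

lemma trans_fls_0: "trans_fls 0 (0 :: 'a::comm_ring_1 fls fls)"
  by (simp add: trans_fls_def)

lemma trans_fls_sum: "(\<And>i. i \<in> A \<Longrightarrow> trans_fls (f i) (g i)) \<Longrightarrow> trans_fls (sum f A) (sum g A :: 'a::comm_ring_1 fls fls)"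
  by (induction A rule: infinite_finite_induct) (auto intro: trans_fls_add trans_fls_0)

text \<open>The transposed series \<open>F'\<close> bounds the inner exponents of \<open>F\<close>
  uniformly in the outer exponent. The coefficient of the product is then a sum over a rectangle,
  where the two summations can be exchanged.\<close>

lemma trans_fls_mult_nth:
  fixes F F' G G' :: "'a::comm_ring_1 fls fls"
  assumes "trans_fls F F'" "trans_fls G G'"
    and "\<And>i. i < a \<Longrightarrow> fls_nth F i = 0" "\<And>i. i < b \<Longrightarrow> fls_nth G i = 0"
    and "\<And>i. i < a' \<Longrightarrow> fls_nth F' i = 0" "\<And>i. i < b' \<Longrightarrow> fls_nth G' i = 0"
  shows "fls_nth (fls_nth (F * G) n) m = (\<Sum>i=a..n - b. \<Sum>j=a'..m - b'.
      fls_nth (fls_nth F i) j * fls_nth (fls_nth G (n - i)) (m - j))"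
proof -
  have "fls_nth (fls_nth F i) j = 0" if "j < a'" for i j
    using assms(1,5) that by (simp add: trans_fls_def)
  moreover have "fls_nth (fls_nth G i) j = 0" if "j < b'" for i j
    using assms(2,6) that by (simp add: trans_fls_def)
  ultimately show ?thesis
    by (simp add: fls_mult_nth_bound[of a F b G] assms fls_nth_sum fls_mult_nth_bound[of a' _ b'])
qed

lemma trans_fls_sym: "trans_fls F F' \<Longrightarrow> trans_fls F' F"
  by (simp add: trans_fls_def)

lemma trans_fls_mult:
  fixes F F' G G' :: "'a::comm_ring_1 fls fls"
  assumes "trans_fls F F'" "trans_fls G G'"
  shows "trans_fls (F * G) (F' * G')"
  unfolding trans_fls_def
proof (intro allI)
  fix m n
  obtain a where a: "\<And>i. i < a \<Longrightarrow> fls_nth F i = 0"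
    using fls_lower_bound by blast
  obtain b where b: "\<And>i. i < b \<Longrightarrow> fls_nth G i = 0"
    using fls_lower_bound by blast
  obtain a' where a': "\<And>i. i < a' \<Longrightarrow> fls_nth F' i = 0"
    using fls_lower_bound by blast
  obtain b' where b': "\<And>i. i < b' \<Longrightarrow> fls_nth G' i = 0"
    using fls_lower_bound by blast
  have "fls_nth (fls_nth (F * G) n) m = (\<Sum>i=a..n - b. \<Sum>j=a'..m - b'.
      fls_nth (fls_nth F i) j * fls_nth (fls_nth G (n - i)) (m - j))"
    by (rule trans_fls_mult_nth[OF assms]) (auto simp: a b a' b')
  also have "\<dots> = (\<Sum>j=a'..m - b'. \<Sum>i=a..n - b.
      fls_nth (fls_nth F' j) i * fls_nth (fls_nth G' (m - j)) (n - i))"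
    using assms by (subst sum.swap) (simp add: trans_fls_def)
  also have "\<dots> = fls_nth (fls_nth (F' * G') m) n"
    by (rule trans_fls_mult_nth[OF trans_fls_sym[OF assms(1)] trans_fls_sym[OF assms(2)] a' b' a b, symmetric])
  finally show "fls_nth (fls_nth (F * G) n) m = fls_nth (fls_nth (F' * G') m) n" .
qed

lemma trans_fls_const: "trans_fls (fls_const F) (flsmap fls_const F)"
  by (auto simp: trans_fls_def)

lemma trans_fls_const': "trans_fls (flsmap fls_const F) (fls_const F)"
  by (auto simp: trans_fls_def)

section \<open>Expansions of the target ring\<close>

text \<open>The conditions are restricted to \<open>K0\<close> because the description operator in
  \<open>rf_eval\<close> controls nothing outside the domain of evaluation.\<close>

definition khom :: "('k::field ratfun \<Rightarrow> 'c::comm_ring_1) \<Rightarrow> bool" where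
  "khom f \<longleftrightarrow> f 1 = 1 \<and> (\<forall>g\<in>K0. \<forall>h\<in>K0. f (g + h) = f g + f h \<and> f (g * h) = f g * f h)"

lemma khom_add_on: "khom f \<Longrightarrow> add_on K0 f"
  by (auto simp: khom_def add_on_def K0_0 K0_add)

lemma khom_0: "khom f \<Longrightarrow> f 0 = 0"
  by (rule add_on_0[OF khom_add_on])

lemma khom_1: "khom f \<Longrightarrow> f 1 = 1"
  by (simp add: khom_def)

lemma khomD:
  assumes "khom f" "g \<in> K0" "h \<in> K0"
  shows "f (g + h) = f g + f h" "f (g * h) = f g * f h" "f 1 = 1" "f 0 = 0"
  using assms khom_0 by (auto simp: khom_def)

lemma khom_diff:
  assumes "khom f" "g \<in> K0" "h \<in> K0"
  shows "f (g - h) = f g - f h"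
  using khomD(1)[OF assms(1), of "g - h" h] assms by (simp add: K0_diff)

lemma khom_comp: "khom f \<Longrightarrow> rhom g \<Longrightarrow> khom (\<lambda>x. g (f x))"
  by (simp add: khom_def rhomD)

lemma khom_rf_eval:
  assumes "rhom c" "x 0 \<noteq> 0" "x 1 \<noteq> 0" "x 0 \<noteq> x 1"
  shows "khom (rf_eval c x)"
  using K0_subset_rf_dom[of c x, OF assms] rf_dom_cst(2)[OF assms(1), of x 1]
  by (auto simp: khom_def subset_iff rf_dom_add_mult[OF assms(1)] rhomD[OF assms(1)])

lemma khom_inverse:
  assumes "khom f" "g \<in> K0" "inverse g \<in> K0" "g \<noteq> 0"
  shows "f g * f (inverse g) = 1"
  using khomD[OF assms(1-3)] assms(4) by simp

lemma rf_eval_inverse: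
  assumes "rhom c" "x 0 \<noteq> 0" "x 1 \<noteq> 0" "x 0 \<noteq> x 1"
    "g \<in> K0" "inverse g \<in> K0" "g \<noteq> 0"
  shows "rf_eval c x (inverse g) = inverse (rf_eval c x g)"
  using khom_inverse[OF khom_rf_eval[OF assms(1-4)] assms(5-7)] by (metis inverse_unique)

lemma K0_diff01: "xv 0 - xv 1 \<in> K0"
  by (intro K0_diff K0_xv)

text \<open>Inverses are unique in any commutative ring, so agreement on constants and variables
  extends to the inverted generators without division in the target.\<close>

lemma khom_eqI:
  assumes f: "khom f" and g: "khom g"
    and c: "\<And>c. f (cst c) = g (cst c)" and x: "f (xv 0) = g (xv 0)" "f (xv 1) = g (xv 1)"
    and "a \<in> K0"
  shows "f a = (g a :: 'c::comm_ring_1)"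
proof -
  have inv: "f (inverse y) = g (inverse y)" if "y \<in> K0" "inverse y \<in> K0" "y \<noteq> 0" "f y = g y" for y
  proof -
    have "f (inverse y) = f (inverse y) * (g y * g (inverse y))"
      using khom_inverse[OF g] that by simp
    also have "\<dots> = (f y * f (inverse y)) * g (inverse y)"
      using that by (simp add: mult_ac)
    also have "\<dots> = g (inverse y)"
      using khom_inverse[OF f, of y] that by simp
    finally show ?thesis .
  qed
  have "f (xv 0 - xv 1) = g (xv 0 - xv 1)"
    by (simp add: khom_diff[OF f] khom_diff[OF g] K0_xv x)
  with \<open>a \<in> K0\<close> show ?thesis
    by (induction rule: K0_induct)
      (auto simp: c x khomD[OF f] khomD[OF g] inv K0_xv K0_inverse K0_diff01)
qed

lemma rhom_cc: "rhom (\<lambda>c. fls_const (fls_const c))"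
  by (intro rhom_comp[of fls_const fls_const] rhom_fls_const)

lemma fls_const_X_neq: "fls_const fls_X \<noteq> (fls_X :: 'k::field fls fls)"
  by (metis fls_X_nth fls_const_nth fls_X_nonzero zero_neq_one)

definition zw_pt :: "nat \<Rightarrow> nat \<Rightarrow> nat \<Rightarrow> 'k::field fls fls" where
  "zw_pt i j l = (if l = i then fls_const fls_X else if l = j then fls_X else 0)"

lemma expn_eq: "expn i j = rf_eval (\<lambda>c. fls_const (fls_const c)) (zw_pt i j)"
  by (simp add: expn_def zw_pt_def[abs_def])

lemma zw_pt: "zw_pt 0 1 0 \<noteq> 0" "zw_pt 0 1 1 \<noteq> 0" "zw_pt 0 1 0 \<noteq> zw_pt 0 1 1"
  "zw_pt 1 0 0 \<noteq> 0" "zw_pt 1 0 1 \<noteq> 0" "zw_pt 1 0 0 \<noteq> zw_pt 1 0 1"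
  by (auto simp: zw_pt_def fls_const_X_neq fls_const_X_neq[symmetric])

lemma khom_expn: "khom (expn 0 1)" "khom (expn 1 0)"
  unfolding expn_eq by (intro khom_rf_eval rhom_cc zw_pt)+

lemma expn_cst [simp]: "expn i j (cst c) = fls_const (fls_const c)"
  unfolding expn_eq by (rule rf_dom_cst(2)[OF rhom_cc])

lemma expn_xv: "expn i j (xv l) = zw_pt i j l"
  unfolding expn_eq by (rule rf_dom_xv(2)[OF rhom_cc])

lemma flsmap_deriv_X: "flsmap fls_deriv fls_X = (0 :: 'a::comm_ring_1 fls fls)"
  by (rule fls_eqI) simp

lemma expn_pd:
  assumes "g \<in> K0"
  shows "expn 0 1 (rf_pd 0 g) = flsmap fls_deriv (expn 0 1 g)"
    "expn 0 1 (rf_pd 1 g) = fls_deriv (expn 0 1 g)"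
proof -
  show "expn 0 1 (rf_pd 0 g) = flsmap fls_deriv (expn 0 1 g)"
    unfolding expn_eq using assms
    by (intro conjunct1[OF rf_eval_pd] rhom_cc zw_pt flsmap_deriv)
      (auto simp: zw_pt_def flsmap_const fls_deriv_mult additive.add[OF additive_flsmap] additive_def flsmap_deriv_X)
  show "expn 0 1 (rf_pd 1 g) = fls_deriv (expn 0 1 g)"
    unfolding expn_eq using assms
    by (intro conjunct1[OF rf_eval_pd] rhom_cc zw_pt)
      (auto simp: zw_pt_def)
qed

definition sub_pt :: "nat \<Rightarrow> nat \<Rightarrow> nat \<Rightarrow> 'k::field ratfun" where
  "sub_pt i j l = (if l = 0 then xv i else if l = 1 then xv j else 0)"

lemma subst2_eq: "subst2 i j = rf_eval cst (sub_pt i j)"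
  by (simp add: subst2_def sub_pt_def[abs_def])

lemma sub_pt: "sub_pt i j 0 \<noteq> 0" "sub_pt i j 1 \<noteq> 0" "i \<noteq> j \<Longrightarrow> sub_pt i j 0 \<noteq> sub_pt i j 1"
  by (auto simp: sub_pt_def xv_inject)

lemma khom_subst2: "i \<noteq> j \<Longrightarrow> khom (subst2 i j)"
  unfolding subst2_eq by (intro khom_rf_eval rhom_cst sub_pt)

lemma subst2_cst [simp]: "subst2 i j (cst c) = cst c"
  unfolding subst2_eq by (rule rf_dom_cst(2)[OF rhom_cst])

lemma subst2_xv: "subst2 i j (xv l) = sub_pt i j l"
  unfolding subst2_eq by (rule rf_dom_xv(2)[OF rhom_cst])

text \<open>Exchanging the variables permutes their inverses and changes the sign of the inverse of
  \<open>z - w\<close>.\<close>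

lemma subst2_1_0_K0: "g \<in> K0 \<Longrightarrow> subst2 1 0 g \<in> K0"
proof (induction rule: K0_induct)
  have inv: "subst2 1 0 (inverse g) = inverse (subst2 1 0 g)" if "g \<in> K0" "inverse g \<in> K0" "g \<noteq> 0" for g
    unfolding subst2_eq using that by (intro rf_eval_inverse rhom_cst sub_pt) auto
  note h = khomD[OF khom_subst2[of 1 0]]
  {
    case inv0 show ?case using K0_inverse K0_xv by (subst inv) (auto simp: subst2_xv sub_pt_def)
  next
    case inv1 show ?case using K0_inverse(1) K0_inverse(2) K0_xv by (subst inv) (auto simp: subst2_xv sub_pt_def)
  next
    case inv01
    have "subst2 1 0 (xv 0 - xv 1) = - (xv 0 - xv 1)"
      by (simp add: khom_diff[OF khom_subst2] K0_xv subst2_xv sub_pt_def)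
    then have "subst2 1 0 (inverse (xv 0 - xv 1)) = - inverse (xv 0 - xv 1)"
      using K0_inverse(3) K0_diff01 by (subst inv) (auto simp flip: inverse_minus_eq)
    then show ?case
      using K0_inverse(3) K0_uminus by metis
  }
qed (auto simp: khomD[OF khom_subst2[of 1 0]] K0_cst K0_add K0_mult subst2_xv sub_pt_def K0_xv)

lemma khom_comp_subst2:
  assumes "khom f"
  shows "khom (\<lambda>g. f (subst2 1 0 g))"
  using assms unfolding khom_def
  by (simp add: subst2_1_0_K0 khomD(1,2)[OF khom_subst2[of 1 0]] khom_1[OF khom_subst2[of 1 0]])

lemma khom_id: "khom (\<lambda>g. g)"
  by (simp add: khom_def)

lemma subst2_0_1: "g \<in> K0 \<Longrightarrow> subst2 0 1 g = g"
  by (rule khom_eqI[OF khom_subst2 khom_id]) (auto simp: subst2_xv sub_pt_def)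

lemma subst2_subst2: "g \<in> K0 \<Longrightarrow> subst2 1 0 (subst2 1 0 g) = g"
  by (rule khom_eqI[OF khom_comp_subst2[OF khom_subst2] khom_id]) (auto simp: subst2_xv sub_pt_def)

text \<open>Both sides are homomorphisms on \<open>K0\<close> with equal values on constants and
  variables. An exchange of variables thus turns the expansion in one region into that in the other;
  braided locality rests on this.\<close>

lemma expn_subst2:
  assumes "g \<in> K0"
  shows "expn 1 0 (subst2 1 0 g) = expn 0 1 g" "expn 0 1 (subst2 1 0 g) = expn 1 0 g"
  using khom_eqI[OF khom_comp_subst2[OF khom_expn(2)] khom_expn(1) _ _ _ assms]
    khom_eqI[OF khom_comp_subst2[OF khom_expn(1)] khom_expn(2) _ _ _ assms]
  by (auto simp: subst2_xv sub_pt_def expn_xv zw_pt_def)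

lemma subst2_pd:
  assumes "g \<in> K0"
  shows "subst2 1 0 (rf_pd 1 g) = rf_pd 0 (subst2 1 0 g)" "subst2 1 0 (rf_pd 0 g) = rf_pd 1 (subst2 1 0 g)"
  unfolding subst2_eq using assms
  by (intro conjunct1[OF rf_eval_pd] rhom_cst sub_pt; auto simp: sub_pt_def rf_pd_xv rf_pd_add rf_pd_mult)+

lemma rf_pd_K0: "g \<in> K0 \<Longrightarrow> i \<le> 1 \<Longrightarrow> rf_pd i g \<in> K0"
proof -
  assume g: "g \<in> K0" "i \<le> 1"
  have "rf_eval cst (sub_pt 0 1) (rf_pd i g) = rf_pd i (rf_eval cst (sub_pt 0 1) g) \<and> rf_pd i g \<in> K0"
    using g by (intro rf_eval_pd rhom_cst sub_pt) (auto simp: sub_pt_def rf_pd_xv rf_pd_add rf_pd_mult)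
  then show ?thesis ..
qed

text \<open>The variable \<open>z\<close> is the inner one in \<open>zw_exp\<close> and the outer one in \<open>wz_exp\<close>.\<close>

definition zw_exp :: "'k::field ratfun \<Rightarrow> ('b::comm_monoid_add \<Rightarrow>\<^sub>0 'k) fls fls" where
  "zw_exp g = flsmap (flsmap (single 0)) (expn 0 1 g)"

definition wz_exp :: "'k::field ratfun \<Rightarrow> ('b::comm_monoid_add \<Rightarrow>\<^sub>0 'k) fls fls" where
  "wz_exp g = flsmap (flsmap (single 0)) (expn 1 0 g)"

lemma khom_zw_exp: "khom zw_exp" and khom_wz_exp: "khom wz_exp"
  unfolding zw_exp_def[abs_def] wz_exp_def[abs_def]
  by (rule khom_comp[OF khom_expn(1) rhom_flsmap[OF rhom_flsmap[OF rhom_single0]]],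
      rule khom_comp[OF khom_expn(2) rhom_flsmap[OF rhom_flsmap[OF rhom_single0]]])

lemma flsmap2_X: "flsmap (flsmap (single (0::'b::comm_monoid_add))) (fls_X :: 'k::field fls fls) = fls_X"
  "flsmap (flsmap (single (0::'b::comm_monoid_add))) (fls_const fls_X :: 'k::field fls fls) = fls_const fls_X"
  "flsmap (flsmap (single (0::'b::comm_monoid_add))) (fls_const (fls_const c) :: 'k::field fls fls) = fls_const (fls_const (single 0 c))"
  by (auto simp: fls_eq_iff)

lemma zw_exp_simps: "zw_exp (cst c) = fls_const (fls_const (single 0 c))" "zw_exp (xv 0) = fls_const fls_X" "zw_exp (xv 1) = fls_X"
  and wz_exp_simps: "wz_exp (cst c) = fls_const (fls_const (single 0 c))" "wz_exp (xv 0) = fls_X" "wz_exp (xv 1) = fls_const fls_X"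
  by (auto simp: zw_exp_def wz_exp_def expn_xv zw_pt_def flsmap2_X)

lemma trans_fls_X: "trans_fls fls_X (fls_const fls_X)" "trans_fls (fls_const fls_X) fls_X"
  by (auto simp: trans_fls_def)

text \<open>Constants, variables and their inverses have the same expansion in both regions; only
  the inverse of \<open>z - w\<close> has two, and one factor \<open>z - w\<close> removes it. Sums
  take the maximum of the exponents, products their sum.\<close>

lemma trans_fls_expansion:
  assumes "g \<in> K0"
  shows "\<exists>N0. \<forall>N\<ge>N0. trans_fls (zw_exp ((xv 0 - xv 1) ^ N * g)) (wz_exp ((xv 0 - xv 1) ^ N * g))"
proof -
  let ?d = "xv 0 - xv 1 :: 'a ratfun"
  let ?T = "\<lambda>g. trans_fls (zw_exp g) (wz_exp g :: ('b \<Rightarrow>\<^sub>0 'a) fls fls)"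
  have T_add: "?T (g + h)" if "?T g" "?T h" "g \<in> K0" "h \<in> K0" for g h
    using that by (simp add: khomD[OF khom_zw_exp] khomD[OF khom_wz_exp] trans_fls_add)
  have T_mult: "?T (g * h)" if "?T g" "?T h" "g \<in> K0" "h \<in> K0" for g h
    using that by (simp add: khomD[OF khom_zw_exp] khomD[OF khom_wz_exp] trans_fls_mult)
  have T_cst: "?T (cst c)" for c
    by (auto simp: zw_exp_simps wz_exp_simps trans_fls_def)
  have xv: "?T (xv 0)" "?T (xv 1)"
    unfolding zw_exp_simps wz_exp_simps by (rule trans_fls_X)+
  have d: "?T ?d"
  proof -
    have "?d = xv 0 + cst (- 1) * xv 1"
      by (simp add: rhomD[OF rhom_cst])
    then show ?thesis
      by (simp only:) (intro T_add T_mult T_cst xv K0_cst K0_xv K0_mult)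
  qed
  have dN: "?T (?d ^ N)" for N
  proof (induction N)
    case 0 then show ?case using T_cst[of 1] by simp
  next
    case (Suc N)
    then show ?case
      unfolding power_Suc using d by (intro T_mult K0_power K0_diff01)
  qed
  have K: "?d ^ N \<in> K0" for N
    by (intro K0_power K0_diff01)
  have all: "\<exists>N0. \<forall>N\<ge>N0. ?T (?d ^ N * g)" if "?T g" "g \<in> K0" for g
    using that T_mult dN K by blast
  have invx: "zw_exp (inverse (xv 0)) = (fls_const fls_X_inv :: ('b \<Rightarrow>\<^sub>0 'a) fls fls)"
    "zw_exp (inverse (xv 1)) = (fls_X_inv :: ('b \<Rightarrow>\<^sub>0 'a) fls fls)" "wz_exp (inverse (xv 1)) = (fls_const fls_X_inv :: ('b \<Rightarrow>\<^sub>0 'a) fls fls)"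
    "wz_exp (inverse (xv 0)) = (fls_X_inv :: ('b \<Rightarrow>\<^sub>0 'a) fls fls)"
  proof -
    \<comment> \<open>The coefficients do not form a field, so the expansions of the inverses are
      identified by uniqueness of inverses.\<close>
    have u: "x = y" if "a * x = 1" "a * y = 1" for a x y :: "('b \<Rightarrow>\<^sub>0 'a) fls fls"
    proof -
      have "x = x * (a * y)"
        using that by simp
      also have "\<dots> = (a * x) * y"
        by (simp only: mult_ac)
      finally show ?thesis
        using that by simp
    qed
    have X: "fls_X * fls_X_inv = (1 :: ('b \<Rightarrow>\<^sub>0 'a) fls fls)" "fls_X * fls_X_inv = (1 :: ('b \<Rightarrow>\<^sub>0 'a) fls)"
      by (simp_all add: fls_X_times_conv_shift fls_X_inv_conv_shift_1)
    have X': "fls_const fls_X * fls_const fls_X_inv = (1 :: ('b \<Rightarrow>\<^sub>0 'a) fls fls)"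
      by (simp add: X)
    note i = khom_inverse[OF khom_zw_exp K0_xv(1) K0_inverse(1) xv_nonzero, unfolded zw_exp_simps]
      khom_inverse[OF khom_zw_exp K0_xv(2) K0_inverse(2) xv_nonzero, unfolded zw_exp_simps]
      khom_inverse[OF khom_wz_exp K0_xv(1) K0_inverse(1) xv_nonzero, unfolded wz_exp_simps]
      khom_inverse[OF khom_wz_exp K0_xv(2) K0_inverse(2) xv_nonzero, unfolded wz_exp_simps]
    show "zw_exp (inverse (xv 0)) = (fls_const fls_X_inv :: ('b \<Rightarrow>\<^sub>0 'a) fls fls)"
      by (rule u[OF i(1) X'])
    show "zw_exp (inverse (xv 1)) = (fls_X_inv :: ('b \<Rightarrow>\<^sub>0 'a) fls fls)"
      by (rule u[OF i(2) X(1)])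
    show "wz_exp (inverse (xv 1)) = (fls_const fls_X_inv :: ('b \<Rightarrow>\<^sub>0 'a) fls fls)"
      by (rule u[OF i(4) X'])
    show "wz_exp (inverse (xv 0)) = (fls_X_inv :: ('b \<Rightarrow>\<^sub>0 'a) fls fls)"
      by (rule u[OF i(3) X(1)])
  qed
  from assms show ?thesis
  proof (induction rule: K0_induct)
    case (cst c)
    then show ?case using K0_cst T_cst by (intro all)
  next
    case (add g h)
    then obtain N1 N2 where N: "\<And>N. N \<ge> N1 \<Longrightarrow> ?T (?d ^ N * g)" "\<And>N. N \<ge> N2 \<Longrightarrow> ?T (?d ^ N * h)"
      by blast
    have "?T (?d ^ N * (g + h))" if "N \<ge> max N1 N2" for N
      unfolding distrib_left by (rule T_add) (use N that add(1,2) K in \<open>auto intro: K0_mult\<close>)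
    then show ?case by blast
  next
    case (mult g h)
    then obtain N1 N2 where N: "\<And>N. N \<ge> N1 \<Longrightarrow> ?T (?d ^ N * g)" "\<And>N. N \<ge> N2 \<Longrightarrow> ?T (?d ^ N * h)"
      by blast
    have "?T (?d ^ N * (g * h))" if "N \<ge> N1 + N2" for N
    proof -
      \<comment> \<open>The power is divided between the factors; \<open>N - N1 \<ge> N2\<close>
        leaves enough for \<open>h\<close>.\<close>
      have *: "?d ^ N * (g * h) = (?d ^ N1 * g) * (?d ^ (N - N1) * h)"
        using that by (simp add: mult_ac flip: power_add)
      show ?thesis
        unfolding * by (rule T_mult) (use N that mult(1,2) K in \<open>auto intro: K0_mult\<close>)
    qed
    then show ?case by blast
  next
    case xv0
    then show ?case using K0_xv xv by (intro all)
  next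
    case xv1
    then show ?case using K0_xv xv by (intro all)
  next
    case inv0
    have "?T (inverse (xv 0))"
      unfolding invx by (auto simp: trans_fls_def)
    then show ?case using K0_inverse by (intro all)
  next
    case inv1
    have "?T (inverse (xv 1))"
      unfolding invx by (auto simp: trans_fls_def)
    then show ?case using K0_inverse by (intro all)
  next
    case inv01
    have "?T (?d ^ N * inverse ?d)" if "N \<ge> 1" for N
    proof -
      have "?d ^ N * inverse ?d = ?d ^ (N - 1)"
        using that by (cases N) auto
      then show ?thesis
        using dN by simp
    qed
    then show ?case by blast
  qed
qed

section \<open>The Hopf algebra\<close>

lemma scl_eq_act: "scl = act (single (0 :: 'b::comm_monoid_add) :: 'a::comm_ring_1 \<Rightarrow> _)"
  by (simp add: fun_eq_iff act_def scl_mult)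

lemma bas_mult: "bas b * bas b' = (bas (b + b') :: 'b::comm_monoid_add \<Rightarrow>\<^sub>0 'a::comm_ring_1)"
  by (simp add: bas_def mult_single)

lemma bas_zero: "bas 0 = (1 :: 'b::comm_monoid_add \<Rightarrow>\<^sub>0 'a::comm_ring_1)"
  by (simp add: bas_def)

lemma rhom_ext_scl:
  assumes "g 0 = 1" "\<And>b b'. g (b + b') = g b * g b'"
  shows "rhom (ext scl (g :: 'b::comm_monoid_add \<Rightarrow> 'c::comm_monoid_add \<Rightarrow>\<^sub>0 'a::comm_ring_1))"
  unfolding scl_eq_act using assms by (intro rhom_ext rhom_single0)

lemma bas_00: "bas (0, 0) = (1 :: 'b::comm_monoid_add \<times> 'c::comm_monoid_add \<Rightarrow>\<^sub>0 'a::comm_ring_1)"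
  by (simp add: bas_zero flip: zero_prod_def)

lemma plus_00: "(0, 0) + p = (p :: 'b::comm_monoid_add \<times> 'c::comm_monoid_add)" "p + (0, 0) = p"
  by (simp_all flip: zero_prod_def)

lemma ext_scl_const:
  assumes "g 0 = 1"
  shows "ext scl g (single 0 c) = (single 0 c :: 'c::comm_monoid_add \<Rightarrow>\<^sub>0 'a::comm_ring_1)"
  using module.ext_single[OF module_scl, of g 0 c] assms by (simp add: scl_mult)

lemma scl_mult_left: "scl c x * y = scl c (x * y :: 'b::comm_monoid_add \<Rightarrow>\<^sub>0 'a::comm_ring_1)"
  and scl_mult_right: "x * scl c y = scl c (x * y :: 'b::comm_monoid_add \<Rightarrow>\<^sub>0 'a::comm_ring_1)"
  by (simp_all add: scl_mult mult_ac)

lemmas scl_add = module.scale_right_distrib[OF module_scl]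
  and scl_scl = module.scale_scale[OF module_scl]
  and scl_one = module.scale_one[OF module_scl]
  and scl_zero = module.scale_zero_right[OF module_scl] module.scale_zero_left[OF module_scl]
  and scl_add_left = module.scale_left_distrib[OF module_scl]
  and scl_sum = module.scale_sum_right[OF module_scl]
  and lin_add = module.ext_add[OF module_scl, folded lin_eq_ext]
  and lin_scl = module.ext_scl[OF module_scl, folded lin_eq_ext]
  and lin_bas = module.ext_bas[OF module_scl, folded lin_eq_ext]
  and lin_single = module.ext_single[OF module_scl, folded lin_eq_ext]

lemma (in module) ext_mult:
  fixes x y :: "'c::comm_monoid_add \<Rightarrow>\<^sub>0 'a"
  shows "ext scale g (x * y) = ext scale (\<lambda>b. ext scale (\<lambda>c. g (b + c)) y) x"
proof (induction x rule: pm_induct)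
  case (single b c)
  show ?case
    by (induction y rule: pm_induct) (auto simp: mult_single distrib_left ext_add algebra_simps)
qed (auto simp: distrib_right ext_add)

lemma hgen_pow: "(hgen n :: 'k::comm_ring_1 V0) ^ k = bas (single n k, 0)"
  by (induction k) (auto simp: hgen_def bas_mult bas_zero[symmetric] zero_prod_def plus_1_eq_Suc simp flip: single_add)

lemma ealpha_add: "ealpha (m + n) = ealpha m * (ealpha n :: 'k::comm_ring_1 V0)"
  by (simp add: ealpha_def bas_mult)

lemma ealpha_0: "ealpha 0 = (1 :: 'k::comm_ring_1 V0)"
  by (simp add: ealpha_def bas_zero flip: zero_prod_def)

lemma V0_alg_induct [case_names const hgen ealpha add mult]:
  assumes const: "\<And>c. P (single 0 c)" and hgen: "\<And>n. P (hgen n)" and ealpha: "\<And>m. P (ealpha m)"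
    and add: "\<And>x y. P x \<Longrightarrow> P y \<Longrightarrow> P (x + y)" and mult: "\<And>x y. P x \<Longrightarrow> P y \<Longrightarrow> P (x * y)"
  shows "P (x :: 'k::comm_ring_1 V0)"
proof (induction x rule: pm_induct)
  case zero
  show ?case using const[of 0] by simp
next
  case (single b c)
  obtain u m where b: "b = (u, m)"
    by (cases b)
  have "P (bas (u, 0))"
  proof (induction u rule: pm_induct)
    case zero
    show ?case using const[of 1] by (simp add: bas_zero flip: zero_prod_def)
  next
    case (single n k)
    have "P (hgen n ^ k)" 
      using const[of 1] by (induction k) (auto intro: mult hgen)
    then show ?case by (simp add: hgen_pow)
  next
    case (add u v)
    then have "P (bas (u, 0) * bas (v, 0))"
      by (rule mult)
    then show ?case by (simp add: bas_mult)
  qed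
  then have "P (single 0 c * (bas (u, 0) * ealpha m))"
    by (intro mult const ealpha)
  then show ?case
    by (simp add: b ealpha_def bas_def mult_single)
qed (rule add)

lemma rhom_V0_eqI:
  assumes "rhom f" "rhom g" "\<And>c. f (single 0 c) = g (single 0 c)"
    "\<And>n. f (hgen n) = g (hgen n)" "\<And>m. f (ealpha m) = g (ealpha m)"
  shows "f x = g (x :: 'k::comm_ring_1 V0)"
  by (induction x rule: V0_alg_induct) (auto simp: assms rhomD[OF assms(1)] rhomD[OF assms(2)])

abbreviation prim :: "nat \<Rightarrow> (mon \<times> mon) \<Rightarrow>\<^sub>0 'k::comm_ring_1" where
  "prim n \<equiv> tens (hgen n) 1 + tens 1 (hgen n)"

lemma comult_eq: "comult = ext scl (\<lambda>(u, m). meval prim u * tens (ealpha m) (ealpha m))"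
  by (simp add: comult_def lin_eq_ext meval_def)

lemma tens_one: "tens 1 1 = 1"
  by (simp flip: single_one bas_zero add: zero_prod_def)

lemma rhom_comult: "rhom comult"
  unfolding comult_eq
  by (rule rhom_ext_scl)
    (auto simp: case_prod_unfold ealpha_0 tens_one meval_add ealpha_add tens_mult mult_ac)

lemma comult_hgen: "comult (hgen n) = prim n"
  by (simp add: comult_eq hgen_def[of n] module.ext_bas[OF module_scl] ealpha_0 tens_one)

lemma comult_ealpha: "comult (ealpha m) = tens (ealpha m) (ealpha m)"
  by (simp add: comult_eq ealpha_def[of m] module.ext_bas[OF module_scl])

lemma comult_const: "comult (single 0 c) = single 0 c"
  by (simp add: comult_eq module.ext_single[OF module_scl] zero_prod_def ealpha_0[unfolded zero_prod_def] tens_one)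
    (simp add: scl_mult flip: zero_prod_def)

lemmas comult_hom = rhomD[OF rhom_comult]

lemma comult_scl: "comult (scl c a) = scl c (comult a)"
  by (simp add: scl_mult comult_hom comult_const)

lemma rhom_antipode: "rhom antipode"
proof -
  have e: "antipode = ext scl (\<lambda>(u, m). single (u, - m) (meval (\<lambda>_. - 1) u))"
    by (simp add: antipode_def lin_eq_ext meval_def power_sum)
  show ?thesis
    unfolding e
    by (rule rhom_ext_scl)
      (auto simp: case_prod_unfold meval_add mult_single simp flip: zero_prod_def)
qed

lemma antipode_simps:
  "antipode (single 0 c) = single 0 c" "antipode (hgen n) = - hgen n" "antipode (ealpha m) = ealpha (- m)"
  by (simp_all add: antipode_def lin_single lin_bas hgen_def ealpha_def zero_prod_def)
    (simp_all add: bas_def single_uminus)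

lemma antipode_scl: "antipode (scl c a) = scl c (antipode a)"
  by (simp add: scl_mult rhomD[OF rhom_antipode] antipode_simps)

lemma counit_eq: "counit = ext (act (\<lambda>c. c)) (\<lambda>(u, m). if u = 0 then 1 else 0)"
  by (auto simp: fun_eq_iff counit_def ext_def act_def intro!: sum.cong)

lemma rhom_id: "rhom (\<lambda>c. c)"
  by (simp add: rhom_def)

lemma rhom_counit: "rhom counit"
proof -
  have "u + v = 0 \<longleftrightarrow> u = 0 \<and> v = 0" for u v :: "nat \<Rightarrow>\<^sub>0 nat"
    by (auto simp: poly_mapping_eq_iff lookup_add fun_eq_iff)
  then show ?thesis
    unfolding counit_eq by (intro rhom_ext rhom_id) (auto simp: case_prod_unfold)
qed

lemma counit_simps: "counit (single 0 c) = c" "counit (hgen n) = 0" "counit (ealpha m) = 1"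
proof -
  interpret module "act (\<lambda>c. c)" by (rule module_act[OF rhom_id])
  show "counit (single 0 c) = c" "counit (hgen n) = 0" "counit (ealpha m) = 1"
    by (simp_all add: counit_eq hgen_def ealpha_def zero_prod_def) 
      (simp_all add: act_def poly_mapping_eq_iff fun_eq_iff lookup_single when_def)
qed

lemma counit_scl: "counit (scl c a) = c * counit a"
  by (simp add: scl_mult rhomD[OF rhom_counit] counit_simps)

subsection \<open>Sweedler sums\<close>

definition bilin :: "('k::comm_ring_1 \<Rightarrow> 'm \<Rightarrow> 'm) \<Rightarrow> ('k V0 \<Rightarrow> 'k V0 \<Rightarrow> 'm::ab_group_add) \<Rightarrow> bool" where
  "bilin s B \<longleftrightarrow> (\<forall>x x' y. B (x + x') y = B x y + B x' y) \<and> (\<forall>x y y'. B x (y + y') = B x y + B x y') \<and>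
     (\<forall>c x y. B (scl c x) y = s c (B x y)) \<and> (\<forall>c x y. B x (scl c y) = s c (B x y))"

context module
begin

text \<open>A bilinear map factors through the tensor product. For primitive and grouplike elements,
  whose coproducts are explicit tensors, this evaluates Sweedler sums.\<close>

lemma ext_tens:
  assumes "bilin scale B"
  shows "ext scale (\<lambda>(b, c). B (bas b) (bas c)) (tens x y) = B x y"
proof -
  have z: "B 0 y = 0" "B x 0 = 0" for x y
    using assms unfolding bilin_def by (metis add_cancel_left_left)+
  show ?thesis
  proof (induction x rule: pm_induct)
    case (single b c)
    show ?case
    proof (induction y rule: pm_induct)
      case (single b' c')
      show ?case
        using assms by (simp add: bilin_def single_eq_scl_bas[of b c] single_eq_scl_bas[of b' c'] ) 
          (simp add: tens_scl_left tens_scl_right ext_scl)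
    qed (use assms in \<open>auto simp: tens_add_right ext_add bilin_def z\<close>)
  qed (use assms in \<open>auto simp: tens_add_left ext_add bilin_def z\<close>)
qed

lemma sw_add: "sweedler scale (a + b) B = sweedler scale a B + sweedler scale b B"
  by (simp add: sweedler_eq_ext comult_hom ext_add)

lemma sw_scl: "sweedler scale (scl c a) B = c *s sweedler scale a B"
  by (simp add: sweedler_eq_ext comult_scl ext_scl)

lemma sw_hgen: "bilin scale B \<Longrightarrow> sweedler scale (hgen n) B = B (hgen n) 1 + B 1 (hgen n)"
  by (simp add: sweedler_eq_ext comult_hgen ext_add ext_tens)

lemma sw_ealpha: "bilin scale B \<Longrightarrow> sweedler scale (ealpha n) B = B (ealpha n) (ealpha n)"
  by (simp add: sweedler_eq_ext comult_ealpha ext_tens)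

lemma sw_one: "bilin scale B \<Longrightarrow> sweedler scale 1 B = B 1 1"
  using ext_tens[of B 1 1] by (simp add: sweedler_eq_ext comult_hom tens_one)

text \<open>The coproduct is multiplicative. A Sweedler sum sees \<open>B\<close> on basis vectors
  only, and products of basis vectors are basis vectors, so \<open>B\<close> may be any
  function.\<close>

lemma sw_mult:
  "sweedler scale (a * b) B = sweedler scale a (\<lambda>a' a''. sweedler scale b (\<lambda>b' b''. B (a' * b') (a'' * b'')))"
  by (simp add: sweedler_eq_ext comult_hom ext_mult case_prod_unfold bas_mult)

lemma sw_swap:
  "sweedler scale a (\<lambda>x y. sweedler scale b (B x y)) = sweedler scale b (\<lambda>p q. sweedler scale a (\<lambda>x y. B x y p q))"
  by (simp add: sweedler_eq_ext case_prod_unfold ext_swap[of _ "comult b" "comult a"])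

lemma sw_add_fun: "sweedler scale a (\<lambda>x y. B x y + C x y) = sweedler scale a B + sweedler scale a C"
  by (simp add: sweedler_eq_ext case_prod_unfold ext_add_fun)

lemma sw_scale_fun: "sweedler scale a (\<lambda>x y. c *s B x y) = c *s sweedler scale a B"
  by (simp add: sweedler_eq_ext case_prod_unfold ext_scale_fun)

end

lemma sw_cong: "(\<And>b c. B (bas b) (bas c) = C (bas b) (bas c)) \<Longrightarrow> sweedler s a B = sweedler s a C"
  unfolding sweedler_def by (intro sum.cong) auto

lemma sw_hom_on:
  assumes "add_on P \<phi>" "\<And>c b b'. s c (B (bas b) (bas b')) \<in> P"
    "\<And>c b b'. \<phi> (s c (B (bas b) (bas b'))) = s' c (\<phi> (B (bas b) (bas b')))"
  shows "\<phi> (sweedler s a B) = sweedler s' a (\<lambda>x y. \<phi> (B x y))"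
proof -
  have "\<phi> (ext s (\<lambda>p. B (bas (fst p)) (bas (snd p))) (comult a)) =
      ext s' (\<lambda>p. \<phi> (B (bas (fst p)) (bas (snd p)))) (comult a)"
    using assms by (intro ext_hom_on) auto
  then show ?thesis
    by (simp add: sweedler_eq_ext case_prod_unfold)
qed

lemma sw_hom:
  assumes "additive \<phi>" "\<And>c y. \<phi> (s c y) = s' c (\<phi> y)"
  shows "\<phi> (sweedler s a B) = sweedler s' a (\<lambda>x y. \<phi> (B x y))"
  using assms by (intro sw_hom_on[of UNIV]) auto

lemma sw_mult_const:
  fixes \<phi> :: "'k::comm_ring_1 \<Rightarrow> 'r::comm_ring_1"
  shows "y * sweedler (act \<phi>) a B = sweedler (act \<phi>) a (\<lambda>p q. y * B p q)"
    "sweedler (act \<phi>) a B * y = sweedler (act \<phi>) a (\<lambda>p q. B p q * y)"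
  by (rule sw_hom, auto simp: additive_def act_def algebra_simps)+

text \<open>Exchanging the tensor factors is a ring homomorphism, so it suffices that the coproducts
  of the primitive and grouplike generators are symmetric.\<close>

lemma cocomm: "ext scl (\<lambda>(b, c). bas (c, b)) (comult a) = comult a"
proof (rule rhom_V0_eqI[of "\<lambda>a. ext scl (\<lambda>(b, c). bas (c, b)) (comult a)" comult])
  have r: "rhom (ext scl (\<lambda>(b, c). bas (c, b)) :: (mon \<times> mon \<Rightarrow>\<^sub>0 'a) \<Rightarrow> _)"
    by (rule rhom_ext_scl) (auto simp: bas_mult bas_zero case_prod_unfold simp flip: zero_prod_def)
  have t: "ext scl (\<lambda>(b, c). bas (c, b)) (tens x y) = tens y x" for x y :: "'a V0"
    using module.ext_tens[OF module_scl, of "\<lambda>x y. tens y x" x y]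
    by (simp add: bilin_def tens_add_left tens_add_right tens_scl_left tens_scl_right)
  show "rhom (\<lambda>a. ext scl (\<lambda>(b, c). bas (c, b)) (comult a :: _ \<Rightarrow>\<^sub>0 'a))"
    by (rule rhom_comp[OF r rhom_comult])
  show "ext scl (\<lambda>(b, c). bas (c, b)) (comult (single 0 c)) = comult (single 0 c)" for c :: 'a
    by (simp add: comult_const ext_scl_const bas_00 case_prod_unfold)
  show "ext scl (\<lambda>(b, c). bas (c, b)) (comult (hgen n)) = (comult (hgen n) :: _ \<Rightarrow>\<^sub>0 'a)" for n
    by (simp add: comult_hgen rhomD[OF r] t add.commute)
  show "ext scl (\<lambda>(b, c). bas (c, b)) (comult (ealpha m)) = (comult (ealpha m) :: _ \<Rightarrow>\<^sub>0 'a)" for m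
    by (simp add: comult_ealpha t)
qed (rule rhom_comult)

lemma coassoc:
  "ext scl (\<lambda>(b, c). ext scl (\<lambda>(b1, b2). bas (b1, b2, c)) (comult (bas b))) (comult a) =
   ext scl (\<lambda>(b, c). ext scl (\<lambda>(c1, c2). bas (b, c1, c2)) (comult (bas c))) (comult (a :: 'k::comm_ring_1 V0))"
proof -
  \<comment> \<open>The embeddings of \<open>V\<close> as the three factors of the tensor cube. Both
    iterated coproducts are expressed through them, which shows that they are ring homomorphisms and
    can be compared on generators.\<close>
  define E1 E2 E3 :: "'k V0 \<Rightarrow> mon \<times> mon \<times> mon \<Rightarrow>\<^sub>0 'k"
    where "E1 = ext scl (\<lambda>b. bas (b, 0, 0))" and "E2 = ext scl (\<lambda>b. bas (0, b, 0))" and "E3 = ext scl (\<lambda>b. bas (0, 0, b))"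
  have bz: "bas (0, 0, 0) = (1 :: mon \<times> mon \<times> mon \<Rightarrow>\<^sub>0 'k)"
    by (simp add: bas_zero flip: zero_prod_def)
  have r: "rhom E1" "rhom E2" "rhom E3"
    unfolding E1_def E2_def E3_def by (rule rhom_ext_scl; simp add: bas_mult bz)+
  define E12 E23 :: "(mon \<times> mon \<Rightarrow>\<^sub>0 'k) \<Rightarrow> mon \<times> mon \<times> mon \<Rightarrow>\<^sub>0 'k"
    where "E12 = ext scl (\<lambda>(b, c). bas (b, c, 0))" and "E23 = ext scl (\<lambda>(b, c). bas (0, b, c))"
  have r2: "rhom E12" "rhom E23"
    unfolding E12_def E23_def
    by (rule rhom_ext_scl; simp add: bas_mult bas_00 bz case_prod_unfold fst_add snd_add)+
  note E = rhomD[OF r(1)] rhomD[OF r(2)] rhomD[OF r(3)] rhomD[OF r2(1)] rhomD[OF r2(2)]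
  have Ebas: "E1 (bas b) = bas (b, 0, 0)" "E2 (bas b) = bas (0, b, 0)" "E3 (bas b) = bas (0, 0, b)" for b
    by (simp_all add: E1_def E2_def E3_def module.ext_bas[OF module_scl])
  have Escl: "E1 (scl c x) = scl c (E1 x)" "E2 (scl c x) = scl c (E2 x)" "E3 (scl c x) = scl c (E3 x)" 
    "E12 (scl c y) = scl c (E12 y)" "E23 (scl c y) = scl c (E23 y)" for c x y
    by (simp_all add: E1_def E2_def E3_def E12_def E23_def module.ext_scl[OF module_scl])
  have bil: "bilin scl (\<lambda>x y. f x * g y)"
    if "rhom f" "rhom g" "\<And>c x. f (scl c x) = scl c (f x)" "\<And>c x. g (scl c x) = scl c (g x)"
    for f g :: "'k V0 \<Rightarrow> mon \<times> mon \<times> mon \<Rightarrow>\<^sub>0 'k"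
    using that by (simp add: bilin_def rhomD distrib_left distrib_right scl_mult_left scl_mult_right)
  have E12t: "E12 (tens x y) = E1 x * E2 y" and E23t: "E23 (tens x y) = E2 x * E3 y" for x y
    using module.ext_tens[OF module_scl bil[OF r(1,2) Escl(1,2)], of x y]
      module.ext_tens[OF module_scl bil[OF r(2,3) Escl(2,3)], of x y]
    by (simp_all add: E12_def E23_def Ebas bas_mult)
  define F1 F2 :: "(mon \<times> mon \<Rightarrow>\<^sub>0 'k) \<Rightarrow> mon \<times> mon \<times> mon \<Rightarrow>\<^sub>0 'k"
    where "F1 = ext scl (\<lambda>(b, c). E12 (comult (bas b)) * E3 (bas c))"
      and "F2 = ext scl (\<lambda>(b, c). E1 (bas b) * E23 (comult (bas c)))"
  have mc: "comult (bas (b + b')) = comult (bas b) * comult (bas b' :: 'k V0)" for b b'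
    by (simp add: comult_hom flip: bas_mult)
  have Eadd: "E1 (bas (b + b')) = E1 (bas b) * E1 (bas b')" "E3 (bas (b + b')) = E3 (bas b) * E3 (bas b')" for b b'
    by (simp_all add: E flip: bas_mult)
  have rF: "rhom F1" "rhom F2"
    unfolding F1_def F2_def
    by (rule rhom_ext_scl; simp add: case_prod_unfold mc E Eadd bas_zero comult_hom fst_add snd_add mult_ac)+
  have F1t: "F1 (tens x y) = E12 (comult x) * E3 y" for x y
    using module.ext_tens[OF module_scl bil[of "\<lambda>x. E12 (comult x)" E3], of x y]
    by (simp add: F1_def rhom_comp[OF r2(1) rhom_comult] r Escl comult_scl)
  have F2t: "F2 (tens x y) = E1 x * E23 (comult y)" for x y
    using module.ext_tens[OF module_scl bil[of E1 "\<lambda>x. E23 (comult x)"], of x y]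
    by (simp add: F2_def rhom_comp[OF r2(2) rhom_comult] r Escl comult_scl)
  have "F1 (comult a) = F2 (comult a)"
  proof (rule rhom_V0_eqI[of "\<lambda>a. F1 (comult a)" "\<lambda>a. F2 (comult a)"])
    show "F1 (comult (single 0 c)) = F2 (comult (single 0 c))" for c
      by (simp add: comult_const F1_def F2_def ext_scl_const case_prod_unfold bas_zero comult_hom E)
    show "F1 (comult (hgen n)) = F2 (comult (hgen n))" for n
      by (simp add: comult_hgen rhomD[OF rF(1)] rhomD[OF rF(2)] F1t F2t E12t E23t comult_hom E add_ac)
    show "F1 (comult (ealpha m)) = F2 (comult (ealpha m))" for m
      by (simp add: comult_ealpha F1t F2t E12t E23t mult_ac)
  qed (rule rhom_comp[OF rF(1) rhom_comult] rhom_comp[OF rF(2) rhom_comult])+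
  moreover
  have "ext scl (\<lambda>(b1, b2). bas (b1, b2, c)) y = E12 y * E3 (bas c)" for c y
    using ext_hom[of "\<lambda>z. z * E3 (bas c)" scl scl "\<lambda>(b, c). bas (b, c, 0)" y]
    by (simp add: E12_def additive_def distrib_right scl_mult_left Ebas bas_mult case_prod_unfold)
  moreover have "ext scl (\<lambda>(c1, c2). bas (b, c1, c2)) y = E1 (bas b) * E23 y" for b y
    using ext_hom[of "\<lambda>z. E1 (bas b) * z" scl scl "\<lambda>(b, c). bas (0, b, c)" y]
    by (simp add: E23_def additive_def distrib_left scl_mult_right Ebas bas_mult case_prod_unfold plus_00)
  ultimately show ?thesis
    by (simp add: F1_def F2_def)
qed

lemma counit_law: "ext scl (\<lambda>(b, c). scl (counit (bas b)) (bas c)) (comult a) = a"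
proof -
  have bil: "bilin scl (\<lambda>x y. scl (counit x) y)"
    by (simp add: bilin_def rhomD[OF rhom_counit] scl_add scl_add_left counit_scl scl_scl mult_ac)
  have r: "rhom (ext scl (\<lambda>(b, c). scl (counit (bas b)) (bas c)) :: (mon \<times> mon \<Rightarrow>\<^sub>0 'a) \<Rightarrow> _)"
    by (rule rhom_ext_scl)
      (auto simp: case_prod_unfold bas_zero scl_one scl_mult_left scl_mult_right scl_scl mult_ac
        rhomD[OF rhom_counit] simp flip: bas_mult)
  note t = module.ext_tens[OF module_scl bil]
  show ?thesis
  proof (rule rhom_V0_eqI[of "\<lambda>a. ext scl (\<lambda>(b, c). scl (counit (bas b)) (bas c)) (comult a)" "\<lambda>a. a"])
    show "rhom (\<lambda>a. ext scl (\<lambda>(b, c). scl (counit (bas b)) (bas c)) (comult a :: _ \<Rightarrow>\<^sub>0 'a))"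
      by (rule rhom_comp[OF r rhom_comult])
    show "ext scl (\<lambda>(b, c). scl (counit (bas b)) (bas c)) (comult (single 0 c)) = single 0 c" for c :: 'a
      by (simp add: comult_const ext_scl_const case_prod_unfold bas_zero rhomD[OF rhom_counit] scl_one)
  qed (auto simp: comult_hgen comult_ealpha rhomD[OF r] t rhom_id counit_simps rhomD[OF rhom_counit] scl_one scl_zero)
qed

text \<open>As \<open>V\<close> is commutative, \<open>b \<otimes> c \<mapsto> S(b) c\<close> is a
  ring homomorphism, and the law can be checked on generators.\<close>

lemma antipode_law: "ext scl (\<lambda>(b, c). antipode (bas b) * bas c) (comult a) = single 0 (counit a)"
proof -
  note S = rhomD[OF rhom_antipode]
  have bil: "bilin scl (\<lambda>x y. antipode x * y)"
    by (simp add: bilin_def S distrib_left distrib_right scl_mult_left scl_mult_right antipode_scl)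
  have r: "rhom (ext scl (\<lambda>(b, c). antipode (bas b) * bas c) :: (mon \<times> mon \<Rightarrow>\<^sub>0 'a) \<Rightarrow> _)"
    by (rule rhom_ext_scl) (auto simp: case_prod_unfold bas_zero S mult_ac simp flip: bas_mult)
  note t = module.ext_tens[OF module_scl bil]
  show ?thesis
  proof (rule rhom_V0_eqI[of "\<lambda>a. ext scl (\<lambda>(b, c). antipode (bas b) * bas c) (comult a)" "\<lambda>a. single 0 (counit a)"])
    show "rhom (\<lambda>a. ext scl (\<lambda>(b, c). antipode (bas b) * bas c) (comult a :: _ \<Rightarrow>\<^sub>0 'a))"
      by (rule rhom_comp[OF r rhom_comult])
    show "rhom (\<lambda>a. single 0 (counit a) :: 'a V0)"
      by (rule rhom_comp[OF rhom_single0 rhom_counit])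
    show "ext scl (\<lambda>(b, c). antipode (bas b) * bas c) (comult (single 0 c)) = single 0 (counit (single 0 c))" for c :: 'a
      by (simp add: comult_const ext_scl_const case_prod_unfold bas_zero S counit_simps)
  qed (auto simp: comult_hgen comult_ealpha rhomD[OF r] t S antipode_simps counit_simps simp flip: ealpha_add,
       simp add: ealpha_0)
qed

context module
begin

lemma sw_cocomm: "sweedler scale a (\<lambda>x y. B y x) = sweedler scale a B"
proof -
  have "sweedler scale a B = ext scale (\<lambda>(b, c). B (bas b) (bas c)) (ext scl (\<lambda>(b, c). bas (c, b)) (comult a))"
    by (simp add: cocomm sweedler_eq_ext)
  then show ?thesis
    by (simp add: ext_ext case_prod_unfold sweedler_eq_ext)
qed

lemma sw_coassoc:
  "sweedler scale a (\<lambda>x y. sweedler scale x (\<lambda>p q. T p q y)) =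
   sweedler scale a (\<lambda>x y. sweedler scale y (\<lambda>p q. T x p q))"
  using arg_cong[OF coassoc[of a], of "ext scale (\<lambda>(x, y, z). T (bas x) (bas y) (bas z))"]
  by (simp add: ext_ext case_prod_unfold sweedler_eq_ext)

text \<open>Coassociativity moves the splitting to the right factor, cocommutativity exchanges its
  parts, and coassociativity moves it back.\<close>

lemma sw_swap23:
  "sweedler scale a (\<lambda>x y. sweedler scale x (\<lambda>p q. T p q y)) =
   sweedler scale a (\<lambda>x y. sweedler scale x (\<lambda>p q. T p y q))"
  by (subst (1 2) sw_coassoc) (simp add: sw_cocomm[of _ "\<lambda>p q. T _ p q"])

lemma sw_counit_left:
  assumes "additive f" "\<And>c x. f (scl c x) = c *s f x"
  shows "sweedler scale a (\<lambda>x y. counit x *s f y) = f a"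
proof -
  have "f (ext scl (\<lambda>p. scl (counit (bas (fst p))) (bas (snd p))) (comult a)) =
      ext scale (\<lambda>p. f (scl (counit (bas (fst p))) (bas (snd p)))) (comult a)"
    by (rule ext_hom) (rule assms)+
  then show ?thesis
    using counit_law[of a] by (simp add: case_prod_unfold sweedler_eq_ext assms)
qed

lemma sw_counit_right:
  assumes "additive f" "\<And>c x. f (scl c x) = c *s f x"
  shows "sweedler scale a (\<lambda>x y. counit y *s f x) = f a"
  using sw_counit_left[OF assms, of a] sw_cocomm[of a "\<lambda>x y. counit x *s f y"] by simp

lemma sw_antipode:
  assumes "additive f" "\<And>c x. f (scl c x) = c *s f x"
  shows "sweedler scale a (\<lambda>x y. f (antipode x * y)) = counit a *s f 1"
proof -
  have "f (ext scl (\<lambda>p. antipode (bas (fst p)) * bas (snd p)) (comult a)) =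
      ext scale (\<lambda>p. f (antipode (bas (fst p)) * bas (snd p))) (comult a)"
    by (rule ext_hom) (rule assms)+
  moreover have "f (single 0 (counit a)) = counit a *s f 1"
    using assms(2)[of "counit a" 1] by (simp add: scl_mult)
  ultimately show ?thesis
    using antipode_law[of a] by (simp add: case_prod_unfold sweedler_eq_ext)
qed

end

subsection \<open>The derivation and its divided powers\<close>

definition D0_mon :: "mon \<Rightarrow> 'k::field_char_0 V0" where
  "D0_mon = (\<lambda>(u, m). (\<Sum>n\<in>keys u. single (u - single n 1 + single (n + 1) 1, m)
        (of_nat (lookup u n * (n + 1)))) + single (u + single 0 1, m) (of_int m))"

lemma D0_eq: "D0 = ext scl D0_mon"
  by (simp add: D0_def D0_mon_def lin_eq_ext)

lemma D0_add: "D0 (x + y) = D0 x + D0 y"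
  and D0_scl: "D0 (scl c x) = scl c (D0 x)"
  and D0_bas: "D0 (bas b) = D0_mon b"
  and D0_single: "D0 (single b c) = scl c (D0_mon b)"
  by (simp_all add: D0_eq module.ext_add[OF module_scl] module.ext_scl[OF module_scl]
      module.ext_bas[OF module_scl] module.ext_single[OF module_scl])

lemma additive_D0: "additive D0"
  by (simp add: additive_def D0_add)

lemma D0_mon_superset:
  assumes "finite S" "keys u \<subseteq> S"
  shows "D0_mon (u, m) = (\<Sum>n\<in>S. single (u - single n 1 + single (n + 1) 1, m)
        (of_nat (lookup u n * (n + 1)))) + single (u + single 0 1, m) (of_int m)"
  unfolding D0_mon_def prod.case
  by (subst sum.mono_neutral_left[OF assms]) (auto simp: in_keys_iff)

text \<open>The Leibniz rule on monomials. Truncated subtraction of exponents does no harm, because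
  the coefficient vanishes when the variable does not occur.\<close>

lemma D0_mon_add: "D0_mon (b + b') = D0_mon b * bas b' + bas b * (D0_mon b' :: 'k::field_char_0 V0)"
proof -
  obtain u m u' m' where b: "b = (u, m)" "b' = (u', m')"
    by (cases b, cases b') auto
  let ?S = "keys u \<union> keys u'"
  have S: "finite ?S" "keys u \<subseteq> ?S" "keys u' \<subseteq> ?S" "keys (u + u') \<subseteq> ?S"
    by (auto simp: keys_add dest: subsetD[OF keys_add])
  have t: "single (u + u' - single n 1 + single (n + 1) 1, m + m') (of_nat (lookup (u + u') n * (n + 1))) =
      single (u - single n 1 + single (n + 1) 1, m) (of_nat (lookup u n * (n + 1))) * bas (u', m') +
      bas (u, m) * single (u' - single n 1 + single (n + 1) 1, m') (of_nat (lookup u' n * (n + 1)) :: 'k)" for n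
  proof -
    have 1: "single (u + u' - single n 1 + single (n + 1) 1, m + m') (of_nat (lookup u n * (n + 1)) :: 'k) =
       single (u - single n 1 + single (n + 1) 1, m) (of_nat (lookup u n * (n + 1))) * bas (u', m')"
    proof (cases "lookup u n = 0")
      case False
      have "u + u' - single n 1 + single (n + 1) 1 = u - single n 1 + single (n + 1) 1 + u'"
        using False by (intro poly_mapping_eqI) (auto simp: lookup_minus lookup_add lookup_single when_def)
      then show ?thesis by (simp add: bas_def mult_single)
    qed (simp add: bas_def)
    have 2: "single (u + u' - single n 1 + single (n + 1) 1, m + m') (of_nat (lookup u' n * (n + 1)) :: 'k) =
       bas (u, m) * single (u' - single n 1 + single (n + 1) 1, m') (of_nat (lookup u' n * (n + 1)))"
    proof (cases "lookup u' n = 0")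
      case False
      have "u + u' - single n 1 + single (n + 1) 1 = u + (u' - single n 1 + single (n + 1) 1)"
        using False by (intro poly_mapping_eqI) (auto simp: lookup_minus lookup_add lookup_single when_def)
      then show ?thesis by (simp add: bas_def mult_single)
    qed (simp add: bas_def)
    have "single (u + u' - single n 1 + single (n + 1) 1, m + m') (of_nat (lookup (u + u') n * (n + 1)) :: 'k) =
      single (u + u' - single n 1 + single (n + 1) 1, m + m') (of_nat (lookup u n * (n + 1))) +
      single (u + u' - single n 1 + single (n + 1) 1, m + m') (of_nat (lookup u' n * (n + 1)))"
      by (simp only: lookup_add distrib_right of_nat_add single_add)
    then show ?thesis
      by (simp only: 1 2)
  qed
  have c: "single (u + u' + single 0 1, m + m') (of_int (m + m') :: 'k) =
      single (u + single 0 1, m) (of_int m) * bas (u', m') + bas (u, m) * single (u' + single 0 1, m') (of_int m')"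
    by (simp add: bas_def mult_single single_add ac_simps)
  define A B where "A n = (single (u - single n 1 + single (n + 1) 1, m) (of_nat (lookup u n * (n + 1))) :: 'k V0)"
    and "B n = (single (u' - single n 1 + single (n + 1) 1, m') (of_nat (lookup u' n * (n + 1))) :: 'k V0)" for n
  define A' B' where "A' = (single (u + single 0 1, m) (of_int m) :: 'k V0)"
    and "B' = (single (u' + single 0 1, m') (of_int m') :: 'k V0)"
  have "D0_mon (b + b') = (\<Sum>n\<in>?S. A n * bas b' + bas b * B n) + (A' * bas b' + bas b * B')"
    unfolding b add_Pair D0_mon_superset[OF S(1,4)] t c A_def B_def A'_def B'_def ..
  moreover have "D0_mon b = (\<Sum>n\<in>?S. A n) + A'" "D0_mon b' = (\<Sum>n\<in>?S. B n) + B'"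
    unfolding b D0_mon_superset[OF S(1,2)] D0_mon_superset[OF S(1,3)] A_def B_def A'_def B'_def by simp_all
  ultimately show ?thesis
    by (simp add: sum.distrib distrib_left distrib_right sum_distrib_left sum_distrib_right)
qed

lemma D0_mult: "D0 (x * y) = D0 x * y + x * D0 y"
proof (induction x rule: pm_induct)
  case (single b c)
  show ?case
  proof (induction y rule: pm_induct)
    case (single b' c')
    show ?case
      by (simp add: single_eq_scl_bas[of b] single_eq_scl_bas[of b'] scl_mult_left scl_mult_right D0_scl
          bas_mult D0_bas D0_mon_add scl_add)
  qed (auto simp: D0_add distrib_left additive.zero[OF additive_D0] algebra_simps)
qed (auto simp: D0_add distrib_right additive.zero[OF additive_D0] algebra_simps)

lemma D0_const: "D0 (single 0 c) = 0"
  by (simp add: D0_single D0_mon_def zero_prod_def scl_zero)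

lemma D0_1 [simp]: "D0 1 = 0"
  using D0_const[of 1] by simp

lemma D0_hgen: "D0 (hgen n) = scl (of_nat (Suc n)) (hgen (Suc n))"
  by (simp add: hgen_def D0_bas D0_mon_def single_eq_scl_bas[of "(_, _)"] scl_zero add.commute plus_1_eq_Suc)

lemma D0_ealpha: "D0 (ealpha m) = scl (of_int m) (hgen 0 * ealpha m)"
  by (simp add: hgen_def ealpha_def D0_bas D0_mon_def single_eq_scl_bas bas_mult)

text \<open>\<open>V\<close> is generated by \<open>e^\<alpha>\<close> and
  \<open>e^-\<alpha>\<close> under products and \<open>D\<close>, because
  \<open>h = (D e^\<alpha>) e^-\<alpha>\<close> and \<open>D h^(n) = (n+1) h^(n+1)\<close>. The
  bicharacter is given by its value on \<open>e^\<alpha>\<close> and its rules for products and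
  \<open>D\<close>, so this is the induction that fits it.\<close>

lemma V0_D_induct [case_names const ealpha ealpha' add mult D]:
  assumes const: "\<And>c. P (single 0 c)" and e: "P (ealpha 1)" "P (ealpha (- 1))"
    and add: "\<And>x y. P x \<Longrightarrow> P y \<Longrightarrow> P (x + y)" and mult: "\<And>x y. P x \<Longrightarrow> P y \<Longrightarrow> P (x * y)"
    and D: "\<And>x. P x \<Longrightarrow> P (D0 x)"
  shows "P (x :: 'k::field_char_0 V0)"
proof (induction x rule: V0_alg_induct)
  case (ealpha m)
  have "P (ealpha (int n))" "P (ealpha (- int n))" for n
  proof (induction n)
    case (Suc n)
    have "ealpha (int (Suc n)) = ealpha 1 * (ealpha (int n) :: 'k V0)"
      "ealpha (- int (Suc n)) = ealpha (- 1) * (ealpha (- int n) :: 'k V0)"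
      by (simp_all flip: ealpha_add)
    with Suc show "P (ealpha (int (Suc n)))" "P (ealpha (- int (Suc n)))"
      by (simp_all only:) (intro mult e Suc)+
  qed (use const[of 1] in \<open>simp_all add: ealpha_0\<close>)
  then show ?case
    by (cases m rule: int_cases2) auto
next
  case (hgen n)
  show ?case
  proof (induction n)
    case 0
    have "D0 (ealpha 1) * ealpha (- 1) = (hgen 0 :: 'k V0)"
      by (simp add: D0_ealpha scl_one mult.assoc ealpha_0 flip: ealpha_add)
    moreover have "P (D0 (ealpha 1) * ealpha (- 1))"
      by (intro mult D e)
    ultimately show ?case by simp
  next
    case (Suc n)
    have "scl (1 / of_nat (Suc n)) (D0 (hgen n)) = (hgen (Suc n) :: 'k V0)"
      by (simp add: D0_hgen scl_scl scl_one del: of_nat_Suc)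
    moreover have "P (scl (1 / of_nat (Suc n)) (D0 (hgen n)))"
      unfolding scl_mult by (intro mult const D Suc)
    ultimately show ?case by simp
  qed
qed (intro const add mult; assumption)+

section \<open>Divided powers \<open>D^(n)\<close> of the derivation, the coefficients of
  \<open>e^(zD)\<close>\<close>

definition dp :: "nat \<Rightarrow> 'k::field_char_0 V0 \<Rightarrow> 'k V0" where
  "dp n a = scl (1 / fact n) ((D0 ^^ n) a)"

lemma dp_0 [simp]: "dp 0 a = a"
  by (simp add: dp_def scl_one)

lemma dp_Suc: "scl (of_nat (Suc n)) (dp (Suc n) a) = D0 (dp n a)"
  by (simp add: dp_def D0_scl scl_scl del: of_nat_Suc)

lemma dp_add: "dp n (x + y) = dp n x + dp n y"
  and dp_scl: "dp n (scl c x) = scl c (dp n x)"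
proof -
  have "(D0 ^^ n) (x + y) = (D0 ^^ n) x + (D0 ^^ n) y" "(D0 ^^ n) (scl c x) = scl c ((D0 ^^ n) x)"
    by (induction n) (auto simp: D0_add D0_scl)
  then show "dp n (x + y) = dp n x + dp n y" "dp n (scl c x) = scl c (dp n x)"
    by (simp_all add: dp_def scl_add scl_scl mult.commute)
qed

lemma dp_1 [simp]: "dp n 1 = (if n = 0 then 1 else 0)"
proof -
  have "(D0 ^^ n) 0 = (0 :: 'a V0)" for n
    by (induction n) (auto simp: additive.zero[OF additive_D0])
  then have "(D0 ^^ Suc n) 1 = (0 :: 'a V0)" for n
    by (simp only: funpow_Suc_right o_apply D0_1)
  then show ?thesis
    by (cases n) (auto simp: dp_def scl_zero scl_one)
qed

lemma D0_pow_hgen: "(D0 ^^ n) (hgen 0) = scl (fact n) (hgen n)"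
  by (induction n) (auto simp: scl_one D0_scl D0_hgen scl_scl mult.commute simp del: of_nat_Suc)

lemma dp_hgen: "dp n (hgen 0) = hgen n"
  by (simp add: dp_def D0_pow_hgen scl_scl scl_one)

text \<open>The recursion solved by the coefficients of \<open>e\<^bsup>zD\<^esup>\<close> of a product and of a coproduct\<close>

lemma (in module) leibniz_rec:
  fixes \<delta> :: "'b \<Rightarrow> 'b"
  assumes inv: "\<And>n x y. of_nat (Suc n) *s x = of_nat (Suc n) *s y \<Longrightarrow> x = y"
    and \<delta>: "additive \<delta>"
    and S: "S 0 = T 0 0" "\<And>n. of_nat (Suc n) *s S (Suc n) = \<delta> (S n)"
    and T: "\<And>i j. \<delta> (T i j) = of_nat (Suc i) *s T (Suc i) j + of_nat (Suc j) *s T i (Suc j)"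
  shows "S n = (\<Sum>i\<le>n. T i (n - i))"
proof (induction n)
  case (Suc n)
  have "of_nat (Suc n) *s S (Suc n) = (\<Sum>i\<le>n. \<delta> (T i (n - i)))"
    by (simp only: S Suc additive.sum[OF \<delta>])
  also have "\<dots> = (\<Sum>i\<le>n. of_nat (Suc i) *s T (Suc i) (n - i)) + (\<Sum>i\<le>n. of_nat (Suc n - i) *s T i (Suc n - i))"
    by (simp add: T sum.distrib Suc_diff_le del: of_nat_Suc)
  \<comment> \<open>Both sums are extended to \<open>i \<le> Suc n\<close> by terms with coefficient
    0, so that the coefficients add up to \<open>Suc n\<close>.\<close>
  also have "(\<Sum>i\<le>n. of_nat (Suc i) *s T (Suc i) (n - i)) = (\<Sum>i\<le>Suc n. of_nat i *s T i (Suc n - i))"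
    by (simp add: sum.atMost_Suc_shift del: sum.atMost_Suc of_nat_Suc)
  also have "(\<Sum>i\<le>n. of_nat (Suc n - i) *s T i (Suc n - i)) = (\<Sum>i\<le>Suc n. of_nat (Suc n - i) *s T i (Suc n - i))"
    by simp
  also have "(\<Sum>i\<le>Suc n. of_nat i *s T i (Suc n - i)) + (\<Sum>i\<le>Suc n. of_nat (Suc n - i) *s T i (Suc n - i)) =
      (\<Sum>i\<le>Suc n. of_nat (Suc n) *s T i (Suc n - i))"
    unfolding sum.distrib[symmetric]
    by (intro sum.cong) (auto simp flip: scale_left_distrib of_nat_add simp del: of_nat_Suc)
  also have "\<dots> = of_nat (Suc n) *s (\<Sum>i\<le>Suc n. T i (Suc n - i))"
    by (simp only: scale_sum_right)
  finally show ?case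
    by (rule inv)
qed (simp add: S)

lemma scl_inj: "scl (of_nat (Suc n)) x = scl (of_nat (Suc n)) (y :: 'b \<Rightarrow>\<^sub>0 'k::field_char_0) \<Longrightarrow> x = y"
proof -
  have "scl (1 / of_nat (Suc n)) (scl (of_nat (Suc n)) x) = x" for x :: "'b \<Rightarrow>\<^sub>0 'k"
    by (simp add: scl_scl scl_one del: of_nat_Suc)
  then show "scl (of_nat (Suc n)) x = scl (of_nat (Suc n)) y \<Longrightarrow> x = y"
    by metis
qed

lemma dp_mult: "dp n (a * b) = (\<Sum>i\<le>n. dp i a * dp (n - i) b)"
  by (rule module.leibniz_rec[OF module_scl scl_inj additive_D0, where T = "\<lambda>i j. dp i a * dp j b"])
    (auto simp: D0_mult scl_mult_left scl_mult_right simp flip: dp_Suc simp del: of_nat_Suc)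

definition D2 :: "(mon \<times> mon \<Rightarrow>\<^sub>0 'k::field_char_0) \<Rightarrow> mon \<times> mon \<Rightarrow>\<^sub>0 'k" where
  "D2 = ext scl (\<lambda>(b, c). tens (D0 (bas b)) (bas c) + tens (bas b) (D0 (bas c)))"

lemma D2_tens: "D2 (tens x y) = tens (D0 x) y + tens x (D0 y)"
  using module.ext_tens[OF module_scl, of "\<lambda>x y. tens (D0 x) y + tens x (D0 y)" x y]
  by (simp add: D2_def bilin_def D0_add D0_scl tens_add_left tens_add_right tens_scl_left tens_scl_right scl_add ac_simps)

lemma D2_add: "D2 (x + y) = D2 x + D2 y" and D2_scl: "D2 (scl c x) = scl c (D2 x)"
  by (simp_all add: D2_def module.ext_add[OF module_scl] module.ext_scl[OF module_scl])

lemma additive_D2: "additive D2"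
  by (simp add: additive_def D2_add)

lemma D2_mult: "D2 (x * y) = D2 x * y + x * D2 y"
proof (induction x rule: pm_induct)
  case (single b c)
  show ?case
  proof (induction y rule: pm_induct)
    case (single b' c')
    have "D2 (bas b * bas b') = D2 (bas b) * bas b' + bas b * (D2 (bas b') :: _ \<Rightarrow>\<^sub>0 'a)"
    proof -
      have "D2 (tens x y * tens x' y') = D2 (tens x y) * tens x' y' + tens x y * D2 (tens x' y')" for x y x' y' :: "'a V0"
        by (simp add: D2_tens D0_mult tens_add_left tens_add_right distrib_left distrib_right flip: tens_mult)
      from this[of "bas (fst b)" "bas (snd b)" "bas (fst b')" "bas (snd b')"] show ?thesis
        by simp
    qed
    then show ?case
      by (simp add: single_eq_scl_bas[of b] single_eq_scl_bas[of b'] scl_mult_left scl_mult_right D2_scl scl_add)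
  qed (auto simp: D2_add distrib_left additive.zero[OF additive_D2] algebra_simps)
qed (auto simp: D2_add distrib_right additive.zero[OF additive_D2] algebra_simps)

text \<open>Both sides are derivations along the homomorphism \<open>comult\<close>, hence
  determined by generators.\<close>

lemma comult_D0: "comult (D0 a) = D2 (comult a)"
proof (induction a rule: V0_alg_induct)
  case (const c)
  have "D2 (single 0 c) = 0"
  proof -
    have "D2 1 = (0 :: mon \<times> mon \<Rightarrow>\<^sub>0 'a)"
      using D2_tens[of 1 1] by (simp add: tens_one)
    then show ?thesis
      using D2_scl[of c 1] by (simp add: scl_mult)
  qed
  then show ?case by (simp add: D0_const comult_hom comult_const)
next
  case (hgen n)
  show ?case
    by (simp add: D0_hgen comult_scl comult_hgen D2_add D2_tens tens_scl_left tens_scl_right scl_add)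
next
  case (ealpha m)
  show ?case
    by (simp add: D0_ealpha comult_scl comult_hom comult_hgen comult_ealpha D2_tens tens_scl_left tens_scl_right
        distrib_right scl_add flip: tens_mult)
next
  case (add x y)
  then show ?case by (simp add: D0_add comult_hom D2_add)
next
  case (mult x y)
  then show ?case by (simp add: D0_mult comult_hom D2_mult)
qed

lemma antipode_D0: "antipode (D0 a) = D0 (antipode a)"
proof (induction a rule: V0_alg_induct)
  case (const c)
  then show ?case by (simp add: D0_const antipode_simps rhomD[OF rhom_antipode])
next
  case (hgen n)
  then show ?case
    by (simp add: D0_hgen antipode_simps antipode_scl additive.minus[OF additive_D0] module.scale_minus_right[OF module_scl])
next
  case (ealpha m)
  then show ?case
    by (simp add: D0_ealpha antipode_simps antipode_scl rhomD[OF rhom_antipode]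
        module.scale_minus_right[OF module_scl] module.scale_minus_left[OF module_scl])
next
  case (add x y)
  then show ?case by (simp add: D0_add rhomD[OF rhom_antipode])
next
  case (mult x y)
  then show ?case by (simp add: D0_mult rhomD[OF rhom_antipode])
qed

lemma (in module) ext_ext_tens:
  assumes "bilin scale B"
  shows "ext scale (\<lambda>p. B (bas (fst p)) (bas (snd p))) (ext scl (\<lambda>p. tens (f p) (g p)) x) = ext scale (\<lambda>p. B (f p) (g p)) x"
  using ext_tens[OF assms] by (simp add: ext_ext case_prod_unfold)

lemma sw_D0:
  fixes s :: "'k::field_char_0 \<Rightarrow> 'm::ab_group_add \<Rightarrow> 'm"
  assumes "module s" "bilin s B"
  shows "sweedler s (D0 a) B = sweedler s a (\<lambda>x y. B (D0 x) y + B x (D0 y))"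
proof -
  interpret module s by fact
  have "D2 x = ext scl (\<lambda>p. tens (D0 (bas (fst p))) (bas (snd p))) x + ext scl (\<lambda>p. tens (bas (fst p)) (D0 (bas (snd p)))) x"
    for x :: "mon \<times> mon \<Rightarrow>\<^sub>0 'k"
    by (simp add: D2_def case_prod_unfold module.ext_add_fun[OF module_scl])
  then show ?thesis
    by (simp add: sweedler_eq_ext comult_D0 case_prod_unfold ext_add ext_ext_tens[OF assms(2)] ext_add_fun)
qed

text \<open>The coproduct of \<open>e^(zD) a\<close> is
  \<open>e^(zD) a' \<otimes> e^(zD) a''\<close>: its coefficients solve the same recursion as those
  of a product, with the derivation \<open>D2\<close> on the tensor square.\<close>

lemma sw_dp:
  fixes s :: "'k::field_char_0 \<Rightarrow> 'm::ab_group_add \<Rightarrow> 'm"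
  assumes "module s" "bilin s B"
  shows "sweedler s (dp n a) B = sweedler s a (\<lambda>x y. \<Sum>i\<le>n. B (dp i x) (dp (n - i) y))"
proof -
  interpret module s by fact
  define T where "T i j = ext scl (\<lambda>p. tens (dp i (bas (fst p))) (dp j (bas (snd p)))) (comult a)" for i j
  have "comult (dp n a) = (\<Sum>i\<le>n. T i (n - i))"
  proof (rule module.leibniz_rec[OF module_scl scl_inj additive_D2, where S = "\<lambda>n. comult (dp n a)"])
    show "comult (dp 0 a) = T 0 0"
      by (simp add: T_def) (simp add: ext_def flip: single_eq_scl_bas pm_expand)
    show "scl (of_nat (Suc n)) (comult (dp (Suc n) a)) = D2 (comult (dp n a))" for n
      by (simp only: comult_D0[symmetric] dp_Suc[symmetric] comult_scl)
    show "D2 (T i j) = scl (of_nat (Suc i)) (T (Suc i) j) + scl (of_nat (Suc j)) (T i (Suc j))" for i j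
    proof -
      have "D2 (T i j) = ext scl (\<lambda>p. D2 (tens (dp i (bas (fst p))) (dp j (bas (snd p))))) (comult a)"
        unfolding T_def by (rule ext_hom[of D2 scl scl, OF additive_D2 D2_scl])
      also have "\<dots> = ext scl (\<lambda>p. scl (of_nat (Suc i)) (tens (dp (Suc i) (bas (fst p))) (dp j (bas (snd p)))) +
          scl (of_nat (Suc j)) (tens (dp i (bas (fst p))) (dp (Suc j) (bas (snd p))))) (comult a)"
        by (simp only: D2_tens dp_Suc[symmetric] tens_scl_left tens_scl_right)
      finally show ?thesis
        by (simp only: T_def module.ext_add_fun[OF module_scl] module.ext_scale_fun[OF module_scl])
    qed
  qed
  then show ?thesis
    by (simp add: sweedler_eq_ext case_prod_unfold T_def ext_sum ext_ext_tens[OF assms(2)] ext_sum_fun)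
qed

lemma fls_nth_exp_zD: "fls_nth (exp_zD a) n = (if n < 0 then 0 else dp (nat n) a)"
  by (simp add: exp_zD_def dp_def)

lemma exp_zD_add: "exp_zD (a + b) = exp_zD a + exp_zD b"
  by (rule fls_eqI) (simp add: fls_nth_exp_zD dp_add)

lemma exp_zD_1: "exp_zD 1 = 1"
  by (rule fls_eqI) (simp add: fls_nth_exp_zD)

lemma exp_zD_scl: "exp_zD (scl c a) = fls_const (single 0 c) * exp_zD a"
  by (rule fls_eqI) (simp add: fls_nth_exp_zD dp_scl scl_zero flip: scl_mult)

lemma exp_zD_D0: "exp_zD (D0 a) = fls_deriv (exp_zD a)"
proof (rule fls_eqI)
  fix n :: int
  have dD: "dp k (D0 a) = scl (of_nat (Suc k)) (dp (Suc k) a)" for k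
    by (simp add: dp_def scl_scl funpow_swap1 del: of_nat_Suc)
  show "fls_nth (exp_zD (D0 a)) n = fls_nth (fls_deriv (exp_zD a)) n"
  proof (cases "n < 0")
    case True
    then show ?thesis by (cases "n = -1") (auto simp: fls_nth_exp_zD)
  next
    case False
    then obtain k where n: "n = int k"
      by (metis nonneg_int_cases not_less)
    have "nat (int k + 1) = Suc k"
      by simp
    then show ?thesis
      by (simp add: n fls_nth_exp_zD dD scl_mult single_add add.commute)
  qed
qed

section \<open>Convolution of bilinear maps\<close>

text \<open>The target ring is a parameter: the same convolution serves bicharacters over
  \<open>K\<close>, the field \<open>Y\<close>, and products of two fields with values in double
  Laurent series.\<close>

definition conv2 :: "('k::comm_ring_1 \<Rightarrow> 'r::comm_ring_1) \<Rightarrow> ('k V0 \<Rightarrow> 'k V0 \<Rightarrow> 'r) \<Rightarrow> ('k V0 \<Rightarrow> 'k V0 \<Rightarrow> 'r) \<Rightarrow>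
    'k V0 \<Rightarrow> 'k V0 \<Rightarrow> 'r" where
  "conv2 \<phi> f g a b = sweedler (act \<phi>) a (\<lambda>a' a''. sweedler (act \<phi>) b (\<lambda>b' b''. f a' b' * g a'' b''))"

context
  fixes \<phi> :: "'k::comm_ring_1 \<Rightarrow> 'r::comm_ring_1"
  assumes \<phi>: "rhom \<phi>"
begin

interpretation module "act \<phi>"
  by (rule module_act) (rule \<phi>)

lemma conv2_comm: "conv2 \<phi> f g a b = conv2 \<phi> g f a b"
proof -
  have "conv2 \<phi> f g a b = sweedler (act \<phi>) a (\<lambda>a' a''. sweedler (act \<phi>) b (\<lambda>b' b''. f a'' b'' * g a' b'))"
    unfolding conv2_def
    by (subst sw_cocomm[symmetric], subst (2) sw_cocomm[symmetric]) (rule refl)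
  then show ?thesis
    by (simp add: conv2_def mult.commute)
qed

text \<open>Coassociativity is used in each argument separately; \<open>sw_swap\<close> first brings
  the nested sums over one argument together and afterwards takes them apart again.\<close>

lemma conv2_assoc: "conv2 \<phi> f (conv2 \<phi> g h) a b = conv2 \<phi> (conv2 \<phi> f g) h a b"
proof -
  let ?s = "sweedler (act \<phi>)"
  have "conv2 \<phi> f (conv2 \<phi> g h) a b =
      ?s a (\<lambda>a1 a2. ?s b (\<lambda>b1 b2. ?s a2 (\<lambda>a3 a4. ?s b2 (\<lambda>b3 b4. f a1 b1 * g a3 b3 * h a4 b4))))"
    by (simp add: conv2_def sw_mult_const mult.assoc)
  also have "\<dots> = ?s a (\<lambda>a1 a2. ?s a2 (\<lambda>a3 a4. ?s b (\<lambda>b1 b2. ?s b2 (\<lambda>b3 b4. f a1 b1 * g a3 b3 * h a4 b4))))"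
    by (subst (2) sw_swap) (rule refl)
  also have "\<dots> = ?s a (\<lambda>a1 a2. ?s a1 (\<lambda>a3 a4. ?s b (\<lambda>b1 b2. ?s b1 (\<lambda>b3 b4. f a3 b3 * g a4 b4 * h a2 b2))))"
    by (simp add: sw_coassoc)
  also have "\<dots> = ?s a (\<lambda>a1 a2. ?s b (\<lambda>b1 b2. ?s a1 (\<lambda>a3 a4. ?s b1 (\<lambda>b3 b4. f a3 b3 * g a4 b4 * h a2 b2))))"
    by (subst (3) sw_swap) (rule refl)
  also have "\<dots> = conv2 \<phi> (conv2 \<phi> f g) h a b"
    by (simp add: conv2_def sw_mult_const)
  finally show ?thesis .
qed

lemma conv2_swap: "conv2 \<phi> (\<lambda>a b. f b a) (\<lambda>a b. g b a) a b = conv2 \<phi> f g b a"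
  unfolding conv2_def by (subst sw_swap) (rule refl)

lemma conv2_bilin: "bilin (act \<phi>) (conv2 \<phi> f g)"
  by (simp add: bilin_def conv2_def sw_add sw_scl sw_add_fun sw_scale_fun)

lemma conv2_counit:
  assumes "bilin (act \<phi>) f"
  shows "conv2 \<phi> f (\<lambda>a b. \<phi> (counit a) * \<phi> (counit b)) a b = f a b"
proof -
  have "conv2 \<phi> f (\<lambda>a b. \<phi> (counit a) * \<phi> (counit b)) a b =
      sweedler (act \<phi>) a (\<lambda>a' a''. act \<phi> (counit a'') (sweedler (act \<phi>) b (\<lambda>b' b''. act \<phi> (counit b'') (f a' b'))))"
    by (simp only: conv2_def flip: sw_scale_fun) (simp add: act_def mult_ac)
  also have "\<dots> = sweedler (act \<phi>) a (\<lambda>a' a''. act \<phi> (counit a'') (f a' b))"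
    using assms by (subst sw_counit_right) (auto simp: bilin_def additive_def)
  also have "\<dots> = f a b"
    using assms by (subst sw_counit_right[of "\<lambda>a. f a b"]) (auto simp: bilin_def additive_def)
  finally show ?thesis .
qed

end

lemma conv2_cong:
  assumes "\<And>b c. f (bas b) (bas c) = f' (bas b) (bas c)" "\<And>b c. g (bas b) (bas c) = g' (bas b) (bas c)"
  shows "conv2 \<phi> f g a b = conv2 \<phi> f' g' a b"
  unfolding conv2_def by (intro sw_cong) (simp add: assms)

lemma conv2_hom_on:
  assumes "rhom \<phi>" "rhom \<psi>" "add_on P \<chi>"
    and P: "\<And>c x. x \<in> P \<Longrightarrow> \<phi> c * x \<in> P \<and> \<chi> (\<phi> c * x) = \<psi> c * \<chi> x"
      "\<And>x y. x \<in> P \<Longrightarrow> y \<in> P \<Longrightarrow> x * y \<in> P \<and> \<chi> (x * y) = \<chi> x * \<chi> y"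
    and fg: "\<And>a b. f a b \<in> P" "\<And>a b. g a b \<in> P"
  shows "\<chi> (conv2 \<phi> f g a b) = conv2 \<psi> (\<lambda>a b. \<chi> (f a b)) (\<lambda>a b. \<chi> (g a b)) a b"
    "conv2 \<phi> f g a b \<in> P"
proof -
  have sP: "sweedler (act \<phi>) a B \<in> P" if "\<And>x y. B x y \<in> P" for a B
    unfolding sweedler_eq_ext ext_def
    by (intro add_on_sum_mem[OF assms(3)]) (auto simp: act_def P that)
  show "conv2 \<phi> f g a b \<in> P"
    unfolding conv2_def by (intro sP) (simp add: P fg)
  have "\<chi> (conv2 \<phi> f g a b) =
      sweedler (act \<psi>) a (\<lambda>a' a''. \<chi> (sweedler (act \<phi>) b (\<lambda>b' b''. f a' b' * g a'' b'')))"
    unfolding conv2_def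
    by (intro sw_hom_on[OF assms(3)]) (auto simp: act_def P fg sP)
  also have "\<dots> = sweedler (act \<psi>) a (\<lambda>a' a''. sweedler (act \<psi>) b (\<lambda>b' b''. \<chi> (f a' b' * g a'' b'')))"
    by (intro sw_cong sw_hom_on[OF assms(3)]) (auto simp: act_def P fg)
  finally show "\<chi> (conv2 \<phi> f g a b) = conv2 \<psi> (\<lambda>a b. \<chi> (f a b)) (\<lambda>a b. \<chi> (g a b)) a b"
    by (simp add: conv2_def P fg)
qed

text \<open>\<open>D\<close> becomes \<open>D \<otimes> 1 + 1 \<otimes> D\<close> under the
  coproduct, which matches the product rule of \<delta>.\<close>

lemma conv2_D0:
  fixes \<phi> :: "'k::field_char_0 \<Rightarrow> 'r::comm_ring_1"
  assumes \<phi>: "rhom \<phi>" and \<delta>: "additive \<delta>" "\<And>x y. \<delta> (x * y) = \<delta> x * y + x * \<delta> y" "\<And>c. \<delta> (\<phi> c) = 0"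
    and f: "bilin (act \<phi>) f" "\<And>a b. f (D0 a) b = \<delta> (f a b)" and g: "bilin (act \<phi>) g" "\<And>a b. g (D0 a) b = \<delta> (g a b)"
  shows "conv2 \<phi> f g (D0 a) b = \<delta> (conv2 \<phi> f g a b)"
proof -
  interpret module "act \<phi>" by (rule module_act) (rule \<phi>)
  have \<delta>c: "\<delta> (act \<phi> c x) = act \<phi> c (\<delta> x)" for c x
    by (simp add: act_def \<delta>)
  have "conv2 \<phi> f g (D0 a) b = sweedler (act \<phi>) a (\<lambda>a' a''. sweedler (act \<phi>) b (\<lambda>b' b''. f (D0 a') b' * g a'' b'') +
      sweedler (act \<phi>) b (\<lambda>b' b''. f a' b' * g (D0 a'') b''))"
    unfolding conv2_def using f(1) g(1)
    by (intro sw_D0[OF module_act[OF \<phi>]])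
      (simp add: bilin_def distrib_left distrib_right sw_add_fun act_def mult_ac flip: sw_mult_const)
  also have "\<dots> = sweedler (act \<phi>) a (\<lambda>a' a''. \<delta> (sweedler (act \<phi>) b (\<lambda>b' b''. f a' b' * g a'' b'')))"
    by (simp add: f g sw_hom[of \<delta> "act \<phi>" "act \<phi>", OF \<delta>(1) \<delta>c] \<delta> sw_add_fun)
  also have "\<dots> = \<delta> (conv2 \<phi> f g a b)"
    unfolding conv2_def by (rule sw_hom[of \<delta> "act \<phi>" "act \<phi>", OF \<delta>(1) \<delta>c, symmetric])
  finally show ?thesis .
qed

section \<open>Bicharacters\<close>

definition scalK :: "'k::field \<Rightarrow> ('p, 'k ratfun) tps" where
  "scalK c = tconst (cst c)"

lemma rhom_tconst: "rhom (tconst :: 'a::comm_ring_1 \<Rightarrow> _)"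
  by (rule rhomI) (auto simp: tconst_add tconst_mult)

lemma rhom_scalK: "rhom scalK"
  unfolding scalK_def[abs_def] by (rule rhom_comp[OF rhom_tconst rhom_cst])

lemma sK_eq: "sK = act scalK"
  by (simp add: fun_eq_iff sK_def act_def scalK_def)

lemma KT_add: "X \<in> KT \<Longrightarrow> Y \<in> KT \<Longrightarrow> X + Y \<in> KT"
  by (auto simp: KT_def K0_add)

lemma KT_mult: "X \<in> KT \<Longrightarrow> Y \<in> KT \<Longrightarrow> X * Y \<in> KT"
  by (auto simp: KT_def tcoeff_mult intro!: K0_sum K0_mult)

lemma KT_0: "0 \<in> KT"
  by (simp add: KT_def K0_0)

lemma KT_const: "scalK c \<in> KT"
  by (simp add: KT_def scalK_def tcoeff_tconst K0_cst K0_0)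

lemma tmap_mult_on:
  assumes "add_on P f" "\<And>x y. x \<in> P \<Longrightarrow> y \<in> P \<Longrightarrow> x * y \<in> P \<and> f (x * y) = f x * f y"
    "\<And>n. tcoeff X n \<in> P" "\<And>n. tcoeff Y n \<in> P"
  shows "tmap f (X * Y) = tmap f X * tmap f Y"
  by (rule tps_eqI) (simp add: tcoeff_mult case_prod_unfold add_on_sum[OF assms(1)] assms)

lemma tmap_rhom_mult: "rhom f \<Longrightarrow> tmap f (X * Y) = tmap f X * tmap f Y"
  by (rule tmap_mult_on[of UNIV]) (auto simp: rhomD)

lemma rhom_tmap: "rhom f \<Longrightarrow> rhom (tmap f)"
  by (rule rhomI) (auto simp: tmap_rhom_mult tps_eqI rhomD tcoeff_one)

lemma tmap_khom:
  assumes "khom f" "X \<in> KT" "Y \<in> KT"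
  shows "tmap f (X + Y) = tmap f X + tmap f Y" "tmap f (X * Y) = tmap f X * tmap f Y"
proof -
  show "tmap f (X + Y) = tmap f X + tmap f Y"
    using assms by (intro tps_eqI) (auto simp: KT_def khomD)
  show "tmap f (X * Y) = tmap f X * tmap f Y"
    using assms by (intro tmap_mult_on[OF khom_add_on]) (auto simp: KT_def khomD K0_mult)
qed

lemma tmap_scalK: "khom f \<Longrightarrow> tmap f (scalK c) = tconst (f (cst c))"
  by (simp add: scalK_def tmap_tconst khom_0)

lemma add_on_tmap: "khom f \<Longrightarrow> add_on KT (tmap f)"
  by (auto simp: add_on_def KT_0 KT_add tmap_khom)

lemma tmap_deriv:
  assumes "additive d" "\<And>x y. d (x * y) = d x * y + x * d y"
  shows "tmap d (X * Y) = tmap d X * Y + X * tmap d Y"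
  by (rule tps_eqI)
    (simp add: tcoeff_mult case_prod_unfold additive.sum[OF assms(1)] assms sum.distrib)

lemma rf_pd_0 [simp]: "rf_pd i 0 = 0"
  using rf_pd_cst[of i 0] by simp

lemma tmap_rf_pd_scalK: "tmap (rf_pd i) (scalK c) = 0"
  by (simp add: scalK_def tmap_tconst)

lemma bc_conv_eq: "bc_conv r s = conv2 scalK r s"
  by (simp add: fun_eq_iff bc_conv_def conv2_def sK_eq)

lemma KT_subst2: "X \<in> KT \<Longrightarrow> tmap (subst2 1 0) X \<in> KT"
  by (simp add: KT_def subst2_1_0_K0)

lemma KT_subst2_subst2: "X \<in> KT \<Longrightarrow> tmap (subst2 1 0) (tmap (subst2 1 0) X) = X"
  by (rule tps_eqI) (simp add: KT_def subst2_subst2)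

section \<open>Functions without pole at \<open>w = 0\<close>, where evaluation at
  \<open>w = 0\<close> is multiplicative\<close>

definition Reg :: "'k::field ratfun set" where
  "Reg = {g \<in> K0. \<forall>q<0. fls_nth (expn 0 1 g) q = 0}"

definition RegT :: "('p, 'k::field ratfun) tps set" where
  "RegT = {X. \<forall>n. tcoeff X n \<in> Reg}"

lemma Reg_add: "g \<in> Reg \<Longrightarrow> h \<in> Reg \<Longrightarrow> g + h \<in> Reg"
  by (auto simp: Reg_def K0_add khomD[OF khom_expn(1)])

lemma Reg_mult: "g \<in> Reg \<Longrightarrow> h \<in> Reg \<Longrightarrow> g * h \<in> Reg"
  by (auto simp: Reg_def K0_mult khomD[OF khom_expn(1)] fls_mult_nth_bound[of 0 _ 0])

lemma Reg_cst: "cst c \<in> Reg"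
  by (auto simp: Reg_def K0_cst)

lemma Reg_0: "0 \<in> Reg"
  using Reg_cst[of 0] by simp

lemma Reg_pd: "g \<in> Reg \<Longrightarrow> rf_pd 0 g \<in> Reg" "g \<in> Reg \<Longrightarrow> rf_pd 1 g \<in> Reg"
proof -
  assume g: "g \<in> Reg"
  then show "rf_pd 0 g \<in> Reg"
    by (auto simp: Reg_def expn_pd rf_pd_K0)
  \<comment> \<open>For \<open>q = -1\<close> the factor is 0; otherwise \<open>q + 1\<close> is
    still negative.\<close>
  have "of_int (q + 1) * fls_nth (expn 0 1 g) (q + 1) = 0" if "q < 0" for q
    using g that by (cases "q = -1") (auto simp: Reg_def)
  then show "rf_pd 1 g \<in> Reg"
    using g by (auto simp: Reg_def expn_pd rf_pd_K0)
qed

lemma Reg_sum: "(\<And>i. i \<in> A \<Longrightarrow> f i \<in> Reg) \<Longrightarrow> sum f A \<in> Reg"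
  by (induction A rule: infinite_finite_induct) (auto intro: Reg_0 Reg_add)

lemma RegT_add: "X \<in> RegT \<Longrightarrow> Y \<in> RegT \<Longrightarrow> X + Y \<in> RegT"
  and RegT_mult: "X \<in> RegT \<Longrightarrow> Y \<in> RegT \<Longrightarrow> X * Y \<in> RegT"
  and RegT_const: "scalK c \<in> RegT"
  and RegT_0: "0 \<in> RegT"
  and RegT_pd: "X \<in> RegT \<Longrightarrow> tmap (rf_pd 0) X \<in> RegT" "X \<in> RegT \<Longrightarrow> tmap (rf_pd 1) X \<in> RegT"
  by (auto simp: RegT_def tcoeff_mult scalK_def tcoeff_tconst Reg_cst Reg_0 Reg_pd intro!: Reg_sum Reg_mult Reg_add)

text \<open>By induction on the degree in the parameters, \<open>X Y = 1\<close> expresses the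
  product of the \<open>n\<close>-th coefficient of \<open>X\<close> with the constant coefficient
  of \<open>Y\<close> through regular terms. The latter does not vanish at \<open>w = 0\<close>, so
  it can be divided out without creating a pole.\<close>

lemma RegT_inverse:
  assumes XY: "X * Y = 1" and X: "X \<in> KT" and Y: "Y \<in> RegT"
    and u: "fls_nth (expn 0 1 (tcoeff Y {#})) 0 \<noteq> 0"
  shows "X \<in> RegT"
proof -
  have "tcoeff X n \<in> Reg" for n
  proof (induction "size n" arbitrary: n rule: less_induct)
    case less
    have K: "tcoeff X i \<in> K0" "tcoeff Y i \<in> Reg" "tcoeff Y i \<in> K0" for i
      using X Y by (auto simp: KT_def RegT_def Reg_def)
    define A where "A = {(i, j). i + j = n}"
    have A: "finite A" "(n, {#}) \<in> A"
      by (auto simp: A_def finite_decomp)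
    have "(\<Sum>(i, j)\<in>A. tcoeff X i * tcoeff Y j) = tcoeff 1 n"
      by (simp add: A_def flip: tcoeff_mult XY)
    then have "tcoeff X n * tcoeff Y {#} = tcoeff 1 n - (\<Sum>(i, j)\<in>A - {(n, {#})}. tcoeff X i * tcoeff Y j)"
      using A by (simp add: sum.remove[of A "(n, {#})"] eq_diff_eq)
    moreover have "(\<Sum>(i, j)\<in>A - {(n, {#})}. tcoeff X i * tcoeff Y j) \<in> Reg"
      using K(2) by (intro Reg_sum) (auto simp: A_def intro!: Reg_mult less)
    moreover have "tcoeff 1 n \<in> Reg"
      using Reg_cst[of 1] Reg_0 by (auto simp: tcoeff_one)
    moreover have "g - h \<in> Reg" if "g \<in> Reg" "h \<in> Reg" for g h :: "'b ratfun"
      using that by (auto simp: Reg_def K0_diff khom_diff[OF khom_expn(1)])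
    ultimately have R: "tcoeff X n * tcoeff Y {#} \<in> Reg"
      by metis
    define E S where "E = expn 0 1 (tcoeff X n)" and "S = expn 0 1 (tcoeff Y {#})"
    have ES: "fls_nth (E * S) q = 0" if "q < 0" for q
      using R that K by (simp add: Reg_def E_def S_def khomD[OF khom_expn(1)])
    have S: "fls_subdegree S = 0"
      using u K(2)[of "{#}"] by (intro fls_subdegree_eqI) (auto simp: S_def Reg_def)
    have "fls_subdegree E \<ge> 0"
    proof (rule ccontr)
      assume "\<not> fls_subdegree E \<ge> 0"
      moreover from this have "E \<noteq> 0"
        by auto
      \<comment> \<open>The lowest coefficients lie in the field of Laurent series in
        \<open>z\<close>, so their product cannot vanish.\<close>
      moreover have "fls_nth (E * S) (fls_subdegree E + fls_subdegree S) = fls_nth E (fls_subdegree E) * fls_nth S (fls_subdegree S)"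
        by (rule fls_times_base)
      ultimately show False
        using ES[of "fls_subdegree E"] u S by (simp add: S_def[symmetric])
    qed
    then show ?case
      using K by (auto simp: Reg_def E_def)
  qed
  then show ?thesis
    by (simp add: RegT_def)
qed

lemma at_w0_eq: "at_w0 g = flsmap (single 0) (fls_nth (expn 0 1 g) 0)"
  by (simp add: at_w0_def flsmap_def)

lemma at_w0_add: "g \<in> K0 \<Longrightarrow> h \<in> K0 \<Longrightarrow> at_w0 (g + h) = at_w0 g + at_w0 h"
  by (simp add: at_w0_eq khomD[OF khom_expn(1)] additive.add[OF additive_flsmap[OF rhomD(4)[OF rhom_single0]]])

lemma at_w0_mult: "g \<in> Reg \<Longrightarrow> h \<in> Reg \<Longrightarrow> at_w0 (g * h) = at_w0 g * at_w0 h"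
  by (simp add: Reg_def at_w0_eq khomD[OF khom_expn(1)] fls_mult_nth_bound[of 0 _ 0] flsmap_mult[OF rhom_single0])

lemma at_w0_cst: "at_w0 (cst c) = fls_const (single 0 c)"
  by (simp add: at_w0_eq flsmap_const)

lemma at_w0_0 [simp]: "at_w0 0 = 0"
  using at_w0_cst[of 0] by simp

lemma at_w0_pd0: "g \<in> K0 \<Longrightarrow> at_w0 (rf_pd 0 g) = fls_deriv (at_w0 g)"
proof -
  assume g: "g \<in> K0"
  have "fls_deriv (flsmap (single 0) F) = (flsmap (single 0) (fls_deriv F) :: 'a V0 fls)" for F :: "'a fls"
    by (rule fls_eqI) (simp add: mult_single flip: single_of_int)
  with g show ?thesis
    by (simp add: at_w0_eq expn_pd)
qed

definition w_coeff :: "nat \<Rightarrow> 'k::field_char_0 ratfun \<Rightarrow> 'k V0 fls" where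
  "w_coeff j g = flsmap (single 0) (fls_nth (expn 0 1 g) (int j))"

lemma w_coeff_eq: "g \<in> K0 \<Longrightarrow> at_w0 ((rf_pd 1 ^^ j) g) = of_nat (fact j) * w_coeff j g"
proof -
  assume g: "g \<in> K0"
  have K: "(rf_pd 1 ^^ j) g \<in> K0" for j
    using g by (induction j) (auto simp: rf_pd_K0)
  \<comment> \<open>Each derivative shifts the index, so the induction needs all coefficients. The
    accumulated factor is the rising factorial of \<open>i + 1\<close>, which is \<open>j!\<close>
    at \<open>i = 0\<close>.\<close>
  have "fls_nth (expn 0 1 ((rf_pd 1 ^^ j) g)) (int i) = of_nat (pochhammer (i + 1) j) * fls_nth (expn 0 1 g) (int (i + j))" for i
  proof (induction j arbitrary: i)
    case (Suc j)
    have *: "int i + 1 = int (Suc i)"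
      by simp
    have "fls_nth (expn 0 1 ((rf_pd 1 ^^ Suc j) g)) (int i) =
        of_nat (Suc i) * fls_nth (expn 0 1 ((rf_pd 1 ^^ j) g)) (int (Suc i))"
      by (simp add: expn_pd K * del: of_nat_Suc)
    also have "\<dots> = of_nat (Suc i * pochhammer (Suc i + 1) j) * fls_nth (expn 0 1 g) (int (i + Suc j))"
      unfolding Suc by (simp only: of_nat_mult mult.assoc add_Suc_right add_Suc)
    moreover have "pochhammer (i + 1) (Suc j) = Suc i * pochhammer (Suc i + 1) j"
      by (simp only: pochhammer_rec Suc_eq_plus1[of i])
    ultimately show ?case
      by (simp only:)
  qed simp
  from this[of 0] have e: "fls_nth (expn 0 1 ((rf_pd 1 ^^ j) g)) 0 = of_nat (fact j) * fls_nth (expn 0 1 g) (int j)"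
    by (simp add: pochhammer_fact)
  show ?thesis
    unfolding at_w0_eq e w_coeff_def flsmap_mult[OF rhom_single0]
    by (simp only: fls_of_nat flsmap_const single_zero single_of_nat)
qed

text \<open>Two properties of \<sigma> enter the vertex algebra: it has no pole at
  \<open>w = 0\<close>, and its coefficient of degree 0 in the parameters does not vanish there. The
  series \<open>f\<close> itself is used for the comparison with \<Psi>.\<close>

locale bichar =
  fixes r :: "('p, 'k::field_char_0) bichar"
  assumes bich: "bicharacter r" and Dcomp: "D_compatible r"
    and reg_sigma: "r (ealpha 1) (ealpha 1) \<in> RegT"
    and unit_sigma: "fls_nth (expn 0 1 (tcoeff (r (ealpha 1) (ealpha 1)) {#})) 0 \<noteq> 0"
begin

lemma r_KT: "r a b \<in> KT"
  and r_bilin: "bilin (act scalK) r"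
  and r_1: "r 1 a = scalK (counit a)" "r a 1 = scalK (counit a)"
  and r_mult_left: "r (a * b) c = sweedler (act scalK) c (\<lambda>c' c''. r a c' * r b c'')"
  and r_mult_right: "r a (b * c) = sweedler (act scalK) a (\<lambda>a' a''. r a' b * r a'' c)"
  using bich by (simp_all add: bicharacter_def bilin_def sK_eq scalK_def)

lemma r_D0: "r (D0 a) b = tmap (rf_pd 0) (r a b)" "r a (D0 b) = tmap (rf_pd 1) (r a b)"
  using Dcomp by (simp_all add: D_compatible_def)

lemma r_add: "r (a + b) c = r a c + r b c" "r a (b + c) = r a b + r a c"
  and r_scl: "r (scl s a) b = scalK s * r a b" "r a (scl s b) = scalK s * r a b"
  using r_bilin by (simp_all add: bilin_def act_def)

lemma r_const: "r (single 0 c) b = scalK c * scalK (counit b)" "r b (single 0 c) = scalK c * scalK (counit b)"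
  using r_scl(1)[where s = c and a = 1 and b = b] r_scl(2)[where s = c and a = b and b = 1] by (simp_all add: r_1 scl_mult mult.commute)

lemma bil_rr: "bilin (act scalK) (\<lambda>c' c''. r a c' * r b c'')" "bilin (act scalK) (\<lambda>c' c''. r c' a * r c'' b)"
  using r_bilin by (simp_all add: bilin_def act_def algebra_simps)

lemma r_mult_ealpha: "r (a * b) (ealpha n) = r a (ealpha n) * r b (ealpha n)"
  "r (ealpha n) (a * b) = r (ealpha n) a * r (ealpha n) b"
  using module.sw_ealpha[OF module_act[OF rhom_scalK] bil_rr(1)] module.sw_ealpha[OF module_act[OF rhom_scalK] bil_rr(2)]
  by (simp_all add: r_mult_left r_mult_right)

lemma r_ealpha_units: "r (ealpha (-1)) (ealpha n) * r (ealpha 1) (ealpha n) = 1"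
  "r (ealpha n) (ealpha (-1)) * r (ealpha n) (ealpha 1) = 1"
  by (simp_all flip: r_mult_ealpha ealpha_add add: ealpha_0 r_1 counit_simps rhomD[OF rhom_scalK])

lemma reg_units: "r (ealpha m) (ealpha n) \<in> RegT" if "m \<in> {1, -1}" "n \<in> {1, -1}" for m n
proof -
  let ?e = "\<lambda>m n. r (ealpha m) (ealpha n)"
  have a: "?e (-1) 1 \<in> RegT"
    by (rule RegT_inverse[OF r_ealpha_units(1) r_KT reg_sigma unit_sigma])
  have b: "?e 1 (-1) \<in> RegT"
    by (rule RegT_inverse[OF r_ealpha_units(2) r_KT reg_sigma unit_sigma])
  \<comment> \<open>\<open>r(e^-\<alpha>, e^-\<alpha>)\<close> is the inverse of the inverse of
    \<sigma>.\<close>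
  have "?e (-1) (-1) = ?e (-1) (-1) * (?e (-1) 1 * ?e 1 1)"
    by (simp add: r_ealpha_units)
  also have "\<dots> = ?e 1 1"
    using r_ealpha_units(2)[of "-1"] by (simp flip: mult.assoc)
  finally have "?e (-1) (-1) \<in> RegT"
    using reg_sigma by simp
  with a b reg_sigma that show ?thesis
    by auto
qed

lemma RegT_sw: "(\<And>x y. B x y \<in> RegT) \<Longrightarrow> sweedler (act scalK) a B \<in> RegT"
proof -
  assume B: "\<And>x y. B x y \<in> RegT"
  have "add_on RegT (\<lambda>x. x)"
    by (simp add: add_on_def RegT_0 RegT_add)
  then show ?thesis
    unfolding sweedler_eq_ext ext_def
    by (rule add_on_sum_mem) (auto simp: act_def B intro: RegT_mult RegT_const)
qed

text \<open>The second argument is first fixed to a grouplike element, where \<open>r\<close> is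
  multiplicative in the first. Then the second argument varies, and its products become Sweedler
  sums of regular terms.\<close>

lemma r_RegT: "r a b \<in> RegT"
proof -
  have *: "r a (ealpha n) \<in> RegT" if "n \<in> {1, -1}" for n a
    by (induction a rule: V0_D_induct)
      (use that in \<open>auto simp: r_const r_add r_mult_ealpha r_D0 reg_units intro: RegT_mult RegT_add RegT_pd RegT_const\<close>)
  show ?thesis
  proof (induction b arbitrary: a rule: V0_D_induct)
    case (mult x y)
    then show ?case by (auto simp: r_mult_right intro!: RegT_sw RegT_mult)
  qed (auto simp: * r_const r_add r_D0 intro: RegT_mult RegT_add RegT_pd RegT_const)
qed

lemma r_D0_pow: "r a ((D0 ^^ j) b) = tmap (rf_pd 1 ^^ j) (r a b)"
  by (induction j) (auto simp: r_D0 tmap_tmap tps_eqI)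

text \<open>Taylor's formula \<open>r(a, e^(wD) b)(z, 0) = r(a, b)(z, w)\<close>, coefficientwise in
  \<open>w\<close>: \<open>D\<close> in the second argument acts as the derivative in
  \<open>w\<close>.\<close>

lemma at_w0_r_dp: "tmap at_w0 (r a (dp j b)) = tmap (w_coeff j) (r a b)"
proof (rule tps_eqI)
  fix n
  have K: "tcoeff (r a b) n \<in> K0" and K': "tcoeff (r a ((D0 ^^ j) b)) n \<in> Reg"
    using r_KT r_RegT by (auto simp: KT_def RegT_def)
  have "tcoeff (tmap at_w0 (r a (dp j b))) n = at_w0 (cst (1 / fact j) * tcoeff (r a ((D0 ^^ j) b)) n)"
    by (simp add: dp_def r_scl scalK_def tconst_mult_left)
  also have "\<dots> = fls_const (single 0 (1 / fact j)) * (of_nat (fact j) * w_coeff j (tcoeff (r a b) n))"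
    using w_coeff_eq[OF K] K' by (simp add: at_w0_mult Reg_cst at_w0_cst r_D0_pow)
  also have "\<dots> = w_coeff j (tcoeff (r a b) n)"
  proof -
    have "fls_const (single 0 (1 / fact j)) * of_nat (fact j) = (1 :: 'k V0 fls)"
      by (simp add: fls_of_nat mult_single flip: single_of_nat)
    then show ?thesis
      by (simp flip: mult.assoc)
  qed
  finally show "tcoeff (tmap at_w0 (r a (dp j b))) n = tcoeff (tmap (w_coeff j) (r a b)) n"
    by simp
qed

subsection \<open>The inverse and the braiding\<close>

definition rtau :: "'k V0 \<Rightarrow> 'k V0 \<Rightarrow> ('p, 'k ratfun) tps" where
  "rtau = bc_tau r"

definition rinv :: "'k V0 \<Rightarrow> 'k V0 \<Rightarrow> ('p, 'k ratfun) tps" where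
  "rinv = bc_inv r"

definition q :: "'k V0 \<Rightarrow> 'k V0 \<Rightarrow> ('p, 'k ratfun) tps" where
  "q = conv2 scalK rtau rinv"

abbreviation cc :: "'k V0 \<Rightarrow> 'k V0 \<Rightarrow> ('p, 'k ratfun) tps" where
  "cc \<equiv> \<lambda>a b. scalK (counit a) * scalK (counit b)"

lemma rtau_KT: "rtau a b \<in> KT" and rinv_KT: "rinv a b \<in> KT"
  by (simp_all add: rtau_def rinv_def bc_tau_def bc_inv_def KT_subst2 r_KT)

lemma swap_scalK: "tmap (subst2 1 0) (scalK c) = scalK c"
  using tmap_scalK[OF khom_subst2[of 1 0]] by (simp add: scalK_def)

lemma swap_hom: "X \<in> KT \<Longrightarrow> Y \<in> KT \<Longrightarrow> tmap (subst2 1 0) (X + Y) = tmap (subst2 1 0) X + tmap (subst2 1 0) Y"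
  "X \<in> KT \<Longrightarrow> Y \<in> KT \<Longrightarrow> tmap (subst2 1 0) (X * Y) = tmap (subst2 1 0) X * tmap (subst2 1 0) Y"
  by (rule tmap_khom[OF khom_subst2]; simp)+

lemma rtau_bilin: "bilin (act scalK) rtau"
  by (simp add: bilin_def rtau_def bc_tau_def r_add r_scl act_def swap_hom r_KT KT_const swap_scalK)

lemma rinv_bilin: "bilin (act scalK) rinv"
  by (simp add: bilin_def rinv_def bc_inv_def r_add r_scl act_def rhomD[OF rhom_antipode] antipode_scl)

lemma conv2_KT: "(\<And>a b. f a b \<in> KT) \<Longrightarrow> (\<And>a b. g a b \<in> KT) \<Longrightarrow> conv2 scalK f g a b \<in> KT"
  by (rule conv2_hom_on(2)[OF rhom_scalK rhom_scalK, of KT "\<lambda>x. x"])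
    (auto simp: add_on_def KT_0 KT_add KT_mult KT_const)

lemma q_KT: "q a b \<in> KT"
  unfolding q_def by (intro conv2_KT rtau_KT rinv_KT)

lemma q_bilin: "bilin (act scalK) q"
  unfolding q_def by (rule conv2_bilin[OF rhom_scalK])

lemma tmap_subst2_pd:
  "X \<in> KT \<Longrightarrow> tmap (subst2 1 0) (tmap (rf_pd 1) X) = tmap (rf_pd 0) (tmap (subst2 1 0) X)"
  "X \<in> KT \<Longrightarrow> tmap (subst2 1 0) (tmap (rf_pd 0) X) = tmap (rf_pd 1) (tmap (subst2 1 0) X)"
  by (auto intro!: tps_eqI simp: KT_def subst2_pd)

lemma q_D0: "q (D0 a) b = tmap (rf_pd 0) (q a b)" "q a (D0 b) = tmap (rf_pd 1) (q a b)"
proof -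
  have 1: "rtau (D0 a) b = tmap (rf_pd 0) (rtau a b)" "rtau a (D0 b) = tmap (rf_pd 1) (rtau a b)"
    "rinv (D0 a) b = tmap (rf_pd 0) (rinv a b)" "rinv a (D0 b) = tmap (rf_pd 1) (rinv a b)" for a b
    by (simp_all add: rtau_def rinv_def bc_tau_def bc_inv_def r_D0 tmap_subst2_pd r_KT antipode_D0)
  have bilin_swap: "bilin (act scalK) (\<lambda>a b. f b a)" if "bilin (act scalK) f" for f :: "'k V0 \<Rightarrow> 'k V0 \<Rightarrow> ('p, 'k ratfun) tps"
    using that by (simp add: bilin_def)
  note d = additive_tmap[OF additive_rf_pd] tmap_deriv[OF additive_rf_pd rf_pd_mult] tmap_rf_pd_scalK
  show "q (D0 a) b = tmap (rf_pd 0) (q a b)"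
    unfolding q_def by (rule conv2_D0[OF rhom_scalK d rtau_bilin 1(1) rinv_bilin 1(3)])
  \<comment> \<open>The rule for the second argument is the rule for the first, applied to the maps
    with exchanged arguments.\<close>
  have "conv2 scalK (\<lambda>a b. rtau b a) (\<lambda>a b. rinv b a) (D0 b) a =
      tmap (rf_pd 1) (conv2 scalK (\<lambda>a b. rtau b a) (\<lambda>a b. rinv b a) b a)"
    by (rule conv2_D0[OF rhom_scalK d bilin_swap[OF rtau_bilin] 1(2) bilin_swap[OF rinv_bilin] 1(4)])
  moreover have "q a b = conv2 scalK (\<lambda>a b. rtau b a) (\<lambda>a b. rinv b a) b a" for a b
    unfolding q_def by (rule conv2_swap[OF rhom_scalK, symmetric])
  ultimately show "q a (D0 b) = tmap (rf_pd 1) (q a b)"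
    by simp
qed

text \<open>Multiplicativity in the first argument turns the convolution into
  \<open>r(S(a') a'', b)\<close>, and the antipode law leaves the counit.\<close>

lemma rinv_r: "conv2 scalK rinv r a b = cc a b"
proof -
  interpret module "act scalK" by (rule module_act[OF rhom_scalK])
  have "conv2 scalK rinv r a b = sweedler (act scalK) a (\<lambda>x y. r (antipode x * y) b)"
    by (simp add: conv2_def rinv_def bc_inv_def r_mult_left)
  also have "\<dots> = act scalK (counit a) (r 1 b)"
    by (rule sw_antipode) (auto simp: additive_def r_add r_scl act_def)
  finally show ?thesis
    by (simp add: act_def r_1)
qed

text \<open>Multiplying by the scalar of the braiding replaces \<open>r\<close> by
  \<open>r^\<tau>\<close>. Unitarity and locality both go back to this.\<close>

lemma q_r: "conv2 scalK q r a b = rtau a b"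
proof -
  have "conv2 scalK q r a b = conv2 scalK rtau (conv2 scalK rinv r) a b"
    by (simp add: q_def conv2_assoc[OF rhom_scalK])
  also have "\<dots> = conv2 scalK rtau cc a b"
    by (rule conv2_cong) (simp_all add: rinv_r)
  finally show ?thesis
    by (simp add: conv2_counit[OF rhom_scalK rtau_bilin])
qed

definition qtau :: "'k V0 \<Rightarrow> 'k V0 \<Rightarrow> ('p, 'k ratfun) tps" where
  "qtau a b = tmap (subst2 1 0) (q b a)"

lemma conv2_tau:
  assumes "\<And>a b. f a b \<in> KT" "\<And>a b. g a b \<in> KT"
  shows "tmap (subst2 1 0) (conv2 scalK f g b a) =
    conv2 scalK (\<lambda>a b. tmap (subst2 1 0) (f b a)) (\<lambda>a b. tmap (subst2 1 0) (g b a)) a b"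
proof -
  have "tmap (subst2 1 0) (conv2 scalK f g b a) =
      conv2 scalK (\<lambda>a b. tmap (subst2 1 0) (f a b)) (\<lambda>a b. tmap (subst2 1 0) (g a b)) b a"
    using assms
    by (intro conv2_hom_on(1)[OF rhom_scalK rhom_scalK add_on_tmap[OF khom_subst2]])
      (auto simp: KT_mult KT_const swap_hom swap_scalK)
  also have "\<dots> = conv2 scalK (\<lambda>a b. tmap (subst2 1 0) (f b a)) (\<lambda>a b. tmap (subst2 1 0) (g b a)) a b"
    by (rule conv2_swap[OF rhom_scalK, symmetric])
  finally show ?thesis .
qed

text \<open>\<open>q^\<tau> = r * (r^-1)^\<tau>\<close>, so its product with
  \<open>q = r^\<tau> * r^-1\<close> cancels in pairs.\<close>

lemma q_qtau: "conv2 scalK q qtau a b = cc a b" "conv2 scalK qtau q a b = cc a b"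
proof -
  note as = conv2_assoc[OF rhom_scalK] and cm = conv2_comm[OF rhom_scalK]
  define rit where "rit a b = tmap (subst2 1 0) (rinv b a)" for a b
  have qt: "qtau a b = conv2 scalK r rit a b" for a b
  proof -
    have "qtau a b = conv2 scalK (\<lambda>a b. tmap (subst2 1 0) (rtau b a)) rit a b"
      unfolding qtau_def q_def rit_def by (intro conv2_tau rtau_KT rinv_KT)
    then show ?thesis
      by (simp add: rtau_def bc_tau_def KT_subst2_subst2 r_KT)
  qed
  have t: "conv2 scalK rit rtau a b = cc a b" for a b
  proof -
    have "conv2 scalK rit rtau a b = tmap (subst2 1 0) (conv2 scalK rinv r b a)"
      unfolding rit_def rtau_def bc_tau_def by (intro conv2_tau[symmetric] rinv_KT r_KT)
    then show ?thesis
      by (simp add: rinv_r swap_hom KT_const swap_scalK mult.commute)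
  qed
  have "conv2 scalK q qtau a b = conv2 scalK q (conv2 scalK r rit) a b"
    by (rule conv2_cong) (simp_all add: qt)
  also have "\<dots> = conv2 scalK (conv2 scalK q r) rit a b"
    by (rule as)
  also have "\<dots> = conv2 scalK rtau rit a b"
    by (rule conv2_cong) (simp_all add: q_r)
  also have "\<dots> = cc a b"
    by (simp add: cm[of rtau] t)
  finally show "conv2 scalK q qtau a b = cc a b" .
  then show "conv2 scalK qtau q a b = cc a b"
    by (simp add: cm)
qed

end

section \<open>Linear maps of topologically free modules\<close>

lemma additive_scl: "additive (scl c)"
  by (simp add: additive_def scl_add)

lemma tscl_eq_tapp: "tscl c x = tapp (\<lambda>d. tmap (scl d) x) c"
  by (simp add: tscl_def tconv_eq_tapp)

lemma additive_tmap_scl: "additive (\<lambda>d. tmap (scl d) x)"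
  by (auto simp: additive_def scl_add_left intro!: tps_eqI)

lemma tscl_tconst: "tscl (tconst c) x = tmap (scl c) x"
  by (simp add: tscl_eq_tapp tapp_tconst scl_zero tps_eqI)

lemma module_tscl: "module (tscl :: ('p, 'a::comm_ring_1) tps \<Rightarrow> ('p, 'b \<Rightarrow>\<^sub>0 'a) tps \<Rightarrow> _)"
proof
  fix x y :: "('p, 'a) tps" and v w :: "('p, 'b \<Rightarrow>\<^sub>0 'a) tps"
  show "tscl x (v + w) = tscl x v + tscl x w"
    by (simp add: tscl_eq_tapp tmap_add[OF additive_scl] tapp_add_fun)
  show "tscl (x + y) v = tscl x v + tscl y v"
    by (simp add: tscl_eq_tapp tapp_add[OF additive_tmap_scl])
  show "tscl x (tscl y v) = tscl (x * y) v"
    by (simp add: tscl_eq_tapp mult_eq_tapp tapp_comp[OF additive_tmap_scl] tmap_tapp[OF additive_scl] tapp_tmap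
        tmap_tmap scl_scl)
  show "tscl 1 v = v"
    using tscl_tconst[of 1 v] by (simp add: scl_one tps_eqI)
qed

lemmas tscl_simps = module.scale_right_distrib[OF module_tscl] module.scale_left_distrib[OF module_tscl]
  module.scale_scale[OF module_tscl] module.scale_one[OF module_tscl]

lemma additive_tscl: "additive (tscl c)" and additive_tscl_left: "additive (\<lambda>c. tscl c v)"
  by (simp_all add: additive_def tscl_simps)

lemma tapp_tscl:
  assumes "additive f" "\<And>c v. f (scl c v) = tmap (scl c) (f v)"
  shows "tapp f (tscl c x) = tscl c (tapp f x)"
  by (simp add: tscl_eq_tapp tapp_comp[OF assms(1)] tapp_tmap assms(2) tmap_tapp[OF additive_scl])

lemma tlinear_tapp:
  assumes "additive f" "\<And>c v. f (scl c v) = tmap (scl c) (f v)"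
  shows "tlinear (tapp f)"
  by (simp add: tlinear_def tapp_add[OF assms(1)] tapp_tscl[OF assms])

lemma tapp_tconst_id: "tapp tconst x = x"
proof (rule tps_eqI)
  fix n
  have "tcoeff (tapp tconst x) n = (\<Sum>(i, j) | i + j = n. if j = {#} then tcoeff x i else 0)"
    by (simp add: tcoeff_tapp tcoeff_tconst)
  then show "tcoeff (tapp tconst x) n = tcoeff x n"
    by (simp add: sum_decomp_delta_right)
qed

lemma tmap_eq_tapp: "tmap f x = tapp (\<lambda>v. tconst (f v)) x"
  using tapp_tconst_id[of "tmap f x"] by (simp add: tapp_tmap)

definition tl0 :: "('b \<Rightarrow> ('p, 'c \<Rightarrow>\<^sub>0 'a) tps) \<Rightarrow> ('b \<Rightarrow>\<^sub>0 'a) \<Rightarrow> ('p, 'c \<Rightarrow>\<^sub>0 'a::comm_ring_1) tps" where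
  "tl0 g v = Abs_tps (\<lambda>j. lin (\<lambda>b. tcoeff (g b) j) v)"

lemma tlin_eq_tapp: "tlin g = tapp (tl0 g)"
  by (simp add: fun_eq_iff tlin_def tapp_def tl0_def)

lemma tcoeff_tl: "tcoeff (tl0 g v) j = lin (\<lambda>b. tcoeff (g b) j) v"
  by (simp add: tl0_def)

lemma additive_tl: "additive (tl0 g)" and tl_scl: "tl0 g (scl c v) = tmap (scl c) (tl0 g v)" and tl_bas: "tl0 g (bas b) = g b"
  by (auto simp: additive_def intro!: tps_eqI simp: tcoeff_tl lin_add lin_scl lin_bas)

lemma tl_unique:
  assumes "additive F" "\<And>c v. F (scl c v) = tmap (scl c) (F v)" "\<And>b. F (bas b) = g b"
  shows "F v = tl0 g v"
  by (rule pm_additive_eqI[OF assms(1) additive_tl]) (simp add: single_eq_scl_bas assms tl_scl tl_bas)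

lemma tapp_eq_tlin:
  assumes "additive F" "\<And>c v. F (scl c v) = tmap (scl c) (F v)"
  shows "tapp F x = tlin (\<lambda>b. F (bas b)) x"
proof -
  have "F = tl0 (\<lambda>b. F (bas b))"
    by (rule HOL.ext, rule tl_unique) (auto simp: assms)
  then show ?thesis
    by (metis tlin_eq_tapp)
qed

lemma tlin_add: "tlin g (x + y) = tlin g x + tlin g y"
  and tlin_tscl: "tlin g (tscl c x) = tscl c (tlin g x)"
  by (simp_all add: tlin_eq_tapp tapp_add additive_tl tapp_tscl tl_scl)

lemma additive_tlin: "additive (tlin g)"
  by (simp add: additive_def tlin_add)

lemma tlin_tconst: "tlin g (tconst v) = tl0 g v"
  by (simp add: tlin_eq_tapp tapp_tconst additive.zero[OF additive_tl])

lemma tlin_tbas: "tlin g (tbas b) = g b"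
  by (simp add: tbas_def tlin_tconst tl_bas)

lemma tlin_comp: "tlin g (tlin h x) = tlin (\<lambda>b. tlin g (h b)) x"
proof -
  have "tapp (tl0 g) (tl0 h v) = tl0 (\<lambda>b. tlin g (h b)) v" for v
  proof (rule tl_unique)
    show "additive (\<lambda>v. tapp (tl0 g) (tl0 h v))"
      by (intro additive_comp[OF additive_tapp[OF additive_tl] additive_tl])
    show "tapp (tl0 g) (tl0 h (scl c v)) = tmap (scl c) (tapp (tl0 g) (tl0 h v))" for c v
      using tlin_tscl[of g "tconst c"] by (simp add: tl_scl tscl_tconst tlin_eq_tapp)
  qed (simp add: tl_bas tlin_eq_tapp)
  then show ?thesis
    by (simp add: tlin_eq_tapp tapp_comp[OF additive_tl])
qed

lemma tlin_id: "tlin tbas x = (x :: ('p, 'b \<Rightarrow>\<^sub>0 'a::comm_ring_1) tps)"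
proof -
  have e: "tl0 tbas = (tconst :: ('b \<Rightarrow>\<^sub>0 'a) \<Rightarrow> ('p, _) tps)"
    by (rule HOL.ext, rule tl_unique[symmetric]) (auto simp: additive_tconst tmap_tconst scl_zero tbas_def)
  show ?thesis
    by (simp add: tlin_eq_tapp e tapp_tconst_id)
qed

lemma tlin_add_fun: "tlin (\<lambda>b. g b + h b) x = tlin g x + tlin h x"
proof -
  have e: "tl0 (\<lambda>b. g b + h b) = (\<lambda>v. tl0 g v + tl0 h v)"
    by (rule HOL.ext, rule tps_eqI) (simp add: tcoeff_tl lin_eq_ext module.ext_add_fun[OF module_scl])
  show ?thesis
    by (simp add: tlin_eq_tapp e tapp_add_fun)
qed

lemma tmap_lin_eq_tlin: "tmap (lin g) x = tlin (\<lambda>b. tconst (g b)) x"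
proof -
  have e: "(\<lambda>v. tconst (lin g v)) = tl0 (\<lambda>b. tconst (g b))"
    by (rule HOL.ext, rule tl_unique) (auto simp: additive_def lin_add tconst_add lin_scl tmap_tconst scl_zero lin_bas)
  show ?thesis
    by (simp add: tmap_eq_tapp tlin_eq_tapp e)
qed

abbreviation mcst :: "('b \<Rightarrow>\<^sub>0 'k::field) \<Rightarrow> 'b \<Rightarrow>\<^sub>0 'k ratfun" where
  "mcst \<equiv> Poly_Mapping.map cst"

lemma mcst_add: "mcst (x + y) = mcst x + mcst y"
  and mcst_scl: "mcst (scl c x) = scl (cst c) (mcst x)"
  and mcst_bas: "mcst (bas b) = bas b"
  by (auto intro!: poly_mapping_eqI simp: lookup_map0 lookup_add rhomD[OF rhom_cst] lookup_bas)

lemma additive_mcst: "additive mcst"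
  by (simp add: additive_def mcst_add)

lemma scalar_ext_tconst: "scalar_ext (tconst x) = tconst (mcst x)"
  by (simp add: scalar_ext_def tmap_tconst additive.zero[OF additive_mcst])

lemma scalar_ext_tbas: "scalar_ext (tbas b) = tbas b"
  by (simp add: tbas_def scalar_ext_tconst mcst_bas)

lemma scalar_ext_add: "scalar_ext (x + y) = scalar_ext x + scalar_ext y"
  by (simp add: scalar_ext_def tmap_add[OF additive_mcst])

lemma scalar_ext_tscl: "scalar_ext (tscl c x) = tscl (tmap cst c) (scalar_ext x)"
  by (simp add: scalar_ext_def tscl_eq_tapp tmap_tapp[OF additive_mcst] tapp_tmap tmap_tmap mcst_scl)

text \<open>A map such as a partial derivative is linear over constants only. It passes the linear
  extension on vectors with constant coefficients, that is, on the image of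
  \<open>scalar_ext\<close>.\<close>

lemma tmap_map_tlin:
  assumes d: "additive d" "\<And>c x. d (cst c * x) = cst c * d x"
  shows "tmap (Poly_Mapping.map d) (tlin g (scalar_ext x)) = tlin (\<lambda>b. tmap (Poly_Mapping.map d) (g b)) (scalar_ext x)"
proof -
  note d0 = additive.zero[OF d(1)]
  have ad: "additive (Poly_Mapping.map d)"
    by (auto intro!: poly_mapping_eqI simp: additive_def lookup_map0 d0 lookup_add additive.add[OF d(1)])
  have "tmap (Poly_Mapping.map d) (tl0 g (mcst v)) = tl0 (\<lambda>b. tmap (Poly_Mapping.map d) (g b)) (mcst v)" for v
  proof (rule pm_additive_eqI[of "\<lambda>v. tmap (Poly_Mapping.map d) (tl0 g (mcst v))"])
    show "additive (\<lambda>v. tmap (Poly_Mapping.map d) (tl0 g (mcst v)))"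
      by (intro additive_comp[OF additive_tmap[OF ad]] additive_comp[OF additive_tl] additive_mcst)
    show "additive (\<lambda>v. tl0 (\<lambda>b. tmap (Poly_Mapping.map d) (g b)) (mcst v))"
      by (intro additive_comp[OF additive_tl] additive_mcst)
    show "tmap (Poly_Mapping.map d) (tl0 g (mcst (single b c))) =
       tl0 (\<lambda>b. tmap (Poly_Mapping.map d) (g b)) (mcst (single b c))" for b c
      by (auto intro!: tps_eqI poly_mapping_eqI simp: single_eq_scl_bas mcst_scl mcst_bas tl_scl tl_bas lookup_map0 d0 d)
  qed
  then show ?thesis
    by (simp add: scalar_ext_def tlin_eq_tapp tapp_tmap tmap_tapp[OF ad])
qed

section \<open>The state-field correspondence\<close>

definition scalY :: "'k::field_char_0 \<Rightarrow> ('p, 'k V0 fls) tps" where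
  "scalY c = tconst (fls_const (single 0 c))"

lemma rhom_scalY: "rhom scalY"
  unfolding scalY_def[abs_def]
  by (rule rhom_comp[OF rhom_tconst rhom_comp[OF rhom_fls_const rhom_single0]])

definition EY :: "'k::field_char_0 V0 \<Rightarrow> 'k V0 \<Rightarrow> ('p, 'k V0 fls) tps" where
  "EY a b = tconst (exp_zD a) * tconst (fls_const b)"

lemma fls_const_scl: "tconst (fls_const (scl c b)) = scalY c * tconst (fls_const b)"
  by (simp add: scalY_def scl_mult flip: tconst_mult)

lemma EY_add: "EY (a + b) c = EY a c + EY b c" "EY a (b + c) = EY a b + EY a c"
  by (simp_all add: EY_def exp_zD_add tconst_add distrib_left distrib_right flip: fls_plus_const)

lemma EY_scl: "EY (scl c a) b = scalY c * EY a b" "EY a (scl c b) = scalY c * EY a b"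
  by (simp_all add: EY_def exp_zD_scl tconst_mult fls_const_scl mult_ac) (simp add: scalY_def mult_ac)

lemma EY_bilin: "bilin (act scalY) EY"
  by (simp add: bilin_def EY_add EY_scl act_def)

lemma tmap_fls_deriv: "tmap fls_deriv (X * Y) = tmap fls_deriv X * Y + X * tmap fls_deriv (Y :: ('p, 'a::comm_ring_1 fls) tps)"
  by (rule tmap_deriv) (auto simp: additive_def)

lemma additive_fls_deriv: "additive (fls_deriv :: 'a::comm_ring_1 fls \<Rightarrow> _)"
  by (simp add: additive_def)

lemma EY_D0: "EY (D0 a) b = tmap fls_deriv (EY a b)"
  by (simp add: EY_def tmap_fls_deriv tmap_tconst exp_zD_D0)

lemma tmap_fls_deriv_scalY: "tmap fls_deriv (scalY c) = 0"
  by (simp add: scalY_def tmap_tconst)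

lemma additive_nth: "additive (\<lambda>F. fls_nth F n)"
  by (simp add: additive_def)

text \<open>There are finitely many parameters, hence finitely many monomials of bounded degree.
  Bounds chosen for single coefficients thereby become uniform below a given degree.\<close>

lemma finite_size_less: "finite {N :: 'p::finite multiset. size N < M}"
proof -
  have "{N :: 'p multiset. size N < M} \<subseteq> mset ` {xs. set xs \<subseteq> UNIV \<and> length xs \<le> M}"
  proof
    fix N :: "'p multiset" assume "N \<in> {N. size N < M}"
    moreover obtain xs where "mset xs = N"
      using ex_mset by blast
    ultimately show "N \<in> mset ` {xs. set xs \<subseteq> UNIV \<and> length xs \<le> M}"
      by (intro image_eqI[of _ _ xs]) (auto simp flip: size_mset)
  qed
  then show ?thesis
    by (rule finite_subset) (intro finite_imageI finite_lists_length_le, simp)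
qed

lemma tps_fls_lower_bound:
  fixes Z :: "('p::finite, 'a::comm_ring_1 fls) tps"
  shows "\<exists>n0. \<forall>n<n0. \<forall>N. size N < M \<longrightarrow> fls_nth (tcoeff Z N) n = 0"
proof -
  obtain f where f: "\<And>N n. n < f N \<Longrightarrow> fls_nth (tcoeff Z N) n = 0"
    using choice[of "\<lambda>N a. \<forall>n<a. fls_nth (tcoeff Z N) n = 0"] fls_lower_bound by blast
  have "fls_nth (tcoeff Z N) n = 0" if "n < Min (insert 0 (f ` {N. size N < M}))" "size N < M" for n N
  proof -
    have "Min (insert 0 (f ` {N. size N < M})) \<le> f N"
      using that finite_size_less[of M] by (intro Min_le) auto
    with that show ?thesis
      by (intro f) auto
  qed
  then show ?thesis by blast
qed

context bichar
begin

definition \<rho> :: "'k V0 \<Rightarrow> 'k V0 \<Rightarrow> ('p, 'k V0 fls) tps" where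
  "\<rho> a b = tmap at_w0 (r a b)"

lemma tmap_at_w0:
  assumes "X \<in> RegT" "Y \<in> RegT"
  shows "tmap at_w0 (X + Y) = tmap at_w0 X + tmap at_w0 Y" "tmap at_w0 (X * Y) = tmap at_w0 X * tmap at_w0 Y"
proof -
  have a: "add_on Reg at_w0"
    by (auto simp: add_on_def Reg_0 Reg_add at_w0_add) (auto simp: Reg_def at_w0_add)
  show "tmap at_w0 (X + Y) = tmap at_w0 X + tmap at_w0 Y"
    using assms a by (intro tps_eqI) (auto simp: RegT_def add_on_def)
  show "tmap at_w0 (X * Y) = tmap at_w0 X * tmap at_w0 Y"
    using assms by (intro tmap_mult_on[OF a]) (auto simp: RegT_def Reg_mult at_w0_mult)
qed

lemma at_w0_scalK: "tmap at_w0 (scalK c) = scalY c"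
  by (simp add: scalK_def scalY_def tmap_tconst at_w0_cst)

lemma \<rho>_bilin: "bilin (act scalY) \<rho>"
  by (simp add: bilin_def \<rho>_def r_add r_scl act_def tmap_at_w0 r_RegT RegT_const at_w0_scalK)

lemma \<rho>_lin: "\<rho> (a + b) c = \<rho> a c + \<rho> b c" "\<rho> a (b + c) = \<rho> a b + \<rho> a c"
  "\<rho> (scl s a) b = scalY s * \<rho> a b" "\<rho> a (scl s b) = scalY s * \<rho> a b"
  using \<rho>_bilin by (simp_all add: bilin_def act_def)

lemma \<rho>_D0: "\<rho> (D0 a) b = tmap fls_deriv (\<rho> a b)"
proof (rule tps_eqI)
  fix n
  have "tcoeff (r a b) n \<in> K0"
    using r_KT by (auto simp: KT_def)
  then show "tcoeff (\<rho> (D0 a) b) n = tcoeff (tmap fls_deriv (\<rho> a b)) n"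
    by (simp add: \<rho>_def r_D0 at_w0_pd0)
qed

lemma \<rho>_1: "\<rho> 1 a = scalY (counit a)" "\<rho> a 1 = scalY (counit a)"
  by (simp_all add: \<rho>_def r_1 at_w0_scalK)

text \<open>\<open>Y\<close> is itself a convolution, of \<open>e^(zD)(a) b\<close> and
  \<open>r(a, b)(z, 0)\<close>, so translation covariance becomes an instance of the general rule
  for \<open>D\<close>.\<close>

lemma Y0_eq: "Y0 r = conv2 scalY EY \<rho>"
proof -
  have "(\<lambda>c. (*) (tconst (fls_const (single 0 c)))) = act (scalY :: 'k \<Rightarrow> ('p, _) tps)"
    by (simp add: fun_eq_iff act_def scalY_def)
  then show ?thesis
    by (simp add: fun_eq_iff Y0_def conv2_def EY_def \<rho>_def Let_def)
qed

lemma Y0_bilin: "bilin (act scalY) (Y0 r)"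
  unfolding Y0_eq by (rule conv2_bilin[OF rhom_scalY])

lemma Y0_add: "Y0 r (a + b) c = Y0 r a c + Y0 r b c" "Y0 r a (b + c) = Y0 r a b + Y0 r a c"
  and Y0_scl: "Y0 r (scl s a) b = scalY s * Y0 r a b" "Y0 r a (scl s b) = scalY s * Y0 r a b"
  using Y0_bilin by (simp_all add: bilin_def act_def)

lemma Y0_D0: "Y0 r (D0 a) b = tmap fls_deriv (Y0 r a b)"
  unfolding Y0_eq
  by (rule conv2_D0[OF rhom_scalY additive_tmap[OF additive_fls_deriv] tmap_fls_deriv tmap_fls_deriv_scalY
      EY_bilin EY_D0 \<rho>_bilin \<rho>_D0])

lemma Y0_1_left: "Y0 r 1 b = tconst (fls_const b)"
proof -
  interpret module "act (scalY :: 'k \<Rightarrow> ('p, _) tps)" by (rule module_act[OF rhom_scalY])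
  have b: "bilin (act scalY) (\<lambda>a' a''. sweedler (act scalY) b (\<lambda>b' b''. EY a' b' * \<rho> a'' b''))"
    by (simp add: bilin_def distrib_left distrib_right sw_add_fun EY_add \<rho>_lin EY_scl mult.assoc mult.left_commute[of "\<rho> _ _"]
        mult.left_commute[of _ "scalY _"] flip: sw_mult_const)
      (simp add: act_def)
  have "Y0 r 1 b = sweedler (act scalY) b (\<lambda>b' b''. act scalY (counit b'') (tconst (fls_const b')))"
    unfolding Y0_eq conv2_def by (subst sw_one[OF b]) (simp add: EY_def \<rho>_1 exp_zD_1 act_def mult.commute)
  also have "\<dots> = tconst (fls_const b)"
    by (rule sw_counit_right)
      (auto simp: additive_def tconst_add act_def scalY_def scl_mult simp flip: fls_plus_const tconst_mult)
  finally show ?thesis .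
qed

lemma Y0_1_right: "Y0 r a 1 = tconst (exp_zD a)"
proof -
  interpret module "act (scalY :: 'k \<Rightarrow> ('p, _) tps)" by (rule module_act[OF rhom_scalY])
  have b: "bilin (act scalY) (\<lambda>b' b''. EY a' b' * \<rho> a'' b'')" for a' a''
    by (simp add: bilin_def distrib_left distrib_right EY_add \<rho>_lin EY_scl) (simp add: act_def mult_ac)
  have "Y0 r a 1 = sweedler (act scalY) a (\<lambda>a' a''. act scalY (counit a'') (tconst (exp_zD a')))"
    unfolding Y0_eq conv2_def sw_one[OF b] by (simp add: EY_def \<rho>_1 act_def mult.commute)
  also have "\<dots> = tconst (exp_zD a)"
    by (rule sw_counit_right) (auto simp: additive_def exp_zD_add tconst_add act_def scalY_def exp_zD_scl tconst_mult)
  finally show ?thesis .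
qed

definition Yz :: "('p, 'k V0) tps \<Rightarrow> ('p, 'k V0) tps \<Rightarrow> ('p, 'k V0 fls) tps" where
  "Yz a b = tapp (\<lambda>a0. tapp (Y0 r a0) b) a"

lemma additive_Y0: "additive (Y0 r a)" "additive (\<lambda>a. Y0 r a b)"
  by (simp_all add: additive_def Y0_add)

lemma Y_r_eq: "Y_r r a n b = tmap (\<lambda>F. fls_nth F n) (Yz a b)"
proof (rule tps_eqI)
  fix N
  let ?f = "\<lambda>i j l. fls_nth (tcoeff (Y0 r (tcoeff a i) (tcoeff b j)) l) n"
  have "tcoeff (Y_r r a n b) N = (\<Sum>(i, j, l) | i + j + l = N. ?f i j l)"
    by (simp add: Y_r_def)
  also have "\<dots> = (\<Sum>((i, j'), (j, l))\<in>(SIGMA p:{(i, j). i + j = N}. {(j, l). j + l = snd p}). ?f i j l)"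
    by (rule sum.reindex_bij_witness[of _ "\<lambda>((i, j'), (j, l)). (i, j, l)" "\<lambda>(i, j, l). ((i, j + l), (j, l))"])
      (auto simp: add.assoc)
  also have "\<dots> = (\<Sum>(i, j') | i + j' = N. \<Sum>(j, l) | j + l = j'. ?f i j l)"
    by (subst sum.Sigma[symmetric]) (simp_all add: case_prod_unfold)
  also have "\<dots> = tcoeff (tmap (\<lambda>F. fls_nth F n) (Yz a b)) N"
    by (simp add: Yz_def tcoeff_tapp fls_nth_sum case_prod_unfold)
  finally show "tcoeff (Y_r r a n b) N = tcoeff (tmap (\<lambda>F. fls_nth F n) (Yz a b)) N" .
qed

lemma Y_r_tapp: "Y_r r a n b = tapp (\<lambda>a0. tapp (\<lambda>b0. tmap (\<lambda>F. fls_nth F n) (Y0 r a0 b0)) b) a"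
  by (simp add: Y_r_eq Yz_def tmap_tapp[OF additive_nth])

lemma nth_scalY: "tmap (\<lambda>F. fls_nth F n) (scalY c * X) = tmap (scl c) (tmap (\<lambda>F. fls_nth F n) X)"
  by (rule tps_eqI) (simp add: scalY_def tconst_mult_left scl_mult)

lemma tmap_nth_add: "tmap (\<lambda>F. fls_nth F n) (X + Y) = tmap (\<lambda>F. fls_nth F n) X + (tmap (\<lambda>F. fls_nth F n) Y :: ('p, 'a::comm_ring_1) tps)"
  by (rule tps_eqI) simp

lemma Y_r_linear: "tlinear (\<lambda>a. Y_r r a n b)" "tlinear (Y_r r a n)"
proof -
  have "tlinear (tapp (\<lambda>a0. tapp (\<lambda>b0. tmap (\<lambda>F. fls_nth F n) (Y0 r a0 b0)) b))"
    by (rule tlinear_tapp)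
      (simp_all add: additive_def Y0_add Y0_scl nth_scalY tapp_add_fun tmap_nth_add tmap_tapp[OF additive_scl])
  then show "tlinear (\<lambda>a. Y_r r a n b)"
    by (simp add: Y_r_tapp[abs_def])
  have "tlinear (tapp (\<lambda>b0. tapp (\<lambda>a0. tmap (\<lambda>F. fls_nth F n) (Y0 r a0 b0)) a))"
    by (rule tlinear_tapp)
      (simp_all add: additive_def Y0_add Y0_scl nth_scalY tapp_add_fun tmap_nth_add tmap_tapp[OF additive_scl])
  then show "tlinear (Y_r r a n)"
    by (subst Y_r_tapp[abs_def], subst tapp_swap)
qed

lemma Y_r_vac: "Y_r r (tconst 1) n b = (if n = 0 then b else 0)"
proof -
  have "Y_r r (tconst 1) n b = tapp (\<lambda>b0. tmap (\<lambda>F. fls_nth F n) (Y0 r 1 b0)) b"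
    unfolding Y_r_tapp
    by (subst tapp_tconst) (auto intro!: tps_eqI simp: tcoeff_tapp additive.zero[OF additive_Y0(2)])
  also have "\<dots> = tapp (\<lambda>b0. tconst (if n = 0 then b0 else 0)) b"
    by (simp add: Y0_1_left tmap_tconst)
  also have "\<dots> = (if n = 0 then b else 0)"
    by (auto simp: tapp_tconst_id intro!: tps_eqI simp: tcoeff_tapp)
  finally show ?thesis .
qed

lemma Y_r_creation: "n < 0 \<Longrightarrow> Y_r r a n (tconst 1) = 0" "Y_r r a 0 (tconst 1) = a"
proof -
  have "Y_r r a n (tconst 1) = tapp (\<lambda>a0. tconst (fls_nth (exp_zD a0) n)) a" for n
    unfolding Y_r_tapp
    by (subst tapp_tconst) (auto intro!: tps_eqI simp: tmap_tconst Y0_1_right additive.zero[OF additive_Y0(1)])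
  then show "n < 0 \<Longrightarrow> Y_r r a n (tconst 1) = 0" "Y_r r a 0 (tconst 1) = a"
    by (auto simp: fls_nth_exp_zD tapp_tconst_id intro!: tps_eqI simp: tcoeff_tapp)
qed

lemma Y_r_translation: "Y_r r (tmap D0 a) n b = tscl (of_int (n + 1)) (Y_r r a (n + 1) b)"
proof -
  have oi: "(of_int m :: ('p, 'k) tps) = tconst (of_int m)" for m
  proof -
    have n: "(of_nat i :: ('p, 'k) tps) = tconst (of_nat i)" for i
      by (induction i) (auto simp: tconst_add)
    show ?thesis
      by (cases m rule: int_cases2) (simp_all add: n tps_eqI tcoeff_tconst)
  qed
  have "tmap (\<lambda>F. fls_nth F n) (Y0 r (D0 a0) b0) = tmap (scl (of_int (n + 1))) (tmap (\<lambda>F. fls_nth F (n + 1)) (Y0 r a0 b0))" for a0 b0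
    by (rule tps_eqI) (simp add: Y0_D0 scl_mult flip: single_of_int)
  then show ?thesis
    unfolding oi tscl_tconst by (simp only: Y_r_tapp tapp_tmap tmap_tapp[OF additive_scl])
qed

end

section \<open>The braiding\<close>

definition sR :: "'k::field \<Rightarrow> ('p, 'b \<Rightarrow>\<^sub>0 'k ratfun) tps \<Rightarrow> ('p, 'b \<Rightarrow>\<^sub>0 'k ratfun) tps" where
  "sR c = tscl (scalK c)"

lemma module_sR: "module sR"
  unfolding sR_def[abs_def]
  by standard (simp_all add: tscl_simps rhomD[OF rhom_scalK])

interpretation mR: module sR
  by (rule module_sR)

lemma sR_eq: "sR c x = tmap (scl (cst c)) x"
  by (simp add: sR_def scalK_def tscl_tconst)

lemma sR_tscl: "tscl X (sR c v) = sR c (tscl X v)"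
  by (simp add: sR_def tscl_simps mult.commute)

lemma sR_left: "tscl (scalK c * X) v = sR c (tscl X v)"
  by (simp add: sR_def tscl_simps)

lemma sw_tscl: "tscl X (sweedler sR a B) = sweedler sR a (\<lambda>x y. tscl X (B x y))"
  by (rule sw_hom[of "tscl X" sR sR, OF additive_tscl sR_tscl])

lemma sw_tscl_left: "tscl (sweedler (act scalK) a B) v = sweedler sR a (\<lambda>x y. tscl (B x y) v)"
  by (rule sw_hom[of "\<lambda>X. tscl X v"]) (auto simp: additive_tscl_left act_def sR_def tscl_simps)

lemma sw_tlin: "tlin g (sweedler sR a B) = sweedler sR a (\<lambda>x y. tlin g (B x y))"
  by (rule sw_hom[of "tlin g" sR sR]) (auto simp: additive_tlin tlin_tscl sR_def)

definition tb2 :: "('b \<Rightarrow>\<^sub>0 'k::field) \<Rightarrow> ('c \<Rightarrow>\<^sub>0 'k) \<Rightarrow> ('p, 'b \<times> 'c \<Rightarrow>\<^sub>0 'k ratfun) tps" where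
  "tb2 x y = tconst (mcst (tens x y))"

lemma tb2_bas: "tb2 (bas b) (bas c) = tbas (b, c)"
  by (simp add: tb2_def mcst_bas tbas_def)

lemma tb2_add: "tb2 (x + x') y = tb2 x y + tb2 x' y" "tb2 x (y + y') = tb2 x y + tb2 x y'"
  by (simp_all add: tb2_def tens_add_left tens_add_right mcst_add tconst_add)

lemma tb2_scl: "tb2 (scl c x) y = sR c (tb2 x y)" "tb2 x (scl c y) = sR c (tb2 x y)"
  by (simp_all add: tb2_def tens_scl_left tens_scl_right mcst_scl sR_eq tmap_tconst scl_zero)

text \<open>The scalar \<open>f\<close> is arbitrary because the inverse of the braiding, its flip,
  its derivatives and its values at other variables are all of this form.\<close>

definition RR :: "('k V0 \<Rightarrow> 'k V0 \<Rightarrow> ('p, 'k::field_char_0 ratfun) tps) \<Rightarrow> 'k V0 \<Rightarrow> 'k V0 \<Rightarrow>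
    ('p, (mon \<times> mon) \<Rightarrow>\<^sub>0 'k ratfun) tps" where
  "RR f a b = sweedler sR a (\<lambda>a' a''. sweedler sR b (\<lambda>b' b''. tscl (f a'' b'') (tb2 a' b')))"

lemma RR_bilin: "RR f (a + a') b = RR f a b + RR f a' b" "RR f a (b + b') = RR f a b + RR f a b'"
  "RR f (scl c a) b = sR c (RR f a b)" "RR f a (scl c b) = sR c (RR f a b)"
  by (simp_all add: RR_def mR.sw_add mR.sw_scl mR.sw_add_fun mR.sw_scale_fun)

definition TT :: "('k V0 \<Rightarrow> 'k V0 \<Rightarrow> ('p, 'k::field_char_0 ratfun) tps) \<Rightarrow>
    ('p, (mon \<times> mon) \<Rightarrow>\<^sub>0 'k ratfun) tps \<Rightarrow> ('p, (mon \<times> mon) \<Rightarrow>\<^sub>0 'k ratfun) tps" where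
  "TT f = tlin (\<lambda>(b, c). RR f (bas b) (bas c))"

lemma tlin_tb2:
  assumes "\<And>x x' y. G (x + x') y = G x y + G x' y" "\<And>x y y'. G x (y + y') = G x y + G x y'"
    "\<And>c x y. G (scl c x) y = sR c (G x y)" "\<And>c x y. G x (scl c y) = sR c (G x y)"
  shows "tlin (\<lambda>(b, c). G (bas b) (bas c)) (tb2 x y) = G x y"
proof -
  let ?g = "\<lambda>(b, c). G (bas b) (bas c)"
  have l: "tlin ?g (sR c v) = sR c (tlin ?g v)" for c v
    by (simp add: sR_def tlin_tscl)
  have z: "G 0 y = 0" "G x 0 = 0" "tb2 0 y = 0" "tb2 x 0 = 0" for x y
    using assms(1)[of 0 0] assms(2)[of _ 0 0] by (simp_all add: tb2_def additive.zero[OF additive_mcst])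
  show ?thesis
  proof (induction x rule: pm_induct)
    case (single b c)
    show ?case
    proof (induction y rule: pm_induct)
      case (single b' c')
      show ?case
        by (simp add: single_eq_scl_bas[of b] single_eq_scl_bas[of b'] tb2_scl l assms tb2_bas tlin_tbas)
    qed (simp_all add: z assms tb2_add tlin_add additive.zero[OF additive_tlin])
  qed (simp_all add: z assms tb2_add tlin_add additive.zero[OF additive_tlin])
qed

lemma TT_tb2: "TT f (tb2 x y) = RR f x y"
  unfolding TT_def by (rule tlin_tb2) (simp_all add: RR_bilin)

text \<open>Coassociativity in both factors merges two successive splittings: composition of
  operators is convolution of scalars, and unitarity becomes an identity between bilinear
  maps.\<close>

lemma TT_RR: "TT g (RR f a b) = RR (conv2 scalK g f) a b"
proof -
  let ?s = "sweedler sR"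
  have "TT g (RR f a b) = ?s a (\<lambda>a1 a2. ?s b (\<lambda>b1 b2. ?s a1 (\<lambda>a3 a4. ?s b1 (\<lambda>b3 b4. tscl (f a2 b2 * g a4 b4) (tb2 a3 b3)))))"
    unfolding TT_def RR_def[of f]
    by (simp add: sw_tlin tlin_tscl, simp only: TT_def[symmetric] TT_tb2, simp add: RR_def sw_tscl tscl_simps)
  also have "\<dots> = ?s a (\<lambda>a1 a2. ?s a1 (\<lambda>a3 a4. ?s b (\<lambda>b1 b2. ?s b1 (\<lambda>b3 b4. tscl (f a2 b2 * g a4 b4) (tb2 a3 b3)))))"
    by (subst (2) mR.sw_swap) (rule refl)
  also have "\<dots> = ?s a (\<lambda>a1 a2. ?s a2 (\<lambda>a3 a4. ?s b (\<lambda>b1 b2. ?s b2 (\<lambda>b3 b4. tscl (g a3 b3 * f a4 b4) (tb2 a1 b1)))))"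
    by (simp add: mR.sw_coassoc mult.commute)
  also have "\<dots> = ?s a (\<lambda>a1 a2. ?s b (\<lambda>b1 b2. ?s a2 (\<lambda>a3 a4. ?s b2 (\<lambda>b3 b4. tscl (g a3 b3 * f a4 b4) (tb2 a1 b1)))))"
    by (subst (3) mR.sw_swap) (rule refl)
  also have "\<dots> = RR (conv2 scalK g f) a b"
    by (simp add: RR_def conv2_def sw_tscl_left)
  finally show ?thesis .
qed

lemma RR_cong: "(\<And>b c. f (bas b) (bas c) = g (bas b) (bas c)) \<Longrightarrow> RR f a b = RR g a b"
  unfolding RR_def by (intro sw_cong) simp

lemma RR_counit: "RR (\<lambda>a b. scalK (counit a) * scalK (counit b)) a b = tb2 a b"
proof -
  have "RR (\<lambda>a b. scalK (counit a) * scalK (counit b)) a b =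
      sweedler sR a (\<lambda>a' a''. sR (counit a'') (sweedler sR b (\<lambda>b' b''. sR (counit b'') (tb2 a' b'))))"
    by (simp only: RR_def flip: mR.sw_scale_fun) (simp add: sR_def tscl_simps mult.commute)
  also have "\<dots> = sweedler sR a (\<lambda>a' a''. sR (counit a'') (tb2 a' b))"
    by (subst mR.sw_counit_right) (auto simp: additive_def tb2_add tb2_scl)
  also have "\<dots> = tb2 a b"
    by (subst mR.sw_counit_right[of "\<lambda>a. tb2 a b"]) (auto simp: additive_def tb2_add tb2_scl)
  finally show ?thesis .
qed

lemma flip_eq: "flip = tlin (\<lambda>(b, c). tbas (c, b))"
  by (simp add: fun_eq_iff flip_def tmap_lin_eq_tlin tbas_def case_prod_unfold)

lemma flip_tb2: "flip (tb2 x y) = tb2 y x"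
proof -
  have e: "flip = tlin (\<lambda>(b, c). tb2 (bas c) (bas b))"
    by (simp add: flip_eq tb2_bas)
  show ?thesis
    unfolding e by (rule tlin_tb2[of "\<lambda>x y. tb2 y x"]) (simp_all add: tb2_add tb2_scl)
qed

lemma flip_RR: "flip (RR f a b) = RR (\<lambda>a b. f b a) b a"
proof -
  have "flip (RR f a b) = sweedler sR a (\<lambda>a' a''. sweedler sR b (\<lambda>b' b''. tscl (f a'' b'') (flip (tb2 a' b'))))"
    unfolding RR_def by (simp add: flip_eq sw_tlin tlin_tscl)
  then show ?thesis
    by (simp add: RR_def flip_tb2) (subst mR.sw_swap, rule refl)
qed

lemma flip_TT_flip: "flip (TT f (flip x)) = TT (\<lambda>a b. f b a) x"
proof -
  have "flip (TT f (flip x)) = tlin (\<lambda>p. flip (TT f (flip (tbas p)))) x"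
    unfolding flip_eq TT_def by (simp add: tlin_comp tlin_tbas)
  moreover have "flip (TT f (flip (tbas p))) = (case p of (b, c) \<Rightarrow> RR (\<lambda>a b. f b a) (bas b) (bas c))" for p
    by (cases p) (simp add: flip_tb2 TT_tb2 flip_RR flip: tb2_bas)
  ultimately show ?thesis
    by (simp add: TT_def)
qed

lemma TT_comp:
  assumes "\<And>a b. conv2 scalK g f a b = scalK (counit a) * scalK (counit b)"
  shows "TT g (TT f x) = x"
proof -
  have "TT g (TT f x) = tlin (\<lambda>p. TT g (case p of (b, c) \<Rightarrow> RR f (bas b) (bas c))) x"
    by (simp add: TT_def tlin_comp)
  also have "(\<lambda>p. TT g (case p of (b, c) \<Rightarrow> RR f (bas b) (bas c))) = tbas"
  proof
    fix p :: "mon \<times> mon"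
    obtain b c where p: "p = (b, c)"
      by (cases p)
    have "TT g (RR f (bas b) (bas c)) = RR (\<lambda>a b. scalK (counit a) * scalK (counit b)) (bas b) (bas c)"
      unfolding TT_RR by (rule RR_cong) (rule assms)
    then show "TT g (case p of (b, c) \<Rightarrow> RR f (bas b) (bas c)) = tbas p"
      by (simp add: p RR_counit tb2_bas)
  qed
  finally show ?thesis
    by (simp add: tlin_id)
qed

section \<open>Vectors with coefficients in \<open>K0\<close>, on which substitutions and expansions
  are additive\<close>

definition KV0 :: "('b \<Rightarrow>\<^sub>0 'k::field ratfun) set" where
  "KV0 = {x. \<forall>b. lookup x b \<in> K0}"

definition KV :: "('p, 'b \<Rightarrow>\<^sub>0 'k::field ratfun) tps set" where
  "KV = {X. \<forall>n. tcoeff X n \<in> KV0}"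

lemma KV0_add: "x \<in> KV0 \<Longrightarrow> y \<in> KV0 \<Longrightarrow> x + y \<in> KV0"
  by (simp add: KV0_def lookup_add K0_add)

lemma KV0_0: "0 \<in> KV0"
  by (simp add: KV0_def K0_0)

lemma KV0_scl: "c \<in> K0 \<Longrightarrow> x \<in> KV0 \<Longrightarrow> scl c x \<in> KV0"
  by (simp add: KV0_def K0_mult)

lemma KV0_sum: "(\<And>i. i \<in> A \<Longrightarrow> f i \<in> KV0) \<Longrightarrow> sum f A \<in> KV0"
  by (induction A rule: infinite_finite_induct) (auto simp: KV0_0 KV0_add)

lemma KV0_mcst: "mcst x \<in> KV0"
  by (simp add: KV0_def lookup_map0 K0_cst)

lemma KV_add: "X \<in> KV \<Longrightarrow> Y \<in> KV \<Longrightarrow> X + Y \<in> KV"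
  by (simp add: KV_def KV0_add)

lemma KV_0: "0 \<in> KV"
  by (simp add: KV_def KV0_0)

lemma tcoeff_tscl: "tcoeff (tscl c x) n = (\<Sum>(i, j) | i + j = n. scl (tcoeff c i) (tcoeff x j))"
  by (simp add: tscl_def tcoeff_tconv)

lemma KV_tscl: "X \<in> KT \<Longrightarrow> V \<in> KV \<Longrightarrow> tscl X V \<in> KV"
  by (auto simp: KV_def KT_def tcoeff_tscl intro!: KV0_sum KV0_scl)

lemma KV_tb2: "tb2 x y \<in> KV"
  by (simp add: KV_def tb2_def tcoeff_tconst KV0_mcst KV0_0)

lemma KV_sR: "V \<in> KV \<Longrightarrow> sR c V \<in> KV"
  by (simp add: sR_def KV_tscl KT_const)

lemma KV_scalar_ext: "scalar_ext X \<in> KV"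
  by (simp add: KV_def scalar_ext_def KV0_mcst)

lemma KV_sw: "(\<And>x y. B x y \<in> KV) \<Longrightarrow> sweedler sR a B \<in> KV"
proof -
  assume B: "\<And>x y. B x y \<in> KV"
  have "add_on KV (\<lambda>x. x)"
    by (simp add: add_on_def KV_0 KV_add)
  then show ?thesis
    unfolding sweedler_eq_ext ext_def by (rule add_on_sum_mem) (auto simp: B intro: KV_sR)
qed

lemma KV_RR: "(\<And>a b. f a b \<in> KT) \<Longrightarrow> RR f a b \<in> KV"
  unfolding RR_def by (intro KV_sw KV_tscl KV_tb2)

lemma KV_tlin:
  assumes "\<And>b. g b \<in> KV" "X \<in> KV"
  shows "tlin g X \<in> KV"
  using assms
  by (auto simp: KV_def tlin_def lin_def KV0_def lookup_sum intro!: K0_sum K0_mult)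

lemma tmap_map_khom:
  fixes X :: "('p, 'k::field ratfun) tps" and V :: "('p, 'b \<Rightarrow>\<^sub>0 'k ratfun) tps"
    and x :: "'c \<Rightarrow>\<^sub>0 'k" and y :: "'d \<Rightarrow>\<^sub>0 'k"
  assumes h: "khom h" "\<And>c. h (cst c) = cst c"
  shows "add_on KV (tmap (Poly_Mapping.map h) :: ('p, 'b \<Rightarrow>\<^sub>0 'k::field ratfun) tps \<Rightarrow> _)"
    "X \<in> KT \<Longrightarrow> V \<in> KV \<Longrightarrow> tmap (Poly_Mapping.map h) (tscl X V) = tscl (tmap h X) (tmap (Poly_Mapping.map h) V)"
    "tmap (Poly_Mapping.map h) (tb2 x y) = tb2 x y"
proof -
  note h0 = khom_0[OF h(1)]
  have m: "Poly_Mapping.map h (x + y) = Poly_Mapping.map h x + Poly_Mapping.map h y"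
    "Poly_Mapping.map h (scl c x) = scl (h c) (Poly_Mapping.map h x)"
    if "x \<in> KV0" "y \<in> KV0" "c \<in> K0" for x y :: "'b \<Rightarrow>\<^sub>0 'k ratfun" and c
    using that by (auto intro!: poly_mapping_eqI simp: lookup_map0 h0 lookup_add KV0_def khomD[OF h(1)])
  have a0: "add_on KV0 (Poly_Mapping.map h :: ('b \<Rightarrow>\<^sub>0 'k ratfun) \<Rightarrow> _)"
    using m K0_0 by (auto simp: add_on_def KV0_0 KV0_add)
  show "add_on KV (tmap (Poly_Mapping.map h) :: ('p, 'b \<Rightarrow>\<^sub>0 'k ratfun) tps \<Rightarrow> _)"
    using a0 by (auto simp: add_on_def KV_0 KV_add KV_def intro!: tps_eqI)
  show "tmap (Poly_Mapping.map h) (tscl X V) = tscl (tmap h X) (tmap (Poly_Mapping.map h) V)"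
    if "X \<in> KT" "V \<in> KV"
    using that
    by (intro tps_eqI) (simp add: tcoeff_tscl case_prod_unfold add_on_sum[OF a0] KT_def KV_def KV0_scl m(2)[OF _ KV0_0])
  have "Poly_Mapping.map h (mcst z) = mcst z" for z :: "'c \<times> 'd \<Rightarrow>\<^sub>0 'k"
    by (rule poly_mapping_eqI) (simp add: lookup_map0 h0 h)
  moreover have "Poly_Mapping.map h (0 :: 'c \<times> 'd \<Rightarrow>\<^sub>0 'k ratfun) = 0"
    by (rule poly_mapping_eqI) (simp add: lookup_map0 h0)
  ultimately show "tmap (Poly_Mapping.map h) (tb2 x y) = tb2 x y"
    by (simp add: tb2_def tmap_tconst)
qed

lemma tmap_map_RR:
  assumes h: "khom h" "\<And>c. h (cst c) = cst c" and f: "\<And>a b. f a b \<in> KT"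
  shows "tmap (Poly_Mapping.map h) (RR f a b) = RR (\<lambda>a b. tmap h (f a b)) a b"
proof -
  note m = tmap_map_khom[of h, OF h]
  have s: "tmap (Poly_Mapping.map h) (sR c V) = sR c (tmap (Poly_Mapping.map h) V)" if "V \<in> KV" for c V
    using that by (simp add: sR_def m(2)[OF KT_const] tmap_scalK[OF h(1)] h(2)) (simp add: scalK_def)
  have "tmap (Poly_Mapping.map h) (RR f a b) =
      sweedler sR a (\<lambda>a' a''. tmap (Poly_Mapping.map h) (sweedler sR b (\<lambda>b' b''. tscl (f a'' b'') (tb2 a' b'))))"
    unfolding RR_def
    by (intro sw_hom_on[OF m(1)] s KV_sR KV_sw KV_tscl f KV_tb2)
  also have "\<dots> = sweedler sR a (\<lambda>a' a''. sweedler sR b (\<lambda>b' b''. tmap (Poly_Mapping.map h) (tscl (f a'' b'') (tb2 a' b'))))"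
    by (intro sw_cong sw_hom_on[OF m(1)] s KV_sR KV_sw KV_tscl f KV_tb2)
  finally show ?thesis
    by (simp add: RR_def m f KV_tb2)
qed

definition tb3 :: "mon \<Rightarrow> mon \<Rightarrow> mon \<Rightarrow> ('p, (mon \<times> mon \<times> mon) \<Rightarrow>\<^sub>0 'k::field ratfun) tps" where
  "tb3 x y z = tbas (x, y, z)"

text \<open>Sweedler sums hand over vectors, while a basis element of the tensor cube is built from
  indices; this reads the index off. The choice is determined because basis vectors are
  inserted.\<close>

definition un :: "('b \<Rightarrow>\<^sub>0 'k::field) \<Rightarrow> 'b" where
  "un x = (SOME b. x = bas b)"

lemma un_bas: "un (bas b :: 'b \<Rightarrow>\<^sub>0 'k::field) = b"
proof -
  have "bas b = (bas (un (bas b :: 'b \<Rightarrow>\<^sub>0 'k)) :: 'b \<Rightarrow>\<^sub>0 'k)"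
    unfolding un_def by (rule someI) (rule refl)
  then show ?thesis
    by (metis lookup_bas zero_neq_one)
qed

context bichar
begin

lemma R0_eq: "R0 r = RR q"
proof -
  have e: "(\<lambda>c. tmap (scl (cst c))) = (sR :: 'k \<Rightarrow> ('p, (mon \<times> mon) \<Rightarrow>\<^sub>0 'k ratfun) tps \<Rightarrow> _)"
    by (simp add: fun_eq_iff sR_eq)
  show ?thesis
    by (intro HOL.ext) (simp add: e R0_def RR_def Let_def scalar_ext_tconst tb2_def bc_conv_eq q_def rtau_def rinv_def)
qed

lemma R_r_eq: "R_r r X = TT q (scalar_ext X)"
  by (simp add: R_r_def TT_def R0_eq)

definition qq :: "nat \<Rightarrow> nat \<Rightarrow> 'k V0 \<Rightarrow> 'k V0 \<Rightarrow> ('p, 'k ratfun) tps" where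
  "qq i j a b = tmap (subst2 i j) (q a b)"

lemma Rval_eq: "i \<noteq> j \<Longrightarrow> Rval (R_r r) i j = (\<lambda>(b, c). RR (qq i j) (bas b) (bas c))"
  by (auto simp: fun_eq_iff Rval_def R_r_eq scalar_ext_tbas TT_def tlin_tbas qq_def[abs_def]
      tmap_map_RR[OF khom_subst2 subst2_cst q_KT])

lemma Rvars_eq: "i \<noteq> j \<Longrightarrow> Rvars (R_r r) i j = TT (qq i j)"
  by (simp add: fun_eq_iff Rvars_def TT_def Rval_eq)

lemma qq_01: "qq 0 1 = q"
  using q_KT by (auto simp: fun_eq_iff qq_def KT_def subst2_0_1 intro!: tps_eqI)

lemma qq_10: "qq 1 0 a b = qtau b a"
  by (simp add: qq_def qtau_def)

lemma R_add: "R_r r (X + X') = R_r r X + R_r r X'"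
  by (simp add: R_r_eq TT_def scalar_ext_add tlin_add)

lemma R_scale: "R_r r (tscl c X) = tscl (tmap cst c) (R_r r X)"
  by (simp add: R_r_eq TT_def scalar_ext_tscl tlin_tscl)

lemma R_KV: "R_r r X \<in> KV"
  unfolding R_r_eq TT_def
  by (intro KV_tlin KV_scalar_ext) (auto intro: KV_RR q_KT)

lemma R_K: "lookup (tcoeff (R_r r X) j) bc \<in> K0"
  using R_KV[of X] unfolding KV_def KV0_def by blast

lemma R_unitarity:
  "(flip \<circ> Rvars (R_r r) 1 0 \<circ> flip) \<circ> Rvars (R_r r) 0 1 = id"
  "Rvars (R_r r) 0 1 \<circ> (flip \<circ> Rvars (R_r r) 1 0 \<circ> flip) = id"
proof -
  have "TT (\<lambda>a b. qq 1 0 b a) = TT qtau"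
    by (simp add: qq_10)
  then show "(flip \<circ> Rvars (R_r r) 1 0 \<circ> flip) \<circ> Rvars (R_r r) 0 1 = id"
    "Rvars (R_r r) 0 1 \<circ> (flip \<circ> Rvars (R_r r) 1 0 \<circ> flip) = id"
    by (simp_all add: fun_eq_iff Rvars_eq flip_TT_flip qq_01 TT_comp q_qtau)
qed

text \<open>On \<open>V \<otimes> V \<otimes> V\<close> each of the three operators multiplies by a scalar after splitting two of the factors;
  they commute by coassociativity and cocommutativity.\<close>

lemma lin_RR:
  fixes f :: "'k V0 \<Rightarrow> 'k V0 \<Rightarrow> ('p, 'k ratfun) tps"
  shows
  "tmap (lin (\<lambda>(b, c). bas (g b c))) (RR f a b) =
    sweedler sR a (\<lambda>a' a''. sweedler sR b (\<lambda>b' b''. tscl (f a'' b'') (tbas (g (un a') (un b')))))"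
proof -
  have e: "tmap (lin (\<lambda>(b, c). bas (g b c))) V = tlin (\<lambda>(b, c). tbas (g b c)) V"
    for V :: "('p, mon \<times> mon \<Rightarrow>\<^sub>0 'k ratfun) tps"
    by (simp add: tmap_lin_eq_tlin tbas_def case_prod_unfold)
  have "tmap (lin (\<lambda>(b, c). bas (g b c))) (RR f a b) =
    sweedler sR a (\<lambda>a' a''. sweedler sR b (\<lambda>b' b''. tscl (f a'' b'') (tlin (\<lambda>(b, c). tbas (g b c)) (tb2 a' b'))))"
    by (simp add: e RR_def sw_tlin tlin_tscl)
  also have "\<dots> = sweedler sR a (\<lambda>a' a''. sweedler sR b (\<lambda>b' b''. tscl (f a'' b'') (tbas (g (un a') (un b')))))"
    by (intro sw_cong) (simp add: un_bas tb2_bas tlin_tbas)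
  finally show ?thesis .
qed

definition W12 :: "('k V0 \<Rightarrow> 'k V0 \<Rightarrow> ('p, 'k ratfun) tps) \<Rightarrow> mon \<times> mon \<times> mon \<Rightarrow>
    ('p, (mon \<times> mon \<times> mon) \<Rightarrow>\<^sub>0 'k ratfun) tps" where
  "W12 f = (\<lambda>(b, c, d). sweedler sR (bas b) (\<lambda>b' b''. sweedler sR (bas c) (\<lambda>c' c''. tscl (f b'' c'') (tbas (un b', un c', d)))))"

definition W13 :: "('k V0 \<Rightarrow> 'k V0 \<Rightarrow> ('p, 'k ratfun) tps) \<Rightarrow> mon \<times> mon \<times> mon \<Rightarrow>
    ('p, (mon \<times> mon \<times> mon) \<Rightarrow>\<^sub>0 'k ratfun) tps" where
  "W13 f = (\<lambda>(b, c, d). sweedler sR (bas b) (\<lambda>b' b''. sweedler sR (bas d) (\<lambda>d' d''. tscl (f b'' d'') (tbas (un b', c, un d')))))"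

definition W23 :: "('k V0 \<Rightarrow> 'k V0 \<Rightarrow> ('p, 'k ratfun) tps) \<Rightarrow> mon \<times> mon \<times> mon \<Rightarrow>
    ('p, (mon \<times> mon \<times> mon) \<Rightarrow>\<^sub>0 'k ratfun) tps" where
  "W23 f = (\<lambda>(b, c, d). sweedler sR (bas c) (\<lambda>c' c''. sweedler sR (bas d) (\<lambda>d' d''. tscl (f c'' d'') (tbas (b, un c', un d')))))"

lemma R12_eq: "i \<noteq> j \<Longrightarrow> R12 (R_r r) i j = tlin (W12 (qq i j))"
  and R13_eq: "i \<noteq> j \<Longrightarrow> R13 (R_r r) i j = tlin (W13 (qq i j))"
  and R23_eq: "i \<noteq> j \<Longrightarrow> R23 (R_r r) i j = tlin (W23 (qq i j))"
  unfolding R12_def R13_def R23_def W12_def W13_def W23_def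
  by (auto intro!: arg_cong[of _ _ tlin] simp: Rval_eq lin_RR[of "\<lambda>x y. (x, y, _)"] lin_RR[of "\<lambda>x y. (x, _, y)"] lin_RR[of "\<lambda>x y. (_, x, y)"])

text \<open>Any two of the operators share one tensor factor. The sums over the other factors are
  moved out of the way, and the two successive splittings of the shared factor are exchanged. As the
  scalars are arbitrary, the values at three different pairs of variables are covered.\<close>

lemma W_commute:
  "tlin (W12 f) (W13 g p) = tlin (W13 g) (W12 f p)"
  "tlin (W12 f) (W23 g p) = tlin (W23 g) (W12 f p)"
  "tlin (W13 f) (W23 g p) = tlin (W23 g) (W13 f p)"
proof -
  let ?s = "sweedler sR"
  obtain b c d where p: "p = (b, c, d)"
    by (cases p)
  define t where "t x y z = (tbas (un x, un y, un z) :: ('p, (mon \<times> mon \<times> mon) \<Rightarrow>\<^sub>0 'k ratfun) tps)"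
    for x y z :: "'k V0"
  have cg: "?s a (\<lambda>x y. ?s a' (\<lambda>x' y'. F x y x' y')) = ?s a (\<lambda>x y. ?s a' (\<lambda>x' y'. G x y x' y'))"
    if "\<And>b c b' c'. F (bas b) (bas c) (bas b') (bas c') = G (bas b) (bas c) (bas b') (bas c')"
    for a a' and F G :: "'k V0 \<Rightarrow> 'k V0 \<Rightarrow> 'k V0 \<Rightarrow> 'k V0 \<Rightarrow> ('p, (mon \<times> mon \<times> mon) \<Rightarrow>\<^sub>0 'k ratfun) tps"
    using that by (intro sw_cong)
  have 1: "tlin (W12 f) (W13 g p) = ?s (bas b) (\<lambda>b1 b2. ?s (bas d) (\<lambda>d1 d2. ?s b1 (\<lambda>b3 b4. ?s (bas c) (\<lambda>c1 c2.
      tscl (g b2 d2 * f b4 c2) (t b3 c1 d1)))))"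
    unfolding p W13_def prod.case
    by (simp add: sw_tlin tlin_tscl tlin_tbas, rule cg) (simp add: W12_def un_bas sw_tscl tscl_simps t_def)
  also have "\<dots> = ?s (bas b) (\<lambda>b1 b2. ?s b1 (\<lambda>b3 b4. ?s (bas d) (\<lambda>d1 d2. ?s (bas c) (\<lambda>c1 c2.
      tscl (g b2 d2 * f b4 c2) (t b3 c1 d1)))))"
    by (subst (2) mR.sw_swap) (rule refl)
  \<comment> \<open>The two splittings of the shared factor \<open>b\<close> change places.\<close>
  also have "\<dots> = ?s (bas b) (\<lambda>b1 b2. ?s b1 (\<lambda>b3 b4. ?s (bas d) (\<lambda>d1 d2. ?s (bas c) (\<lambda>c1 c2.
      tscl (g b4 d2 * f b2 c2) (t b3 c1 d1)))))"
    by (rule mR.sw_swap23)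
  also have "\<dots> = ?s (bas b) (\<lambda>b1 b2. ?s b1 (\<lambda>b3 b4. ?s (bas c) (\<lambda>c1 c2. ?s (bas d) (\<lambda>d1 d2.
      tscl (g b4 d2 * f b2 c2) (t b3 c1 d1)))))"
    by (subst (3) mR.sw_swap) (rule refl)
  also have "\<dots> = ?s (bas b) (\<lambda>b1 b2. ?s (bas c) (\<lambda>c1 c2. ?s b1 (\<lambda>b3 b4. ?s (bas d) (\<lambda>d1 d2.
      tscl (g b4 d2 * f b2 c2) (t b3 c1 d1)))))"
    by (subst (2) mR.sw_swap) (rule refl)
  also have "\<dots> = tlin (W13 g) (W12 f p)"
    unfolding p W12_def prod.case
    by (simp add: sw_tlin tlin_tscl tlin_tbas, rule cg) (simp add: W13_def un_bas sw_tscl tscl_simps t_def mult.commute)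
  finally show "tlin (W12 f) (W13 g p) = tlin (W13 g) (W12 f p)" .
  have "tlin (W12 f) (W23 g p) = ?s (bas c) (\<lambda>c1 c2. ?s (bas d) (\<lambda>d1 d2. ?s (bas b) (\<lambda>b3 b4. ?s c1 (\<lambda>c3 c4.
      tscl (g c2 d2 * f b4 c4) (t b3 c3 d1)))))"
    unfolding p W23_def prod.case
    by (simp add: sw_tlin tlin_tscl tlin_tbas, rule cg) (simp add: W12_def un_bas sw_tscl tscl_simps t_def)
  also have "\<dots> = ?s (bas d) (\<lambda>d1 d2. ?s (bas b) (\<lambda>b3 b4. ?s (bas c) (\<lambda>c1 c2. ?s c1 (\<lambda>c3 c4.
      tscl (g c2 d2 * f b4 c4) (t b3 c3 d1)))))"
    by (subst mR.sw_swap, subst (2) mR.sw_swap) (rule refl)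
  also have "\<dots> = ?s (bas d) (\<lambda>d1 d2. ?s (bas b) (\<lambda>b3 b4. ?s (bas c) (\<lambda>c1 c2. ?s c1 (\<lambda>c3 c4.
      tscl (g c4 d2 * f b4 c2) (t b3 c3 d1)))))"
    by (simp add: mR.sw_swap23[of _ "\<lambda>c3 c4 c2. tscl (g c4 _ * f _ c2) (t _ c3 _)"])
  also have "\<dots> = ?s (bas b) (\<lambda>b3 b4. ?s (bas c) (\<lambda>c1 c2. ?s c1 (\<lambda>c3 c4. ?s (bas d) (\<lambda>d1 d2.
      tscl (g c4 d2 * f b4 c2) (t b3 c3 d1)))))"
    by (subst mR.sw_swap, subst (2) mR.sw_swap, subst (3) mR.sw_swap) (rule refl)
  also have "\<dots> = tlin (W23 g) (W12 f p)"
    unfolding p W12_def prod.case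
    by (simp add: sw_tlin tlin_tscl tlin_tbas, rule cg) (simp add: W23_def un_bas sw_tscl tscl_simps t_def mult.commute)
  finally show "tlin (W12 f) (W23 g p) = tlin (W23 g) (W12 f p)" .
  have "tlin (W13 f) (W23 g p) = ?s (bas c) (\<lambda>c1 c2. ?s (bas d) (\<lambda>d1 d2. ?s (bas b) (\<lambda>b3 b4. ?s d1 (\<lambda>d3 d4.
      tscl (g c2 d2 * f b4 d4) (t b3 c1 d3)))))"
    unfolding p W23_def prod.case
    by (simp add: sw_tlin tlin_tscl tlin_tbas, rule cg) (simp add: W13_def un_bas sw_tscl tscl_simps t_def)
  also have "\<dots> = ?s (bas c) (\<lambda>c1 c2. ?s (bas b) (\<lambda>b3 b4. ?s (bas d) (\<lambda>d1 d2. ?s d1 (\<lambda>d3 d4.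
      tscl (g c2 d2 * f b4 d4) (t b3 c1 d3)))))"
    by (subst (2) mR.sw_swap) (rule refl)
  also have "\<dots> = ?s (bas c) (\<lambda>c1 c2. ?s (bas b) (\<lambda>b3 b4. ?s (bas d) (\<lambda>d1 d2. ?s d1 (\<lambda>d3 d4.
      tscl (g c2 d4 * f b4 d2) (t b3 c1 d3)))))"
    by (simp add: mR.sw_swap23[of _ "\<lambda>d3 d4 d2. tscl (g _ d2 * f _ d4) (t _ _ d3)"])
  also have "\<dots> = ?s (bas b) (\<lambda>b3 b4. ?s (bas d) (\<lambda>d1 d2. ?s (bas c) (\<lambda>c1 c2. ?s d1 (\<lambda>d3 d4.
      tscl (g c2 d4 * f b4 d2) (t b3 c1 d3)))))"
    by (subst mR.sw_swap, subst (2) mR.sw_swap) (rule refl)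
  also have "\<dots> = tlin (W23 g) (W13 f p)"
    unfolding p W13_def prod.case
    by (simp add: sw_tlin tlin_tscl tlin_tbas, rule cg) (simp add: W23_def un_bas sw_tscl tscl_simps t_def mult.commute)
  finally show "tlin (W13 f) (W23 g p) = tlin (W23 g) (W13 f p)" .
qed

lemma R_yang_baxter:
  "R12 (R_r r) 0 1 \<circ> R13 (R_r r) 0 2 \<circ> R23 (R_r r) 1 2 = R23 (R_r r) 1 2 \<circ> R13 (R_r r) 0 2 \<circ> R12 (R_r r) 0 1"
proof -
  have c: "tlin (W12 f) (tlin (W13 g) x) = tlin (W13 g) (tlin (W12 f) x)"
    "tlin (W12 f) (tlin (W23 g) x) = tlin (W23 g) (tlin (W12 f) x)"
    "tlin (W13 f) (tlin (W23 g) x) = tlin (W23 g) (tlin (W13 f) x)" for f g x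
    by (simp_all add: tlin_comp W_commute)
  show ?thesis
    by (simp add: fun_eq_iff R12_eq R13_eq R23_eq) (simp add: c)
qed

section \<open>The shift conditions of the braiding\<close>

lemma ttens_tconst: "ttens (tconst x) (tconst y) = tconst (tens x y)"
  by (simp add: ttens_def tconv_eq_tapp tapp_tconst tmap_tconst tps_eqI)

lemma op_left_eq: "op_left (tmap D0) = tlin (\<lambda>(b, c). tb2 (D0 (bas b)) (bas c))"
  and op_right_eq: "op_right (tmap D0) = tlin (\<lambda>(b, c). tb2 (bas b) (D0 (bas c)))"
  by (simp_all add: op_left_def op_right_def tbas_def tmap_tconst additive.zero[OF additive_D0] ttens_tconst
      scalar_ext_tconst tb2_def)

lemma RR_pd:
  fixes f :: "'k V0 \<Rightarrow> 'k V0 \<Rightarrow> ('p, 'k ratfun) tps"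
  shows "tmap (Poly_Mapping.map (rf_pd i)) (RR f a b) = RR (\<lambda>a b. tmap (rf_pd i) (f a b)) a b"
proof -
  let ?m = "tmap (Poly_Mapping.map (rf_pd i)) :: ('p, mon \<times> mon \<Rightarrow>\<^sub>0 'k ratfun) tps \<Rightarrow> _"
  have ap: "Poly_Mapping.map (rf_pd i) (x + y) = Poly_Mapping.map (rf_pd i) x + Poly_Mapping.map (rf_pd i) y" for x y :: "mon \<times> mon \<Rightarrow>\<^sub>0 'k ratfun"
    by (rule poly_mapping_eqI) (simp add: lookup_map0 lookup_add rf_pd_add)
  have a: "additive ?m"
    by (intro additive_tmap) (simp add: additive_def ap)
  have s: "?m (sR c V) = sR c (?m V)" for c V
    by (auto intro!: tps_eqI poly_mapping_eqI simp: sR_eq lookup_map0 rf_pd_mult)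
  have t: "?m (tscl X (tb2 x y)) = tscl (tmap (rf_pd i) X) (tb2 x y)" for X and x y :: "'k V0"
  proof -
    have "tscl X (tconst v) = tmap (\<lambda>d. scl d v) X" for X :: "('p, 'k ratfun) tps" and v :: "mon \<times> mon \<Rightarrow>\<^sub>0 'k ratfun"
      by (simp add: tscl_eq_tapp tmap_tconst scl_zero tmap_eq_tapp[of "\<lambda>d. scl d v"])
    then show ?thesis
      by (auto intro!: tps_eqI poly_mapping_eqI simp: tb2_def lookup_map0 rf_pd_mult)
  qed
  show ?thesis
    unfolding RR_def
    by (simp add: sw_hom[of ?m sR sR, OF a s] t)
qed

text \<open>The coproduct of \<open>D a\<close> has two parts: \<open>D\<close> on \<open>a'\<close>
  gives the operator \<open>D \<otimes> 1\<close> after \<open>R\<close>, and \<open>D\<close> on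
  \<open>a''\<close> differentiates the scalar in \<open>z\<close>.\<close>

lemma R_shift_left: "op_left (tmap D0) (R_r r X) - Rvars (R_r r) 0 1 (op_left (tmap D0) (scalar_ext X)) =
    - tmap (Poly_Mapping.map (rf_pd 0)) (R_r r X)"
proof -
  have b: "bilin sR (\<lambda>a' a''. sweedler sR b (\<lambda>b' b''. tscl (q a'' b'') (tb2 a' b')))" for b
    using q_bilin
    by (simp add: bilin_def tb2_add tb2_scl tscl_simps(1,2) sR_tscl sR_left mR.sw_add_fun mR.sw_scale_fun act_def)
  have *: "RR q (D0 a) b = op_left (tmap D0) (RR q a b) + tmap (Poly_Mapping.map (rf_pd 0)) (RR q a b)" for a b
  proof -
    have "op_left (tmap D0) (tb2 x y) = (tb2 (D0 x) y :: ('p, mon \<times> mon \<Rightarrow>\<^sub>0 'k ratfun) tps)" for x y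
      unfolding op_left_eq by (rule tlin_tb2) (simp_all add: D0_add D0_scl tb2_add tb2_scl)
    then have "op_left (tmap D0) (RR q a b) = sweedler sR a (\<lambda>a' a''. sweedler sR b (\<lambda>b' b''. tscl (q a'' b'') (tb2 (D0 a') b')))"
      by (simp add: RR_def op_left_eq sw_tlin tlin_tscl)
    moreover have "RR q (D0 a) b = sweedler sR a (\<lambda>a' a''. sweedler sR b (\<lambda>b' b''. tscl (q a'' b'') (tb2 (D0 a') b')) +
        sweedler sR b (\<lambda>b' b''. tscl (q (D0 a'') b'') (tb2 a' b')))"
      unfolding RR_def by (rule sw_D0[OF module_sR b])
    ultimately show ?thesis
      by (simp add: mR.sw_add_fun RR_pd) (simp add: RR_def q_D0)
  qed
  have "Rvars (R_r r) 0 1 (op_left (tmap D0) (scalar_ext X)) = tlin (\<lambda>p. TT q (case p of (b, c) \<Rightarrow> tb2 (D0 (bas b)) (bas c))) (scalar_ext X)"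
    by (simp add: Rvars_eq qq_01 op_left_eq TT_def tlin_comp)
  also have "(\<lambda>p. TT q (case p of (b, c) \<Rightarrow> tb2 (D0 (bas b)) (bas c))) =
      (\<lambda>p. op_left (tmap D0) (case p of (b, c) \<Rightarrow> RR q (bas b) (bas c)) +
        tmap (Poly_Mapping.map (rf_pd 0)) (case p of (b, c) \<Rightarrow> RR q (bas b) (bas c)))"
    by (auto simp: fun_eq_iff TT_tb2 *)
  also have "tlin \<dots> (scalar_ext X) = op_left (tmap D0) (R_r r X) + tmap (Poly_Mapping.map (rf_pd 0)) (R_r r X)"
    by (simp add: tlin_add_fun R_r_eq TT_def tmap_map_tlin[OF additive_rf_pd] rf_pd_mult) (simp add: op_left_eq tlin_comp)
  finally show ?thesis
    by simp
qed

lemma R_shift_right: "op_right (tmap D0) (R_r r X) - Rvars (R_r r) 0 1 (op_right (tmap D0) (scalar_ext X)) =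
    - tmap (Poly_Mapping.map (rf_pd 1)) (R_r r X)"
proof -
  have b: "bilin sR (\<lambda>b' b''. tscl (q a'' b'') (tb2 a' b'))" for a' a''
    using q_bilin
    by (simp add: bilin_def tb2_add tb2_scl tscl_simps(1,2) sR_tscl sR_left act_def)
  have *: "RR q a (D0 b) = op_right (tmap D0) (RR q a b) + tmap (Poly_Mapping.map (rf_pd 1)) (RR q a b)" for a b
  proof -
    have "op_right (tmap D0) (tb2 x y) = (tb2 x (D0 y) :: ('p, mon \<times> mon \<Rightarrow>\<^sub>0 'k ratfun) tps)" for x y
      unfolding op_right_eq by (rule tlin_tb2) (simp_all add: D0_add D0_scl tb2_add tb2_scl)
    then have "op_right (tmap D0) (RR q a b) = sweedler sR a (\<lambda>a' a''. sweedler sR b (\<lambda>b' b''. tscl (q a'' b'') (tb2 a' (D0 b'))))"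
      by (simp add: RR_def op_right_eq sw_tlin tlin_tscl)
    moreover have "RR q a (D0 b) = sweedler sR a (\<lambda>a' a''. sweedler sR b (\<lambda>b' b''. tscl (q a'' b'') (tb2 a' (D0 b')) +
        tscl (q a'' (D0 b'')) (tb2 a' b')))"
      unfolding RR_def sw_D0[OF module_sR b] ..
    ultimately show ?thesis
      by (simp add: mR.sw_add_fun RR_pd) (simp add: RR_def q_D0)
  qed
  have "Rvars (R_r r) 0 1 (op_right (tmap D0) (scalar_ext X)) = tlin (\<lambda>p. TT q (case p of (b, c) \<Rightarrow> tb2 (bas b) (D0 (bas c)))) (scalar_ext X)"
    by (simp add: Rvars_eq qq_01 op_right_eq TT_def tlin_comp)
  also have "(\<lambda>p. TT q (case p of (b, c) \<Rightarrow> tb2 (bas b) (D0 (bas c)))) =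
      (\<lambda>p. op_right (tmap D0) (case p of (b, c) \<Rightarrow> RR q (bas b) (bas c)) +
        tmap (Poly_Mapping.map (rf_pd 1)) (case p of (b, c) \<Rightarrow> RR q (bas b) (bas c)))"
    by (auto simp: fun_eq_iff TT_tb2 *)
  also have "tlin \<dots> (scalar_ext X) = op_right (tmap D0) (R_r r X) + tmap (Poly_Mapping.map (rf_pd 1)) (R_r r X)"
    by (simp add: tlin_add_fun R_r_eq TT_def tmap_map_tlin[OF additive_rf_pd] rf_pd_mult) (simp add: op_right_eq tlin_comp)
  finally show ?thesis
    by simp
qed

end

section \<open>Braided locality\<close>

definition scalYY :: "'k::field_char_0 \<Rightarrow> ('p, 'k V0 fls fls) tps" where
  "scalYY c = tconst (fls_const (fls_const (single 0 c)))"

lemma rhom_scalYY: "rhom scalYY"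
  unfolding scalYY_def[abs_def]
  by (rule rhom_comp[OF rhom_tconst rhom_comp[OF rhom_fls_const rhom_comp[OF rhom_fls_const rhom_single0]]])

interpretation mYY: module "act (scalYY :: 'k::field_char_0 \<Rightarrow> ('p, 'k V0 fls fls) tps)"
  by (rule module_act[OF rhom_scalYY])

abbreviation inn :: "('p, 'v::comm_ring_1 fls) tps \<Rightarrow> ('p, 'v fls fls) tps" where
  "inn \<equiv> tmap fls_const"

abbreviation out :: "('p, 'v::comm_ring_1 fls) tps \<Rightarrow> ('p, 'v fls fls) tps" where
  "out \<equiv> tmap (flsmap fls_const)"

lemma rhom_inn: "rhom (fls_const :: 'v::comm_ring_1 fls \<Rightarrow> _)"
  by (rule rhom_fls_const)

lemmas inn_hom = rhomD[OF rhom_tmap[OF rhom_inn]]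

lemma inn_scalY: "inn (scalY c) = scalYY c" and out_scalY: "out (scalY c) = scalYY c"
  by (simp_all add: scalY_def scalYY_def tmap_tconst additive.zero flsmap_const fls_eq_iff[of "flsmap _ 0"])

lemma mult_tconst_right: "Y * tconst z = tmap (\<lambda>X. X * z) Y"
proof -
  have "Y * tconst z = tmap ((*) z) Y"
    by (subst mult.commute) (rule tconst_mult_left)
  also have "\<dots> = tmap (\<lambda>X. X * z) Y"
    by (rule tps_eqI) (simp add: mult.commute)
  finally show ?thesis .
qed

text \<open>This is how a field acts on the series \<open>Y(b, w)c\<close>: a map with values in
  series in \<open>z\<close> is applied to every coefficient of a series in \<open>w\<close>, which
  makes \<open>w\<close> the outer and \<open>z\<close> the inner variable. \<open>MM\<close>
  extends this to series in the parameters.\<close>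

definition flift :: "('v \<Rightarrow> ('p, 'w::comm_ring_1) tps) \<Rightarrow> 'v::comm_ring_1 fls \<Rightarrow> ('p, 'w fls) tps" where
  "flift f F = Abs_tps (\<lambda>N. flsmap (\<lambda>v. tcoeff (f v) N) F)"

lemma tcoeff_flift: "tcoeff (flift f F) N = flsmap (\<lambda>v. tcoeff (f v) N) F"
  by (simp add: flift_def)

lemma nth_flift: "f 0 = 0 \<Longrightarrow> fls_nth (tcoeff (flift f F) N) n = tcoeff (f (fls_nth F n)) N"
  by (simp add: tcoeff_flift)

lemma fls_tps_eqI: "(\<And>N n. fls_nth (tcoeff X N) n = fls_nth (tcoeff Y N) n) \<Longrightarrow> X = Y"
  by (intro tps_eqI fls_eqI)

lemma additive_flift: "additive f \<Longrightarrow> additive (flift f)"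
  unfolding additive_def[of "flift f"]
  by (auto intro!: fls_tps_eqI simp: nth_flift additive.zero additive.add)

definition MM :: "('v \<Rightarrow> ('p, 'w::comm_ring_1) tps) \<Rightarrow> ('p, 'v::comm_ring_1 fls) tps \<Rightarrow> ('p, 'w fls) tps" where
  "MM f U = tapp (flift f) U"

lemma nth_MM: "f 0 = 0 \<Longrightarrow> tmap (\<lambda>F. fls_nth F n) (MM f U) = tapp f (tmap (\<lambda>F. fls_nth F n) U)"
  by (rule tps_eqI) (simp add: MM_def tcoeff_tapp fls_nth_sum case_prod_unfold nth_flift)

lemma MM_add_fun: "f 0 = 0 \<Longrightarrow> g 0 = 0 \<Longrightarrow> MM (\<lambda>u. f u + g u) U = MM f U + MM g U"
  unfolding MM_def tapp_add_fun[symmetric]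
  by (rule arg_cong[of _ _ "\<lambda>f. tapp f U"]) (auto intro!: HOL.ext fls_tps_eqI simp: nth_flift)

lemma MM_mult_fun:
  fixes f :: "'v::comm_ring_1 \<Rightarrow> ('p, 'w::comm_ring_1 fls) tps"
  assumes "f 0 = 0"
  shows "MM (\<lambda>u. X * f u) U = inn X * MM f U"
proof -
  have e: "flift (\<lambda>u. X * f u) = (\<lambda>F. inn X * flift f F)"
    by (rule HOL.ext, rule fls_tps_eqI) (simp add: nth_flift assms tcoeff_mult fls_nth_sum case_prod_unfold)
  show ?thesis
    by (simp add: MM_def e mult_tapp)
qed

lemma MM_sum_fun: "(\<And>i. f i 0 = 0) \<Longrightarrow> MM (\<lambda>u. \<Sum>i\<in>A. f i u) U = (\<Sum>i\<in>A. MM (f i) U)"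
proof (induction A rule: infinite_finite_induct)
  case (insert i A)
  have "MM (\<lambda>u. \<Sum>i\<in>insert i A. f i u) U = MM (\<lambda>u. f i u + (\<Sum>i\<in>A. f i u)) U"
    using insert by simp
  also have "\<dots> = MM (f i) U + MM (\<lambda>u. \<Sum>i\<in>A. f i u) U"
    by (rule MM_add_fun) (simp_all add: insert)
  finally show ?case
    using insert by simp
qed (auto intro!: fls_tps_eqI simp: MM_def tcoeff_tapp nth_flift fls_nth_sum case_prod_unfold)

lemma MM_sw_fun:
  assumes "\<And>x y. f x y 0 = 0"
  shows "MM (\<lambda>u. sweedler (act scalY) a (\<lambda>x y. f x y u)) U = sweedler (act scalYY) a (\<lambda>x y. MM (f x y) U)"
  unfolding sweedler_eq_ext ext_def
  by (subst MM_sum_fun) (auto simp: act_def assms case_prod_unfold MM_mult_fun inn_scalY)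

lemma MM_add: "additive f \<Longrightarrow> MM f (U + U') = MM f U + MM f U'"
  unfolding MM_def by (rule tapp_add[OF additive_flift])

text \<open>A series in \<open>w\<close> with scalar coefficients can be pulled out of a linear map
  coefficient by coefficient, and becomes a factor in the outer variable.\<close>

lemma MM_mult:
  fixes f :: "'k::field_char_0 V0 \<Rightarrow> ('p, 'k V0 fls) tps"
  assumes "additive f" "\<And>c u. f (scl c u) = scalY c * f u"
  shows "MM f (U * tmap (flsmap (single 0)) G) = MM f U * out (tmap (flsmap (single 0)) G)"
proof -
  note f0 = additive.zero[OF assms(1)]
  have s: "tcoeff (f (v * single 0 c)) N = tcoeff (f v) N * fls_const (single 0 c)" for v c N
  proof -
    have "f (v * single 0 c) = f v * tconst (fls_const (single 0 c))"
      using assms(2)[of c v] by (simp add: scl_mult mult.commute scalY_def)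
    then show ?thesis
      by (simp add: mult_tconst_right)
  qed
  have "flift f (F * flsmap (single 0) H) = flift f F * tconst (flsmap fls_const (flsmap (single 0) H))" for F H
  proof (rule fls_tps_eqI)
    fix N n
    obtain a where a: "\<And>i. i < a \<Longrightarrow> fls_nth F i = 0"
      using fls_lower_bound by blast
    obtain b where b: "\<And>i. i < b \<Longrightarrow> fls_nth H i = 0"
      using fls_lower_bound by blast
    show "fls_nth (tcoeff (flift f (F * flsmap (single 0) H)) N) n =
        fls_nth (tcoeff (flift f F * tconst (flsmap fls_const (flsmap (single 0) H))) N) n"
      by (simp add: mult_tconst_right nth_flift f0 fls_mult_nth_bound[of a _ b] a b additive.sum[OF assms(1)] tcoeff_sum s)
  qed
  then have *: "flift f (F * flsmap (single 0) H) = flift f F * tconst (flsmap fls_const (flsmap (single 0) H))" for F H .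
  have "MM f (U * tmap (flsmap (single 0)) G) = tapp (\<lambda>F. tapp (flift f) (tmap ((*) F) (tmap (flsmap (single 0)) G))) U"
    unfolding MM_def by (simp add: mult_eq_tapp[of U] tapp_comp[OF additive_flift[OF assms(1)]])
  also have "\<dots> = tapp (\<lambda>F. tapp (\<lambda>H. flift f F * tconst (flsmap fls_const (flsmap (single 0) H))) G) U"
    by (simp add: tapp_tmap *)
  also have "\<dots> = tapp (\<lambda>F. flift f F * out (tmap (flsmap (single 0)) G)) U"
    by (simp add: tmap_tmap tmap_eq_tapp[of "\<lambda>H. flsmap fls_const (flsmap (single 0) H)"] flip: mult_tapp)
  also have "\<dots> = MM f U * out (tmap (flsmap (single 0)) G)"
    by (simp add: MM_def tapp_mult)
  finally show ?thesis .
qed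

lemma MM_sw:
  fixes f :: "'k::field_char_0 V0 \<Rightarrow> ('p, 'k V0 fls) tps"
  assumes f: "additive f" "\<And>c u. f (scl c u) = scalY c * f u"
  shows "MM f (sweedler (act scalY) a B) = sweedler (act scalYY) a (\<lambda>x y. MM f (B x y))"
proof (rule sw_hom)
  show "additive (MM f)"
    by (simp add: additive_def MM_add[OF f(1)])
  show "MM f (act scalY c U) = act scalYY c (MM f U)" for c and U :: "('p, 'k V0 fls) tps"
    using MM_mult[OF f, of U "tconst (fls_const c)"] out_scalY[of c]
    by (simp add: act_def mult.commute[of _ U] mult.commute[of _ "MM f U"] tmap_tconst flsmap_const scalY_def scalYY_def fls_eq_iff[of "flsmap _ 0"])
qed

context bichar
begin

definition rzw :: "'k V0 \<Rightarrow> 'k V0 \<Rightarrow> ('p, 'k V0 fls fls) tps" where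
  "rzw a b = tmap zw_exp (r a b)"

definition rwz :: "'k V0 \<Rightarrow> 'k V0 \<Rightarrow> ('p, 'k V0 fls fls) tps" where
  "rwz a b = tmap wz_exp (r a b)"

definition M :: "'k V0 \<Rightarrow> 'k V0 \<Rightarrow> ('p, 'k V0 fls) tps" where
  "M a b = sweedler (act scalY) b (\<lambda>b' b''. tconst (fls_const b') * \<rho> a b'')"

interpretation mY: module "act (scalY :: 'k \<Rightarrow> ('p, 'k V0 fls) tps)"
  by (rule module_act[OF rhom_scalY])

lemma M_add: "M a (b + b') = M a b + M a b'" "M (a + a') b = M a b + M a' b"
  and M_scl: "M a (scl c b) = scalY c * M a b" "M (scl c a) b = scalY c * M a b"
  by (simp_all add: M_def mY.sw_add mY.sw_scl \<rho>_lin distrib_left mY.sw_add_fun sw_mult_const mult_ac)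
    (simp_all add: act_def sw_mult_const mult_ac)

lemma M_0: "M a 0 = 0"
  using M_add(1)[of a 0 0] by simp

lemma Y0_M: "Y0 r a b = sweedler (act scalY) a (\<lambda>a' a''. tconst (exp_zD a') * M a'' b)"
  by (simp add: Y0_eq conv2_def EY_def M_def sw_mult_const mult.assoc)

lemma \<rho>_mult: "\<rho> a (b * c) = sweedler (act scalY) a (\<lambda>a' a''. \<rho> a' b * \<rho> a'' c)"
proof -
  have a: "add_on RegT (tmap at_w0 :: ('p, 'k ratfun) tps \<Rightarrow> _)"
    by (auto simp: add_on_def RegT_0 RegT_add tmap_at_w0)
  have "\<rho> a (b * c) = sweedler (act scalY) a (\<lambda>a' a''. tmap at_w0 (r a' b * r a'' c))"
    unfolding \<rho>_def r_mult_right
    by (rule sw_hom_on[OF a]) (auto simp: act_def RegT_mult RegT_const r_RegT tmap_at_w0 at_w0_scalK)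
  then show ?thesis
    by (simp add: tmap_at_w0 r_RegT \<rho>_def)
qed

lemma M_mult: "M a (b * c) = sweedler (act scalY) a (\<lambda>a' a''. M a' b * M a'' c)"
proof -
  let ?s = "sweedler (act scalY)"
  have "M a (b * c) = ?s b (\<lambda>b' b''. ?s c (\<lambda>c' c''. ?s a (\<lambda>a' a''. tconst (fls_const b') * \<rho> a' b'' * (tconst (fls_const c') * \<rho> a'' c''))))"
    by (simp add: M_def mY.sw_mult \<rho>_mult sw_mult_const fls_const_mult_const tconst_mult mult_ac flip: fls_const_mult_const)
  also have "\<dots> = ?s a (\<lambda>a' a''. ?s b (\<lambda>b' b''. ?s c (\<lambda>c' c''. tconst (fls_const b') * \<rho> a' b'' * (tconst (fls_const c') * \<rho> a'' c''))))"
    by (subst (2) mY.sw_swap, subst mY.sw_swap) (rule refl)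
  finally show ?thesis
    by (simp only: M_def sw_mult_const(2)) (simp only: sw_mult_const(1))
qed

lemma rzw_nth: "0 \<le> j \<Longrightarrow> tmap (\<lambda>F. fls_nth F j) (rzw a b) = \<rho> a (dp (nat j) b)"
  "j < 0 \<Longrightarrow> tmap (\<lambda>F. fls_nth F j) (rzw a b) = 0"
proof -
  show "tmap (\<lambda>F. fls_nth F j) (rzw a b) = \<rho> a (dp (nat j) b)" if "0 \<le> j"
    using that by (intro tps_eqI) (simp add: rzw_def \<rho>_def at_w0_r_dp zw_exp_def w_coeff_def fls_eq_iff[of "flsmap _ 0"])
  show "tmap (\<lambda>F. fls_nth F j) (rzw a b) = 0" if "j < 0"
    using that r_RegT[of a b] by (intro tps_eqI) (simp add: rzw_def zw_exp_def RegT_def Reg_def fls_eq_iff[of "flsmap _ 0"])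
qed

text \<open>The coproduct of \<open>e^(wD) b\<close> is
  \<open>e^(wD) b' \<otimes> e^(wD) b''\<close>, and Taylor's formula rebuilds the two-point
  function \<open>r(a, b'')(z, w)\<close> from values at \<open>w = 0\<close>. Being a power series
  in \<open>w\<close>, it appears expanded in \<open>|z| > |w|\<close>.\<close>

lemma flift_exp: "flift (M a) (exp_zD b) = sweedler (act scalYY) b (\<lambda>b' b''. tconst (flsmap fls_const (exp_zD b')) * rzw a b'')"
proof -
  let ?B = "\<lambda>x y. tconst (fls_const x) * \<rho> a y :: ('p, _) tps"
  have bil: "bilin (act scalY) ?B"
    by (simp add: bilin_def act_def tconst_add distrib_left distrib_right \<rho>_lin fls_const_scl mult_ac flip: fls_plus_const)
  have nt: "tmap (\<lambda>F. fls_nth F n) (act scalYY c Y) = act scalY c (tmap (\<lambda>F. fls_nth F n) Y)" for c n and Y :: "('p, 'k V0 fls fls) tps"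
    by (rule tps_eqI) (simp add: act_def scalYY_def scalY_def tconst_mult_left)
  have X: "tmap (\<lambda>F. fls_nth F n) (tconst (flsmap fls_const (exp_zD x)) * rzw a y) =
      (if n < 0 then 0 else \<Sum>i\<le>nat n. ?B (dp i x) (dp (nat n - i) y))" for n and x y :: "'k V0"
  proof (rule tps_eqI)
    fix N
    have z: "fls_nth (tcoeff (rzw a y) N) j = tcoeff (if j < 0 then 0 else \<rho> a (dp (nat j) y)) N" for j
      using arg_cong[OF rzw_nth(1)[of j a y], of "\<lambda>X. tcoeff X N"] arg_cong[OF rzw_nth(2)[of j a y], of "\<lambda>X. tcoeff X N"]
      by (cases "j < 0") auto
    have "fls_nth (flsmap fls_const (exp_zD x) * tcoeff (rzw a y) N) n =
        (\<Sum>i=0..n. fls_const (dp (nat i) x) * tcoeff (\<rho> a (dp (nat (n - i)) y)) N)"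
      by (subst fls_mult_nth_bound[of 0 _ 0]) (auto simp: fls_nth_exp_zD z intro!: sum.cong)
    also have "\<dots> = (if n < 0 then 0 else \<Sum>i\<le>nat n. fls_const (dp i x) * tcoeff (\<rho> a (dp (nat n - i) y)) N)"
      by (auto intro!: sum.reindex_bij_witness[of _ int nat] simp: nat_diff_distrib)
    finally show "tcoeff (tmap (\<lambda>F. fls_nth F n) (tconst (flsmap fls_const (exp_zD x)) * rzw a y)) N =
        tcoeff (if n < 0 then 0 else \<Sum>i\<le>nat n. ?B (dp i x) (dp (nat n - i) y)) N"
      by (simp add: tconst_mult_left tcoeff_sum)
  qed
  have "tmap (\<lambda>F. fls_nth F n) (flift (M a) (exp_zD b)) =
      tmap (\<lambda>F. fls_nth F n) (sweedler (act scalYY) b (\<lambda>b' b''. tconst (flsmap fls_const (exp_zD b')) * rzw a b''))" for n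
  proof -
    have "tmap (\<lambda>F. fls_nth F n) (flift (M a) (exp_zD b)) = (if n < 0 then 0 else M a (dp (nat n) b))"
      by (rule tps_eqI) (simp add: nth_flift M_0 fls_nth_exp_zD)
    also have "\<dots> = sweedler (act scalY) b (\<lambda>x y. if n < 0 then 0 else \<Sum>i\<le>nat n. ?B (dp i x) (dp (nat n - i) y))"
      unfolding M_def
      by (cases "n < 0") (simp_all add: sw_dp[OF module_act[OF rhom_scalY] bil], simp add: sweedler_eq_ext case_prod_unfold)
    also have "\<dots> = sweedler (act scalY) b (\<lambda>x y. tmap (\<lambda>F. fls_nth F n) (tconst (flsmap fls_const (exp_zD x)) * rzw a y))"
      by (simp only: X)
    also have "\<dots> = tmap (\<lambda>F. fls_nth F n) (sweedler (act scalYY) b (\<lambda>b' b''. tconst (flsmap fls_const (exp_zD b')) * rzw a b''))"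
      by (rule sw_hom[symmetric]) (auto simp: additive_tmap additive_nth nt)
    finally show ?thesis .
  qed
  then show ?thesis
    by (intro fls_tps_eqI) (metis tcoeff_tmap)
qed

lemma flift_exp_const: "flift (M a) (exp_zD b * fls_const c) = sweedler (act scalYY) a (\<lambda>a' a''. flift (M a') (exp_zD b) * inn (M a'' c))"
proof (rule fls_tps_eqI)
  fix N n
  have nt: "tmap (\<lambda>F. fls_nth F n) (act scalYY c Y) = act scalY c (tmap (\<lambda>F. fls_nth F n) Y)" for c n and Y :: "('p, 'k V0 fls fls) tps"
    by (rule tps_eqI) (simp add: act_def scalYY_def scalY_def tconst_mult_left)
  have i: "tmap (\<lambda>F. fls_nth F n) (Y * inn X) = tmap (\<lambda>F. fls_nth F n) Y * X" for X and Y :: "('p, 'k V0 fls fls) tps"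
    by (rule tps_eqI) (simp add: tcoeff_mult fls_nth_sum case_prod_unfold)
  have f: "tmap (\<lambda>F. fls_nth F n) (flift (M a) F) = M a (fls_nth F n)" for a F
    by (rule tps_eqI) (simp add: nth_flift M_0)
  have "tmap (\<lambda>F. fls_nth F n) (flift (M a) (exp_zD b * fls_const c)) = M a (fls_nth (exp_zD b) n * c)"
    by (simp add: f)
  also have "\<dots> = sweedler (act scalY) a (\<lambda>a' a''. tmap (\<lambda>F. fls_nth F n) (flift (M a') (exp_zD b) * inn (M a'' c)))"
    by (simp add: M_mult i f)
  also have "\<dots> = tmap (\<lambda>F. fls_nth F n) (sweedler (act scalYY) a (\<lambda>a' a''. flift (M a') (exp_zD b) * inn (M a'' c)))"
    by (rule sw_hom[symmetric]) (auto simp: additive_tmap additive_nth nt)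
  finally show "fls_nth (tcoeff (flift (M a) (exp_zD b * fls_const c)) N) n =
      fls_nth (tcoeff (sweedler (act scalYY) a (\<lambda>a' a''. flift (M a') (exp_zD b) * inn (M a'' c))) N) n"
    by (metis tcoeff_tmap)
qed

definition EE :: "'k V0 \<Rightarrow> 'k V0 \<Rightarrow> ('p, 'k V0 fls fls) tps" where
  "EE a b = tconst (fls_const (exp_zD a)) * tconst (flsmap fls_const (exp_zD b))"

text \<open>The part of the product of two fields that involves the vector \<open>c\<close>:
  \<open>\<Sum> c' r(a, c'')(z, 0) r(b, c''')(w, 0)\<close>. Together with the exponentials in
  \<open>EE\<close> it forms \<open>PP\<close>, the factor that is symmetric in the two
  fields.\<close>

definition NN :: "'k V0 \<Rightarrow> 'k V0 \<Rightarrow> 'k V0 \<Rightarrow> ('p, 'k V0 fls fls) tps" where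
  "NN c a b = sweedler (act scalYY) c (\<lambda>c' c''. inn (M a c') * out (\<rho> b c''))"

definition PP :: "'k V0 \<Rightarrow> 'k V0 \<Rightarrow> 'k V0 \<Rightarrow> ('p, 'k V0 fls fls) tps" where
  "PP c = conv2 scalYY EE (NN c)"

definition yy :: "'k V0 \<Rightarrow> 'k V0 \<Rightarrow> 'k V0 \<Rightarrow> ('p, 'k V0 fls fls) tps" where
  "yy a b c = conv2 scalYY rzw (PP c) a b"

text \<open>\<open>M(a, -)\<close> is distributed over the product
  \<open>e^(wD)(b') c' r(b'', c'')(w, 0)\<close>: on the exponential it yields the two-point
  function, on \<open>c'\<close> the interaction with the vector, and the scalar factor passes
  through. What remains is to reorder the Sweedler sums into a convolution.\<close>

lemma MM_Y0: "MM (Y0 r a) (Y0 r b c) = yy a b c"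
proof -
  let ?s = "sweedler (act scalYY)"
  have Ma: "additive (M a)" for a
    by (simp add: additive_def M_add)
  have \<rho>c: "\<rho> b c = tmap (flsmap (single 0)) (tmap (\<lambda>g. fls_nth (expn 0 1 g) 0) (r b c))" for b c
    by (rule tps_eqI) (simp add: \<rho>_def at_w0_eq)
  have 1: "MM (M a) (Y0 r b c) = ?s b (\<lambda>b1 b2. ?s c (\<lambda>c1 c2. ?s a (\<lambda>a1 a2. ?s b1 (\<lambda>b3 b4.
      tconst (flsmap fls_const (exp_zD b3)) * rzw a1 b4 * inn (M a2 c1) * out (\<rho> b2 c2)))))" for a
  proof -
    have "MM (M a) (EY b1 c1 * \<rho> b2 c2) = flift (M a) (exp_zD b1 * fls_const c1) * out (\<rho> b2 c2)" for b1 c1 b2 c2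
      unfolding \<rho>c EY_def
      by (subst MM_mult[OF Ma M_scl(1)])
        (simp add: MM_def tapp_tconst additive.zero[OF additive_flift[OF Ma]] flip: tconst_mult)
    then show ?thesis
      by (simp add: Y0_eq conv2_def MM_sw[OF Ma M_scl(1)] flift_exp_const flift_exp sw_mult_const)
  qed
  have "MM (Y0 r a) (Y0 r b c) = ?s a (\<lambda>a' a''. tconst (fls_const (exp_zD a')) * MM (M a'') (Y0 r b c))"
  proof -
    have "MM (Y0 r a) U = ?s a (\<lambda>a' a''. tconst (fls_const (exp_zD a')) * MM (M a'') U)" for U
      unfolding Y0_M[abs_def] by (subst MM_sw_fun) (simp_all add: M_0 MM_mult_fun tmap_tconst)
    then show ?thesis .
  qed
  also have "\<dots> = ?s a (\<lambda>a1 a2. ?s b (\<lambda>b1 b2. ?s c (\<lambda>c1 c2. ?s a2 (\<lambda>a3 a4. ?s b1 (\<lambda>b3 b4.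
      EE a1 b3 * (rzw a3 b4 * (inn (M a4 c1) * out (\<rho> b2 c2))))))))"
    by (simp add: 1 sw_mult_const EE_def mult.assoc)
  also have "\<dots> = ?s a (\<lambda>a1 a2. ?s b (\<lambda>b1 b2. ?s a2 (\<lambda>a3 a4. ?s b1 (\<lambda>b3 b4. ?s c (\<lambda>c1 c2.
      EE a1 b3 * (rzw a3 b4 * (inn (M a4 c1) * out (\<rho> b2 c2))))))))"
    by (subst (3) mYY.sw_swap, subst (4) mYY.sw_swap) (rule refl)
  also have "\<dots> = ?s a (\<lambda>a1 a2. ?s a2 (\<lambda>a3 a4. ?s b (\<lambda>b1 b2. ?s b1 (\<lambda>b3 b4. 
      EE a1 b3 * (rzw a3 b4 * NN c a4 b2)))))"
    by (subst (2) mYY.sw_swap) (simp add: NN_def sw_mult_const)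
  also have "\<dots> = ?s a (\<lambda>a1 a2. ?s a2 (\<lambda>a3 a4. ?s b (\<lambda>b1 b2. ?s b2 (\<lambda>b3 b4. 
      EE a1 b1 * (rzw a3 b3 * NN c a4 b4)))))"
    by (simp add: mYY.sw_coassoc[of b])
  also have "\<dots> = ?s a (\<lambda>a1 a2. ?s b (\<lambda>b1 b2. ?s a2 (\<lambda>a3 a4. ?s b2 (\<lambda>b3 b4. 
      EE a1 b1 * (rzw a3 b3 * NN c a4 b4)))))"
    by (subst (2) mYY.sw_swap) (rule refl)
  also have "\<dots> = conv2 scalYY EE (conv2 scalYY rzw (NN c)) a b"
    by (simp add: conv2_def sw_mult_const)
  also have "\<dots> = conv2 scalYY (conv2 scalYY rzw EE) (NN c) a b"
    unfolding conv2_assoc[OF rhom_scalYY] by (rule conv2_cong) (simp_all add: conv2_comm[OF rhom_scalYY, of EE])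
  also have "\<dots> = yy a b c"
    unfolding yy_def PP_def by (rule conv2_assoc[OF rhom_scalYY, symmetric])
  finally show ?thesis .
qed

lemma additive_MM_args: "additive (\<lambda>c. yy a b c)" "additive (\<lambda>b. yy a b c)" "additive (\<lambda>a. yy a b c)"
proof -
  show "additive (\<lambda>c. yy a b c)" "additive (\<lambda>b. yy a b c)"
    by (simp_all add: additive_def Y0_add MM_add[OF additive_Y0(1)] flip: MM_Y0)
  show "additive (\<lambda>a. yy a b c)"
    by (simp add: additive_def yy_def conv2_def mYY.sw_add)
qed

lemma YY_eq: "Y_r r a m (Y_r r b n c) = tmap (\<lambda>F. fls_nth (fls_nth F n) m) (tapp (\<lambda>a0. tapp (\<lambda>b0. tapp (yy a0 b0) c) b) a)"
proof -
  have A: "tapp (\<lambda>u. tmap (\<lambda>F. fls_nth F m) (Y0 r a0 u)) (tmap (\<lambda>F. fls_nth F n) (Y0 r b0 c0)) =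
      tmap (\<lambda>F. fls_nth (fls_nth F n) m) (yy a0 b0 c0)" for a0 b0 c0
    by (simp add: tmap_tmap additive.zero[OF additive_Y0(1)] flip: tmap_tapp[OF additive_nth] MM_Y0 nth_MM)
  have ad: "additive (\<lambda>u. tmap (\<lambda>F. fls_nth F m) (Y0 r a0 u))" for a0
    by (simp add: additive_def Y0_add tmap_nth_add)
  have nn: "additive (\<lambda>F. fls_nth (fls_nth F n) m)"
    by (simp add: additive_def)
  show ?thesis
    by (simp add: Y_r_tapp[of a] Y_r_tapp[of b] tapp_comp[OF ad] A tmap_tapp[OF nn])
qed

end

section \<open>Equality of double series up to a power of \<open>z - w\<close>\<close>

definition ttrans :: "('p, 'v::comm_ring_1 fls fls) tps \<Rightarrow> ('p, 'v fls fls) tps \<Rightarrow> bool" where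
  "ttrans X Y \<longleftrightarrow> (\<forall>n. trans_fls (tcoeff X n) (tcoeff Y n))"

lemma ttrans_mult: "ttrans X X' \<Longrightarrow> ttrans Y Y' \<Longrightarrow> ttrans (X * Y) (X' * Y')"
  by (auto simp: ttrans_def tcoeff_mult intro!: trans_fls_sum trans_fls_mult)

lemma ttrans_sum: "(\<And>i. i \<in> A \<Longrightarrow> ttrans (f i) (g i)) \<Longrightarrow> ttrans (sum f A) (sum g A)"
  by (auto simp: ttrans_def tcoeff_sum intro!: trans_fls_sum)

lemma ttrans_tconst: "trans_fls F F' \<Longrightarrow> ttrans (tconst F) (tconst F')"
  by (simp add: ttrans_def tcoeff_tconst trans_fls_0)

lemma ttrans_scalYY: "ttrans (scalYY c) (scalYY c)"
  unfolding scalYY_def by (rule ttrans_tconst) (auto simp: trans_fls_def)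

lemma ttrans_sw: "(\<And>x y. ttrans (B x y) (C x y)) \<Longrightarrow> ttrans (sweedler (act scalYY) a B) (sweedler (act scalYY) a C)"
  by (auto simp: sweedler_eq_ext ext_def act_def intro!: ttrans_sum ttrans_mult ttrans_scalYY)

lemma ttrans_inn_out: "ttrans (inn X) (out X)" "ttrans (out X) (inn X)"
  by (auto simp: ttrans_def trans_fls_const trans_fls_const')

definition Zzw :: "'v::comm_ring_1 fls fls" where
  "Zzw = fls_const fls_X - fls_X"

definition Zwz :: "'v::comm_ring_1 fls fls" where
  "Zwz = fls_X - fls_const fls_X"

lemma zw_exp_diff: "zw_exp (xv 0 - xv 1) = Zzw" "wz_exp (xv 0 - xv 1) = Zwz"
  by (simp_all add: khom_diff[OF khom_zw_exp] khom_diff[OF khom_wz_exp] K0_xv zw_exp_simps wz_exp_simps Zzw_def Zwz_def)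

lemma khom_power: "khom f \<Longrightarrow> g \<in> K0 \<Longrightarrow> f (g ^ n) = f g ^ n"
  by (induction n) (auto simp: khom_1 khomD K0_power)

lemma exp_diff_power: "g \<in> K0 \<Longrightarrow> zw_exp ((xv 0 - xv 1) ^ N * g) = Zzw ^ N * zw_exp g"
  "g \<in> K0 \<Longrightarrow> wz_exp ((xv 0 - xv 1) ^ N * g) = Zwz ^ N * wz_exp g"
  by (simp_all add: khomD[OF khom_zw_exp] khomD[OF khom_wz_exp] K0_power K0_diff01 khom_power[OF khom_zw_exp]
      khom_power[OF khom_wz_exp] zw_exp_diff)

text \<open>The exponent \<open>N\<close> must not depend on \<open>i\<close>, which stands for the vectors that the two fields are applied to.\<close>

definition loc :: "nat \<Rightarrow> ('i \<Rightarrow> ('p, 'v::comm_ring_1 fls fls) tps) \<Rightarrow> ('i \<Rightarrow> ('p, 'v fls fls) tps) \<Rightarrow> bool" where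
  "loc M X Y \<longleftrightarrow> (\<forall>\<^sub>F N in sequentially. \<forall>i n. size n < M \<longrightarrow>
     trans_fls (Zzw ^ N * tcoeff (X i) n) (Zwz ^ N * tcoeff (Y i) n))"

lemma loc_sum:
  assumes "finite A" "\<And>j. j \<in> A \<Longrightarrow> loc M (X j) (Y j)"
  shows "loc M (\<lambda>i. \<Sum>j\<in>A. X j i) (\<lambda>i. \<Sum>j\<in>A. Y j i)"
proof -
  have "\<forall>\<^sub>F N in sequentially. \<forall>j\<in>A. \<forall>i n. size n < M \<longrightarrow>
     trans_fls (Zzw ^ N * tcoeff (X j i) n) (Zwz ^ N * tcoeff (Y j i) n)"
    using assms by (intro eventually_ball_finite) (auto simp: loc_def)
  then show ?thesis
    unfolding loc_def by eventually_elim (simp add: tcoeff_sum sum_distrib_left trans_fls_sum)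
qed

text \<open>\<open>P\<close> and \<open>Q\<close> are already the same double series, so the
  exponent found for \<open>X\<close> and \<open>Y\<close> serves for the products.\<close>

lemma loc_mult:
  assumes "loc M X Y" "\<And>i. ttrans (P i) (Q i)"
  shows "loc M (\<lambda>i. X i * P i) (\<lambda>i. Y i * Q i)"
  using assms(1) unfolding loc_def
proof eventually_elim
  case (elim N)
  show ?case
  proof (intro allI impI)
    fix i and n :: "'b multiset"
    assume n: "size n < M"
    have "trans_fls (\<Sum>(k, l) | k + l = n. (Zzw ^ N * tcoeff (X i) k) * tcoeff (P i) l)
      (\<Sum>(k, l) | k + l = n. (Zwz ^ N * tcoeff (Y i) k) * tcoeff (Q i) l)"
    proof (rule trans_fls_sum, clarify)
      fix k l
      assume "n = k + l"
      then have "trans_fls (Zzw ^ N * tcoeff (X i) k) (Zwz ^ N * tcoeff (Y i) k)" "trans_fls (tcoeff (P i) l) (tcoeff (Q i) l)"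
        using n elim assms(2) by (auto simp: ttrans_def)
      then show "trans_fls (Zzw ^ N * tcoeff (X i) k * tcoeff (P i) l) (Zwz ^ N * tcoeff (Y i) k * tcoeff (Q i) l)"
        by (rule trans_fls_mult)
    qed
    then show "trans_fls (Zzw ^ N * tcoeff (X i * P i) n) (Zwz ^ N * tcoeff (Y i * Q i) n)"
      by (simp add: tcoeff_mult sum_distrib_left mult.assoc case_prod_unfold)
  qed
qed

lemma loc_sw:
  assumes "\<And>x y. loc M (X x y) (Y x y)"
  shows "loc M (\<lambda>i. sweedler (act scalYY) a (\<lambda>x y. X x y i)) (\<lambda>i. sweedler (act scalYY) a (\<lambda>x y. Y x y i))"
  unfolding sweedler_eq_ext ext_def
proof (rule loc_sum)
  fix p :: "mon \<times> mon"
  obtain b c where p: "p = (b, c)"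
    by (cases p)
  show "loc M (\<lambda>i. act scalYY (lookup (comult a) p) (case p of (b, c) \<Rightarrow> X (bas b) (bas c) i))
     (\<lambda>i. act scalYY (lookup (comult a) p) (case p of (b, c) \<Rightarrow> Y (bas b) (bas c) i))"
    unfolding act_def p prod.case mult.commute[of "scalYY _"]
    by (rule loc_mult[OF assms]) (rule ttrans_scalYY)
qed simp

lemma loc_const:
  fixes X :: "('p::finite, 'k::field_char_0 ratfun) tps"
  assumes "X \<in> KT"
  shows "loc M (\<lambda>i. tmap zw_exp X) (\<lambda>i. tmap wz_exp X :: ('p, ('b::comm_monoid_add \<Rightarrow>\<^sub>0 'k) fls fls) tps)"
proof -
  have "\<forall>\<^sub>F N in sequentially. trans_fls (Zzw ^ N * zw_exp (tcoeff X n) :: ('b \<Rightarrow>\<^sub>0 'k) fls fls) (Zwz ^ N * wz_exp (tcoeff X n))" for n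
    using trans_fls_expansion[of "tcoeff X n"] assms
    by (auto simp: KT_def exp_diff_power eventually_sequentially)
  then have "\<forall>\<^sub>F N in sequentially. \<forall>n\<in>{n. size n < M}. trans_fls (Zzw ^ N * zw_exp (tcoeff X n) :: ('b \<Rightarrow>\<^sub>0 'k) fls fls) (Zwz ^ N * wz_exp (tcoeff X n))"
    by (intro eventually_ball_finite finite_size_less) auto
  then show ?thesis
    unfolding loc_def by eventually_elim auto
qed

lemma loc_tapp:
  fixes x :: "('p::finite, 'a) tps" and f g :: "'i \<Rightarrow> 'a \<Rightarrow> ('p, 'v::comm_ring_1 fls fls) tps"
  assumes "\<And>j. loc M (\<lambda>i. f i (tcoeff x j)) (\<lambda>i. g i (tcoeff x j))"
  shows "loc M (\<lambda>i. tapp (f i) x) (\<lambda>i. tapp (g i) x)"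
proof -
  have "\<forall>\<^sub>F N in sequentially. \<forall>j\<in>{j. size j < M}. \<forall>i n. size n < M \<longrightarrow>
     trans_fls (Zzw ^ N * tcoeff (f i (tcoeff x j)) n) (Zwz ^ N * tcoeff (g i (tcoeff x j)) n)"
    using assms by (intro eventually_ball_finite finite_size_less) (auto simp: loc_def)
  then show ?thesis
    unfolding loc_def
  proof eventually_elim
    case (elim N)
    show ?case
    proof (intro allI impI)
      fix i and n :: "'p multiset"
      assume n: "size n < M"
      show "trans_fls (Zzw ^ N * tcoeff (tapp (f i) x) n) (Zwz ^ N * tcoeff (tapp (g i) x) n)"
        unfolding tcoeff_tapp sum_distrib_left case_prod_unfold
        using n elim by (intro trans_fls_sum) auto
    qed
  qed
qed

text \<open>Here the series acted upon is the varying index, so one exponent must serve the values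
  of \<open>f\<close> and \<open>g\<close> at all arguments. For a fixed series, as in
  \<open>loc_tapp\<close>, a maximum over its finitely many relevant coefficients is enough.\<close>

lemma loc_tapp_family:
  fixes f g :: "'a \<Rightarrow> ('p::finite, 'v::comm_ring_1 fls fls) tps"
  assumes "loc M f g"
  shows "loc M (tapp f) (tapp g)"
  using assms unfolding loc_def
proof eventually_elim
  case (elim N)
  show ?case
  proof (intro allI impI)
    fix x and n :: "'p multiset"
    assume n: "size n < M"
    show "trans_fls (Zzw ^ N * tcoeff (tapp f x) n) (Zwz ^ N * tcoeff (tapp g x) n)"
      unfolding tcoeff_tapp sum_distrib_left case_prod_unfold
      using n elim by (intro trans_fls_sum) auto
  qed
qed

lemma mul_zw_pow:
  "(mul_zw ^^ N) (\<lambda>m n. fls_nth (fls_nth F n) m) = (\<lambda>m n. fls_nth (fls_nth (Zzw ^ N * F) n) m)"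
  for F :: "'v::comm_ring_1 fls fls"
proof (induction N)
  case (Suc N)
  have "fls_nth (fls_nth (Zzw * G) n) m = fls_nth (fls_nth G n) (m - 1) - fls_nth (fls_nth G (n - 1)) m" for G :: "'v fls fls" and m n
    by (simp add: Zzw_def left_diff_distrib fls_X_times_conv_shift)
  then show ?case
    unfolding funpow.simps o_apply Suc power_Suc mult.assoc by (simp add: mul_zw_def)
qed simp

text \<open>With \<open>z\<close> as outer variable, \<open>w - z\<close> is the negative of
  \<open>Zwz\<close>.\<close>

lemma mul_wz_pow:
  "(mul_wz ^^ N) (\<lambda>m n. fls_nth (fls_nth F m) n) = (\<lambda>m n. fls_nth (fls_nth ((- Zwz) ^ N * F) m) n)"
  for F :: "'v::comm_ring_1 fls fls"
proof (induction N)
  case (Suc N)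
  have "fls_nth (fls_nth ((- Zwz) * G) m) n = fls_nth (fls_nth G m) (n - 1) - fls_nth (fls_nth G (m - 1)) n" for G :: "'v fls fls" and m n
    by (simp add: Zwz_def left_diff_distrib fls_X_times_conv_shift)
  then show ?case
    unfolding funpow.simps o_apply Suc power_Suc mult.assoc by (simp only: mul_wz_def)
qed simp

lemma tcoeff_mul_zw: "tcoeff ((mul_zw ^^ N) F m n) j = (mul_zw ^^ N) (\<lambda>m n. tcoeff (F m n) j) m n"
  and tcoeff_mul_wz: "tcoeff ((mul_wz ^^ N) F m n) j = (mul_wz ^^ N) (\<lambda>m n. tcoeff (F m n) j) m n"
  by (induction N arbitrary: m n) (simp_all add: mul_zw_def mul_wz_def)

text \<open>Identifies the formal sum in \<open>YYX\<close> with a product of double series. The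
  lower bounds of the inner series depend on the outer index, so the finite set supporting the sum
  is a dependent family of intervals.\<close>

lemma nth_nth_scalar_mult:
  fixes F :: "'k::field_char_0 fls fls" and G :: "'k V0 fls fls"
  shows "fls_nth (fls_nth (flsmap (flsmap (single 0)) F * G) m) n =
    (\<Sum>(p, q). scl (fls_nth (fls_nth F p) q) (fls_nth (fls_nth G (m - p)) (n - q)))"
proof -
  obtain a where a: "\<And>i. i < a \<Longrightarrow> fls_nth F i = 0"
    using fls_lower_bound by blast
  obtain b where b: "\<And>i. i < b \<Longrightarrow> fls_nth G i = 0"
    using fls_lower_bound by blast
  have s0: "flsmap (single 0) (0 :: 'k fls) = (0 :: 'k V0 fls)"
    by (simp add: fls_eq_iff)
  obtain c where c: "\<And>p j. j < c p \<Longrightarrow> fls_nth (fls_nth F p) j = 0"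
    using choice[of "\<lambda>p c. \<forall>j<c. fls_nth (fls_nth F p) j = 0"] fls_lower_bound by blast
  obtain d where d: "\<And>p j. j < d p \<Longrightarrow> fls_nth (fls_nth G p) j = 0"
    using choice[of "\<lambda>p c. \<forall>j<c. fls_nth (fls_nth G p) j = 0"] fls_lower_bound by blast
  let ?g = "\<lambda>p q. scl (fls_nth (fls_nth F p) q) (fls_nth (fls_nth G (m - p)) (n - q))"
  let ?S = "SIGMA p:{a..m - b}. {c p..n - d (m - p)}"
  have "fls_nth (fls_nth (flsmap (flsmap (single 0)) F * G) m) n = (\<Sum>p=a..m - b. \<Sum>q=c p..n - d (m - p). ?g p q)"
    by (simp add: fls_mult_nth_bound[of a _ b] a b s0 fls_nth_sum)
      (intro sum.cong refl, subst fls_mult_nth_bound, auto simp: c d scl_mult)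
  also have "\<dots> = (\<Sum>(p, q)\<in>?S. ?g p q)"
    by (subst sum.Sigma) auto
  also have "\<dots> = (\<Sum>(p, q). ?g p q)"
  proof (rule Sum_any.expand_superset[symmetric])
    have "p \<in> {a..m - b}" "q \<in> {c p..n - d (m - p)}" if "?g p q \<noteq> 0" for p q
    proof -
      have "fls_nth (fls_nth F p) q \<noteq> 0" "fls_nth (fls_nth G (m - p)) (n - q) \<noteq> 0"
        using that by (auto simp: scl_zero)
      then have "\<not> p < a" "\<not> m - p < b" "\<not> q < c p" "\<not> n - q < d (m - p)"
        using a b c d by (metis fls_zero_nth)+
      then show "p \<in> {a..m - b}" "q \<in> {c p..n - d (m - p)}"
        by auto
    qed
    then show "{pq. (case pq of (p, q) \<Rightarrow> ?g p q) \<noteq> 0} \<subseteq> ?S"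
      by auto
  qed auto
  finally show ?thesis .
qed

text \<open>The action of a vector of \<open>V \<otimes> V \<otimes> K\<close> in
  \<open>YYX\<close>: the basis tensor \<open>p\<close> is replaced by a product of fields
  \<open>K p\<close>, and its coefficient by the expansion in \<open>|w| > |z|\<close>.\<close>

definition HH :: "(mon \<times> mon \<Rightarrow> ('p, 'k::field_char_0 V0 fls fls) tps) \<Rightarrow> (mon \<times> mon \<Rightarrow>\<^sub>0 'k ratfun) \<Rightarrow>
    ('p, 'k V0 fls fls) tps" where
  "HH K x = (\<Sum>p\<in>keys x. tconst (wz_exp (lookup x p)) * K p)"

lemma HH_superset:
  assumes "finite S" "keys x \<subseteq> S"
  shows "HH K x = (\<Sum>p\<in>S. tconst (wz_exp (lookup x p)) * K p)"
  unfolding HH_def using assms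
  by (intro sum.mono_neutral_left) (auto simp: in_keys_iff khom_0[OF khom_wz_exp])

lemma HH_add_on: "add_on KV0 (HH K)"
  unfolding add_on_def
proof (intro conjI ballI)
  fix x y :: "mon \<times> mon \<Rightarrow>\<^sub>0 'a ratfun"
  assume xy: "x \<in> KV0" "y \<in> KV0"
  let ?S = "keys x \<union> keys y"
  have S: "finite ?S" "keys x \<subseteq> ?S" "keys y \<subseteq> ?S" "keys (x + y) \<subseteq> ?S"
    by (auto dest: subsetD[OF keys_add])
  have "wz_exp (lookup x p + lookup y p) = wz_exp (lookup x p) + (wz_exp (lookup y p) :: 'a V0 fls fls)" for p
    using xy unfolding KV0_def by (intro khomD(1)[OF khom_wz_exp]) blast+
  then show "HH K (x + y) = HH K x + HH K y"
    by (simp only: HH_superset[OF S(1,2)] HH_superset[OF S(1,3)] HH_superset[OF S(1,4)] lookup_add tconst_add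
        distrib_right sum.distrib)
qed (auto simp: KV0_0 KV0_add)

lemma HH_scl: "c \<in> K0 \<Longrightarrow> x \<in> KV0 \<Longrightarrow> HH K (scl c x) = tconst (wz_exp c) * HH K x"
proof -
  assume cx: "c \<in> K0" "x \<in> KV0"
  have S: "keys (scl c x) \<subseteq> keys x"
    by (auto simp: in_keys_iff)
  have "wz_exp (c * lookup x p) = wz_exp c * (wz_exp (lookup x p) :: 'a V0 fls fls)" for p
    using cx unfolding KV0_def by (intro khomD(2)[OF khom_wz_exp]) blast+
  then show ?thesis
    by (simp add: HH_superset[OF _ S] HH_superset[of "keys x" x] sum_distrib_left tconst_mult mult.assoc)
qed

lemma HH_bas: "HH K (bas p) = K p"
  by (subst HH_superset[of "{p}"]) (simp_all add: bas_def khom_1[OF khom_wz_exp])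

lemma tapp_HH_add_on: "add_on KV (tapp (HH K))"
proof -
  have "tapp (HH K) (X + Y) = tapp (HH K) X + tapp (HH K) Y" if "X \<in> KV" "Y \<in> KV" for X Y
    using that HH_add_on[of K]
    by (intro tps_eqI) (simp add: tcoeff_tapp case_prod_unfold KV_def add_on_def sum.distrib)
  then show ?thesis
    by (auto simp: add_on_def KV_0 KV_add)
qed

lemma tapp_HH_tscl:
  assumes "X \<in> KT" "V \<in> KV"
  shows "tapp (HH K) (tscl X V) = tmap wz_exp X * tapp (HH K) V"
proof (rule tps_eqI)
  fix n
  have s: "HH K (\<Sum>(k, l) | k + l = i. scl (tcoeff X k) (tcoeff V l)) =
      (\<Sum>(k, l) | k + l = i. tconst (wz_exp (tcoeff X k)) * HH K (tcoeff V l))" for i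
    using assms by (subst add_on_sum[OF HH_add_on]) (auto simp: KT_def KV_def KV0_scl HH_scl case_prod_unfold)
  have "tcoeff (tapp (HH K) (tscl X V)) n =
    (\<Sum>(i, j) | i + j = n. \<Sum>(k, l) | k + l = i. wz_exp (tcoeff X k) * tcoeff (HH K (tcoeff V l)) j)"
    unfolding tcoeff_tapp tcoeff_tscl s by (simp add: tcoeff_sum case_prod_unfold tconst_mult_left)
  also have "\<dots> = tcoeff (tmap wz_exp X * tapp (HH K) V) n"
    unfolding sum_decomp_assoc by (simp add: tcoeff_mult tcoeff_tapp sum_distrib_left case_prod_unfold)
  finally show "tcoeff (tapp (HH K) (tscl X V)) n = tcoeff (tmap wz_exp X * tapp (HH K) V) n" .
qed

lemma tapp_HH_RR:
  assumes f: "\<And>a b. f a b \<in> KT" and K: "\<And>b c. K (b, c) = G (bas b) (bas c)"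
  shows "tapp (HH K) (RR f a b) = conv2 scalYY (\<lambda>a b. tmap wz_exp (f a b)) G a b"
proof -
  have s: "tapp (HH K) (sR c V) = act scalYY c (tapp (HH K) V)" if "V \<in> KV" for c V
    using that by (simp add: sR_def tapp_HH_tscl KT_const tmap_scalK[OF khom_wz_exp] act_def wz_exp_simps scalYY_def)
  have t: "tapp (HH K) (tb2 (bas x) (bas y)) = G (bas x) (bas y)" for x y
    unfolding tb2_bas tbas_def by (subst tapp_tconst) (simp_all add: HH_bas K, simp add: HH_def)
  have "tapp (HH K) (RR f a b) =
      sweedler (act scalYY) a (\<lambda>a' a''. tapp (HH K) (sweedler sR b (\<lambda>b' b''. tscl (f a'' b'') (tb2 a' b'))))"
    unfolding RR_def
    by (intro sw_hom_on[OF tapp_HH_add_on] s KV_sR KV_sw KV_tscl f KV_tb2)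
  also have "\<dots> = sweedler (act scalYY) a (\<lambda>a' a''. sweedler (act scalYY) b (\<lambda>b' b''. tapp (HH K) (tscl (f a'' b'') (tb2 a' b'))))"
    by (intro sw_cong sw_hom_on[OF tapp_HH_add_on] s KV_sR KV_sw KV_tscl f KV_tb2)
  also have "\<dots> = sweedler (act scalYY) a (\<lambda>a' a''. sweedler (act scalYY) b (\<lambda>b' b''. tmap wz_exp (f a'' b'') * G a' b'))"
    by (intro sw_cong) (simp add: tapp_HH_tscl f KV_tb2 t)
  also have "\<dots> = conv2 scalYY G (\<lambda>a b. tmap wz_exp (f a b)) a b"
    by (simp add: conv2_def mult.commute)
  finally show ?thesis
    by (simp add: conv2_comm[OF rhom_scalYY])
qed

context bichar
begin

text \<open>The product of fields after the braiding: the two-point function is expanded in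
  \<open>|w| > |z|\<close>, and the symmetric factor is read with the pairs exchanged.\<close>

definition yy' :: "'k V0 \<Rightarrow> 'k V0 \<Rightarrow> 'k V0 \<Rightarrow> ('p, 'k V0 fls fls) tps" where
  "yy' a b c = conv2 scalYY rwz (\<lambda>a b. PP c b a) a b"

text \<open>The vector \<open>c\<close> is split in three; cocommutativity exchanges the parts
  paired with \<open>a\<close> and with \<open>b\<close>, and the exponentials commute.\<close>

lemma ttrans_PP: "ttrans (PP c a b) (PP c b a)"
proof -
  let ?s = "sweedler (act scalYY)"
  have M: "inn (M a b) = ?s b (\<lambda>b' b''. tconst (fls_const (fls_const b')) * inn (\<rho> a b''))" for a b
    unfolding M_def
    by (subst sw_hom[of inn "act scalY" "act scalYY"])
      (auto simp: additive_def inn_hom act_def inn_scalY tmap_tconst)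
  have N: "NN c a b = ?s c (\<lambda>c1 c2. ?s c1 (\<lambda>c3 c4. tconst (fls_const (fls_const c3)) * inn (\<rho> a c4) * out (\<rho> b c2)))" for a b
    by (simp add: NN_def M sw_mult_const)
  have N': "NN c b a = ?s c (\<lambda>c1 c2. ?s c1 (\<lambda>c3 c4. tconst (fls_const (fls_const c3)) * inn (\<rho> b c2) * out (\<rho> a c4)))" for a b
    unfolding N by (rule mYY.sw_swap23)
  have NN: "ttrans (NN c a b) (NN c b a)" for a b
  proof -
    have "ttrans (tconst (fls_const (fls_const c3)) * inn (\<rho> a c4) * out (\<rho> b c2))
      (tconst (fls_const (fls_const c3)) * inn (\<rho> b c2) * out (\<rho> a c4))" for c2 c3 c4
    proof -
      have "ttrans (tconst (fls_const (fls_const c3)) * inn (\<rho> a c4) * out (\<rho> b c2))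
        (tconst (fls_const (fls_const c3)) * out (\<rho> a c4) * inn (\<rho> b c2))"
        by (intro ttrans_mult ttrans_inn_out ttrans_tconst) (auto simp: trans_fls_def)
      then show ?thesis
        by (simp add: mult_ac)
    qed
    then show ?thesis
      unfolding N[of a b] N'[of b a] by (intro ttrans_sw)
  qed
  have EE: "ttrans (EE a b) (EE b a)" for a b
  proof -
    have "ttrans (EE a b) (tconst (flsmap fls_const (exp_zD a)) * tconst (fls_const (exp_zD b)))"
      unfolding EE_def by (intro ttrans_mult ttrans_tconst trans_fls_const trans_fls_const')
    then show ?thesis
      by (simp add: EE_def mult.commute)
  qed
  have "PP c b a = conv2 scalYY (\<lambda>a b. EE b a) (\<lambda>a b. NN c b a) a b"
    unfolding PP_def by (rule conv2_swap[OF rhom_scalYY, symmetric])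
  then show ?thesis
    unfolding PP_def conv2_def by (simp only:) (intro ttrans_sw ttrans_mult EE NN)
qed

text \<open>By \<open>q_r\<close> the convolution is \<open>r^\<tau>(b, a)\<close>, that is
  \<open>r(a, b)\<close> with the variables exchanged, and the exchange turns the expansion in one
  region into that in the other.\<close>

lemma wz_q: "conv2 scalYY (\<lambda>b a. tmap zw_exp (q b a)) rzw b a = rwz a b"
proof -
  have "conv2 scalYY (\<lambda>b a. tmap zw_exp (q b a)) rzw b a = tmap zw_exp (conv2 scalK q r b a)"
    unfolding rzw_def
    by (rule conv2_hom_on(1)[OF rhom_scalK rhom_scalYY add_on_tmap[OF khom_zw_exp], symmetric])
      (auto simp: KT_mult KT_const tmap_khom[OF khom_zw_exp] tmap_scalK[OF khom_zw_exp] zw_exp_simps scalYY_def q_KT r_KT)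
  also have "\<dots> = rwz a b"
    using r_KT[of a b]
    by (intro tps_eqI) (simp add: q_r rtau_def bc_tau_def rwz_def zw_exp_def wz_exp_def KT_def expn_subst2)
  finally show ?thesis .
qed

end

locale bichar_fin = bichar r for r :: "('p::finite, 'k::field_char_0) bichar"
begin

lemma loc_yy_yy': "loc M' (\<lambda>c. yy a b c) (\<lambda>c. yy' a b c)"
  unfolding yy_def yy'_def conv2_def rzw_def rwz_def
  by (intro loc_sw loc_mult loc_const r_KT ttrans_PP)

text \<open>\<open>YYX\<close> applies \<open>HH\<close> to the braided tensor, which gives the
  convolution of the expanded scalar \<open>q\<close> with the product of fields. Associativity
  brings \<open>q\<close> next to \<open>r\<close>, where \<open>wz_q\<close> applies.\<close>

lemma YYX_eq: "YYX (Y_r r) (tmap (Poly_Mapping.map (subst2 1 0)) (R_r r (ttens b a))) c m n =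
    tmap (\<lambda>F. fls_nth (fls_nth F m) n) (tapp (\<lambda>a0. tapp (\<lambda>b0. tapp (yy' a0 b0) c) b) a)"
proof -
  define X where "X = tmap (Poly_Mapping.map (subst2 1 0)) (R_r r (ttens b a))"
  define K where "K = (\<lambda>(b, a). tapp (yy (bas b) (bas a)) c)"
  have khs: "khom (subst2 1 0 :: 'k ratfun \<Rightarrow> _)"
    by (rule khom_subst2) simp
  have YY: "Y_r r (tbas b) n (Y_r r (tbas a) m c) = tmap (\<lambda>F. fls_nth (fls_nth F m) n) (K (b, a))" for a b m n
    unfolding YY_eq tbas_def K_def prod.case
    by (subst tapp_tconst, simp add: tcoeff_tapp additive.zero[OF additive_MM_args(3)] tps_eqI,
        subst tapp_tconst) (auto intro!: tps_eqI simp: tcoeff_tapp additive.zero[OF additive_MM_args(2)])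
  have "YYX (Y_r r) X c m n = tmap (\<lambda>F. fls_nth (fls_nth F m) n) (tapp (HH K) X)"
  proof (rule tps_eqI)
    fix N
    have "(\<Sum>(p, q). scl (fls_nth (fls_nth (expn 1 0 g) p) q) (tcoeff (Y_r r (tbas b) (n - q) (Y_r r (tbas a) (m - p) c)) j)) =
        fls_nth (fls_nth (wz_exp g * tcoeff (K (b, a)) j) m) n" for g a b j
      unfolding wz_exp_def nth_nth_scalar_mult by (simp add: YY)
    then show "tcoeff (YYX (Y_r r) X c m n) N = tcoeff (tmap (\<lambda>F. fls_nth (fls_nth F m) n) (tapp (HH K) X)) N"
      by (simp add: YYX_def tcoeff_tapp HH_def tcoeff_sum tconst_mult_left fls_nth_sum case_prod_unfold)
  qed
  also have "tapp (HH K) X = tapp (\<lambda>b0. tapp (\<lambda>a0. tapp (HH K) (RR (qq 1 0) b0 a0)) a) b"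
  proof -
    have RK: "tcoeff (RR f x y) n \<in> KV0" if "\<And>a b. f a b \<in> KT" for f x y n
      using KV_RR[OF that] by (auto simp: KV_def)
    have tappK: "tcoeff (tapp f x) n \<in> KV0" if "\<And>a n. tcoeff (f a) n \<in> KV0" for f :: "'k V0 \<Rightarrow> ('p, mon \<times> mon \<Rightarrow>\<^sub>0 'k ratfun) tps" and x n
      using that by (auto simp: tcoeff_tapp intro!: KV0_sum)
    have ms: "add_on KV0 (Poly_Mapping.map (subst2 1 0) :: (mon \<times> mon \<Rightarrow>\<^sub>0 'k ratfun) \<Rightarrow> _)"
    proof -
      have "Poly_Mapping.map (subst2 1 0) (x + y) = Poly_Mapping.map (subst2 1 0) x + Poly_Mapping.map (subst2 1 0) y"
        if "x \<in> KV0" "y \<in> KV0" for x y :: "mon \<times> mon \<Rightarrow>\<^sub>0 'k ratfun"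
      proof (rule poly_mapping_eqI)
        fix p
        have "lookup x p \<in> K0" "lookup y p \<in> K0"
          using that by (auto simp only: KV0_def mem_Collect_eq)
        then show "lookup (Poly_Mapping.map (subst2 1 0) (x + y)) p = lookup (Poly_Mapping.map (subst2 1 0) x + Poly_Mapping.map (subst2 1 0) y) p"
          by (simp add: lookup_map0 khom_0[OF khs] lookup_add khomD[OF khs])
      qed
      then show ?thesis
        by (auto simp only: add_on_def KV0_0 KV0_add)
    qed
    have "scalar_ext (ttens b a) = tapp (\<lambda>b0. tapp (\<lambda>a0. tb2 b0 a0) a) b"
      by (simp add: scalar_ext_def ttens_def tconv_eq_tapp tmap_tapp[OF additive_mcst] tmap_tmap tb2_def flip: tmap_eq_tapp)
    then have "R_r r (ttens b a) = tapp (\<lambda>b0. tapp (\<lambda>a0. RR q b0 a0) a) b"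
      unfolding R_r_eq TT_def tlin_eq_tapp
      by (simp add: tapp_comp[OF additive_tl]) (simp flip: tlin_eq_tapp TT_def add: TT_tb2)
    then have "X = tapp (\<lambda>b0. tapp (\<lambda>a0. RR (qq 1 0) b0 a0) a) b"
      unfolding X_def
      by (simp add: tmap_tapp_on[OF ms] tappK RK q_KT tmap_map_RR[OF khs subst2_cst q_KT]) (simp add: qq_def[abs_def])
    then show ?thesis
      by (simp add: tapp_comp_on[OF HH_add_on] tappK RK qq_def KT_subst2 q_KT)
  qed
  also have "(\<lambda>b0. tapp (\<lambda>a0. tapp (HH K) (RR (qq 1 0) b0 a0)) a) = (\<lambda>b0. tapp (\<lambda>a0. tapp (yy' a0 b0) c) a)"
  proof -
    have "tapp (HH K) (RR (qq 1 0) b0 a0) = tapp (yy' a0 b0) c" for b0 a0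
    proof -
      have "tapp (HH K) (RR (qq 1 0) b0 a0) = conv2 scalYY (\<lambda>b a. tmap wz_exp (qq 1 0 b a)) (\<lambda>b a. tapp (yy b a) c) b0 a0"
        by (rule tapp_HH_RR) (simp_all add: qq_def KT_subst2 q_KT K_def)
      \<comment> \<open>The scalar is taken at \<open>(w, z)\<close>. Its expansion in
        \<open>|w| > |z|\<close> is, as a double series, that of \<open>q(z, w)\<close> in
        \<open>|z| > |w|\<close>.\<close>
      also have "(\<lambda>b a. tmap wz_exp (qq 1 0 b a)) = (\<lambda>b a. tmap zw_exp (q b a))"
        using q_KT by (auto intro!: HOL.ext tps_eqI simp: qq_def wz_exp_def zw_exp_def KT_def expn_subst2)
      also have "conv2 scalYY (\<lambda>b a. tmap zw_exp (q b a)) (\<lambda>b a. tapp (yy b a) c) b0 a0 =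
          tapp (\<lambda>c0. conv2 scalYY (\<lambda>b a. tmap zw_exp (q b a)) (\<lambda>b a. yy b a c0) b0 a0) c"
        by (simp add: conv2_def sweedler_eq_ext ext_def act_def mult_tapp case_prod_unfold flip: tapp_sum_fun)
      also have "(\<lambda>c0. conv2 scalYY (\<lambda>b a. tmap zw_exp (q b a)) (\<lambda>b a. yy b a c0) b0 a0) = yy' a0 b0"
      proof
        fix c0
        have "conv2 scalYY (\<lambda>b a. tmap zw_exp (q b a)) (\<lambda>b a. yy b a c0) b0 a0 =
            conv2 scalYY (conv2 scalYY (\<lambda>b a. tmap zw_exp (q b a)) rzw) (PP c0) b0 a0"
          unfolding yy_def by (rule conv2_assoc[OF rhom_scalYY])
        also have "\<dots> = conv2 scalYY (\<lambda>b a. rwz a b) (PP c0) b0 a0"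
          by (rule conv2_cong) (simp_all add: wz_q)
        also have "\<dots> = yy' a0 b0 c0"
          unfolding yy'_def by (rule conv2_swap[OF rhom_scalYY, symmetric])
        finally show "conv2 scalYY (\<lambda>b a. tmap zw_exp (q b a)) (\<lambda>b a. yy b a c0) b0 a0 = yy' a0 b0 c0" .
      qed
      finally show ?thesis .
    qed
    then show ?thesis by simp
  qed
  also have "tapp (\<lambda>b0. tapp (\<lambda>a0. tapp (yy' a0 b0) c) a) b = tapp (\<lambda>a0. tapp (\<lambda>b0. tapp (yy' a0 b0) c) b) a"
    by (rule tapp_swap)
  finally show ?thesis
    by (simp only: X_def)
qed

lemma Y_r_locality: "\<exists>N. \<forall>c m n. tcong M' ((mul_zw ^^ N) (\<lambda>m n. Y_r r a m (Y_r r b n c)) m n)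
    ((mul_wz ^^ N) (YYX (Y_r r) (tmap (Poly_Mapping.map (subst2 1 0)) (R_r r (ttens b a))) c) m n)"
proof -
  define G where "G c = tapp (\<lambda>a0. tapp (\<lambda>b0. tapp (yy a0 b0) c) b) a" for c
  define G' where "G' c = tapp (\<lambda>a0. tapp (\<lambda>b0. tapp (yy' a0 b0) c) b) a" for c
  have "loc M' G G'"
    unfolding G_def[abs_def] G'_def[abs_def]
    by (intro loc_tapp loc_tapp_family loc_yy_yy')
  then obtain N0 where N0: "\<And>N c n. N \<ge> N0 \<Longrightarrow> size n < M' \<Longrightarrow>
      trans_fls (Zzw ^ N * tcoeff (G c) n) (Zwz ^ N * tcoeff (G' c) n)"
    unfolding loc_def eventually_sequentially by blast
  \<comment> \<open>An even exponent makes the powers of \<open>w - z\<close> and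
    \<open>z - w\<close> equal.\<close>
  have "tcong M' ((mul_zw ^^ (2 * N0)) (\<lambda>m n. Y_r r a m (Y_r r b n c)) m n)
    ((mul_wz ^^ (2 * N0)) (YYX (Y_r r) (tmap (Poly_Mapping.map (subst2 1 0)) (R_r r (ttens b a))) c) m n)" for c m n
    unfolding tcong_def tcoeff_mul_zw tcoeff_mul_wz YYX_eq YY_eq tcoeff_tmap mul_zw_pow mul_wz_pow
  proof (intro allI impI)
    fix j :: "'p multiset"
    assume j: "size j < M'"
    have "trans_fls (Zzw ^ (2 * N0) * tcoeff (G c) j) (Zwz ^ (2 * N0) * tcoeff (G' c) j)"
      using j by (intro N0) auto
    then show "fls_nth (fls_nth (Zzw ^ (2 * N0) * tcoeff (tapp (\<lambda>a0. tapp (\<lambda>b0. tapp (yy a0 b0) c) b) a) j) n) m =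
      fls_nth (fls_nth ((- Zwz) ^ (2 * N0) * tcoeff (tapp (\<lambda>a0. tapp (\<lambda>b0. tapp (yy' a0 b0) c) b) a) j) m) n"
      by (simp add: trans_fls_def G_def G'_def power_mult)
  qed
  then show ?thesis by blast
qed

lemma Y_r_field: "\<exists>n0. \<forall>n<n0. tcong M' (Y_r r a n b) 0"
  using tps_fls_lower_bound[of M' "Yz a b"] by (auto simp: Y_r_eq tcong_def)

theorem HD_qva: "HD_quantum_vertex_algebra (tconst 1) (Y_r r) (tmap D0) (R_r r)"
proof
  show "tlinear (tmap D0)"
    unfolding tmap_eq_tapp[abs_def]
    by (rule tlinear_tapp) (simp_all add: additive_def D0_add tconst_add D0_scl tmap_tconst scl_zero)
qed (rule Y_r_linear Y_r_field R_add R_scale R_K R_yang_baxter R_shift_left R_shift_right R_unitarity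
    Y_r_translation Y_r_vac Y_r_creation Y_r_locality; assumption?)+

end

section \<open>Exponentials of commuting operators\<close>

text \<open>The coefficient of \<open>y^k\<close> in the \<open>j\<close>-th power of
  \<open>\<Sum> A_n y^n\<close>. Grouping compositions by their length isolates the factor
  \<open>1 / j!\<close>, so that the power rule can be proved for each \<open>j\<close>.\<close>

primrec exp_pow :: "(nat \<Rightarrow> 'v \<Rightarrow> 'v) \<Rightarrow> nat \<Rightarrow> nat \<Rightarrow> 'v \<Rightarrow> 'v::comm_monoid_add" where
  "exp_pow A 0 k x = (if k = 0 then x else 0)"
| "exp_pow A (Suc j) k x = (\<Sum>n=1..k. A n (exp_pow A j (k - n) x))"

lemma length_le_sum_list: "0 \<notin> set ns \<Longrightarrow> length ns \<le> sum_list (ns :: nat list)"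
  by (induction ns) auto

lemma finite_comps: "finite {ns. 0 \<notin> set ns \<and> sum_list ns = (k::nat)}"
proof (rule finite_subset)
  show "{ns. 0 \<notin> set ns \<and> sum_list ns = k} \<subseteq> {ns. set ns \<subseteq> {..k} \<and> length ns \<le> k}"
    using length_le_sum_list member_le_sum_list by fastforce
qed (simp add: finite_lists_length_le)

lemma sum_triangle_swap:
  "(\<Sum>n=1..k. \<Sum>m=1..k - n. f n m) = (\<Sum>m=1..k. \<Sum>n=1..k - m. f n m)" for k :: nat
proof -
  have "(\<Sum>n=1..k. \<Sum>m=1..k - n. f n m) = (\<Sum>(n, m)\<in>(SIGMA n:{1..k}. {1..k - n}). f n m)"
    by (rule sum.Sigma) auto
  also have "\<dots> = (\<Sum>(m, n)\<in>(SIGMA n:{1..k}. {1..k - n}). f n m)"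
    by (rule sum.reindex_bij_witness[of _ prod.swap prod.swap]) auto
  also have "\<dots> = (\<Sum>m=1..k. \<Sum>n=1..k - m. f n m)"
    by (rule sum.Sigma[symmetric]) auto
  finally show ?thesis .
qed

lemma exp_coeff_cong:
  assumes "\<And>n x. n \<noteq> 0 \<Longrightarrow> A n x = A' n x"
  shows "exp_coeff A k x = exp_coeff A' k x"
proof -
  have "foldr A ns x = foldr A' ns x" if "0 \<notin> set ns" for ns
    using that assms by (induction ns) auto
  then show ?thesis
    unfolding exp_coeff_def by (intro sum.cong) auto
qed

lemma exp_coeff_mult: "exp_coeff (\<lambda>n x. a n * x) k x = exp_coeff (\<lambda>n x. a n * x) k 1 * x"
  for x :: "'b::comm_monoid_add \<Rightarrow>\<^sub>0 'f::field_char_0"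
proof -
  have "foldr (\<lambda>n x. a n * x) ns x = foldr (\<lambda>n x. a n * x) ns 1 * x" for ns
    by (induction ns) (auto simp: mult.assoc)
  then show ?thesis
    by (simp add: exp_coeff_def sum_distrib_right flip: scl_mult_left)
qed

context
  fixes A :: "nat \<Rightarrow> ('b \<Rightarrow>\<^sub>0 'f) \<Rightarrow> 'b \<Rightarrow>\<^sub>0 'f::field_char_0"
  assumes A: "\<And>n. additive (A n)" "\<And>n c x. A n (scl c x) = scl c (A n x)"
begin

lemma A_simps: "A n 0 = 0" "A n (x + y) = A n x + A n y" "A n (sum f S) = (\<Sum>i\<in>S. A n (f i))"
  using additive.zero[OF A(1)] additive.add[OF A(1)] additive.sum[OF A(1)] by auto

text \<open>Splitting off the first part of a composition matches the recursion of
  \<open>exp_pow\<close>.\<close>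

lemma sum_comps: "(\<Sum>ns | 0 \<notin> set ns \<and> sum_list ns = k \<and> length ns = j. foldr A ns x) = exp_pow A j k x"
proof (induction j arbitrary: k)
  case 0
  have "{ns. 0 \<notin> set ns \<and> sum_list ns = k \<and> length ns = 0} = (if k = 0 then {[]} else {})"
    by auto
  then show ?case by auto
next
  case (Suc j)
  let ?S = "\<lambda>k j. {ns. 0 \<notin> set ns \<and> sum_list ns = k \<and> length ns = j}"
  have fin: "finite (?S k j)" for k j :: nat
    by (rule finite_subset[OF _ finite_comps[of k]]) auto
  have "exp_pow A (Suc j) k x = (\<Sum>n=1..k. \<Sum>ns\<in>?S (k - n) j. A n (foldr A ns x))"
    by (simp add: Suc.IH[symmetric] A_simps)
  also have "\<dots> = (\<Sum>(n, ns)\<in>(SIGMA n:{1..k}. ?S (k - n) j). A n (foldr A ns x))"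
    by (rule sum.Sigma) (use fin in auto)
  also have "\<dots> = (\<Sum>ns\<in>?S k (Suc j). foldr A ns x)"
    by (rule sum.reindex_bij_witness[of _ "\<lambda>ns. (hd ns, tl ns)" "\<lambda>(n, ns). n # ns"])
      (auto simp: length_Suc_conv)
  finally show ?case ..
qed

lemma exp_coeff_eq: "exp_coeff A k x = (\<Sum>j\<le>k. scl (1 / fact j) (exp_pow A j k x))"
proof -
  let ?S = "{ns. 0 \<notin> set ns \<and> sum_list ns = k}"
  have "exp_coeff A k x = (\<Sum>j\<le>k. \<Sum>ns | ns \<in> ?S \<and> length ns = j. scl (1 / fact (length ns)) (foldr A ns x))"
    unfolding exp_coeff_def
    by (rule sum.group[symmetric]) (use finite_comps length_le_sum_list in auto)
  also have "\<dots> = (\<Sum>j\<le>k. scl (1 / fact j) (\<Sum>ns | 0 \<notin> set ns \<and> sum_list ns = k \<and> length ns = j. foldr A ns x))"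
    by (intro sum.cong refl) (auto simp: scl_sum intro!: sum.cong)
  finally show ?thesis
    by (simp add: sum_comps)
qed

lemma exp_pow_0: "k < j \<Longrightarrow> exp_pow A j k x = 0"
  by (induction j arbitrary: k) (auto simp: A_simps intro!: sum.neutral)

lemma exp_coeff_0: "exp_coeff A 0 x = x"
  by (simp add: exp_coeff_eq scl_one)

lemma exp_pow_lin: "exp_pow A j k (x + y) = exp_pow A j k x + exp_pow A j k y" "exp_pow A j k (scl c x) = scl c (exp_pow A j k x)"
  by (induction j arbitrary: k) (auto simp: A_simps A(2) sum.distrib scl_sum scl_zero)

lemma exp_coeff_lin: "exp_coeff A k (x + y) = exp_coeff A k x + exp_coeff A k y" "exp_coeff A k (scl c x) = scl c (exp_coeff A k x)"
  by (simp_all add: exp_coeff_eq exp_pow_lin scl_add sum.distrib scl_sum scl_scl mult.commute)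

context
  assumes comm: "\<And>m n x. A m (A n x) = A n (A m x)"
begin

text \<open>The coefficients of \<open>y d/dy S^(j+1) = (j+1) (y dS/dy) S^j\<close>, valid because
  the operators commute.\<close>

lemma exp_pow_rec: "scl (of_nat k) (exp_pow A (Suc j) k x) =
  scl (of_nat (Suc j)) (\<Sum>n=1..k. scl (of_nat n) (A n (exp_pow A j (k - n) x)))"
proof (induction j arbitrary: k)
  case 0
  have "scl (of_nat k) (A n (if k - n = 0 then x else 0)) = scl (of_nat n) (A n (if k - n = 0 then x else 0))" if "n \<in> {1..k}" for n
    using that by (cases "n = k") (auto simp: A_simps scl_zero)
  then show ?case
    by (simp only: exp_pow.simps scl_sum of_nat_0 of_nat_Suc add_0_right scl_one cong: sum.cong)
next
  case (Suc j)
  let ?P = "exp_pow A"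
  \<comment> \<open>\<open>k = n + (k - n)\<close>: the first part differentiates the leftmost
    factor, the second the remaining power, to which the induction hypothesis applies.\<close>
  have "scl (of_nat k) (?P (Suc (Suc j)) k x) =
      (\<Sum>n=1..k. scl (of_nat n) (A n (?P (Suc j) (k - n) x)) + A n (scl (of_nat (k - n)) (?P (Suc j) (k - n) x)))"
    by (simp del: exp_pow.simps(2) add: exp_pow.simps(2)[of A "Suc j"] scl_sum)
      (intro sum.cong refl, auto simp: A(2) of_nat_diff simp flip: scl_add_left)
  also have "\<dots> = (\<Sum>n=1..k. scl (of_nat n) (A n (?P (Suc j) (k - n) x))) +
      (\<Sum>n=1..k. \<Sum>m=1..k - n. scl (of_nat (Suc j) * of_nat m) (A n (A m (?P j (k - n - m) x))))"
    by (simp only: sum.distrib Suc.IH A_simps A(2) scl_sum scl_scl)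
  \<comment> \<open>Commutativity brings the differentiated factor to the front.\<close>
  also have "(\<Sum>n=1..k. \<Sum>m=1..k - n. scl (of_nat (Suc j) * of_nat m) (A n (A m (?P j (k - n - m) x)))) =
      (\<Sum>m=1..k. \<Sum>n=1..k - m. scl (of_nat (Suc j) * of_nat m) (A m (A n (?P j (k - m - n) x))))"
    by (subst sum_triangle_swap, intro sum.cong refl, subst comm) (simp add: add.commute)
  also have "\<dots> = (\<Sum>m=1..k. scl (of_nat (Suc j)) (scl (of_nat m) (A m (?P (Suc j) (k - m) x))))"
    by (simp add: A_simps scl_sum scl_scl)
  finally have "scl (of_nat k) (?P (Suc (Suc j)) k x) = (\<Sum>n=1..k. scl (of_nat n) (A n (?P (Suc j) (k - n) x))) +
      scl (of_nat (Suc j)) (\<Sum>n=1..k. scl (of_nat n) (A n (?P (Suc j) (k - n) x)))"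
    by (simp only: scl_sum)
  then show ?case
    by (simp only: of_nat_Suc[of "Suc j"] scl_add_left scl_one)
qed

text \<open>The differential equation \<open>y d/dy exp S = (y dS/dy) exp S\<close> in coefficients;
  in this form both exponentials of \<Psi> are computed.\<close>

lemma exp_coeff_rec: "scl (of_nat k) (exp_coeff A k x) = (\<Sum>n=1..k. scl (of_nat n) (A n (exp_coeff A (k - n) x)))"
proof (cases k)
  case (Suc k')
  have *: "(\<Sum>j\<le>k'. scl (1 / fact j) (exp_pow A j (k - n) x)) = exp_coeff A (k - n) x" if "n \<in> {1..k}" for n
    unfolding exp_coeff_eq using that Suc
    by (intro sum.mono_neutral_right) (auto simp: exp_pow_0 scl_zero)
  have "scl (of_nat k) (exp_coeff A k x) = (\<Sum>j\<le>k. scl (1 / fact j) (scl (of_nat k) (exp_pow A j k x)))"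
    by (simp add: exp_coeff_eq scl_sum scl_scl mult.commute)
  also have "\<dots> = (\<Sum>j\<le>k'. scl (1 / fact (Suc j)) (scl (of_nat k) (exp_pow A (Suc j) k x)))"
    unfolding Suc sum.atMost_Suc_shift by (simp add: scl_zero del: exp_pow.simps(2))
  also have "\<dots> = (\<Sum>j\<le>k'. \<Sum>n=1..k. scl (of_nat n) (A n (scl (1 / fact j) (exp_pow A j (k - n) x))))"
  proof (rule sum.cong)
    fix j
    have "1 / fact (Suc j) * of_nat (Suc j) = (1 / fact j :: 'f)"
      by (simp add: divide_simps del: of_nat_Suc)
    then show "scl (1 / fact (Suc j)) (scl (of_nat k) (exp_pow A (Suc j) k x)) =
        (\<Sum>n=1..k. scl (of_nat n) (A n (scl (1 / fact j) (exp_pow A j (k - n) x))))"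
      unfolding exp_pow_rec scl_scl by (simp add: scl_sum scl_scl A(2) mult.commute)
  qed simp
  also have "\<dots> = (\<Sum>n=1..k. scl (of_nat n) (A n (\<Sum>j\<le>k'. scl (1 / fact j) (exp_pow A j (k - n) x))))"
    by (subst sum.swap) (simp add: A_simps scl_sum)
  finally show ?thesis
    by (simp add: *)
qed (simp add: scl_zero)

end

end

section \<open>The Heisenberg operators on symmetric functions\<close>

lemma vpart_eq: "vpart v = meval (\<lambda>i. v (i + 1))"
  by (simp add: vpart_def meval_def fun_eq_iff)

lemma zee_superset:
  assumes "finite S" "keys l \<subseteq> S"
  shows "zee l = (\<Prod>i\<in>S. (i + 1) ^ lookup l i * fact (lookup l i))"
  unfolding zee_def by (rule prod.mono_neutral_left) (use assms in \<open>auto simp: in_keys_iff\<close>)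

lemma zee_add_single: "zee (l + single i 1) = zee l * ((i + 1) * (lookup l i + 1))"
proof -
  let ?S = "insert i (keys l)"
  have fact: "m ^ (k + 1) * fact (k + 1) = m ^ k * fact k * (m * (k + 1))" for m k :: nat
    unfolding Suc_eq_plus1[symmetric] power_Suc fact_Suc by (simp add: algebra_simps)
  have "zee (l + single i 1) = (\<Prod>j\<in>?S. (j + 1) ^ lookup (l + single i 1) j * fact (lookup (l + single i 1) j))"
    by (rule zee_superset) (use keys_add[of l "single i 1"] in auto)
  also have "\<dots> = (\<Prod>j\<in>?S. (j + 1) ^ lookup l j * fact (lookup l j) * (if j = i then (i + 1) * (lookup l i + 1) else 1))"
    by (intro prod.cong) (auto simp: lookup_add lookup_single when_def fact)
  also have "\<dots> = zee l * ((i + 1) * (lookup l i + 1))"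
    by (subst prod.distrib) (simp add: zee_superset[of ?S l] subset_insertI)
  finally show ?thesis .
qed

lemma zee_nonzero: "zee l \<noteq> 0"
  by (simp add: zee_def)

text \<open>The derivative by the \<open>i\<close>-th polynomial generator with
  \<open>e^(m\<alpha>)\<close> constant: on symmetric functions it is the derivative by
  \<open>p_(i+1)\<close>, on \<open>V\<close> the one by \<open>h^(i)\<close>.\<close>

definition pd :: "nat \<Rightarrow> 'f::comm_ring_1 V0 \<Rightarrow> 'f V0" where
  "pd i = ext scl (\<lambda>(u, m). single (u - single i 1, m) (of_nat (lookup u i)))"

lemma pd_add: "pd i (x + y) = pd i x + pd i y" and pd_scl: "pd i (scl c x) = scl c (pd i x)"
  and pd_bas: "pd i (bas (u, m)) = single (u - single i 1, m) (of_nat (lookup u i))"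
  and pd_single: "pd i (single (u, m) c) = scl c (single (u - single i 1, m) (of_nat (lookup u i)))"
  by (simp_all add: pd_def module.ext_add[OF module_scl] module.ext_scl[OF module_scl] module.ext_bas[OF module_scl] module.ext_single[OF module_scl])

lemma additive_pd: "additive (pd i)"
  by (simp add: additive_def pd_add)

lemma pd_mult: "pd i (x * y) = pd i x * y + x * pd i y"
proof (induction x rule: pm_induct)
  case (single b c)
  show ?case
  proof (induction y rule: pm_induct)
    case (single b' c')
    obtain u m u' m' where b: "b = (u, m)" "b' = (u', m')"
      by (cases b, cases b')
    have "lookup u i \<noteq> 0 \<Longrightarrow> u + u' - Poly_Mapping.single i 1 = (u - Poly_Mapping.single i 1) + u'"
      "lookup u' i \<noteq> 0 \<Longrightarrow> u + u' - Poly_Mapping.single i 1 = u + (u' - Poly_Mapping.single i 1)"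
      using single_minus_one[of u i u'] single_minus_one[of u' i u] by (simp_all add: add.commute)
    then show ?case
      by (cases "lookup u i = 0"; cases "lookup u' i = 0")
        (simp_all add: b mult_single pd_single lookup_add algebra_simps scl_zero flip: single_add)
  qed (simp_all add: pd_add distrib_left additive.zero[OF additive_pd])
qed (simp_all add: pd_add distrib_right additive.zero[OF additive_pd])

lemma pd_hgen: "pd i (hgen j) = (if i = j then 1 else 0)"
  by (auto simp: hgen_def pd_bas lookup_single when_def simp flip: bas_00) (simp add: bas_def)

lemma pd_ealpha: "pd i (ealpha m) = 0" and pd_const: "pd i (single 0 c) = 0"
  by (simp_all add: ealpha_def pd_bas pd_single zero_prod_def scl_zero)

lemma pd_comm: "pd i (pd j x) = pd j (pd i x)"
proof (induction x rule: V0_alg_induct)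
  case (mult x y)
  then show ?case by (simp add: pd_mult pd_add algebra_simps)
qed (auto simp: pd_add pd_hgen pd_ealpha pd_const additive.zero[OF additive_pd] pd_const[of _ 1, unfolded single_one])

lemma heis_minus_eq: "heis_minus v n x = scl (inverse (v n)) (hgen (n - 1)) * x"
proof -
  have "on_Lambda ((*) (psum n)) x = hgen (n - 1) * x"
    unfolding on_Lambda_def
  proof (rule pm_additive_eqI[where F = "lin _" and G = "(*) (hgen (n - 1))"])
    show "additive (lin (\<lambda>(l, m). tens (psum n * bas l) (bas m)))" "additive ((*) (hgen (n - 1)))"
      by (simp_all add: additive_def lin_add distrib_left)
  qed (auto simp: lin_scl lin_bas psum_def bas_mult single_eq_scl_bas[of "(_, _)"] hgen_def scl_mult_right)
  then show ?thesis
    by (simp add: heis_minus_def scl_mult_left)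
qed

definition psi_minus :: "(nat \<Rightarrow> 'f::field_char_0) \<Rightarrow> nat \<Rightarrow> 'f V0" where
  "psi_minus v j = exp_coeff (\<lambda>i x. scl (inverse (v i) / of_nat i) (hgen (i - 1)) * x) j 1"

text \<open>\<open>h_n\<close> acts as \<open>n\<close> times the derivative by \<open>p_n\<close>,
  so \<open>- h_n / n\<close> is minus that derivative, and \<open>v\<close> disappears.\<close>

definition psi_plus :: "nat \<Rightarrow> 'f::field_char_0 V0 \<Rightarrow> 'f V0" where
  "psi_plus = exp_coeff (\<lambda>i x. - pd (i - 1) x)"

context
  fixes v :: "nat \<Rightarrow> 'f::field_char_0"
  assumes v: "\<And>n. n \<ge> 1 \<Longrightarrow> v n \<noteq> 0"
begin

lemma vpart_nonzero: "vpart v l \<noteq> 0"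
  using v by (simp add: vpart_def)

lemma vform_bas: "vform v f (bas l) = lookup f l * (of_nat (zee l) * vpart v l)"
proof -
  have "vform v f (bas l) = (\<Sum>u\<in>keys f. if u = l then lookup f l * (of_nat (zee l) * vpart v l) else 0)"
    unfolding vform_def by (intro sum.cong) (auto simp: lookup_bas)
  then show ?thesis
    by (auto simp: in_keys_iff)
qed

lemma vform_scl_bas: "vform v (scl c (bas l)) g = c * lookup g l * (of_nat (zee l) * vpart v l)"
proof (cases "c = 0")
  case False
  then have "keys (scl c (bas l) :: (nat \<Rightarrow>\<^sub>0 nat) \<Rightarrow>\<^sub>0 'f) = {l}"
    by (simp add: bas_def)
  then show ?thesis
    by (simp add: vform_def lookup_bas)
qed (simp add: vform_def scl_zero)

lemma lookup_psum_mult: "lookup (psum (Suc i) * g) l = (if lookup l i = 0 then 0 else lookup g (l - single i 1))"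
  for g :: "'f symfun"
proof (induction g rule: pm_induct)
  case (single u c)
  have "single i 1 + u = l \<longleftrightarrow> lookup l i \<noteq> 0 \<and> u = l - single i 1"
  proof
    assume "lookup l i \<noteq> 0 \<and> u = l - single i 1"
    then show "single i 1 + u = l"
      by (auto intro!: poly_mapping_eqI simp: lookup_add lookup_minus lookup_single when_def)
  qed (auto simp: lookup_add)
  then show ?case
    by (auto simp: psum_def bas_def mult_single lookup_single when_def)
qed (simp_all add: distrib_left lookup_add)

text \<open>Removing a part \<open>n = i + 1\<close> of multiplicity \<open>m\<close> divides
  \<open>z_\<lambda> v_\<lambda>\<close> by \<open>n m v_n\<close>; hence the adjoint of
  \<open>p_n\<close> is \<open>n v_n\<close> times the derivative. The description in
  \<open>perp\<close> is unique because pairing with a basis vector reads off a coefficient with a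
  nonzero factor.\<close>

lemma perp_bas: "perp v (Suc i) (bas l) = scl (of_nat (Suc i * lookup l i) * v (Suc i)) (bas (l - single i 1))"
  unfolding perp_def
proof (rule the_equality)
  show e: "\<forall>g. vform v (scl (of_nat (Suc i * lookup l i) * v (Suc i)) (bas (l - single i 1))) g = vform v (bas l) (psum (Suc i) * g)"
  proof
    fix g
    show "vform v (scl (of_nat (Suc i * lookup l i) * v (Suc i)) (bas (l - single i 1))) g = vform v (bas l) (psum (Suc i) * g)"
    proof (cases "lookup l i = 0")
      case True
      then show ?thesis
        unfolding vform_scl_bas vform_scl_bas[of 1, unfolded scl_one] lookup_psum_mult by simp
    next
      case False
      define u where "u = l - single i 1"
      have l: "l = u + single i 1"
        using False by (auto intro!: poly_mapping_eqI simp: u_def lookup_add lookup_minus lookup_single when_def)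
      have "zee l = zee u * (Suc i * lookup l i)" "vpart v l = vpart v u * v (Suc i)"
        unfolding l zee_add_single vpart_eq meval_add meval_single by (simp_all add: lookup_add One_nat_def)
      with False show ?thesis
        unfolding vform_scl_bas vform_scl_bas[of 1, unfolded scl_one] lookup_psum_mult by (simp flip: u_def)
    qed
  qed
  fix f'
  assume f: "\<forall>g. vform v f' g = vform v (bas l) (psum (Suc i) * g)"
  show "f' = scl (of_nat (Suc i * lookup l i) * v (Suc i)) (bas (l - single i 1))"
  proof (rule poly_mapping_eqI)
    fix u
    from f e have "vform v f' (bas u) = vform v (scl (of_nat (Suc i * lookup l i) * v (Suc i)) (bas (l - single i 1))) (bas u)"
      by simp
    then show "lookup f' u = lookup (scl (of_nat (Suc i * lookup l i) * v (Suc i)) (bas (l - single i 1))) u"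
      unfolding vform_bas using vpart_nonzero[of u] zee_nonzero[of u] by simp
  qed
qed

lemma heis_plus_eq: "heis_plus v (Suc i) x = scl (of_nat (Suc i)) (pd i x)"
proof (rule pm_additive_eqI[where F = "heis_plus v (Suc i)" and G = "\<lambda>x. scl (of_nat (Suc i)) (pd i x)"])
  show "additive (heis_plus v (Suc i))" "additive (\<lambda>x. scl (of_nat (Suc i)) (pd i x))"
    by (simp_all add: additive_def heis_plus_def on_Lambda_def lin_add scl_add pd_add)
  show "heis_plus v (Suc i) (single b c) = scl (of_nat (Suc i)) (pd i (single b c))" for b c
    using v[of "Suc i"]
    by (cases b) (simp add: heis_plus_def on_Lambda_def lin_single perp_bas tens_scl_left pd_single scl_scl,
      simp add: bas_def, intro arg_cong[where f = "single _"], simp add: field_simps)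
qed

lemma exp_heis_plus: "exp_coeff (\<lambda>i x. scl (- 1 / of_nat i) (heis_plus v i x)) l x = psi_plus l x"
  unfolding psi_plus_def
proof (rule exp_coeff_cong)
  fix n x assume "n \<noteq> (0::nat)"
  then obtain i where n: "n = Suc i" using not0_implies_Suc by blast
  have "scl (- 1) y = - y" for y :: "'f V0"
    by (auto intro!: poly_mapping_eqI)
  then show "scl (- 1 / of_nat n) (heis_plus v n x) = - pd (n - 1) x"
    by (simp add: n heis_plus_eq scl_scl del: of_nat_Suc)
qed

end

lemma exp_heis_minus: "exp_coeff (\<lambda>i x. scl (1 / of_nat i) (heis_minus v i x)) j x = psi_minus v j * x"
  unfolding psi_minus_def exp_coeff_mult[symmetric]
  by (rule exp_coeff_cong) (simp add: heis_minus_eq scl_mult_left scl_scl)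

lemma psi_minus_0: "psi_minus v 0 = 1"
  unfolding psi_minus_def by (rule exp_coeff_0) (simp_all add: additive_def distrib_left scl_mult_right)

lemma psi_minus_rec: "scl (of_nat k) (psi_minus v k) = (\<Sum>n=1..k. scl (inverse (v n)) (hgen (n - 1)) * psi_minus v (k - n))"
proof -
  have "scl (of_nat k) (psi_minus v k) = (\<Sum>n=1..k. scl (of_nat n) (scl (inverse (v n) / of_nat n) (hgen (n - 1)) * psi_minus v (k - n)))"
    unfolding psi_minus_def by (rule exp_coeff_rec) (simp_all add: additive_def distrib_left scl_mult_right mult.left_commute)
  also have "\<dots> = (\<Sum>n=1..k. scl (inverse (v n)) (hgen (n - 1)) * psi_minus v (k - n))"
    by (intro sum.cong refl) (simp add: scl_scl flip: scl_mult_left)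
  finally show ?thesis .
qed

lemma psi_plus_hyps: "additive (\<lambda>x. - pd i x)" "- pd i (scl c x) = scl c (- pd i x)" "- pd i (- pd j x) = - pd j (- pd i x)"
  by (simp_all add: additive_def pd_add pd_scl additive.minus[OF additive_pd] pd_comm[of i]) (auto intro!: poly_mapping_eqI)

lemma psi_plus_0: "psi_plus 0 x = x"
  unfolding psi_plus_def by (rule exp_coeff_0) (rule psi_plus_hyps)+

lemma psi_plus_lin: "psi_plus l (x + y) = psi_plus l x + psi_plus l y" "psi_plus l (scl c x) = scl c (psi_plus l x)"
  unfolding psi_plus_def by (rule exp_coeff_lin; rule psi_plus_hyps)+

lemma psi_plus_rec: "scl (of_nat k) (psi_plus k x) = - (\<Sum>n=1..k. scl (of_nat n) (pd (n - 1) (psi_plus (k - n) x)))"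
proof -
  have "scl (of_nat k) (psi_plus k x) = (\<Sum>n=1..k. scl (of_nat n) (- pd (n - 1) (psi_plus (k - n) x)))"
    unfolding psi_plus_def by (rule exp_coeff_rec) (rule psi_plus_hyps)+
  also have "\<dots> = - (\<Sum>n=1..k. scl (of_nat n) (pd (n - 1) (psi_plus (k - n) x)))"
    by (simp add: additive.minus[OF additive_scl] sum_negf)
  finally show ?thesis .
qed

lemma psi_plus_const: "(\<And>i. pd i x = 0) \<Longrightarrow> psi_plus l x = (if l = 0 then x else 0)"
proof (induction l rule: less_induct)
  case (less l)
  show ?case
  proof (cases l)
    case (Suc k)
    have "scl (of_nat l) (psi_plus l x) = 0"
      unfolding psi_plus_rec using less by (auto intro!: sum.neutral simp: scl_zero additive.zero[OF additive_pd])
    then show ?thesis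
      using scl_inj[of k "psi_plus l x" 0] by (simp add: Suc scl_zero)
  qed (simp add: psi_plus_0)
qed

text \<open>\<open>e^(m\<alpha>)\<close> is constant for all the derivatives, and the recursion
  passes this on. It lets \<open>e^\<alpha>\<close> move out of the annihilation part of
  \<Psi>.\<close>

lemma psi_plus_ealpha: "psi_plus l (ealpha m * x) = ealpha m * psi_plus l x"
proof (induction l rule: less_induct)
  case (less l)
  show ?case
  proof (cases l)
    case (Suc k)
    have "scl (of_nat l) (psi_plus l (ealpha m * x)) = - (\<Sum>n=1..l. scl (of_nat n) (pd (n - 1) (ealpha m * psi_plus (l - n) x)))"
      unfolding psi_plus_rec using less Suc by (intro arg_cong[where f = uminus] sum.cong refl) auto
    also have "\<dots> = ealpha m * scl (of_nat l) (psi_plus l x)"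
      unfolding psi_plus_rec by (simp add: pd_mult pd_ealpha sum_distrib_left scl_mult_right)
    finally show ?thesis
      using scl_inj[of k] by (simp add: Suc scl_mult_right)
  qed (simp add: psi_plus_0)
qed

text \<open>Taylor's theorem: the exponential of minus the sum of \<open>y^n\<close> times the
  derivative by \<open>p_n\<close> is the substitution \<open>p_n \<mapsto> p_n - y^n\<close>, here
  read off at one power of \<open>y\<close>.\<close>

lemma psi_plus_hgen: "psi_plus l (hgen j * x) = hgen j * psi_plus l x - (if j < l then psi_plus (l - Suc j) x else 0)"
  for x :: "'f::field_char_0 V0"
proof (induction l rule: less_induct)
  case (less l)
  show ?case
  proof (cases l)
    case (Suc k)
    let ?T = "\<lambda>n. if j < l - n then psi_plus (l - n - Suc j) x else 0"
    have 1: "(\<Sum>n=1..l. scl (of_nat n) (if n = Suc j then psi_plus (l - n) x else 0)) = (if j < l then scl (of_nat (Suc j)) (psi_plus (l - Suc j) x) else 0)"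
    proof -
      have "(\<Sum>n=1..l. scl (of_nat n) (if n = Suc j then psi_plus (l - n) x else 0)) =
          (\<Sum>n=1..l. if n = Suc j then scl (of_nat (Suc j)) (psi_plus (l - Suc j) x) else 0)"
        by (intro sum.cong) (auto simp: scl_zero)
      then show ?thesis by (simp add: Suc_le_eq)
    qed
    \<comment> \<open>The terms with \<open>j < l - n\<close> form the recursion at
      \<open>l - Suc j\<close>, read backwards.\<close>
    have 2: "(\<Sum>n=1..l. scl (of_nat n) (pd (n - 1) (?T n))) = - (if j < l then scl (of_nat (l - Suc j)) (psi_plus (l - Suc j) x) else 0)"
    proof (cases "j < l")
      case True
      have "(\<Sum>n=1..l. scl (of_nat n) (pd (n - 1) (?T n))) = (\<Sum>n=1..l - Suc j. scl (of_nat n) (pd (n - 1) (?T n)))"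
        by (rule sum.mono_neutral_right) (auto simp: scl_zero additive.zero[OF additive_pd])
      also have "\<dots> = (\<Sum>n=1..l - Suc j. scl (of_nat n) (pd (n - 1) (psi_plus (l - Suc j - n) x)))"
        by (intro sum.cong refl) (auto simp: add.commute)
      finally show ?thesis
        using True by (simp only: psi_plus_rec if_True minus_minus)
    qed (auto simp: scl_zero additive.zero[OF additive_pd] intro!: sum.neutral)
    have "scl (of_nat l) (psi_plus l (hgen j * x)) = - (\<Sum>n=1..l. scl (of_nat n) (pd (n - 1) (hgen j * psi_plus (l - n) x - ?T n)))"
      unfolding psi_plus_rec using less Suc by (intro arg_cong[where f = uminus] sum.cong refl) auto
    also have "\<dots> = - (\<Sum>n=1..l. hgen j * scl (of_nat n) (pd (n - 1) (psi_plus (l - n) x)) +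
        scl (of_nat n) (if n = Suc j then psi_plus (l - n) x else 0) - scl (of_nat n) (pd (n - 1) (?T n)))"
      by (intro arg_cong[where f = uminus] sum.cong refl)
        (auto simp: pd_mult pd_hgen additive.diff[OF additive_pd] additive.diff[OF additive_scl] scl_add scl_mult_right)
    also have "\<dots> = hgen j * scl (of_nat l) (psi_plus l x) - (if j < l then scl (of_nat (Suc j)) (psi_plus (l - Suc j) x) else 0)
        - (if j < l then scl (of_nat (l - Suc j)) (psi_plus (l - Suc j) x) else 0)"
      unfolding sum.distrib sum_subtractf 1 2 psi_plus_rec sum_distrib_left[symmetric] by simp
    also have "\<dots> = scl (of_nat l) (hgen j * psi_plus l x - (if j < l then psi_plus (l - Suc j) x else 0))"
    proof (cases "j < l")
      case True
      have "(of_nat l :: 'f) = of_nat (Suc j) + of_nat (l - Suc j)"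
        using True by (simp flip: of_nat_add)
      then have "scl (of_nat l) (psi_plus (l - Suc j) x) = scl (of_nat (Suc j)) (psi_plus (l - Suc j) x) + scl (of_nat (l - Suc j)) (psi_plus (l - Suc j) x)"
        by (simp only: scl_add_left)
      with True show ?thesis
        by (simp add: additive.diff[OF additive_scl] scl_mult_right)
    qed (simp add: scl_mult_right)
    finally show ?thesis
      unfolding Suc by (rule scl_inj)
  qed (simp add: psi_plus_0)
qed

section \<open>The values of the bicharacter\<close>

lemma tconst_of_nat: "tconst (of_nat n) = (of_nat n :: ('p, 'a::comm_ring_1) tps)"
  by (induction n) (simp_all add: tconst_add)

lemma tconst_of_int: "tconst (of_int n) = (of_int n :: ('p, 'a::comm_ring_1) tps)"
  by (cases n rule: int_cases2) (simp_all add: tconst_of_nat rhomD(6)[OF rhom_tconst])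

text \<open>From \<open>f' = f g'\<close> with \<open>g = log f\<close>, whose derivative has the
  coefficients \<open>- inverse (v (Suc n))\<close>.\<close>

lemma f_ser_rec: "of_nat (Suc q) * fps_nth (f_ser v) (Suc q) = - (\<Sum>n\<le>q. inverse (v (Suc n)) * fps_nth (f_ser v) (q - n))"
proof -
  let ?g = "Abs_fps (\<lambda>n. if n = 0 then 0 else - (inverse (v n) / of_nat n))"
  have "fps_deriv (f_ser v) = f_ser v * fps_deriv ?g"
    by (simp add: f_ser_def fps_compose_deriv)
  also have "fps_deriv ?g = Abs_fps (\<lambda>n. - inverse (v (Suc n)))"
    by (rule fps_ext) (simp add: Suc_eq_plus1[symmetric] del: of_nat_Suc Suc_eq_plus1)
  finally have "fps_nth (fps_deriv (f_ser v)) q = fps_nth (Abs_fps (\<lambda>n. - inverse (v (Suc n))) * f_ser v) q"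
    by (simp add: mult.commute)
  then show ?thesis
    by (simp add: fps_mult_nth sum_negf atLeast0AtMost Suc_eq_plus1[symmetric] del: of_nat_Suc Suc_eq_plus1)
qed

lemma f_ser_0: "fps_nth (f_ser v) 0 = 1"
  by (simp add: f_ser_def)

text \<open>The monomial \<open>X z^k\<close> with a scalar \<open>X\<close> in
  \<open>k[[t]]\<close>. The values of \<open>r\<close> at \<open>w = 0\<close> that \<Psi> and the
  Heisenberg operators require all have this shape.\<close>

definition zpow :: "('p, 'k::field_char_0) tps \<Rightarrow> int \<Rightarrow> ('p, 'k V0 fls) tps" where
  "zpow X k = tmap (\<lambda>c. fls_shift (- k) (fls_const (single 0 c))) X"

lemma nth_zpow: "fls_nth (tcoeff (zpow X k) N) n = (if n = k then single 0 (tcoeff X N) else 0)"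
  by (simp add: zpow_def)

lemma zpow_mult: "zpow X k * zpow Y l = zpow (X * Y) (k + l)"
  by (rule fls_tps_eqI) (simp add: zpow_def tcoeff_mult case_prod_unfold fls_times_both_shifted_simp fls_nth_sum mult_single
      additive.sum[OF rhomD(4)[OF rhom_single0]])

lemma zpow_add: "zpow (X + Y) k = zpow X k + zpow Y k" and zpow_diff: "zpow (X - Y) k = zpow X k - zpow Y k"
  and zpow_0: "zpow 0 k = 0"
  by (auto intro!: fls_tps_eqI simp: nth_zpow single_add single_diff)

lemma zpow_uminus: "zpow (- X) k = - zpow X k"
  using zpow_diff[of 0 X k] by (simp add: zpow_0)

lemma zpow_sum: "zpow (sum f A) k = (\<Sum>i\<in>A. zpow (f i) k)"
  by (induction A rule: infinite_finite_induct) (simp_all add: zpow_0 zpow_add)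

lemma scalY_eq_zpow: "scalY c = zpow (tconst c) 0"
  by (auto intro!: fls_tps_eqI simp: nth_zpow scalY_def tcoeff_tconst)

lemma zpow_1: "zpow 1 0 = 1"
  using scalY_eq_zpow[of 1] by (simp add: scalY_def)

lemma fls_deriv_zpow: "tmap fls_deriv (zpow X k) = zpow (of_int k * X) (k - 1)"
proof (rule fls_tps_eqI)
  fix N n
  have "tcoeff (of_int k * X) N = of_int k * tcoeff X N"
    using tconst_mult_left[of "of_int k" X] rhomD(3)[OF rhom_tconst] by (simp add: tconst_of_int)
  then show "fls_nth (tcoeff (tmap fls_deriv (zpow X k)) N) n = fls_nth (tcoeff (zpow (of_int k * X) (k - 1)) N) n"
    by (auto simp: nth_zpow rhomD(3)[OF rhom_single0] simp flip: single_of_int)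
qed

context bichar
begin

interpretation mY: module "act (scalY :: 'k \<Rightarrow> ('p, 'k V0 fls) tps)"
  by (rule module_act[OF rhom_scalY])

lemma \<rho>_mult_left: "\<rho> (a * b) c = sweedler (act scalY) c (\<lambda>c' c''. \<rho> a c' * \<rho> b c'')"
proof -
  have a: "add_on RegT (tmap at_w0 :: ('p, 'k ratfun) tps \<Rightarrow> _)"
    by (auto simp: add_on_def RegT_0 RegT_add tmap_at_w0)
  have "\<rho> (a * b) c = sweedler (act scalY) c (\<lambda>c' c''. tmap at_w0 (r a c' * r b c''))"
    unfolding \<rho>_def r_mult_left
    by (rule sw_hom_on[OF a]) (auto simp: act_def RegT_mult RegT_const r_RegT tmap_at_w0 at_w0_scalK)
  then show ?thesis
    by (simp add: tmap_at_w0 r_RegT \<rho>_def)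
qed

lemma bilin_\<rho>\<rho>: "bilin (act scalY) (\<lambda>c' c''. \<rho> a c' * \<rho> b c'')" "bilin (act scalY) (\<lambda>c' c''. \<rho> c' a * \<rho> c'' b)"
  by (simp_all add: bilin_def \<rho>_lin act_def algebra_simps)

lemma bilin_MM: "bilin (act scalY) (\<lambda>c' c''. M c' a * M c'' b)"
  by (simp add: bilin_def M_add M_scl act_def algebra_simps)

lemma bilin_EM: "bilin (act scalY) (\<lambda>c' c''. tconst (exp_zD c') * M c'' b)"
  by (simp add: bilin_def M_add M_scl act_def exp_zD_add exp_zD_scl tconst_add tconst_mult distrib_left distrib_right mult_ac)
    (simp add: scalY_def mult_ac)

lemma bilin_M: "bilin (act scalY) (\<lambda>b' b''. tconst (fls_const b') * \<rho> a b'')"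
  by (simp add: bilin_def \<rho>_lin act_def fls_const_scl tconst_add distrib_left distrib_right mult_ac flip: fls_plus_const)

lemma M_hgen: "M a (hgen j) = tconst (fls_const (hgen j)) * scalY (counit a) + \<rho> a (hgen j)"
  unfolding M_def mY.sw_hgen[OF bilin_M] by (simp add: \<rho>_1)

lemma M_ealpha: "M a (ealpha m) = tconst (fls_const (ealpha m)) * \<rho> a (ealpha m)"
  unfolding M_def mY.sw_ealpha[OF bilin_M] ..

lemma M_1: "M 1 b = tconst (fls_const b)"
  using Y0_M[of 1 b] unfolding mY.sw_one[OF bilin_EM] by (simp add: Y0_1_left exp_zD_1)

lemma M_const: "M a (single 0 c) = scalY (c * counit a)"
proof -
  have "M a (ealpha 0) = scalY (counit a)"
    unfolding M_ealpha by (simp add: ealpha_0 \<rho>_1)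
  then show ?thesis
    using M_scl(1)[of a c "ealpha 0"] by (simp add: ealpha_0 scl_mult rhomD(3)[OF rhom_scalY])
qed

lemma M_mult_hgen: "M (hgen i) (b * c) = M (hgen i) b * tconst (fls_const c) + tconst (fls_const b) * M (hgen i) c"
  unfolding M_mult mY.sw_hgen[OF bilin_MM] M_1 ..

lemma M_mult_ealpha: "M (ealpha m) (b * c) = M (ealpha m) b * M (ealpha m) c"
  unfolding M_mult mY.sw_ealpha[OF bilin_MM] ..

lemma Y0_hgen: "Y0 r (hgen i) b = tconst (exp_zD (hgen i) * fls_const b) + M (hgen i) b"
  unfolding Y0_M mY.sw_hgen[OF bilin_EM] M_1 by (simp add: exp_zD_1 tconst_mult)

lemma Y0_ealpha: "Y0 r (ealpha m) b = tconst (exp_zD (ealpha m)) * M (ealpha m) b"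
  unfolding Y0_M mY.sw_ealpha[OF bilin_EM] ..

lemma \<rho>_ealpha_mult: "\<rho> (ealpha m) (a * b) = \<rho> (ealpha m) a * \<rho> (ealpha m) b"
  unfolding \<rho>_mult mY.sw_ealpha[OF bilin_\<rho>\<rho>(2)] ..

text \<open>\<open>D e^\<alpha> = h e^\<alpha>\<close>. As \<open>h^(j)\<close> is primitive and
  \<open>h\<close> has counit 0, \<open>r(h e^\<alpha>, h^(j))\<close> reduces to
  \<open>r(h, h^(j))\<close>.\<close>

lemma \<rho>_hgen_hgen: "\<rho> (hgen 0) (hgen j) = tmap fls_deriv (\<rho> (ealpha 1) (hgen j))"
proof -
  have "tmap fls_deriv (\<rho> (ealpha 1) (hgen j)) = \<rho> (hgen 0 * ealpha 1) (hgen j)"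
    by (simp add: D0_ealpha scl_one flip: \<rho>_D0)
  also have "\<dots> = \<rho> (hgen 0) (hgen j)"
    unfolding \<rho>_mult_left mY.sw_hgen[OF bilin_\<rho>\<rho>(1)] by (simp add: \<rho>_1 counit_simps rhomD[OF rhom_scalY])
  finally show ?thesis ..
qed

lemma \<rho>_hgen_ealpha: "\<rho> (hgen 0) (ealpha m) * \<rho> (ealpha 1) (ealpha m) = tmap fls_deriv (\<rho> (ealpha 1) (ealpha m))"
proof -
  have "tmap fls_deriv (\<rho> (ealpha 1) (ealpha m)) = \<rho> (hgen 0 * ealpha 1) (ealpha m)"
    by (simp add: D0_ealpha scl_one flip: \<rho>_D0)
  then show ?thesis
    unfolding \<rho>_mult_left mY.sw_ealpha[OF bilin_\<rho>\<rho>(1)] by simp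
qed

end

lemma dp_D0: "dp n (D0 a) = scl (of_nat (Suc n)) (dp (Suc n) a)"
  unfolding dp_Suc by (simp add: dp_def funpow_swap1 D0_scl)

text \<open>\<open>D e^\<alpha> = h e^\<alpha>\<close> and the Leibniz rule for divided powers, with
  \<open>D^(i) h = h^(i)\<close>.\<close>

lemma dp_ealpha_rec: "scl (of_nat (Suc n)) (dp (Suc n) (ealpha 1)) = (\<Sum>i\<le>n. hgen i * dp (n - i) (ealpha 1))"
  by (simp only: D0_ealpha dp_mult dp_hgen of_int_1 scl_one flip: dp_D0)

section \<open>Expansion in the parameters and the values of \<open>r\<close> at
  \<open>w = 0\<close> for the given \<sigma>\<close>

locale fock =
  fixes \<kappa> :: "'k::field_char_0 \<Rightarrow> 'f::field_char_0" and A :: "'f set" and \<iota> :: "'f \<Rightarrow> ('p::finite, 'k) tps"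
    and v :: "nat \<Rightarrow> 'f" and r :: "('p, 'k) bichar"
  assumes texp: "t_expansion \<kappa> A \<iota>"
    and v: "\<And>n. n \<ge> 1 \<Longrightarrow> v n \<noteq> 0"
    and v_A: "\<And>n. n \<ge> 1 \<Longrightarrow> inverse (v n) \<in> A"
    and sigma: "is_sigma \<iota> v (r (ealpha 1) (ealpha 1))"
    and fbich: "bicharacter r" and fDcomp: "D_compatible r"
begin

lemma rhom_\<kappa>: "rhom \<kappa>"
  using texp by (auto simp: t_expansion_def rhom_def)

lemma A_add: "a \<in> A \<Longrightarrow> b \<in> A \<Longrightarrow> a + b \<in> A" and A_mult: "a \<in> A \<Longrightarrow> b \<in> A \<Longrightarrow> a * b \<in> A"
  and \<iota>_add: "a \<in> A \<Longrightarrow> b \<in> A \<Longrightarrow> \<iota> (a + b) = \<iota> a + \<iota> b"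
  and \<iota>_mult: "a \<in> A \<Longrightarrow> b \<in> A \<Longrightarrow> \<iota> (a * b) = \<iota> a * \<iota> b"
  and A_\<kappa>: "\<kappa> c \<in> A" and \<iota>_\<kappa>: "\<iota> (\<kappa> c) = tconst c"
  using texp by (auto simp: t_expansion_def)

lemma A_0: "0 \<in> A" and \<iota>_0: "\<iota> 0 = 0" and A_1: "1 \<in> A" and \<iota>_1: "\<iota> 1 = 1"
  using A_\<kappa>[of 0] A_\<kappa>[of 1] \<iota>_\<kappa>[of 0] \<iota>_\<kappa>[of 1] by (simp_all add: rhomD[OF rhom_\<kappa>])

lemma add_on_\<iota>: "add_on A \<iota>"
  by (auto simp: add_on_def A_0 A_add \<iota>_add)

lemma \<kappa>_of_nat: "\<kappa> (of_nat n) = of_nat n"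
  by (induction n) (simp_all add: rhomD[OF rhom_\<kappa>])

lemma \<kappa>_inverse: "\<kappa> (1 / of_nat n) = 1 / of_nat n"
proof (cases "n = 0")
  case False
  then have "\<kappa> (1 / of_nat n) * of_nat n = 1"
    by (simp flip: \<kappa>_of_nat rhomD(3)[OF rhom_\<kappa>]) (simp add: rhomD(1)[OF rhom_\<kappa>])
  with False show ?thesis
    by (simp add: field_simps)
qed (simp add: rhomD[OF rhom_\<kappa>])

lemma A_uminus: "a \<in> A \<Longrightarrow> - a \<in> A" and \<iota>_uminus: "a \<in> A \<Longrightarrow> \<iota> (- a) = - \<iota> a"
proof -
  assume a: "a \<in> A"
  have m: "- a = \<kappa> (- 1) * a"
    by (simp add: rhomD[OF rhom_\<kappa>])
  show A: "- a \<in> A"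
    unfolding m by (intro A_mult A_\<kappa> a)
  have "\<iota> a + \<iota> (- a) = 0"
    using \<iota>_add[OF a A] by (simp add: \<iota>_0)
  then show "\<iota> (- a) = - \<iota> a"
    by (simp add: add_eq_0_iff)
qed

lemma A_of_nat: "of_nat n \<in> A" and \<iota>_of_nat: "\<iota> (of_nat n) = of_nat n"
  using A_\<kappa>[of "of_nat n"] \<iota>_\<kappa>[of "of_nat n"] by (simp_all add: \<kappa>_of_nat tconst_of_nat)

text \<open>The recursion divides only by positive integers, whose inverses lie in the image of
  \<open>k\<close>.\<close>

lemma f_ser_A: "fps_nth (f_ser v) n \<in> A"
proof (induction n rule: less_induct)
  case (less n)
  show ?case
  proof (cases n)
    case (Suc q)
    have "fps_nth (f_ser v) n = \<kappa> (1 / of_nat n) * - (\<Sum>i\<le>q. inverse (v (Suc i)) * fps_nth (f_ser v) (q - i))"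
      unfolding \<kappa>_inverse f_ser_rec[symmetric] by (simp add: Suc del: of_nat_Suc)
    also have "\<dots> \<in> A"
      by (intro A_mult A_\<kappa> A_uminus add_on_sum_mem[OF add_on_\<iota>] v_A less) (auto simp: Suc)
    finally show ?thesis .
  qed (simp add: f_ser_0 A_1)
qed

lemma sigma_nth: "fls_nth (fls_nth (expn 0 1 (tcoeff (r (ealpha 1) (ealpha 1)) N)) q) p =
        (if q \<ge> 0 \<and> p = 1 - q then tcoeff (\<iota> (fps_nth (f_ser v) (nat q))) N else 0)"
  using sigma unfolding is_sigma_def by blast

sublocale bichar_fin r
proof
  show "r (ealpha 1) (ealpha 1) \<in> RegT"
    using sigma by (auto simp: RegT_def Reg_def is_sigma_def KT_def intro!: fls_eqI)
  \<comment> \<open>At \<open>w = 0\<close>, the coefficient of \<sigma> of degree 0 in the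
    parameters is \<open>z\<close>, because \<open>f\<close> has constant term 1.\<close>
  have "fls_nth (fls_nth (expn 0 1 (tcoeff (r (ealpha 1) (ealpha 1)) {#})) 0) 1 = 1"
    by (simp add: sigma_nth f_ser_0 \<iota>_1 tcoeff_one)
  then show "fls_nth (expn 0 1 (tcoeff (r (ealpha 1) (ealpha 1)) {#})) 0 \<noteq> 0"
    by auto
qed (rule fbich fDcomp)+

lemma \<rho>_dp_ealpha: "\<rho> (ealpha 1) (dp n (ealpha 1)) = zpow (\<iota> (fps_nth (f_ser v) n)) (1 - int n)"
  unfolding \<rho>_def at_w0_r_dp
  by (rule fls_tps_eqI) (simp add: nth_zpow w_coeff_def sigma_nth)

text \<open>The values \<open>r(e^\<alpha>, D^(n) e^\<alpha>)(z, 0)\<close> are the Taylor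
  coefficients of \<sigma>. Writing \<open>D^(n+1) e^\<alpha>\<close> through the
  \<open>h^(i)\<close> gives a recursion of the form of \<open>f_ser_rec\<close>, which can be
  solved for the top value since its factor is the invertible \<open>z\<close>.\<close>

lemma \<rho>_ealpha_hgen: "\<rho> (ealpha 1) (hgen j) = - zpow (\<iota> (inverse (v (Suc j)))) (- int j - 1)"
proof (induction j rule: less_induct)
  case (less q)
  let ?f = "\<lambda>n. \<iota> (fps_nth (f_ser v) n)"
  let ?v = "\<lambda>n. \<iota> (inverse (v (Suc n)))"
  have v: "inverse (v (Suc n)) \<in> A" for n
    by (rule v_A) simp
  have "of_nat (Suc q) * ?f (Suc q) = - (\<Sum>n\<le>q. ?v n * ?f (q - n))"
    unfolding \<iota>_of_nat[symmetric]
    by (subst \<iota>_mult[symmetric, OF A_of_nat f_ser_A], subst f_ser_rec, subst \<iota>_uminus,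
        (intro add_on_sum_mem[OF add_on_\<iota>] A_mult f_ser_A v), subst add_on_sum[OF add_on_\<iota>])
      (auto intro!: A_mult f_ser_A v simp: \<iota>_mult[OF v f_ser_A])
  also have "\<dots> = - ?v q - (\<Sum>n<q. ?v n * ?f (q - n))"
    by (simp add: lessThan_Suc_atMost[symmetric] f_ser_0 \<iota>_1)
  finally have f: "of_nat (Suc q) * ?f (Suc q) = - ?v q - (\<Sum>n<q. ?v n * ?f (q - n))" .
  have "\<rho> (ealpha 1) (scl (of_nat (Suc q)) (dp (Suc q) (ealpha 1))) =
      \<rho> (ealpha 1) (hgen q) * zpow 1 1 + (\<Sum>i<q. \<rho> (ealpha 1) (hgen i) * zpow (?f (q - i)) (1 - int (q - i)))"
    unfolding dp_ealpha_rec lessThan_Suc_atMost[symmetric]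
    by (simp add: \<rho>_lin additive.sum[of "\<rho> (ealpha 1)"] additive_def \<rho>_ealpha_mult \<rho>_dp_ealpha f_ser_0 \<iota>_1 del: dp_0)
  also have "(\<Sum>i<q. \<rho> (ealpha 1) (hgen i) * zpow (?f (q - i)) (1 - int (q - i))) = - zpow (\<Sum>i<q. ?v i * ?f (q - i)) (- int q)"
    by (simp add: less zpow_mult zpow_sum sum_negf)
  also have "\<rho> (ealpha 1) (scl (of_nat (Suc q)) (dp (Suc q) (ealpha 1))) = zpow (of_nat (Suc q) * ?f (Suc q)) (- int q)"
    by (simp add: \<rho>_lin \<rho>_dp_ealpha scalY_eq_zpow zpow_mult tconst_of_nat del: of_nat_Suc) simp
  finally have "\<rho> (ealpha 1) (hgen q) * zpow 1 1 = - zpow (?v q) (- int q)"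
    unfolding f zpow_diff zpow_uminus by simp
  then have "\<rho> (ealpha 1) (hgen q) * (zpow 1 1 * zpow 1 (- 1)) = - (zpow (?v q) (- int q) * zpow 1 (- 1))"
    by (simp flip: mult.assoc)
  then show ?case
    by (simp add: zpow_mult zpow_1)
qed

lemma \<rho>_ealpha_ealpha: "\<rho> (ealpha 1) (ealpha m) = zpow 1 m"
proof -
  have 1: "\<rho> (ealpha 1) (ealpha (n + 1)) = \<rho> (ealpha 1) (ealpha n) * zpow 1 1" for n
    using \<rho>_dp_ealpha[of 0] by (simp add: ealpha_add \<rho>_ealpha_mult f_ser_0 \<iota>_1)
  show ?thesis
  proof (induction m rule: int_induct[of _ 0])
    case base
    then show ?case
      by (simp add: ealpha_0 \<rho>_1 counit_simps zpow_1 rhomD[OF rhom_scalY])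
  next
    case (step1 i)
    then show ?case
      by (simp add: 1 zpow_mult)
  next
    case (step2 i)
    \<comment> \<open>The descent to negative exponents is possible because \<open>z\<close> is
      invertible.\<close>
    have "\<rho> (ealpha 1) (ealpha (i - 1)) * (zpow 1 1 * zpow 1 (- 1)) = zpow 1 i * zpow 1 (- 1)"
      using 1[of "i - 1"] step2 by (simp flip: mult.assoc)
    then show ?case
      by (simp add: zpow_mult zpow_1)
  qed
qed

lemma \<rho>_hh: "\<rho> (hgen 0) (hgen j) = zpow (of_nat (Suc j) * \<iota> (inverse (v (Suc j)))) (- int j - 2)"
proof -
  have "tmap fls_deriv (- X) = - tmap fls_deriv X" for X :: "('p, 'k V0 fls) tps"
    by (auto intro!: tps_eqI)
  moreover have "zpow (of_int (- int j - 1) * X) k = - zpow (of_nat (Suc j) * X) k" for X :: "('p, 'k) tps" and k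
    unfolding zpow_uminus[symmetric] by (intro arg_cong[where f = "\<lambda>X. zpow X k"]) (simp add: algebra_simps)
  ultimately show ?thesis
    by (simp only: \<rho>_hgen_hgen \<rho>_ealpha_hgen fls_deriv_zpow) (simp add: algebra_simps)
qed

lemma \<rho>_he: "\<rho> (hgen 0) (ealpha m) = zpow (of_int m) (- 1)"
proof -
  have "\<rho> (hgen 0) (ealpha m) * (zpow 1 m * zpow 1 (- m)) = zpow (of_int m) (m - 1) * zpow 1 (- m)"
    using \<rho>_hgen_ealpha[of m] by (simp add: \<rho>_ealpha_ealpha fls_deriv_zpow flip: mult.assoc)
  then show ?thesis
    by (simp add: zpow_mult zpow_1)
qed

end

section \<open>Comparison of the two spaces\<close>

lemma pm_monomial_induct:
  assumes "Q 0" "\<And>u j. Q u \<Longrightarrow> Q (u + single j 1)"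
  shows "Q (u :: 'a \<Rightarrow>\<^sub>0 nat)"
proof (induction "\<Sum>i\<in>keys u. lookup u i" arbitrary: u)
  case 0
  then have "u = 0"
    by (auto intro!: poly_mapping_eqI simp: in_keys_iff)
  then show ?case
    using assms(1) by simp
next
  case (Suc n)
  then obtain j where j: "j \<in> keys u"
    by fastforce
  define u' where "u' = u - single j 1"
  have u: "u = u' + single j 1"
    using j by (auto intro!: poly_mapping_eqI simp: u'_def lookup_add lookup_minus lookup_single when_def in_keys_iff)
  have k: "finite (keys u)" "keys u' \<subseteq> keys u"
    by (auto simp: u in_keys_iff lookup_add)
  have "(\<Sum>i\<in>keys u. lookup u i) = (\<Sum>i\<in>keys u. lookup u' i + (if i = j then 1 else 0))"
    by (intro sum.cong) (auto simp: u lookup_add lookup_single when_def)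
  also have "\<dots> = (\<Sum>i\<in>keys u. lookup u' i) + 1"
    using j by (simp add: sum.distrib)
  also have "(\<Sum>i\<in>keys u. lookup u' i) = (\<Sum>i\<in>keys u'. lookup u' i)"
    using k by (intro sum.mono_neutral_right) (auto simp: in_keys_iff)
  finally have "n = (\<Sum>i\<in>keys u'. lookup u' i)"
    using Suc(2) by simp
  then show ?case
    using Suc(1) assms(2) by (simp add: u)
qed

lemma bas_Suc: "bas (u + single j 1, m) = hgen j * (bas (u, m) :: 'a::comm_ring_1 V0)"
  by (simp add: hgen_def bas_mult add.commute)

definition emb :: "('p, 'k::comm_ring_1) tps \<Rightarrow> ('p, 'k V0) tps" where
  "emb = tmap (single 0)"

lemma emb_tconst: "emb (tconst c) * tconst y = tconst (scl c y)"
  unfolding emb_def by (subst tmap_tconst) (simp_all add: scl_mult tconst_mult)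

lemma nth_mult_const: "tmap (\<lambda>F. fls_nth F n) (X * tconst (fls_const y)) = tmap (\<lambda>F. fls_nth F n) X * tconst y"
  "tmap (\<lambda>F. fls_nth F n) (tconst (fls_const y) * X) = tconst y * tmap (\<lambda>F. fls_nth F n) X"
  unfolding mult_tconst_right tconst_mult_left by (auto intro!: tps_eqI)

lemma nth_zpow_mult: "tmap (\<lambda>F. fls_nth F n) (zpow X k * Z) = emb X * tmap (\<lambda>F. fls_nth F (n - k)) Z"
  by (rule tps_eqI)
    (simp add: zpow_def emb_def tcoeff_mult fls_nth_sum case_prod_unfold fls_shifted_times_simps)

lemma nth_zpow_tmap: "tmap (\<lambda>F. fls_nth F n) (zpow X k) = (if n = k then emb X else 0)"
  by (auto intro!: tps_eqI simp: nth_zpow emb_def)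

context fock
begin

abbreviation "L \<equiv> fock_lattice v A"
abbreviation "I \<equiv> identify v \<iota>"

lemma vpart_nz: "vpart v l \<noteq> 0"
  by (rule vpart_nonzero[OF v])

lemma vpart_simps: "vpart v 0 = 1" "vpart v (l + l') = vpart v l * vpart v l'" "vpart v (single j 1) = v (Suc j)"
  unfolding vpart_eq by (simp_all add: meval_add One_nat_def)

lemma L_lookup: "x \<in> L \<Longrightarrow> vpart v (fst u) * lookup x u \<in> A"
  by (cases u) (auto simp: fock_lattice_def)

lemma lookup_I: "lookup (tcoeff (I x) N) u = tcoeff (\<iota> (vpart v (fst u) * lookup x u)) N"
proof -
  have "lookup (tcoeff (I x) N) u = (\<Sum>u'\<in>keys x. if u' = u then tcoeff (\<iota> (vpart v (fst u) * lookup x u)) N else 0)"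
    by (auto simp: identify_def lookup_sum lookup_single when_def intro!: sum.cong)
  then show ?thesis
    by (auto simp: in_keys_iff \<iota>_0)
qed

lemma I_eqI: "(\<And>N u. tcoeff (\<iota> (vpart v (fst u) * lookup x u)) N = lookup (tcoeff y N) u) \<Longrightarrow> I x = y"
  by (intro tps_eqI poly_mapping_eqI) (simp only: lookup_I)

lemma add_on_I: "add_on L I"
proof -
  have "x + y \<in> L \<and> I (x + y) = I x + I y" if "x \<in> L" "y \<in> L" for x y
  proof
    show "x + y \<in> L"
      using that by (auto simp: fock_lattice_def lookup_add distrib_left intro: A_add)
    show "I (x + y) = I x + I y"
      by (rule I_eqI) (simp add: lookup_add lookup_I distrib_left \<iota>_add L_lookup that)
  qed
  moreover have "0 \<in> L"
    by (simp add: fock_lattice_def A_0)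
  ultimately show ?thesis
    by (auto simp: add_on_def)
qed

lemma L_single: "vpart v (fst u) * c \<in> A \<Longrightarrow> single u c \<in> L"
  by (auto simp: fock_lattice_def lookup_single when_def A_0)

lemma I_single: "I (single u c) = tmap (single u) (\<iota> (vpart v (fst u) * c))"
  by (rule I_eqI) (auto simp: lookup_single when_def \<iota>_0)

lemma L_sum: "(\<And>i. i \<in> S \<Longrightarrow> f i \<in> L) \<Longrightarrow> sum f S \<in> L"
  by (rule add_on_sum_mem[OF add_on_I])

lemma I_sum: "(\<And>i. i \<in> S \<Longrightarrow> f i \<in> L) \<Longrightarrow> I (sum f S) = (\<Sum>i\<in>S. I (f i))"
  by (rule add_on_sum[OF add_on_I])

text \<open>\<open>vpart\<close> is multiplicative, so the lattice is closed under products and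
  \<open>identify\<close> respects them, monomial by monomial.\<close>

lemma L_mult: "x \<in> L \<Longrightarrow> y \<in> L \<Longrightarrow> x * y \<in> L" and I_mult: "x \<in> L \<Longrightarrow> y \<in> L \<Longrightarrow> I (x * y) = I x * I y"
proof -
  assume x: "x \<in> L" and y: "y \<in> L"
  let ?x = "\<lambda>b. single b (lookup x b)" and ?y = "\<lambda>b. single b (lookup y b)"
  have sL: "?x b \<in> L" "?y b \<in> L" for b
    by (intro L_single L_lookup x y)+
  have e: "x * y = (\<Sum>b\<in>keys x. \<Sum>c\<in>keys y. ?x b * ?y c)"
    by (subst pm_expand[of x], subst pm_expand[of y]) (rule sum_product)
  have p: "vpart v (fst (b + c)) * (lookup x b * lookup y c) = (vpart v (fst b) * lookup x b) * (vpart v (fst c) * lookup y c)" for b c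
    by (simp add: vpart_simps mult_ac)
  have m: "?x b * ?y c \<in> L" for b c
    unfolding mult_single by (rule L_single) (simp only: p A_mult L_lookup x y)
  have Im: "I (?x b * ?y c) = I (?x b) * I (?y c)" for b c
    unfolding mult_single I_single p \<iota>_mult[OF L_lookup[OF x] L_lookup[OF y]]
  proof (rule tps_eqI)
    fix N
    have s: "additive (single (b + c) :: 'k \<Rightarrow> _)"
      by (simp add: additive_def single_add)
    show "tcoeff (tmap (single (b + c)) (\<iota> (vpart v (fst b) * lookup x b) * \<iota> (vpart v (fst c) * lookup y c))) N =
      tcoeff (tmap (single b) (\<iota> (vpart v (fst b) * lookup x b)) * tmap (single c) (\<iota> (vpart v (fst c) * lookup y c))) N"
      by (simp add: tcoeff_mult additive.sum[OF s] mult_single case_prod_unfold)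
  qed
  show "x * y \<in> L"
    unfolding e by (intro L_sum m)
  have "I (x * y) = (\<Sum>b\<in>keys x. I (?x b)) * (\<Sum>c\<in>keys y. I (?y c))"
    unfolding e by (simp add: I_sum L_sum m Im sum_product)
  also have "\<dots> = I x * I y"
    by (simp add: sL flip: I_sum pm_expand)
  finally show "I (x * y) = I x * I y" .
qed

lemma L_scl: "c \<in> A \<Longrightarrow> x \<in> L \<Longrightarrow> scl c x \<in> L" and I_scl: "c \<in> A \<Longrightarrow> x \<in> L \<Longrightarrow> I (scl c x) = emb (\<iota> c) * I x"
proof -
  assume c: "c \<in> A" "x \<in> L"
  have s: "single 0 c \<in> L"
    by (rule L_single) (simp add: vpart_simps c)
  show "scl c x \<in> L" "I (scl c x) = emb (\<iota> c) * I x"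
    unfolding scl_mult by (simp_all add: L_mult s c I_mult I_single vpart_simps emb_def)
qed

lemma L_uminus: "x \<in> L \<Longrightarrow> - x \<in> L"
  by (auto simp: fock_lattice_def intro: A_uminus)

lemma I_diff: "x \<in> L \<Longrightarrow> y \<in> L \<Longrightarrow> I (x - y) = I x - I y"
proof -
  assume x: "x \<in> L" and y: "y \<in> L"
  have d: "x - y \<in> L"
    using add_on_I L_uminus[OF y] x unfolding add_on_def by (metis diff_conv_add_uminus)
  have "I ((x - y) + y) = I (x - y) + I y"
    using add_on_I d y unfolding add_on_def by blast
  then show "I (x - y) = I x - I y"
    by simp
qed

text \<open>The element \<open>v_n^-1 p_n\<close> with \<open>n = j + 1\<close>, the generator of
  the lattice that corresponds to \<open>h^(j)\<close>.\<close>

definition hv :: "nat \<Rightarrow> 'f V0" where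
  "hv j = scl (inverse (v (Suc j))) (hgen j)"

lemma hv_L: "hv j \<in> L" and I_hv: "I (hv j) = tconst (hgen j)"
proof -
  have h: "hv j = single (single j 1, 0) (inverse (v (Suc j)))"
    by (simp add: hv_def hgen_def bas_def)
  have e: "vpart v (single j 1) * inverse (v (Suc j)) = 1"
    unfolding vpart_simps using v[of "Suc j"] by simp
  show "hv j \<in> L"
    unfolding h by (rule L_single) (simp only: fst_conv e A_1)
  show "I (hv j) = tconst (hgen j)"
    unfolding h I_single fst_conv e \<iota>_1 by (rule tps_eqI) (simp add: tcoeff_one tcoeff_tconst hgen_def bas_def)
qed

lemma fock_bas_L: "fock_bas v u \<in> L" and I_fock_bas: "I (fock_bas v u) = tbas u"
proof -
  show "fock_bas v u \<in> L"
    unfolding fock_bas_def by (rule L_single) (simp add: vpart_nz A_1)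
  show "I (fock_bas v u) = tbas u"
    unfolding fock_bas_def I_single tbas_def
    by (rule tps_eqI) (simp add: vpart_nz \<iota>_1 tcoeff_one tcoeff_tconst bas_def)
qed

lemma fock_bas_0: "fock_bas v (0, m) = ealpha m"
  by (simp add: fock_bas_def vpart_simps ealpha_def bas_def)

lemma ealpha_L: "ealpha m \<in> L" and I_ealpha: "I (ealpha m) = tconst (ealpha m)"
  using fock_bas_L[of "(0, m)"] I_fock_bas[of "(0, m)"] by (simp_all add: fock_bas_0 tbas_def ealpha_def)

lemma fock_bas_Suc: "fock_bas v (u + single j 1, m) = hv j * fock_bas v (u, m)"
  by (simp add: fock_bas_def hv_def hgen_def bas_def mult_single vpart_simps add.commute mult.commute)

lemma fock_bas_eq: "fock_bas v (u, m) = scl (inverse (vpart v u)) (bas (u, m))"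
  by (simp add: fock_bas_def bas_def)

lemma transports_I:
  assumes "\<And>x. x \<in> L \<Longrightarrow> T x \<in> L" "\<And>u. I (T (fock_bas v u)) = tmap (\<lambda>F. fls_nth F n) (Y0 r a (bas u))"
  shows "transports v A \<iota> T (Y_r r (tconst a) n)"
proof -
  let ?F = "\<lambda>b. tmap (\<lambda>F. fls_nth F n) (Y0 r a b)"
  have "Y_r r (tconst a) n x = tapp ?F x" for x
  proof -
    have "tapp (\<lambda>b0. tmap (\<lambda>F. fls_nth F n) (Y0 r 0 b0)) x = 0"
      by (rule tps_eqI) (simp add: tcoeff_tapp additive.zero[OF additive_Y0(2)])
    then show ?thesis
      unfolding Y_r_tapp by (rule tapp_tconst)
  qed
  also have "tapp ?F x = tlin (\<lambda>u. ?F (bas u)) x" for x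
    by (rule tapp_eq_tlin) (simp_all add: additive_def Y0_add Y0_scl nth_scalY tmap_nth_add)
  finally have "Y_r r (tconst a) n = tlin (\<lambda>u. ?F (bas u))" ..
  then show ?thesis
    using assms by (simp add: transports_def)
qed

lemma nth_exp_hgen: "fls_nth (exp_zD (hgen 0) * fls_const b) n = (if n < 0 then 0 else hgen (nat n) * b)"
  by (simp add: fls_nth_exp_zD dp_hgen)

text \<open>Both sides are derivations in \<open>b\<close>, so generators suffice. The exponent -1
  is left out: it carries the zero mode, which multiplies \<open>e^(m\<alpha>)\<close> by
  \<open>m\<close>.\<close>

lemma M_hgen_nth: "n \<ge> 0 \<Longrightarrow> tmap (\<lambda>F. fls_nth F n) (M (hgen 0) b) = 0"
  "tmap (\<lambda>F. fls_nth F (- int j - 2)) (M (hgen 0) b) = emb (of_nat (Suc j) * \<iota> (inverse (v (Suc j)))) * tconst (pd j b)"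
proof -
  let ?nth = "\<lambda>n. tmap (\<lambda>F. fls_nth F n) :: ('p, 'k V0 fls) tps \<Rightarrow> ('p, 'k V0) tps"
  let ?c = "\<lambda>j. emb (of_nat (Suc j) * \<iota> (inverse (v (Suc j)))) :: ('p, 'k V0) tps"
  have "(\<forall>n\<ge>0. ?nth n (M (hgen 0) b) = 0) \<and> (\<forall>j. ?nth (- int j - 2) (M (hgen 0) b) = ?c j * tconst (pd j b))"
  proof (induction b rule: V0_alg_induct)
    case (const c)
    show ?case
      by (simp add: M_const counit_simps rhomD(5)[OF rhom_scalY] pd_const) (auto intro!: tps_eqI)
  next
    case (hgen i)
    have "M (hgen 0) (hgen i) = zpow (of_nat (Suc i) * \<iota> (inverse (v (Suc i)))) (- int i - 2)"
      by (simp only: M_hgen \<rho>_hh counit_simps rhomD(5)[OF rhom_scalY] mult_zero_right add_0)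
    then show ?case
      by (auto simp: nth_zpow_tmap pd_hgen simp del: of_nat_Suc)
  next
    case (ealpha m)
    have "?nth n (M (hgen 0) (ealpha m)) = 0" if "n \<noteq> - 1" for n
      by (simp add: M_ealpha \<rho>_he nth_mult_const nth_zpow_tmap that)
    then show ?case
      by (simp add: pd_ealpha)
  next
    case (add x y)
    then show ?case
      by (simp add: M_add tmap_nth_add pd_add tconst_add distrib_left)
  next
    case (mult x y)
    then show ?case
      by (simp add: M_mult_hgen tmap_nth_add nth_mult_const pd_mult tconst_add tconst_mult distrib_left mult_ac)
  qed
  then show "n \<ge> 0 \<Longrightarrow> ?nth n (M (hgen 0) b) = 0" "?nth (- int j - 2) (M (hgen 0) b) = ?c j * tconst (pd j b)"
    by auto
qed

text \<open>Nonnegative powers of \<open>z\<close> in \<open>Y(h, z)\<close> come from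
  \<open>e^(zD) h\<close> alone, whose coefficient at \<open>z^j\<close> is
  \<open>h^(j)\<close>.\<close>

lemma heis_minus_transports: "transports v A \<iota> (heis_minus v (Suc j)) (Y_r r (tconst (hgen 0)) (int j))"
proof (rule transports_I)
  have e: "heis_minus v (Suc j) x = hv j * x" for x
    by (simp add: heis_minus_eq hv_def)
  show "x \<in> L \<Longrightarrow> heis_minus v (Suc j) x \<in> L" for x
    unfolding e by (intro L_mult hv_L)
  show "I (heis_minus v (Suc j) (fock_bas v u)) = tmap (\<lambda>F. fls_nth F (int j)) (Y0 r (hgen 0) (bas u))" for u
  proof -
    have "tmap (\<lambda>F. fls_nth F (int j)) (Y0 r (hgen 0) (bas u)) = tconst (hgen j * bas u)"
      by (simp add: Y0_hgen tmap_nth_add M_hgen_nth tmap_tconst nth_exp_hgen del: fls_mult_const_nth)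
    then show ?thesis
      by (simp add: e I_mult hv_L fock_bas_L I_hv I_fock_bas tbas_def tconst_mult)
  qed
qed

text \<open>In the generators \<open>hv\<close> of the lattice, the derivative by \<open>p_n\<close>
  is \<open>v_n^-1\<close> times the derivative by the generator, and \<open>v_n^-1\<close> lies in
  \<open>A\<close>.\<close>

lemma pd_L: "x \<in> L \<Longrightarrow> pd j x \<in> L" and pd_fock_bas: "I (pd j (fock_bas v u)) = emb (\<iota> (inverse (v (Suc j)))) * tconst (pd j (bas u))"
proof -
  have vp: "vpart v (l - single j 1) * (c * of_nat (lookup l j)) = inverse (v (Suc j)) * (vpart v l * c) * of_nat (lookup l j)" for l c
  proof (cases "lookup l j = 0")
    case False
    define u where "u = l - single j 1"
    have l: "l = u + single j 1"
      using False by (auto intro!: poly_mapping_eqI simp: u_def lookup_add lookup_minus lookup_single when_def)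
    have "vpart v l = vpart v u * v (Suc j)"
      unfolding l vpart_simps ..
    then show ?thesis
      using v[of "Suc j"] by (simp flip: u_def)
  qed simp
  have s: "pd j (single (l, m) c) \<in> L" if "vpart v l * c \<in> A" for l m c
    unfolding pd_single scl_single
    by (rule L_single) (simp only: fst_conv vp, intro A_mult v_A that A_of_nat, simp)
  have "pd j (\<Sum>u\<in>keys x. single u (lookup x u)) \<in> L" if "x \<in> L" for x
    unfolding additive.sum[OF additive_pd]
  proof (rule L_sum)
    fix u
    show "pd j (single u (lookup x u)) \<in> L"
      using s[of "fst u" "lookup x u" "snd u"] L_lookup[OF that, of u] by simp
  qed
  then show "x \<in> L \<Longrightarrow> pd j x \<in> L"
    by (simp flip: pm_expand)
  obtain l m where u: "u = (l, m)" by (cases u)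
  have "\<iota> (vpart v (l - single j 1) * (inverse (vpart v l) * of_nat (lookup l j))) = \<iota> (inverse (v (Suc j))) * of_nat (lookup l j)"
    unfolding vp using v_A[of "Suc j"] by (simp add: vpart_nz \<iota>_mult A_of_nat \<iota>_of_nat)
  then have "I (pd j (fock_bas v u)) = tmap (single (l - single j 1, m)) (\<iota> (inverse (v (Suc j))) * of_nat (lookup l j))"
    by (simp add: u fock_bas_def pd_single I_single)
  also have "\<dots> = emb (\<iota> (inverse (v (Suc j)))) * tconst (pd j (bas u))"
    unfolding tconst_of_nat[symmetric] mult_tconst_right emb_def
    by (rule tps_eqI) (simp add: u pd_bas mult_single)
  finally show "I (pd j (fock_bas v u)) = emb (\<iota> (inverse (v (Suc j)))) * tconst (pd j (bas u))" .
qed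

text \<open>The mode \<open>h_n\<close> is the coefficient of \<open>z^(-n-1)\<close>, here with
  \<open>n = j + 1\<close>; at negative powers only \<open>M\<close> contributes.\<close>

lemma heis_plus_transports: "transports v A \<iota> (heis_plus v (Suc j)) (Y_r r (tconst (hgen 0)) (- int j - 2))"
proof (rule transports_I)
  have e: "heis_plus v (Suc j) x = scl (of_nat (Suc j)) (pd j x)" for x
    by (rule heis_plus_eq) (rule v)
  show "x \<in> L \<Longrightarrow> heis_plus v (Suc j) x \<in> L" for x
    unfolding e by (intro L_scl pd_L A_of_nat)
  show "I (heis_plus v (Suc j) (fock_bas v u)) = tmap (\<lambda>F. fls_nth F (- int j - 2)) (Y0 r (hgen 0) (bas u))" for u
  proof -
    have "I (heis_plus v (Suc j) (fock_bas v u)) = emb (of_nat (Suc j)) * (emb (\<iota> (inverse (v (Suc j)))) * tconst (pd j (bas u)))"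
      unfolding e by (simp only: I_scl A_of_nat pd_L fock_bas_L pd_fock_bas \<iota>_of_nat)
    also have "\<dots> = emb (of_nat (Suc j) * \<iota> (inverse (v (Suc j)))) * tconst (pd j (bas u))"
      by (simp only: emb_def tmap_rhom_mult[OF rhom_single0] mult.assoc)
    also have "\<dots> = tmap (\<lambda>F. fls_nth F (- int j - 2)) (Y0 r (hgen 0) (bas u))"
      unfolding Y0_hgen tmap_nth_add M_hgen_nth by (subst tmap_tconst) (simp_all add: nth_exp_hgen del: fls_mult_const_nth)
    finally show ?thesis .
  qed
qed

end

context fock
begin

lemma L_exp_coeff:
  assumes "\<And>n y. n \<noteq> 0 \<Longrightarrow> y \<in> L \<Longrightarrow> T n y \<in> L" "x \<in> L"
  shows "exp_coeff T k x \<in> L"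
  unfolding exp_coeff_def
proof (rule L_sum)
  fix ns assume ns: "ns \<in> {ns. 0 \<notin> set ns \<and> sum_list ns = k}"
  have "1 / fact n = (1 / of_nat (fact n) :: 'f)" for n
    by simp
  then have f: "1 / fact n \<in> A" for n
    using A_\<kappa>[of "1 / of_nat (fact n)"] unfolding \<kappa>_inverse by simp
  have "foldr T ns x \<in> L"
    using ns assms by (induction ns arbitrary: k) auto
  then show "scl (1 / fact (length ns)) (foldr T ns x) \<in> L"
    by (intro L_scl f)
qed

lemma A_inverse_of_nat: "1 / of_nat n \<in> A" and \<iota>_inverse_of_nat: "\<iota> (1 / of_nat n) = tconst (1 / of_nat n)"
  using A_\<kappa>[of "1 / of_nat n"] \<iota>_\<kappa>[of "1 / of_nat n"] unfolding \<kappa>_inverse .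

abbreviation "W \<equiv> psi_plus :: nat \<Rightarrow> 'f V0 \<Rightarrow> 'f V0"
abbreviation "C \<equiv> psi_minus v"

lemma W_L: "x \<in> L \<Longrightarrow> W l x \<in> L"
  unfolding psi_plus_def by (rule L_exp_coeff) (auto intro: L_uminus pd_L)

lemma exp_plus: "exp_coeff (\<lambda>i x. scl (- 1 / of_nat i) (heis_plus v i x)) l x = W l x"
  by (rule exp_heis_plus) (rule v)

lemma C_eq: "C j = exp_coeff (\<lambda>i x. scl (1 / of_nat i) (heis_minus v i x)) j 1"
  using exp_heis_minus[of v j 1] by simp

lemma C_L: "C j \<in> L"
  unfolding C_eq
proof (rule L_exp_coeff)
  show "1 \<in> L"
    using ealpha_L[of 0] by (simp add: ealpha_0)
  fix n :: nat and y assume n: "n \<noteq> 0" and y: "y \<in> L"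
  obtain i where i: "n = Suc i"
    using n not0_implies_Suc by blast
  have "scl (1 / of_nat n) (hv i * y) \<in> L"
    by (intro L_scl A_inverse_of_nat L_mult hv_L y)
  then show "scl (1 / of_nat n) (heis_minus v n y) \<in> L"
    by (simp add: heis_minus_eq hv_def i)
qed

text \<open>Under the identification \<open>hv i\<close> becomes \<open>h^(i)\<close>, so both sides
  obey one recursion; the inverse of \<open>j\<close> by which it divides lies in
  \<open>A\<close>.\<close>

lemma C_ealpha: "I (C j * ealpha 1) = tconst (dp j (ealpha 1))"
proof (induction j rule: less_induct)
  case (less j)
  show ?case
  proof (cases j)
    case 0
    then show ?thesis
      by (simp add: psi_minus_0 I_ealpha)
  next
    case (Suc k)
    have 1: "C j * ealpha 1 = scl (1 / of_nat j) (\<Sum>i\<le>k. hv i * (C (k - i) * ealpha 1))"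
    proof -
      have "scl (of_nat j) (C j) = (\<Sum>i\<le>k. hv i * C (k - i))"
        unfolding psi_minus_rec Suc by (rule sum.reindex_bij_witness[of _ Suc "\<lambda>i. i - 1"]) (auto simp: hv_def Suc_eq_plus1)
      then have "scl (1 / of_nat j) (scl (of_nat j) (C j)) * ealpha 1 = scl (1 / of_nat j) (\<Sum>i\<le>k. hv i * (C (k - i) * ealpha 1))"
        by (simp add: sum_distrib_right mult.assoc scl_mult_left)
      then show ?thesis
        by (simp add: Suc scl_scl scl_one del: of_nat_Suc)
    qed
    have 2: "dp j (ealpha 1) = scl (1 / of_nat j) (\<Sum>i\<le>k. hgen i * dp (k - i) (ealpha 1))"
      unfolding dp_ealpha_rec[symmetric] Suc by (simp add: scl_scl scl_one del: of_nat_Suc)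
    have L: "hv i * (C (k - i) * ealpha 1) \<in> L" for i
      by (intro L_mult hv_L C_L ealpha_L)
    have "I (C j * ealpha 1) = emb (tconst (1 / of_nat j)) * (\<Sum>i\<le>k. I (hv i * (C (k - i) * ealpha 1)))"
      unfolding 1 by (simp only: I_scl A_inverse_of_nat \<iota>_inverse_of_nat L_sum L I_sum)
    also have "\<dots> = emb (tconst (1 / of_nat j)) * (\<Sum>i\<le>k. tconst (hgen i * dp (k - i) (ealpha 1)))"
      using less by (simp add: Suc I_mult hv_L L_mult C_L ealpha_L I_hv tconst_mult)
    also have "\<dots> = tconst (dp j (ealpha 1))"
      unfolding 2 by (simp add: emb_tconst flip: additive.sum[OF additive_tconst])
    finally show ?thesis .
  qed
qed

lemma M_ealpha_hgen_mult: "M (ealpha 1) (hgen j * b) =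
    tconst (fls_const (hgen j)) * M (ealpha 1) b - zpow (\<iota> (inverse (v (Suc j)))) (- int j - 1) * M (ealpha 1) b"
  unfolding M_mult_ealpha M_hgen \<rho>_ealpha_hgen counit_simps rhomD(1)[OF rhom_scalY] by (simp add: algebra_simps)

lemma W_hv: "W l (hv j * x) = hv j * W l x - (if j < l then scl (inverse (v (Suc j))) (W (l - Suc j) x) else 0)"
  unfolding hv_def scl_mult_left psi_plus_lin psi_plus_hgen by (simp add: additive.diff[OF additive_scl] scl_mult_left scl_zero)

abbreviation "znth n \<equiv> tmap (\<lambda>F. fls_nth F n) :: ('p, 'k V0 fls) tps \<Rightarrow> ('p, 'k V0) tps"

lemma znth_diff: "znth n (X - Y) = znth n X - znth n Y"
  by (rule tps_eqI) simp

text \<open>The three claims are proved together while one generator at a time is multiplied in; on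
  both sides the step is the substitution
  \<open>h^(j) \<mapsto> h^(j) - v_(j+1)^-1 z^(-j-1)\<close>. The bound on the exponents enters the
  third claim, and the vanishing for large \<open>l\<close> makes the sums in \<Psi> finite.\<close>

lemma W_M:
  "(\<forall>k>m. znth k (M (ealpha 1) (bas (u, m))) = 0) \<and> (\<exists>B. \<forall>l>B. W l (fock_bas v (u, m)) = 0) \<and>
   (\<forall>l. I (W l (fock_bas v (u, m))) = znth (m - int l) (M (ealpha 1) (bas (u, m))))"
proof (induction u rule: pm_monomial_induct)
  case 1
  have W: "W l (ealpha m) = (if l = 0 then ealpha m else 0)" for l
    by (rule psi_plus_const) (rule pd_ealpha)
  have M: "M (ealpha 1) (ealpha m) = zpow 1 m * tconst (fls_const (ealpha m))"
    by (simp add: M_ealpha \<rho>_ealpha_ealpha mult.commute)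
  have e: "emb 1 = (1 :: ('p, 'k V0) tps)"
    by (simp add: emb_def rhomD(1)[OF rhom_tmap[OF rhom_single0]])
  have b: "bas (0, m) = ealpha m"
    by (simp add: ealpha_def)
  show ?case
    unfolding fock_bas_0 b W M nth_mult_const nth_zpow_tmap
    by (auto simp: I_ealpha e add_on_0[OF add_on_I] intro!: exI[of _ 0])
next
  case (2 u j)
  let ?x = "fock_bas v (u, m)" and ?b = "M (ealpha 1) (bas (u, m))"
  obtain B where B: "\<And>l. l > B \<Longrightarrow> W l ?x = 0"
    using 2 by blast
  have M0: "k > m \<Longrightarrow> znth k ?b = 0" for k
    using 2 by blast
  have IW: "I (W l ?x) = znth (m - int l) ?b" for l
    using 2 by blast
  have M: "znth k (M (ealpha 1) (bas (u + single j 1, m))) =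
      tconst (hgen j) * znth k ?b - emb (\<iota> (inverse (v (Suc j)))) * znth (k + int j + 1) ?b" for k
    unfolding bas_Suc M_ealpha_hgen_mult znth_diff nth_mult_const nth_zpow_mult by (simp add: algebra_simps)
  have W: "W l (fock_bas v (u + single j 1, m)) = hv j * W l ?x - (if j < l then scl (inverse (v (Suc j))) (W (l - Suc j) ?x) else 0)" for l
    unfolding fock_bas_Suc W_hv ..
  have vA: "inverse (v (Suc j)) \<in> A"
    by (rule v_A) simp
  have "I (W l (fock_bas v (u + single j 1, m))) = znth (m - int l) (M (ealpha 1) (bas (u + single j 1, m)))" for l
  proof -
    \<comment> \<open>For \<open>l \<le> j\<close> the exponent on the right exceeds
      \<open>m\<close>, where the coefficient is 0, in agreement with the left side.\<close>
    have "I (if j < l then scl (inverse (v (Suc j))) (W (l - Suc j) ?x) else 0) =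
        emb (\<iota> (inverse (v (Suc j)))) * znth (m - int l + int j + 1) ?b"
      by (auto simp: I_scl vA W_L fock_bas_L IW add_on_0[OF add_on_I] M0 of_nat_diff algebra_simps)
    moreover have "(if j < l then scl (inverse (v (Suc j))) (W (l - Suc j) ?x) else 0) \<in> L"
      using add_on_I by (auto simp: L_scl vA W_L fock_bas_L add_on_def)
    ultimately show ?thesis
      unfolding W M by (simp only: I_diff I_mult L_mult hv_L W_L fock_bas_L I_hv IW)
  qed
  moreover have "W l (fock_bas v (u + single j 1, m)) = 0" if "l > B + Suc j" for l
    unfolding W using that B by (auto simp: scl_zero)
  moreover have "znth k (M (ealpha 1) (bas (u + single j 1, m))) = 0" if "k > m" for k
    unfolding M using that M0 by simp
  ultimately show ?case
    by blast
qed

text \<open>For given \<open>n\<close> the index \<open>l\<close> determines \<open>j\<close>, and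
  only \<open>l \<le> B\<close> contribute, so the formal sum in \<open>Psi\<close> is finite. The
  factor \<open>vpart v u\<close> passes from the monomial basis to the basis of the
  lattice.\<close>

lemma Psi_bas:
  assumes B: "\<forall>l>B. W l (fock_bas v (u, m)) = 0"
  shows "Psi v n (single (u, m) c) = scl (c * vpart v u)
    (\<Sum>l | l \<le> B \<and> n - m + int l \<ge> 0. C (nat (n - m + int l)) * ealpha 1 * W l (fock_bas v (u, m)))"
proof -
  let ?x = "fock_bas v (u, m)"
  let ?g = "\<lambda>j l. if int j - int l + m = n then C j * W l (ealpha 1 * bas (u, m)) else 0"
  have b: "bas (u, m) = scl (vpart v u) ?x"
    by (simp add: fock_bas_eq scl_scl vpart_nz scl_one)
  \<comment> \<open>\<open>e^\<alpha>\<close> is moved past the annihilation part to stand next to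
    the creation part, the form to which \<open>C_ealpha\<close> applies.\<close>
  have g: "?g j l = scl (vpart v u) (if int j - int l + m = n then C j * ealpha 1 * W l ?x else 0)" for j l
    unfolding psi_plus_ealpha b psi_plus_lin by (simp add: scl_mult_right mult.assoc scl_zero)
  let ?h = "\<lambda>l. (nat (n - m + int l), l)"
  let ?S = "{l. l \<le> B \<and> n - m + int l \<ge> 0}"
  have S: "finite ?S"
    by (rule finite_subset[of _ "{..B}"]) auto
  have "Psi v n (single (u, m) c) = scl c (\<Sum>(j, l). ?g j l)"
    unfolding Psi_def lin_single prod.case exp_heis_minus exp_plus ..
  also have "(\<Sum>(j, l). ?g j l) = (\<Sum>(j, l)\<in>?h ` ?S. ?g j l)"
  proof (rule Sum_any.expand_superset)
    show "{p. (case p of (j, l) \<Rightarrow> ?g j l) \<noteq> 0} \<subseteq> ?h ` ?S"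
    proof
      fix p assume p: "p \<in> {p. (case p of (j, l) \<Rightarrow> ?g j l) \<noteq> 0}"
      obtain j l where jl: "p = (j, l)" by (cases p)
      with p have nz: "?g j l \<noteq> 0" by simp
      then have 1: "int j - int l + m = n" by (auto split: if_splits)
      have "l \<le> B"
      proof (rule ccontr)
        assume "\<not> l \<le> B"
        then have "?g j l = 0"
          unfolding g using B by (simp add: scl_zero)
        with nz show False by blast
      qed
      with 1 show "p \<in> ?h ` ?S"
        unfolding jl by (intro image_eqI[of _ _ l]) auto
    qed
  qed (use S in auto)
  also have "\<dots> = (\<Sum>l\<in>?S. ?g (nat (n - m + int l)) l)"
    by (subst sum.reindex) (auto simp: inj_on_def)
  also have "\<dots> = (\<Sum>l\<in>?S. scl (vpart v u) (C (nat (n - m + int l)) * ealpha 1 * W l ?x))"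
    by (rule sum.cong[OF refl], subst g) auto
  finally show ?thesis
    by (simp add: scl_sum scl_scl)
qed

lemma Psi_L: "x \<in> L \<Longrightarrow> Psi v n x \<in> L"
proof -
  assume x: "x \<in> L"
  have s: "Psi v n (single u c) \<in> L" if "vpart v (fst u) * c \<in> A" for u c
  proof -
    obtain l m where u: "u = (l, m)" by (cases u)
    obtain B where B: "\<forall>k>B. W k (fock_bas v (l, m)) = 0"
      using W_M by blast
    have "c * vpart v l \<in> A"
      using that by (simp add: u mult.commute)
    then show ?thesis
      unfolding u Psi_bas[OF B] by (intro L_scl L_sum L_mult C_L ealpha_L W_L fock_bas_L)
  qed
  have "additive (Psi v n)"
    by (simp add: additive_def Psi_def lin_add)
  then have "Psi v n (\<Sum>u\<in>keys x. single u (lookup x u)) = (\<Sum>u\<in>keys x. Psi v n (single u (lookup x u)))"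
    by (rule additive.sum)
  also have "\<dots> \<in> L"
    by (intro L_sum s L_lookup x)
  finally show "Psi v n x \<in> L"
    by (simp flip: pm_expand)
qed

lemma Psi_transports: "transports v A \<iota> (Psi v n) (Y_r r (tconst (ealpha 1)) n)"
proof (rule transports_I)
  show "I (Psi v n (fock_bas v u)) = znth n (Y0 r (ealpha 1) (bas u))" for u
  proof -
    obtain l m where u: "u = (l, m)" by (cases u)
    let ?x = "fock_bas v (l, m)" and ?M = "M (ealpha 1) (bas (l, m))"
    obtain B where B: "\<forall>k>B. W k ?x = 0"
      using W_M by blast
    have M0: "k > m \<Longrightarrow> znth k ?M = 0" and IW: "I (W i ?x) = znth (m - int i) ?M" for k i
      using W_M by blast+
    \<comment> \<open>The vanishing of \<open>W\<close> beyond \<open>B\<close> becomes a lower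
      bound for the exponents of \<open>z\<close>.\<close>
    have M1: "znth k ?M = 0" if "k < m - int B" for k
      using IW[of "nat (m - k)"] B[rule_format, of "nat (m - k)"] that by (simp add: add_on_0[OF add_on_I])
    let ?S = "{i. i \<le> B \<and> n - m + int i \<ge> 0}"
    have S: "finite ?S"
      by (rule finite_subset[of _ "{..B}"]) auto
    have "Psi v n (fock_bas v u) = (\<Sum>i\<in>?S. C (nat (n - m + int i)) * ealpha 1 * W i ?x)"
    proof -
      have "fock_bas v u = single (l, m) (inverse (vpart v l))"
        by (simp add: u fock_bas_def)
      then show ?thesis
        using Psi_bas[OF B, of n "inverse (vpart v l)"] by (simp add: vpart_nz scl_one)
    qed
    then have "I (Psi v n (fock_bas v u)) = (\<Sum>i\<in>?S. tconst (dp (nat (n - m + int i)) (ealpha 1)) * znth (m - int i) ?M)"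
      by (simp only: I_sum I_mult L_mult C_L ealpha_L W_L fock_bas_L C_ealpha IW)
    also have "\<dots> = znth n (tconst (exp_zD (ealpha 1)) * ?M)"
    proof (rule tps_eqI)
      fix N
      have M': "fls_nth (tcoeff ?M N) k = 0" if "k < m - int B \<or> k > m" for k
        using M0[of k] M1[of k] that by (metis tcoeff_tmap tcoeff_add_group(1))
      have "tcoeff (\<Sum>i\<in>?S. tconst (dp (nat (n - m + int i)) (ealpha 1)) * znth (m - int i) ?M) N =
          (\<Sum>i\<in>?S. fls_nth (exp_zD (ealpha 1)) (n - m + int i) * fls_nth (tcoeff ?M N) (m - int i))"
        by (simp add: tcoeff_sum tconst_mult_left fls_nth_exp_zD)
      \<comment> \<open>The index becomes the exponent \<open>k = m - i\<close>; the conditions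
        \<open>i \<ge> 0\<close> and \<open>n - m + i \<ge> 0\<close> bound it by
        \<open>min m n\<close>.\<close>
      also have "\<dots> = (\<Sum>k\<in>{m - int B..min m n}. fls_nth (tcoeff ?M N) k * fls_nth (exp_zD (ealpha 1)) (n - k))"
        by (rule sum.reindex_bij_witness[of _ "\<lambda>k. nat (m - k)" "\<lambda>i. m - int i"]) (auto simp: algebra_simps)
      also have "\<dots> = (\<Sum>k\<in>{m - int B..n}. fls_nth (tcoeff ?M N) k * fls_nth (exp_zD (ealpha 1)) (n - k))"
        by (rule sum.mono_neutral_left) (auto simp: M')
      also have "\<dots> = fls_nth (tcoeff ?M N * exp_zD (ealpha 1)) n"
        by (subst fls_mult_nth_bound[of "m - int B" _ 0]) (auto simp: M' fls_nth_exp_zD)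
      finally show "tcoeff (\<Sum>i\<in>?S. tconst (dp (nat (n - m + int i)) (ealpha 1)) * znth (m - int i) ?M) N =
          tcoeff (znth n (tconst (exp_zD (ealpha 1)) * ?M)) N"
        by (simp add: tconst_mult_left mult.commute)
    qed
    finally show ?thesis
      by (simp add: u Y0_ealpha)
  qed
qed (rule Psi_L)

end

text \<open>\<open>h_-n\<close> is the coefficient of \<open>z^(n-1)\<close> and \<open>h_n\<close>
  that of \<open>z^(-n-1)\<close> in \<open>Y(h, z)\<close>, so the first clauses say that the
  identification of the two spaces respects the Heisenberg operators. The state witnessing that
  \<Psi> belongs to the structure is \<open>e^\<alpha>\<close>.\<close>

theorem theorem5p3:
  fixes \<kappa> :: "'k::field_char_0 \<Rightarrow> 'f::field_char_0"
    and A :: "'f set"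
    and \<iota> :: "'f \<Rightarrow> ('p::finite, 'k) tps"
    and v :: "nat \<Rightarrow> 'f"
    and \<sigma> :: "('p, 'k ratfun) tps"
    and r :: "('p, 'k) bichar"
  assumes "t_expansion \<kappa> A \<iota>"
    and "\<And>n. n \<ge> 1 \<Longrightarrow> v n \<noteq> 0"
    and "\<And>n. n \<ge> 1 \<Longrightarrow> inverse (v n) \<in> A"
    and "is_sigma \<iota> v \<sigma>"
    and "bicharacter r"
    and "D_compatible r"
    and "r (ealpha 1) (ealpha 1) = \<sigma>"
  shows
    "(\<forall>n\<ge>1. transports v A \<iota> (heis_minus v n) (Y_r r (tconst (hgen 0)) (int n - 1)) \<and>
            transports v A \<iota> (heis_plus v n) (Y_r r (tconst (hgen 0)) (- int n - 1))) \<and>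
     (\<forall>n. transports v A \<iota> (Psi v n) (Y_r r (tconst (ealpha 1)) n)) \<and>
     HD_quantum_vertex_algebra (tconst 1) (Y_r r) (tmap D0) (R_r r) \<and>
     (\<exists>a. \<forall>n. transports v A \<iota> (Psi v n) (Y_r r a n))"
proof -
  interpret fock \<kappa> A \<iota> v r
    using assms by unfold_locales auto
  have "transports v A \<iota> (heis_minus v n) (Y_r r (tconst (hgen 0)) (int n - 1)) \<and>
      transports v A \<iota> (heis_plus v n) (Y_r r (tconst (hgen 0)) (- int n - 1))" if n1: "n \<ge> 1" for n
  proof -
    obtain j where n: "n = Suc j"
      using n1 by (cases n) auto
    have "int n - 1 = int j" "- int n - 1 = - int j - 2"
      by (simp_all add: n)
    then show ?thesis
      using heis_minus_transports[of j] heis_plus_transports[of j] by (simp only: n)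
  qed
  then show ?thesis
    using Psi_transports HD_qva by blast
qed

end
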